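(* For every (nonempty) countable compact metric space $K$ there exists a $\mathcal{L}_\infty$-space $X$, with $X^*$ isomorphic to $\ell_1$, so that its Calkin algebra is isomorphic, as a Banach algebra, to $C(K)$.
   Context: Banach spaces are over the real scalars. "Countable" means finite or countably infinite. $C(K)$ is the Banach algebra of continuous real-valued functions on $K$ with pointwise operations and the supremum norm. Two Banach algebras are isomorphic as Banach algebras if there is a bijective algebra homomorphism between them that is bounded with bounded inverse. For a Banach space $X$, $\mathcal{L}(X)$ is the algebra of bounded linear operators on $X$, $\mathcal{K}(X)$ is the ideal of compact operators, and the Calkin algebra of $X$ is the quotient Banach algebra $\mathcal{C}al(X)=\mathcal{L}(X)/\mathcal{K}(X)$ with the quotient norm. $\mathcal{L}_\infty$-spaces: for Banach spaces $Z,W$ and $C>0$ write $Z\simeq^C W$ if there is an onto linear isomorphism $T:Z\to W$ with $\|T\|\|T^{-1}\|\le C$. A separable Banach space $X$ is a $\mathcal{L}_{\infty,C}$-space if there is a strictly increasing sequence $(Y_n)_{n\in\mathbb{N}}$ of finite dimensional subspaces of $X$ with $Y_n\simeq^C \ell_\infty(\dim Y_n)$ for every $n$ and $X=\overline{\bigcup_n Y_n}$, where $\ell_\infty(d)$ is $\mathbb{R}^d$ with the maximum norm. $X$ is a $\mathcal{L}_\infty$-space if it is a $\mathcal{L}_{\infty,C}$-space for some $C>0$. *)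

theory Defs
  imports "HOL-Analysis.Analysis" "HOL-Algebra.QuotRing" "HOL-Algebra.Module"
begin

section \<open>Normed spaces and normed algebras as records\<close>

text \<open>
  The dual, the operator algebra and the Calkin algebra of a space that is itself only a set cannot
  be types, so they are records over the \<open>module\<close> records of HOL-Algebra, extended by a norm.
  These records carry a ring multiplication and unit; for mere normed spaces both are
  \<open>undefined\<close> and nothing below refers to them.
\<close>

record 'a normed_module = "(real, 'a) module" +
  nrm :: "'a \<Rightarrow> real"

definition normed_subspace :: "'a::real_normed_vector set \<Rightarrow> 'a normed_module" where
  "normed_subspace X =
     \<lparr>carrier = X, mult = undefined, one = undefined, zero = 0, add = (+),
      smult = (*\<^sub>R), nrm = norm\<rparr>"

definition bounded_linear_map :: "'a normed_module \<Rightarrow> 'b normed_module \<Rightarrow> ('a \<Rightarrow> 'b) \<Rightarrow> bool" where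
  "bounded_linear_map V W T \<longleftrightarrow>
     T \<in> carrier V \<rightarrow> carrier W \<and>
     (\<forall>x\<in>carrier V. \<forall>y\<in>carrier V. T (x \<oplus>\<^bsub>V\<^esub> y) = T x \<oplus>\<^bsub>W\<^esub> T y) \<and>
     (\<forall>c. \<forall>x\<in>carrier V. T (c \<odot>\<^bsub>V\<^esub> x) = c \<odot>\<^bsub>W\<^esub> T x) \<and>
     (\<exists>B. \<forall>x\<in>carrier V. nrm W (T x) \<le> B * nrm V x)"

text \<open>As for \<^const>\<open>onorm\<close>, the vector \<open>x = 0\<close> contributes \<open>0 / 0 = 0\<close>.\<close>

definition operator_norm :: "'a normed_module \<Rightarrow> 'b normed_module \<Rightarrow> ('a \<Rightarrow> 'b) \<Rightarrow> real" where
  "operator_norm V W T = (SUP x\<in>carrier V. nrm W (T x) / nrm V x)"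

definition normed_iso :: "'a normed_module \<Rightarrow> 'b normed_module \<Rightarrow> ('a \<Rightarrow> 'b) \<Rightarrow> bool" where
  "normed_iso V W T \<longleftrightarrow>
     bij_betw T (carrier V) (carrier W) \<and>
     bounded_linear_map V W T \<and>
     bounded_linear_map W V (inv_into (carrier V) T)"

definition normed_isomorphic :: "'a normed_module \<Rightarrow> 'b normed_module \<Rightarrow> bool" where
  "normed_isomorphic V W \<longleftrightarrow> (\<exists>T. normed_iso V W T)"

definition normed_isomorphic_const ::
    "real \<Rightarrow> 'a normed_module \<Rightarrow> 'b normed_module \<Rightarrow> bool" where
  "normed_isomorphic_const C V W \<longleftrightarrow>
     (\<exists>T. normed_iso V W T \<and>
       operator_norm V W T * operator_norm W V (inv_into (carrier V) T) \<le> C)"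

definition banach_algebra_isomorphic :: "'a normed_module \<Rightarrow> 'b normed_module \<Rightarrow> bool" where
  "banach_algebra_isomorphic A B \<longleftrightarrow> (\<exists>h. h \<in> ring_iso A B \<and> normed_iso A B h)"


section \<open>Classical spaces\<close>

definition ell1 :: "(nat \<Rightarrow> real) normed_module" where
  "ell1 =
     \<lparr>carrier = {a. summable (\<lambda>n. \<bar>a n\<bar>)}, mult = undefined, one = undefined,
      zero = (\<lambda>n. 0), add = (\<lambda>a b n. a n + b n), smult = (\<lambda>c a n. c * a n),
      nrm = (\<lambda>a. \<Sum>n. \<bar>a n\<bar>)\<rparr>"

text \<open>The inserted \<open>0\<close> only matters for \<open>d = 0\<close>.\<close>

definition ell_infty_dim :: "nat \<Rightarrow> (nat \<Rightarrow> real) normed_module" where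
  "ell_infty_dim d =
     \<lparr>carrier = {..<d} \<rightarrow>\<^sub>E UNIV, mult = undefined, one = undefined,
      zero = (\<lambda>i\<in>{..<d}. 0), add = (\<lambda>a b. \<lambda>i\<in>{..<d}. a i + b i),
      smult = (\<lambda>c a. \<lambda>i\<in>{..<d}. c * a i),
      nrm = (\<lambda>a. Max (insert 0 ((\<lambda>i. \<bar>a i\<bar>) ` {..<d})))\<rparr>"

definition continuous_function_algebra :: "'k::topological_space set \<Rightarrow> ('k \<Rightarrow> real) normed_module"
  where
  "continuous_function_algebra K =
     \<lparr>carrier = {f \<in> extensional K. continuous_on K f},
      mult = (\<lambda>f g. \<lambda>x\<in>K. f x * g x), one = (\<lambda>x\<in>K. 1),
      zero = (\<lambda>x\<in>K. 0), add = (\<lambda>f g. \<lambda>x\<in>K. f x + g x),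
      smult = (\<lambda>c f. \<lambda>x\<in>K. c * f x),
      nrm = (\<lambda>f. SUP x\<in>K. \<bar>f x\<bar>)\<rparr>"


section \<open>Operators, dual and Calkin algebra\<close>

definition operator_space :: "'a normed_module \<Rightarrow> 'b normed_module \<Rightarrow> ('a \<Rightarrow> 'b) normed_module" where
  "operator_space V W =
     \<lparr>carrier = {T \<in> extensional (carrier V). bounded_linear_map V W T},
      mult = undefined, one = undefined,
      zero = (\<lambda>x\<in>carrier V. \<zero>\<^bsub>W\<^esub>),
      add = (\<lambda>S T. \<lambda>x\<in>carrier V. S x \<oplus>\<^bsub>W\<^esub> T x),
      smult = (\<lambda>c T. \<lambda>x\<in>carrier V. c \<odot>\<^bsub>W\<^esub> T x),
      nrm = operator_norm V W\<rparr>"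

definition dual_space :: "'a::real_normed_vector set \<Rightarrow> ('a \<Rightarrow> real) normed_module" where
  "dual_space X = operator_space (normed_subspace X) (normed_subspace UNIV)"

definition operator_algebra :: "'a::real_normed_vector set \<Rightarrow> ('a \<Rightarrow> 'a) normed_module" where
  "operator_algebra X =
     operator_space (normed_subspace X) (normed_subspace X)
       \<lparr>mult := compose X, one := (\<lambda>x\<in>X. x)\<rparr>"

text \<open>The closure is taken in the ambient type, which is the closure in \<open>X\<close> when \<open>X\<close> is closed.\<close>

definition compact_operators :: "'a::real_normed_vector set \<Rightarrow> ('a \<Rightarrow> 'a) set" where
  "compact_operators X =
     {T \<in> carrier (operator_algebra X). compact (closure (T ` (X \<inter> cball 0 1)))}"

text \<open>
  The ring structure is that of the quotient ring. Scalar multiplication of cosets follows the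
  pattern of \<^const>\<open>rcoset_mult\<close>; the norm of a coset is the infimum of the norms of its elements.
\<close>

definition calkin_algebra :: "'a::real_normed_vector set \<Rightarrow> ('a \<Rightarrow> 'a) set normed_module" where
  "calkin_algebra X =
     (let L = operator_algebra X; K = compact_operators X; Q = L Quot K in
      \<lparr>carrier = carrier Q, mult = mult Q, one = one Q, zero = zero Q, add = add Q,
       smult = (\<lambda>c A. \<Union>T\<in>A. K +>\<^bsub>L\<^esub> (c \<odot>\<^bsub>L\<^esub> T)),
       nrm = (\<lambda>A. INF T\<in>A. nrm L T)\<rparr>)"


section \<open>Script L-infinity spaces\<close>

definition script_L_infty_const :: "real \<Rightarrow> 'a::real_normed_vector set \<Rightarrow> bool" where
  "script_L_infty_const C X \<longleftrightarrow>
     separable_space (top_of_set X) \<and>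
     (\<exists>Y :: nat \<Rightarrow> 'a set.
        strict_mono Y \<and>
        (\<forall>n. subspace (Y n) \<and> Y n \<subseteq> X \<and> (\<exists>B. finite B \<and> span B = Y n) \<and>
             normed_isomorphic_const C (normed_subspace (Y n)) (ell_infty_dim (dim (Y n)))) \<and>
        X = closure (\<Union>n. Y n))"

definition script_L_infty :: "'a::real_normed_vector set \<Rightarrow> bool" where
  "script_L_infty X \<longleftrightarrow> (\<exists>C>0. script_L_infty_const C X)"


section \<open>Separable Banach spaces\<close>

text \<open>
  HOL cannot quantify existentially over types. Every separable Banach space is isometric to a closed
  subspace of the space of bounded real sequences (if \<open>x\<^sub>n\<close> is dense in the space and
  \<open>f\<^sub>n\<close> is a norming functional of \<open>x\<^sub>n\<close>, map \<open>x\<close> to \<open>(f\<^sub>n x)\<close>), so these closed subspaces represent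
  all separable Banach spaces; in particular all script L-infinity spaces. The type
  \<open>nat \<Rightarrow>\<^sub>C real\<close> is that sequence space, since \<open>nat\<close> is discrete and the norm of
  \<^typ>\<open>nat \<Rightarrow>\<^sub>C real\<close> is the supremum norm.
\<close>

definition separable_banach_space :: "(nat \<Rightarrow>\<^sub>C real) set \<Rightarrow> bool" where
  "separable_banach_space X \<longleftrightarrow> subspace X \<and> closed X \<and> separable_space (top_of_set X)"

end

theory Submission imports Defs begin

text \<open>
  The space is a Bourgain--Delbaen space over \<open>\<Gamma> = \<nat>\<close> of Argyros--Haydon type: the functionals
  \<open>e\<^sub>g\<^sup>*\<close> are built from sums of earlier functionals with weights \<open>1 / m\<^sub>j\<close>, and those of odd weight
  follow a coding. In addition every \<open>g\<close> carries a label in \<open>K\<close>, and \<open>e\<^sub>g\<^sup>*\<close> only looks at earlier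
  functionals on coordinates whose labels lie in the class of the label of \<open>g\<close> in a clopen partition
  of \<open>K\<close>, which gets finer as the construction proceeds. Hence multiplication of the coordinates by
  a function of the label is bounded as soon as this function is locally constant, and after
  a correction on each partition level for every continuous function.

  Conversely, let \<open>T\<close> be bounded and \<open>t\<close> a point of \<open>K\<close>. If, on a rapidly increasing sequence
  \<open>x\<^sub>k\<close>, the distance of \<open>T x\<^sub>k\<close> to the multiples of \<open>x\<^sub>k\<close> stayed large on every class around \<open>t\<close>, then
  functionals of even weight would give averages \<open>z\<close> and \<open>\<eta>\<close> with \<open>\<eta> z\<close> small and \<open>\<eta> (T z)\<close> large, and
  a dependent sequence of these would be too short in norm for its image under \<open>T\<close>. So \<open>T\<close> is
  asymptotically a scalar \<open>\<phi> t\<close> near \<open>t\<close>; \<open>\<phi>\<close> is continuous. As \<open>K\<close> is countable, errors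
  \<open>\<epsilon> 2\<^sup>-\<^sup>i\<close> can be allotted to its points before passing to a finite cover by classes, so \<open>T\<close> differs from
  the multiplication by \<open>\<phi>\<close> by an operator that is null on rapidly increasing sequences, which is
  compact. The same estimates show that bounded functionals are null on block sequences, so the dual is
  \<open>\<ell>\<^sub>1\<close>.
\<close>

section \<open>The triangular system\<close>

text \<open>The classes must get finer along the coordinates. With one fixed partition only the
  functions constant on its classes would act boundedly; here a function constant on the classes of
  some level commutes with every cut made from that level on, so it disturbs each evaluation
  analysis in one place only.

  Two-term functionals with rational coefficients keep the index set countable, and two terms are
  enough: a scalar \<open>l\<close> with \<open>T x\<close> near \<open>l * x\<close> fails to exist
  only if two coordinates already exclude it, by Helly's theorem on the line.

  The obstacle is that this scalar may depend on the vector. Junk elements, of weight index 0, have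
  no evaluation analysis and serve as probes: adding the basis vector of a far junk element to
  \<open>x\<close> gives another rapidly increasing sequence, whose scalar can be read off at that
  element.

  The recurring constant 3 bounds the extension of a vector from its first coordinates to all of
  them; it rests on all weights being at least 16.\<close>

definition mw :: "nat \<Rightarrow> real" where "mw j = 16 ^ (2 ^ j)"

text \<open>\<open>mw j\<close> and \<open>nn j\<close> are the parameters \<open>m\<^sub>j\<close> and \<open>n\<^sub>j\<close>. Each of the steps of the induction on \<open>d\<close> in
  \<open>ris_sum\<close> costs a factor \<open>2 * nn j\<close> and gains a factor \<open>1 / 16\<close>; the exponent in \<open>nn\<close> makes room for
  the steps needed to gain \<open>1 / (mw (Suc j))\<^sup>2\<close>.\<close>

primrec nn :: "nat \<Rightarrow> nat" where
  "nn 0 = 1"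
| "nn (Suc j) = (16 ^ 2 ^ Suc j)\<^sup>2 * (2 * nn j) ^ (2 ^ Suc (Suc j) + 1)"

lemma mw_ge: "mw j \<ge> 16"
proof -
  have "(16::real) ^ 1 \<le> 16 ^ (2 ^ j)" by (intro power_increasing) auto
  then show ?thesis by (simp add: mw_def)
qed

lemma mw_pos: "mw j > 0" using mw_ge[of j] by simp

text \<open>This is the reason for the double exponent: a functional of weight index above
  \<open>j\<close> carries a factor of at most \<open>1 / (mw j)\<^sup>2\<close>, which both the
  averages and the dependent sequences rely on.\<close>

lemma mw_Suc: "mw (Suc j) = (mw j)\<^sup>2"
  by (simp add: mw_def power_mult[symmetric] mult.commute)

lemma mw_mono: "i \<le> j \<Longrightarrow> mw i \<le> mw j"
  unfolding mw_def by (intro power_increasing) auto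

lemma mw_ge_self: "real n \<le> mw n"
proof -
  have "n < 2 ^ n" by simp
  also have "(2::nat) ^ n < 2 ^ (2 ^ n)" by simp
  also have "(2::nat) ^ (2 ^ n) \<le> 16 ^ (2 ^ n)" by (intro power_mono) auto
  finally have "real n \<le> real (16 ^ (2 ^ n))" by linarith
  then show ?thesis by (simp add: mw_def)
qed

lemma mw_power: "(16::real) ^ (2 ^ Suc j) = (mw j)\<^sup>2"
  by (simp add: mw_def power_mult[symmetric] mult.commute)

lemma nn_pos: "nn j \<ge> 1"
  by (induction j) auto

lemma nn_Suc: "real (nn (Suc j)) = (mw (Suc j))\<^sup>2 * (2 * real (nn j)) ^ (2 ^ Suc (Suc j) + 1)"
  by (simp add: mw_def)

lemma nn_Suc_ge: "nn j \<le> nn (Suc j)"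
proof -
  have "nn j \<le> (2 * nn j) ^ 1" by simp
  also have "\<dots> \<le> (2 * nn j) ^ (2 ^ Suc (Suc j) + 1)"
    using nn_pos[of j] by (intro power_increasing) auto
  also have "\<dots> \<le> nn (Suc j)" by simp
  finally show ?thesis .
qed

lemma nn_mono: "i \<le> j \<Longrightarrow> nn i \<le> nn j"
  using lift_Suc_mono_le[of nn] nn_Suc_ge by blast

text \<open>The elements of the paper's index set \<open>\<Gamma>\<close> are natural numbers. The parameter \<open>lab\<close>
  carries the point of \<open>K\<close> assigned to an element, \<open>sim p\<close> is the partition of \<open>K\<close> at level \<open>p\<close>,
  and \<open>prd\<close> is the previous element of the evaluation analysis.\<close>

locale ah_system =
  fixes K :: "'k::metric_space set"
    and sim :: "nat \<Rightarrow> 'k \<Rightarrow> 'k \<Rightarrow> bool"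
    and lab :: "nat \<Rightarrow> 'k"
    and wt age cut e1 e2 :: "nat \<Rightarrow> nat"
    and prd :: "nat \<Rightarrow> nat option"
    and c1 c2 :: "nat \<Rightarrow> real"
  assumes countable_K: "countable K" and compact_K: "compact K" and K_ne: "K \<noteq> {}"
    and sim_refl: "sim p s s"
    and sim_sym: "sim p s t \<Longrightarrow> sim p t s"
    and sim_trans: "sim p s t \<Longrightarrow> sim p t u \<Longrightarrow> sim p s u"
    and sim_mono: "p \<le> q \<Longrightarrow> sim q s t \<Longrightarrow> sim p s t"
    and sim_cover: "\<exists>F. finite F \<and> F \<subseteq> K \<and> (\<forall>s\<in>K. \<exists>!\<tau>. \<tau> \<in> F \<and> sim (P \<tau>) s \<tau>)"
    and sim_nhds: "\<tau> \<in> K \<Longrightarrow> eventually (\<lambda>s. sim p s \<tau>) (at \<tau> within K)"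
    and sim_dist: "e > 0 \<Longrightarrow> \<exists>p. \<forall>s\<in>K. \<forall>t\<in>K. sim p s t \<longrightarrow> dist s t < e"
    and lab_in: "lab g \<in> K"
    and wt_le: "wt g \<le> g"
    and e1_less: "e1 g < g \<or> c1 g = 0"
    and e2_less: "e2 g < g \<or> c2 g = 0"
    and c_le: "\<bar>c1 g\<bar> + \<bar>c2 g\<bar> \<le> 1"
    and age_le: "age g \<le> nn (wt g)"
    and age_pos: "age g \<ge> 1"
    and age_None: "prd g = None \<Longrightarrow> age g = 1"
    and prd_cut: "prd g = Some h \<Longrightarrow> h < cut g"
    and cut_le: "cut g \<le> g"
    and prd_lab: "prd g = Some h \<Longrightarrow> lab h = lab g"
    and prd_wt: "prd g = Some h \<Longrightarrow> wt h = wt g"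
    and prd_age: "prd g = Some h \<Longrightarrow> age g = Suc (age h)"
    and odd_c: "odd (wt g) \<Longrightarrow> c1 g = 1 \<and> c2 g = 0"
    and odd_None: "odd (wt g) \<Longrightarrow> prd g = None \<Longrightarrow>
        \<exists>i. wt (e1 g) = 4 * i + 2 \<and> (real (nn (wt g)))\<^sup>2 \<le> mw (wt (e1 g))"
    and odd_Some: "odd (wt g) \<Longrightarrow> prd g = Some h \<Longrightarrow> wt (e1 g) = 4 * h + 4"
    and rich_even: "even j \<Longrightarrow> j \<noteq> 0 \<Longrightarrow> t \<in> K \<Longrightarrow> a1 \<in> \<rat> \<Longrightarrow> a2 \<in> \<rat> \<Longrightarrow> \<bar>a1\<bar> + \<bar>a2\<bar> \<le> 1 \<Longrightarrow>
        (case po of None \<Rightarrow> True | Some h \<Rightarrow> h < p \<and> lab h = t \<and> wt h = j \<and> age h < nn j) \<Longrightarrow>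
        \<exists>g\<ge>M. wt g = j \<and> lab g = t \<and> prd g = po \<and> cut g = p \<and> e1 g = b1 \<and> e2 g = b2 \<and>
          c1 g = a1 \<and> c2 g = a2"
    and rich_odd: "odd j \<Longrightarrow> t \<in> K \<Longrightarrow>
        (case po of None \<Rightarrow> \<exists>i. wt b1 = 4 * i + 2 \<and> (real (nn j))\<^sup>2 \<le> mw (wt b1)
         | Some h \<Rightarrow> h < p \<and> lab h = t \<and> wt h = j \<and> age h < nn j \<and> wt b1 = 4 * h + 4) \<Longrightarrow>
        \<exists>g\<ge>M. wt g = j \<and> lab g = t \<and> prd g = po \<and> cut g = p \<and> e1 g = b1 \<and>
          c1 g = 1 \<and> c2 g = 0"
    and rich_junk: "t \<in> K \<Longrightarrow>
        \<exists>g\<ge>M. wt g = 0 \<and> lab g = t \<and> prd g = None \<and> c1 g = 0 \<and> c2 g = 0"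
begin

section \<open>Multiplication by functions of the label\<close>

definition mul :: "nat \<Rightarrow> ('k \<Rightarrow> real) \<Rightarrow> (nat \<Rightarrow> real) \<Rightarrow> nat \<Rightarrow> real" where
  "mul N \<phi> x = (\<lambda>z. if N \<le> z then \<phi> (lab z) * x z else 0)"

text \<open>One number serves as first coordinate and as partition level, because the weighted term
  of an element with cut \<open>p\<close> sees only coordinates from \<open>p\<close> on in a class
  of level \<open>p\<close>. A function of level \<open>N\<close> therefore interferes only with
  weighted terms whose cut is below \<open>N\<close>. The bound is asked on the whole type, as
  classes are formed off \<open>K\<close> too.\<close>

definition adm :: "nat \<Rightarrow> ('k \<Rightarrow> real) \<Rightarrow> bool" where
  "adm N \<phi> \<longleftrightarrow> (\<forall>s t. sim N s t \<longrightarrow> \<phi> s = \<phi> t) \<and> (\<forall>s. \<bar>\<phi> s\<bar> \<le> 1)"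

definition cls :: "nat \<Rightarrow> 'k \<Rightarrow> 'k \<Rightarrow> real" where
  "cls p t = (\<lambda>s. if sim p s t then 1 else 0)"

definition cutm :: "nat \<Rightarrow> (nat \<Rightarrow> real) \<Rightarrow> nat \<Rightarrow> real" where
  "cutm g = mul (cut g) (cls (cut g) (lab g))"

lemma sim_eq: "sim p s t \<Longrightarrow> sim p s u \<longleftrightarrow> sim p t u"
  using sim_sym sim_trans by blast

lemma adm_cls: "adm p (cls p t)"
proof -
  have "cls p t s = cls p t u" if "sim p s u" for s u
    unfolding cls_def using sim_eq[OF that] by simp
  then show ?thesis by (auto simp: adm_def) (auto simp: cls_def)
qed

lemma adm_const: "\<bar>a\<bar> \<le> 1 \<Longrightarrow> adm N (\<lambda>s. a)"
  by (simp add: adm_def)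

lemma mul_mul: "mul N \<phi> (mul N' \<phi>' x) = mul (max N N') (\<lambda>s. \<phi> s * \<phi>' s) x"
  by (auto simp: mul_def)

lemma mul_commute: "mul N \<phi> (mul N' \<phi>' x) = mul N' \<phi>' (mul N \<phi> x)"
  by (auto simp: mul_def)

lemma adm_mono: "adm N \<phi> \<Longrightarrow> N \<le> N' \<Longrightarrow> adm N' \<phi>"
  unfolding adm_def using sim_mono by blast

lemma adm_mult: "adm N \<phi> \<Longrightarrow> adm N' \<phi>' \<Longrightarrow> adm (max N N') (\<lambda>s. \<phi> s * \<phi>' s)"
proof -
  assume a: "adm N \<phi>" "adm N' \<phi>'"
  have "\<bar>\<phi> s * \<phi>' s\<bar> \<le> 1 * 1" for s
    unfolding abs_mult using a by (intro mult_mono) (auto simp: adm_def)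
  moreover have "adm (max N N') \<phi>" "adm (max N N') \<phi>'" using a adm_mono by auto
  ultimately show ?thesis unfolding adm_def by (metis mult_1)
qed

lemma mul_linear: "mul N \<phi> (\<lambda>z. a * x z + b * y z) = (\<lambda>z. a * mul N \<phi> x z + b * mul N \<phi> y z)"
  by (auto simp: mul_def algebra_simps)

lemma mul_sum: "mul N \<phi> (\<lambda>z. \<Sum>k\<in>I. x k z) = (\<lambda>z. \<Sum>k\<in>I. mul N \<phi> (x k) z)"
  by (auto simp: mul_def sum_distrib_left)

lemma mul_1: "mul 0 (\<lambda>s. 1) x = x"
  by (auto simp: mul_def)

lemma mul_zero[simp]: "mul N \<phi> (\<lambda>z. 0) = (\<lambda>z. 0)"
  by (auto simp: mul_def)

text \<open>\<open>ev g x\<close> is the value at \<open>\<Sum>\<^sub>z x z d\<^sub>z\<close> of the functional \<open>e\<^sub>g\<^sup>*\<close>; the guards are only for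
  termination.\<close>

function ev :: "nat \<Rightarrow> (nat \<Rightarrow> real) \<Rightarrow> real" where
  "ev g x = x g + (case prd g of None \<Rightarrow> 0 | Some h \<Rightarrow> if h < g then ev h x else 0) +
     ((if e1 g < g then c1 g * ev (e1 g) (cutm g x) else 0) +
      (if e2 g < g then c2 g * ev (e2 g) (cutm g x) else 0)) / mw (wt g)"
  by pat_completeness auto
termination by (relation "Wellfounded.measure fst") auto

declare ev.simps [simp del]

section \<open>The recursion for the functionals: locality and linearity\<close>

definition pv :: "nat \<Rightarrow> (nat \<Rightarrow> real) \<Rightarrow> real" where
  "pv g x = (case prd g of None \<Rightarrow> 0 | Some h \<Rightarrow> ev h x)"

definition bt :: "nat \<Rightarrow> (nat \<Rightarrow> real) \<Rightarrow> real" where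
  "bt g x = c1 g * ev (e1 g) x + c2 g * ev (e2 g) x"

lemma prd_less: "prd g = Some h \<Longrightarrow> h < g"
  using prd_cut cut_le less_le_trans by blast

text \<open>The guards of the recursion disappear: a predecessor is always smaller, and where
  \<open>e1 g\<close> or \<open>e2 g\<close> is not, its coefficient is zero.\<close>

lemma ev_eq: "ev g x = x g + pv g x + bt g (cutm g x) / mw (wt g)"
  using prd_less[of g] e1_less[of g] e2_less[of g]
  by (subst ev.simps, cases "prd g") (auto simp: pv_def bt_def)

lemma pv_None[simp]: "prd g = None \<Longrightarrow> pv g x = 0" by (simp add: pv_def)

lemma pv_Some[simp]: "prd g = Some h \<Longrightarrow> pv g x = ev h x" by (simp add: pv_def)

lemma cutm_linear: "cutm g (\<lambda>z. a * x z + b * y z) = (\<lambda>z. a * cutm g x z + b * cutm g y z)"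
  unfolding cutm_def by (rule mul_linear)

lemma bt_bound:
  assumes "\<And>h. h < g \<Longrightarrow> \<bar>ev h x\<bar> \<le> B" "B \<ge> 0"
  shows "\<bar>bt g x\<bar> \<le> B"
proof -
  have 1: "\<bar>c1 g * ev (e1 g) x\<bar> \<le> \<bar>c1 g\<bar> * B"
    using e1_less[of g] assms by (cases "c1 g = 0") (auto simp: abs_mult intro!: mult_left_mono)
  have 2: "\<bar>c2 g * ev (e2 g) x\<bar> \<le> \<bar>c2 g\<bar> * B"
    using e2_less[of g] assms by (cases "c2 g = 0") (auto simp: abs_mult intro!: mult_left_mono)
  have "\<bar>bt g x\<bar> \<le> (\<bar>c1 g\<bar> + \<bar>c2 g\<bar>) * B"
    unfolding bt_def using 1 2 by (simp add: algebra_simps)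
  also have "\<dots> \<le> 1 * B" using c_le assms(2) by (intro mult_right_mono) auto
  finally show ?thesis by simp
qed

lemma bt_cong:
  assumes "\<And>h. h < g \<Longrightarrow> ev h x = ev h y"
  shows "bt g x = bt g y"
  unfolding bt_def using e1_less[of g] e2_less[of g] assms by auto

lemma ev_cong: "(\<And>z. z \<le> g \<Longrightarrow> x z = y z) \<Longrightarrow> ev g x = ev g y"
proof (induction g arbitrary: x y rule: less_induct)
  case (less g)
  have "pv g x = pv g y"
  proof (cases "prd g")
    case (Some h)
    then have "ev h x = ev h y" using prd_less[OF Some] by (intro less.IH less.prems) auto
    then show ?thesis using Some by simp
  qed simp
  moreover have "bt g (cutm g x) = bt g (cutm g y)"
    by (rule bt_cong, rule less.IH) (auto simp: cutm_def mul_def less.prems)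
  ultimately show ?case by (simp add: ev_eq[of g] less.prems)
qed

lemma ev_linear: "ev g (\<lambda>z. a * x z + b * y z) = a * ev g x + b * ev g y"
proof (induction g arbitrary: x y rule: less_induct)
  case (less g)
  have "pv g (\<lambda>z. a * x z + b * y z) = a * pv g x + b * pv g y"
    using less.IH[OF prd_less] by (cases "prd g") simp_all
  moreover have "bt g (\<lambda>z. a * x z + b * y z) = a * bt g x + b * bt g y" for x y
    unfolding bt_def using e1_less[of g] e2_less[of g] less.IH[of "e1 g" x y] less.IH[of "e2 g" x y]
    by (auto simp: algebra_simps)
  ultimately show ?case
    by (simp add: ev_eq[of g] cutm_linear add_divide_distrib algebra_simps)
qed

lemma ev_zero[simp]: "ev g (\<lambda>z. 0) = 0"
  using ev_linear[of g 0 "\<lambda>_. 0" 0 "\<lambda>_. 0"] by simp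

lemma ev_add: "ev g (\<lambda>z. x z + y z) = ev g x + ev g y"
  using ev_linear[of g 1 x 1 y] by simp

lemma ev_diff: "ev g (\<lambda>z. x z - y z) = ev g x - ev g y"
  using ev_linear[of g 1 x "-1" y] by simp

lemma ev_cmult: "ev g (\<lambda>z. a * x z) = a * ev g x"
  using ev_linear[of g a x 0 x] by simp

lemma ev_sum: "ev g (\<lambda>z. \<Sum>k\<in>I. x k z) = (\<Sum>k\<in>I. ev g (x k))"
  by (induction I rule: infinite_finite_induct) (auto simp: ev_add)

lemma bt_linear: "bt g (\<lambda>z. a * x z + b * y z) = a * bt g x + b * bt g y"
  unfolding bt_def by (simp add: ev_linear algebra_simps)

lemma bt_zero[simp]: "bt g (\<lambda>z. 0) = 0" by (simp add: bt_def)

lemma bt_cmult: "bt g (\<lambda>z. a * x z) = a * bt g x"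
  using bt_linear[of g a x 0 x] by simp

lemma ev_zero_cong: "(\<And>z. z \<le> g \<Longrightarrow> x z = 0) \<Longrightarrow> ev g x = 0"
  using ev_cong[of g x "\<lambda>_. 0"] by simp

text \<open>A class of level \<open>cut g\<close> lies inside one class of level \<open>N\<close>,
  and on it \<open>\<phi>\<close> has the constant value \<open>\<phi> (lab g)\<close>. This is how
  labels and refining partitions make multiplications almost commute with the functionals.\<close>

lemma mul_cut_le:
  assumes "N \<le> cut g" "adm N \<phi>"
  shows "cutm g (mul N \<phi> x) = (\<lambda>z. \<phi> (lab g) * cutm g x z)"
proof
  fix z
  have "cut g \<le> z \<Longrightarrow> sim (cut g) (lab z) (lab g) \<Longrightarrow> \<phi> (lab z) = \<phi> (lab g)"
    using assms sim_mono unfolding adm_def by blast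
  then show "cutm g (mul N \<phi> x) z = \<phi> (lab g) * cutm g x z"
    using assms by (auto simp: cutm_def mul_def cls_def)
qed

lemma cutm_mul:
  assumes "adm N \<phi>"
  shows "\<exists>N' \<phi>'. adm N' \<phi>' \<and> cut g \<le> N' \<and> (\<forall>x. cutm g (mul N \<phi> x) = mul N' \<phi>' x)"
  unfolding cutm_def using mul_mul adm_mult[OF adm_cls assms] by (metis max.cobounded1)

text \<open>All elements of an evaluation analysis share one label, so above \<open>N\<close> the
  multiplication acts on every term as the scalar \<open>\<phi> (lab g)\<close>. Something is lost
  only where the chain passes \<open>N\<close>: the value at the last element below
  \<open>N\<close>, bounded by \<open>A\<close>, and one weighted term. Asking for \<open>A\<close>
  only at elements of the weight of \<open>g\<close> keeps the estimate sensitive to the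
  weight.\<close>

lemma mul_diff_aux:
  assumes "adm N \<phi>" "B \<ge> 0" "A \<ge> 0"
    and "\<And>h. h \<le> g \<Longrightarrow> wt h = wt g \<Longrightarrow> \<bar>ev h x\<bar> \<le> A"
    and "\<And>h N \<phi>. h < g \<Longrightarrow> adm N \<phi> \<Longrightarrow> \<bar>ev h (mul N \<phi> x)\<bar> \<le> B"
  shows "\<bar>ev g (mul N \<phi> x) - \<phi> (lab g) * ev g x\<bar> \<le> A + 2 * B / mw (wt g)"
  using assms
proof (induction g rule: less_induct)
  case (less g)
  let ?y = "mul N \<phi> x"
  have phi: "\<bar>\<phi> (lab g)\<bar> \<le> 1" using less.prems by (auto simp: adm_def)
  have mp: "mw (wt g) > 0" by (rule mw_pos)
  have b1: "\<bar>bt g (cutm g x)\<bar> \<le> B"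
    using less.prems(2,5) adm_cls by (intro bt_bound) (auto simp: cutm_def)
  have b2: "\<bar>bt g (cutm g ?y)\<bar> \<le> B"
    using less.prems(2,5) cutm_mul[OF less.prems(1)] by (intro bt_bound) metis+
  have b1': "\<bar>\<phi> (lab g) * bt g (cutm g x)\<bar> \<le> B"
    using phi b1 mult_mono[of "\<bar>\<phi> (lab g)\<bar>" 1 "\<bar>bt g (cutm g x)\<bar>" B] by (simp add: abs_mult)
  show ?case
  proof (cases "prd g")
    case (Some h)
    then have h: "h < g" "h < cut g" "wt h = wt g" "lab h = lab g"
      using prd_less prd_cut prd_wt prd_lab by auto
    show ?thesis
    proof (cases "N \<le> h")
      case True
      then have "cutm g ?y = (\<lambda>z. \<phi> (lab g) * cutm g x z)" using h less.prems by (intro mul_cut_le) auto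
      moreover have "?y g = \<phi> (lab g) * x g" using True h by (simp add: mul_def)
      ultimately have "ev g ?y - \<phi> (lab g) * ev g x = ev h ?y - \<phi> (lab h) * ev h x"
        using Some h by (simp add: ev_eq[of g] bt_cmult algebra_simps)
      moreover have "\<bar>ev h ?y - \<phi> (lab h) * ev h x\<bar> \<le> A + 2 * B / mw (wt h)"
        using less.prems h by (intro less.IH) auto
      ultimately show ?thesis using h by simp
    next
      case False
      then have z: "ev h ?y = 0" by (intro ev_zero_cong) (auto simp: mul_def)
      have evh: "\<bar>\<phi> (lab g) * ev h x\<bar> \<le> A"
        using phi less.prems(4)[of h] h mult_mono[of "\<bar>\<phi> (lab g)\<bar>" 1 "\<bar>ev h x\<bar>" A]
        by (simp add: abs_mult)
      show ?thesis
      proof (cases "N \<le> g")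
        case True
        then have "ev g ?y - \<phi> (lab g) * ev g x =
          - (\<phi> (lab g) * ev h x) + (bt g (cutm g ?y) - \<phi> (lab g) * bt g (cutm g x)) / mw (wt g)"
          using Some z by (simp add: ev_eq[of g] mul_def diff_divide_distrib algebra_simps)
        moreover have "\<bar>(bt g (cutm g ?y) - \<phi> (lab g) * bt g (cutm g x)) / mw (wt g)\<bar> \<le> 2 * B / mw (wt g)"
          unfolding abs_divide using b2 b1' mp by (auto intro!: divide_right_mono)
        ultimately show ?thesis using evh by linarith
      next
        case False
        then have "ev g ?y = 0" by (intro ev_zero_cong) (auto simp: mul_def)
        moreover have "\<bar>\<phi> (lab g) * ev g x\<bar> \<le> A"
          using phi less.prems(4)[of g] mult_mono[of "\<bar>\<phi> (lab g)\<bar>" 1 "\<bar>ev g x\<bar>" A]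
          by (simp add: abs_mult)
        ultimately show ?thesis using less.prems(2) mp by (simp add: add_increasing2)
      qed
    qed
  next
    case None
    show ?thesis
    proof (cases "N \<le> g")
      case True
      then have "ev g ?y - \<phi> (lab g) * ev g x =
          (bt g (cutm g ?y) - \<phi> (lab g) * bt g (cutm g x)) / mw (wt g)"
        using None by (simp add: ev_eq[of g] mul_def diff_divide_distrib algebra_simps)
      moreover have "\<bar>(bt g (cutm g ?y) - \<phi> (lab g) * bt g (cutm g x)) / mw (wt g)\<bar> \<le> 2 * B / mw (wt g)"
        unfolding abs_divide using b2 b1' mp by (auto intro!: divide_right_mono)
      ultimately show ?thesis using less.prems(3) by linarith
    next
      case False
      then have "ev g ?y = 0" by (intro ev_zero_cong) (auto simp: mul_def)
      moreover have "\<bar>\<phi> (lab g) * ev g x\<bar> \<le> A"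
        using phi less.prems(4)[of g] mult_mono[of "\<bar>\<phi> (lab g)\<bar>" 1 "\<bar>ev g x\<bar>" A]
        by (simp add: abs_mult)
      ultimately show ?thesis using less.prems(2) mp by (simp add: add_increasing2)
    qed
  qed
qed

text \<open>The Bourgain-Delbaen extension from the coordinates up to \<open>n\<close>. There the
  comparison with \<open>\<phi> (lab g)\<close> gives \<open>2 * B + 6 / 16 * B\<close>. A chain
  leaving this range picks up one more weighted term, at most \<open>3 / 16 * B\<close>; afterwards
  its cuts lie beyond \<open>n\<close> and see nothing of \<open>x\<close>.\<close>

lemma ext_bound:
  assumes "B \<ge> 0" "\<And>h. h \<le> n \<Longrightarrow> \<bar>ev h x\<bar> \<le> B" "\<And>z. z > n \<Longrightarrow> x z = 0" "adm N \<phi>"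
  shows "\<bar>ev g (mul N \<phi> x)\<bar> \<le> 3 * B"
  using assms(4)
proof (induction g arbitrary: N \<phi> rule: less_induct)
  case (less g)
  have le: "\<bar>ev h (mul N \<phi> x)\<bar> \<le> 2 * B + 6 / 16 * B" if "h \<le> g" "h \<le> n" for h
  proof -
    have "\<bar>ev h (mul N \<phi> x) - \<phi> (lab h) * ev h x\<bar> \<le> B + 2 * (3 * B) / mw (wt h)"
      using that assms less by (intro mul_diff_aux) auto
    moreover have "2 * (3 * B) / mw (wt h) \<le> 2 * (3 * B) / 16"
      using mw_ge[of "wt h"] assms(1) by (intro divide_left_mono) auto
    moreover have "\<bar>\<phi> (lab h) * ev h x\<bar> \<le> B"
      using less.prems assms that mult_mono[of "\<bar>\<phi> (lab h)\<bar>" 1 "\<bar>ev h x\<bar>" B]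
      by (auto simp add: abs_mult adm_def)
    ultimately show ?thesis by linarith
  qed
  show ?case
  proof (cases "g \<le> n")
    case True
    then show ?thesis using le[of g] assms(1) by simp
  next
    case False
    then have g0: "mul N \<phi> x g = 0" using assms(3) by (simp add: mul_def)
    have "\<bar>bt g (cutm g (mul N \<phi> x))\<bar> \<le> 3 * B"
      using less.IH assms(1) cutm_mul[OF less.prems] by (intro bt_bound) (metis, auto)
    then have b2: "\<bar>bt g (cutm g (mul N \<phi> x)) / mw (wt g)\<bar> \<le> 3 * B / 16"
      unfolding abs_divide using mw_ge[of "wt g"] assms(1) by (intro frac_le) auto
    show ?thesis
    proof (cases "prd g")
      case None
      then have "ev g (mul N \<phi> x) = bt g (cutm g (mul N \<phi> x)) / mw (wt g)" using g0 by (simp add: ev_eq[of g])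
      then show ?thesis using b2 assms(1) by linarith
    next
      case (Some h)
      then have h: "h < g" "h < cut g" using prd_less prd_cut by auto
      show ?thesis
      proof (cases "n \<le> h")
        case True
        then have "cutm g (mul N \<phi> x) = (\<lambda>z. 0)"
          using assms(3) h by (auto simp: cutm_def mul_def)
        then have "ev g (mul N \<phi> x) = ev h (mul N \<phi> x)" using Some g0 by (simp add: ev_eq[of g])
        then show ?thesis using less.IH[OF h(1)] less.prems by simp
      next
        case False
        then have "\<bar>ev h (mul N \<phi> x)\<bar> \<le> 2 * B + 6 / 16 * B" using le h by auto
        moreover have "ev g (mul N \<phi> x) = ev h (mul N \<phi> x) + bt g (cutm g (mul N \<phi> x)) / mw (wt g)"
          using Some g0 by (simp add: ev_eq[of g])
        ultimately show ?thesis using b2 assms(1) by linarith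
      qed
    qed
  qed
qed

end

section \<open>Sums of rapidly increasing sequences\<close>

lemma sum_at_most_one:
  fixes f :: "'a \<Rightarrow> real"
  assumes "\<And>k k'. k \<in> I \<Longrightarrow> k' \<in> I \<Longrightarrow> k \<noteq> k' \<Longrightarrow> f k = 0 \<or> f k' = 0"
    and "\<And>k. k \<in> I \<Longrightarrow> \<bar>f k\<bar> \<le> C" "C \<ge> 0"
  shows "\<bar>sum f I\<bar> \<le> C"
proof (cases "finite I \<and> (\<exists>k\<in>I. f k \<noteq> 0)")
  case True
  then obtain k where k: "k \<in> I" "f k \<noteq> 0" "finite I" by blast
  then have "sum f I = f k + sum f (I - {k})" by (simp add: sum.remove)
  moreover have "sum f (I - {k}) = 0" using assms(1)[OF k(1)] k(2) by (intro sum.neutral) blast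
  ultimately show ?thesis using assms(2)[OF k(1)] by simp
next
  case False
  then have "sum f I = 0" by (cases "finite I") auto
  then show ?thesis using assms(3) by simp
qed

section \<open>Norm bounds, initial and final parts, and dependence on the weight\<close>

context ah_system
begin

text \<open>The norm of \<open>x\<close> is the supremum of \<open>\<bar>ev g x\<bar>\<close>. As
  \<open>x\<close> may be any sequence, this can be infinite, hence a bound instead of a
  value.\<close>

definition bnd :: "real \<Rightarrow> (nat \<Rightarrow> real) \<Rightarrow> bool" where
  "bnd B x \<longleftrightarrow> (\<forall>g. \<bar>ev g x\<bar> \<le> B)"

definition head :: "nat \<Rightarrow> (nat \<Rightarrow> real) \<Rightarrow> nat \<Rightarrow> real" where
  "head n x = (\<lambda>z. if z < n then x z else 0)"

definition tail :: "nat \<Rightarrow> (nat \<Rightarrow> real) \<Rightarrow> nat \<Rightarrow> real" where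
  "tail n = mul n (\<lambda>s. 1)"

definition supp :: "nat \<Rightarrow> nat \<Rightarrow> (nat \<Rightarrow> real) \<Rightarrow> bool" where
  "supp p q x \<longleftrightarrow> (\<forall>z. z < p \<or> q \<le> z \<longrightarrow> x z = 0)"

lemma head_tail: "x = (\<lambda>z. head n x z + tail n x z)"
  by (auto simp: head_def tail_def mul_def)

lemma bnd_nonneg: "bnd B x \<Longrightarrow> B \<ge> 0"
  unfolding bnd_def using abs_ge_zero order_trans by blast

lemma bnd_mono: "bnd B x \<Longrightarrow> B \<le> B' \<Longrightarrow> bnd B' x"
  unfolding bnd_def using order_trans by blast

lemma bnd_zero: "B \<ge> 0 \<Longrightarrow> bnd B (\<lambda>z. 0)" by (simp add: bnd_def)

lemma bnd_add: "bnd B x \<Longrightarrow> bnd B' y \<Longrightarrow> bnd (B + B') (\<lambda>z. x z + y z)"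
  unfolding bnd_def ev_add by (meson abs_triangle_ineq add_mono order_trans)

lemma bnd_cmult: "bnd B x \<Longrightarrow> bnd (\<bar>a\<bar> * B) (\<lambda>z. a * x z)"
  unfolding bnd_def ev_cmult abs_mult by (simp add: mult_left_mono)

lemma bnd_diff: "bnd B x \<Longrightarrow> bnd B' y \<Longrightarrow> bnd (B + B') (\<lambda>z. x z - y z)"
  unfolding bnd_def ev_diff by (meson abs_triangle_ineq4 add_mono order_trans)

lemma bnd_sum:
  assumes "\<And>k. k \<in> I \<Longrightarrow> bnd (B k) (x k)"
  shows "bnd (sum B I) (\<lambda>z. \<Sum>k\<in>I. x k z)"
  unfolding bnd_def
proof
  fix g
  have "\<bar>\<Sum>k\<in>I. ev g (x k)\<bar> \<le> (\<Sum>k\<in>I. B k)"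
    using assms by (intro order_trans[OF sum_abs] sum_mono) (auto simp: bnd_def)
  then show "\<bar>ev g (\<lambda>z. \<Sum>k\<in>I. x k z)\<bar> \<le> sum B I" by (simp add: ev_sum)
qed

lemma head_bound:
  assumes "\<And>h. h < n \<Longrightarrow> \<bar>ev h x\<bar> \<le> B" "B \<ge> 0" "adm N \<phi>"
  shows "\<bar>ev g (mul N \<phi> (head n x))\<bar> \<le> 3 * B"
proof (cases n)
  case 0
  then have "head n x = (\<lambda>z. 0)" by (simp add: head_def)
  then show ?thesis using assms by simp
next
  case (Suc m)
  have "ev h (head n x) = ev h x" if "h \<le> m" for h
    using that Suc by (intro ev_cong) (auto simp: head_def)
  then show ?thesis using assms Suc by (intro ext_bound[of _ m]) (auto simp: head_def)
qed

lemma head_bnd: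
  fixes B :: real
  assumes "\<And>h. h < n \<Longrightarrow> \<bar>ev h x\<bar> \<le> B" "B \<ge> 0"
  shows "bnd (3 * B) (head n x)"
  using head_bound[OF assms adm_const[of 1 0]] by (simp add: bnd_def mul_1)

lemma mul_bound:
  assumes "\<And>h. h \<le> g \<Longrightarrow> \<bar>ev h x\<bar> \<le> B" "adm N \<phi>"
  shows "\<bar>ev g (mul N \<phi> x)\<bar> \<le> 3 * B"
proof -
  have B: "B \<ge> 0" using assms(1)[of g] by linarith
  have "ev g (mul N \<phi> x) = ev g (mul N \<phi> (head (Suc g) x))"
    by (intro ev_cong) (auto simp: head_def mul_def)
  then show ?thesis using head_bound[of "Suc g" x B] assms B by auto
qed

lemma bnd_mul: "bnd B x \<Longrightarrow> adm N \<phi> \<Longrightarrow> bnd (3 * B) (mul N \<phi> x)"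
  unfolding bnd_def using mul_bound by blast

lemma bnd_tail: "bnd B x \<Longrightarrow> bnd (3 * B) (tail n x)"
  unfolding tail_def by (intro bnd_mul adm_const) auto

lemma bnd_head: "bnd B x \<Longrightarrow> bnd (3 * B) (head n x)"
  using head_bnd bnd_nonneg unfolding bnd_def by blast

text \<open>\<open>ev z\<close> sees no coordinate after \<open>z\<close>, and the multiplication
  removes those before. So the functional biorthogonal to the basis vector at \<open>z\<close> is
  \<open>ev z\<close> after a multiplication, and the bound for multiplications carries over to
  coordinates.\<close>

lemma coef_ev: "x z = ev z (mul z (cls z (lab z)) x)"
proof -
  let ?y = "mul z (cls z (lab z)) x"
  have "ev z ?y = ev z (\<lambda>u. if u = z then x z else 0)"
    by (intro ev_cong) (auto simp: mul_def cls_def sim_refl)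
  also have "\<dots> = x z"
  proof -
    have "pv z (\<lambda>u. if u = z then x z else 0) = 0"
      using prd_less[of z] by (cases "prd z") (auto intro!: ev_zero_cong)
    moreover have "bt z (cutm z (\<lambda>u. if u = z then x z else 0)) = bt z (\<lambda>u. 0)"
      by (intro bt_cong ev_cong) (auto simp: cutm_def mul_def)
    ultimately show ?thesis by (simp add: ev_eq[of z])
  qed
  finally show ?thesis by simp
qed

lemma coef_bound: "(\<And>h. h \<le> z \<Longrightarrow> \<bar>ev h x\<bar> \<le> B) \<Longrightarrow> \<bar>x z\<bar> \<le> 3 * B"
  using mul_bound[OF _ adm_cls] coef_ev[of x z] by simp

lemma bnd_coef: "bnd B x \<Longrightarrow> \<bar>x z\<bar> \<le> 3 * B"
  using coef_bound unfolding bnd_def by blast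

lemma ev_inj: "(\<And>h. ev h x = ev h y) \<Longrightarrow> x = y"
proof
  fix z assume "\<And>h. ev h x = ev h y"
  then have "\<bar>x z - y z\<bar> \<le> 3 * 0"
    using coef_bound[of z "\<lambda>z. x z - y z" 0] by (simp add: ev_diff)
  then show "x z = y z" by simp
qed

lemma mul_wt_bound:
  assumes "bnd B x" "\<And>h. wt h = wt g \<Longrightarrow> \<bar>ev h x\<bar> \<le> A" "adm N \<phi>"
  shows "\<bar>ev g (mul N \<phi> x)\<bar> \<le> 2 * A + 6 * B / mw (wt g)"
proof -
  have A: "A \<ge> 0" using assms(2)[of g] by linarith
  have "\<bar>ev g (mul N \<phi> x) - \<phi> (lab g) * ev g x\<bar> \<le> A + 2 * (3 * B) / mw (wt g)"
    using assms A bnd_nonneg bnd_mul[OF assms(1)] unfolding bnd_def by (intro mul_diff_aux) auto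
  moreover have "\<bar>\<phi> (lab g) * ev g x\<bar> \<le> A"
    using assms(2)[of g] assms(3) mult_mono[of "\<bar>\<phi> (lab g)\<bar>" 1 "\<bar>ev g x\<bar>" A]
    by (auto simp: abs_mult adm_def)
  ultimately show ?thesis by simp
qed

text \<open>Along a chain of the weight of \<open>g\<close> nothing happens up to \<open>n\<close>.
  The step that leaves this range contributes a single term with the factor
  \<open>1 / mw (wt g)\<close>, and the later cuts miss \<open>x\<close>.\<close>

lemma local_weight:
  assumes "B \<ge> 0" "\<And>h. h \<le> n \<Longrightarrow> \<bar>ev h x\<bar> \<le> B" "\<And>z. z > n \<Longrightarrow> x z = 0"
    and "\<And>h. h \<le> n \<Longrightarrow> wt h = wt g \<Longrightarrow> ev h x = 0"
  shows "\<bar>ev g x\<bar> \<le> 3 * B / mw (wt g)"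
  using assms(4)
proof (induction g rule: less_induct)
  case (less g)
  have nn: "3 * B / mw (wt g) \<ge> 0" using assms(1) mw_pos[of "wt g"] by simp
  show ?case
  proof (cases "g \<le> n")
    case True
    then show ?thesis using less.prems[of g] nn by simp
  next
    case False
    then have x0: "x g = 0" using assms(3) by simp
    have b: "\<bar>bt g (cutm g x) / mw (wt g)\<bar> \<le> 3 * B / mw (wt g)"
      unfolding abs_divide using ext_bound[OF assms(1-3) adm_cls] assms(1) mw_pos[of "wt g"]
      by (auto simp: cutm_def intro!: divide_right_mono bt_bound)
    show ?thesis
    proof (cases "prd g")
      case None
      then show ?thesis using x0 b by (simp add: ev_eq[of g])
    next
      case (Some h)
      note h = prd_less[OF Some] prd_cut[OF Some] prd_wt[OF Some]
      show ?thesis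
      proof (cases "h \<le> n")
        case True
        then show ?thesis using Some x0 b less.prems[of h] h by (simp add: ev_eq[of g])
      next
        case False
        then have "cutm g x = (\<lambda>z. 0)" using assms(3) h by (auto simp: cutm_def mul_def)
        then have "ev g x = ev h x" using Some x0 by (simp add: ev_eq[of g])
        then show ?thesis using less.IH[OF h(1)] less.prems h by simp
      qed
    qed
  qed
qed

text \<open>The multiplications \<open>mul N \<phi>\<close> are closed under composition and contain the cuts \<open>cutm g\<close>, so
  estimates for all of them at once survive the recursion for \<open>ev\<close>.\<close>

definition good :: "real \<Rightarrow> nat \<Rightarrow> (nat \<Rightarrow> real) \<Rightarrow> bool" where
  "good C j x \<longleftrightarrow> (\<forall>N \<phi> g. adm N \<phi> \<longrightarrow> \<bar>ev g (mul N \<phi> x)\<bar> \<le> C \<and>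
     (wt g < j \<longrightarrow> \<bar>ev g (mul N \<phi> x)\<bar> \<le> C / mw (wt g)))"

lemma goodD1: "good C j x \<Longrightarrow> adm N \<phi> \<Longrightarrow> \<bar>ev g (mul N \<phi> x)\<bar> \<le> C"
  unfolding good_def by blast

lemma goodD2: "good C j x \<Longrightarrow> adm N \<phi> \<Longrightarrow> wt g < j \<Longrightarrow> \<bar>ev g (mul N \<phi> x)\<bar> \<le> C / mw (wt g)"
  unfolding good_def by blast

lemma good_bnd: "good C j x \<Longrightarrow> bnd C x"
  unfolding bnd_def using goodD1[OF _ adm_const[of 1 0]] by (simp add: mul_1)

lemma good_nonneg: "good C j x \<Longrightarrow> C \<ge> 0"
  using good_bnd bnd_nonneg by blast

lemma good_mul: "good C j x \<Longrightarrow> adm N \<phi> \<Longrightarrow> good C j (mul N \<phi> x)"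
  unfolding good_def mul_mul using adm_mult by blast

lemma good_coef: "good C j x \<Longrightarrow> \<bar>x z\<bar> \<le> C"
  using coef_ev[of x z] goodD1[OF _ adm_cls] by metis

lemma good_add: "good C j x \<Longrightarrow> good C' j y \<Longrightarrow> good (C + C') j (\<lambda>z. x z + y z)"
proof -
  assume a: "good C j x" "good C' j y"
  have m: "mul N \<phi> (\<lambda>z. x z + y z) = (\<lambda>z. mul N \<phi> x z + mul N \<phi> y z)" for N \<phi>
    using mul_linear[of N \<phi> 1 x 1 y] by simp
  show ?thesis
    unfolding good_def m ev_add add_divide_distrib
    using a unfolding good_def by (meson abs_triangle_ineq add_mono order_trans)
qed

lemma good_mono: "good C j x \<Longrightarrow> C \<le> C' \<Longrightarrow> good C' j x"
  unfolding good_def using mw_pos by (meson divide_right_mono less_imp_le order_trans)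

text \<open>All chain elements of weight \<open>w \<ge> q\<close> lie beyond the support, so only the first term of the
  evaluation analysis survives.\<close>

lemma high_weight:
  assumes "supp p q x" "good C j x" "q \<le> wt g" "adm N \<phi>"
  shows "\<bar>ev g (mul N \<phi> x)\<bar> \<le> C / mw (wt g)"
  using assms(3)
proof (induction g rule: less_induct)
  case (less g)
  let ?y = "mul N \<phi> x"
  have q: "q \<le> g" using less.prems wt_le[of g] by simp
  then have x0: "?y g = 0" using assms(1) by (simp add: supp_def mul_def)
  show ?case
  proof (cases "prd g")
    case None
    have "\<bar>bt g (cutm g ?y)\<bar> \<le> C"
      using good_bnd[OF good_mul[OF good_mul[OF assms(2,4)] adm_cls]] good_nonneg[OF assms(2)]
      unfolding cutm_def by (intro bt_bound) (auto simp: bnd_def)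
    then show ?thesis using None x0 mw_pos[of "wt g"]
      by (simp add: ev_eq[of g] divide_right_mono)
  next
    case (Some h)
    note h = prd_less[OF Some] prd_cut[OF Some] prd_wt[OF Some]
    have "q \<le> cut g" using h less.prems wt_le[of h] by simp
    then have "cutm g ?y = (\<lambda>z. 0)" using assms(1) by (auto simp: cutm_def mul_def supp_def)
    then have "ev g ?y = ev h ?y" using Some x0 by (simp add: ev_eq[of g])
    then show ?thesis using less.IH[OF h(1)] less.prems h by simp
  qed
qed

text \<open>Below the weight index \<open>j k\<close> the vector \<open>x k\<close> already decays.
  The condition \<open>q k \<le> j k'\<close> is the rapid increase: a given weight index lies
  between \<open>j k\<close> and \<open>q k\<close> for at most one \<open>k\<close>. The length is
  finite because the estimates concern finite sums; an infinite sequence is one satisfying this for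
  every \<open>L\<close>.\<close>

definition ris :: "real \<Rightarrow> nat \<Rightarrow> (nat \<Rightarrow> nat \<Rightarrow> real) \<Rightarrow> (nat \<Rightarrow> nat) \<Rightarrow> (nat \<Rightarrow> nat) \<Rightarrow> (nat \<Rightarrow> nat) \<Rightarrow> bool"
  where "ris C L x p q j \<longleftrightarrow> C \<ge> 0 \<and>
    (\<forall>k<L. good C (j k) (x k) \<and> supp (p k) (q k) (x k) \<and> p k < q k) \<and>
    (\<forall>k k'. k < k' \<longrightarrow> k' < L \<longrightarrow> q k \<le> p k' \<and> q k \<le> j k')"

lemma ev_supp_zero: "supp p q x \<Longrightarrow> g < p \<or> q \<le> N \<Longrightarrow> ev g (mul N \<phi> x) = 0"
  by (rule ev_zero_cong) (auto simp: supp_def mul_def)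

text \<open>One expansion along the evaluation analysis. Each of its \<open>age g\<close> terms
  costs \<open>C\<close> for the coordinate itself, \<open>C\<close> for the vector straddling the
  cut, and \<open>A\<close>. The vectors starting between the cut and the element are different ones
  for different terms, so these contributions add up to a single count, divided by the
  weight.\<close>

lemma ris_sum_step:
  fixes A C E :: real
  assumes r: "ris C L x p q j" and A: "A \<ge> 0" and E: "E \<ge> 0"
    and IH: "\<And>g N \<phi> I. adm N \<phi> \<Longrightarrow> I \<subseteq> {..<L} \<Longrightarrow>
      \<bar>\<Sum>k\<in>I. ev g (mul N \<phi> (x k))\<bar> \<le> A + card I * E"
    and N: "adm N \<phi>" and I: "I \<subseteq> {..<L}"
  shows "\<bar>\<Sum>k\<in>I. ev g (mul N \<phi> (x k))\<bar> \<le>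
    age g * (2 * C + A) + card {k \<in> I. p k < g} * E / mw (wt g)"
proof (induction g rule: less_induct)
  case (less g)
  let ?y = "\<lambda>k. mul N \<phi> (x k)"
  \<comment> \<open>Vectors starting at \<open>g\<close> or later vanish under functionals below
    \<open>g\<close>, and those ending before \<open>cut g\<close> are removed by the cut. Among the
    vectors starting before the cut at most one reaches beyond it.\<close>
  let ?I' = "{k \<in> I. cut g \<le> p k \<and> p k < g}"
  have C: "C \<ge> 0" using r by (simp add: ris_def)
  have fin: "finite I" using I finite_subset by blast
  have sep: "q k \<le> p k' \<or> q k' \<le> p k" if "k \<in> I" "k' \<in> I" "k \<noteq> k'" for k k'
  proof -
    have "k < L" "k' < L" "k < k' \<or> k' < k" using that I by auto
    then show ?thesis using r unfolding ris_def by blast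
  qed
  have gd: "good C (j k) (x k)" "supp (p k) (q k) (x k)" if "k \<in> I" for k
    using that r I unfolding ris_def by auto
  have mp: "mw (wt g) \<ge> 1" using mw_ge[of "wt g"] by simp
  have s1: "\<bar>\<Sum>k\<in>I. ?y k g\<bar> \<le> C"
  proof (rule sum_at_most_one)
    fix k k' assume k: "k \<in> I" "k' \<in> I" "k \<noteq> k'"
    have "g < p k \<or> q k \<le> g \<or> g < p k' \<or> q k' \<le> g" using sep[OF k] by auto
    then show "?y k g = 0 \<or> ?y k' g = 0"
      using gd(2)[OF k(1)] gd(2)[OF k(2)] by (auto simp: supp_def mul_def)
  next
    fix k assume "k \<in> I"
    then show "\<bar>?y k g\<bar> \<le> C" using good_coef good_mul gd(1) N by blast
  qed (rule C)
  have s2: "\<bar>bt g (cutm g (\<lambda>z. \<Sum>k\<in>I. ?y k z))\<bar> \<le> C + (A + card ?I' * E)"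
  proof (rule bt_bound)
    fix h assume h: "h < g"
    obtain N' \<phi>' where N': "adm N' \<phi>'" "cut g \<le> N'" "\<And>x. cutm g (mul N \<phi> x) = mul N' \<phi>' x"
      using cutm_mul[OF N] by blast
    have "ev h (cutm g (\<lambda>z. \<Sum>k\<in>I. ?y k z)) = (\<Sum>k\<in>I. ev h (mul N' \<phi>' (x k)))"
      by (simp add: mul_sum[symmetric] N' ev_sum[symmetric])
    also have "\<dots> = (\<Sum>k\<in>?I'. ev h (mul N' \<phi>' (x k))) + (\<Sum>k\<in>I - ?I'. ev h (mul N' \<phi>' (x k)))"
      using fin by (metis (no_types, lifting) add.commute mem_Collect_eq subsetI sum.subset_diff)
    finally have e: "ev h (cutm g (\<lambda>z. \<Sum>k\<in>I. ?y k z)) =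
      (\<Sum>k\<in>?I'. ev h (mul N' \<phi>' (x k))) + (\<Sum>k\<in>I - ?I'. ev h (mul N' \<phi>' (x k)))" .
    have "\<bar>\<Sum>k\<in>I - ?I'. ev h (mul N' \<phi>' (x k))\<bar> \<le> C"
    proof (rule sum_at_most_one)
      have z: "ev h (mul N' \<phi>' (x k)) = 0" if "k \<in> I - ?I'" "\<not> (p k < cut g \<and> cut g < q k)" for k
        using that h N'(2) gd(2)[of k] by (intro ev_supp_zero) auto
      fix k k' assume k: "k \<in> I - ?I'" "k' \<in> I - ?I'" "k \<noteq> k'"
      then have "q k \<le> p k' \<or> q k' \<le> p k" using sep by blast
      then have "\<not> (p k < cut g \<and> cut g < q k) \<or> \<not> (p k' < cut g \<and> cut g < q k')" by auto
      then show "ev h (mul N' \<phi>' (x k)) = 0 \<or> ev h (mul N' \<phi>' (x k')) = 0" using z k by blast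
    next
      fix k assume "k \<in> I - ?I'"
      then show "\<bar>ev h (mul N' \<phi>' (x k))\<bar> \<le> C" using gd(1)[of k] N' goodD1 by auto
    qed (rule C)
    moreover have "\<bar>\<Sum>k\<in>?I'. ev h (mul N' \<phi>' (x k))\<bar> \<le> A + card ?I' * E"
      using I by (intro IH N') auto
    ultimately show "\<bar>ev h (cutm g (\<lambda>z. \<Sum>k\<in>I. ?y k z))\<bar> \<le> C + (A + card ?I' * E)"
      using e by linarith
  qed (use C A E in auto)
  have s3: "\<bar>bt g (cutm g (\<lambda>z. \<Sum>k\<in>I. ?y k z)) / mw (wt g)\<bar> \<le> C + A + card ?I' * E / mw (wt g)"
  proof -
    have "\<bar>bt g (cutm g (\<lambda>z. \<Sum>k\<in>I. ?y k z)) / mw (wt g)\<bar> \<le> (C + A + card ?I' * E) / mw (wt g)"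
      unfolding abs_divide using s2 mp by (simp add: divide_right_mono)
    also have "\<dots> = (C + A) / mw (wt g) + card ?I' * E / mw (wt g)" by (simp add: add_divide_distrib)
    also have "(C + A) / mw (wt g) \<le> (C + A) / 1" using mp C A by (intro divide_left_mono) auto
    finally show ?thesis by simp
  qed
  have e: "(\<Sum>k\<in>I. ev g (?y k)) =
    (\<Sum>k\<in>I. ?y k g) + pv g (\<lambda>z. \<Sum>k\<in>I. ?y k z) + bt g (cutm g (\<lambda>z. \<Sum>k\<in>I. ?y k z)) / mw (wt g)"
    unfolding ev_sum[symmetric] by (rule ev_eq)
  show ?case
  proof (cases "prd g")
    case None
    have "card ?I' * E / mw (wt g) \<le> card {k \<in> I. p k < g} * E / mw (wt g)"
      using fin mp E by (intro divide_right_mono mult_right_mono) (auto intro!: card_mono)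
    moreover have "2 * C + A \<le> age g * (2 * C + A)"
      using age_pos[of g] C A mult_right_mono[of 1 "real (age g)" "2 * C + A"] by auto
    moreover have "\<bar>a + 0 + b\<bar> \<le> u + v"
      if "\<bar>a\<bar> \<le> C" "\<bar>b\<bar> \<le> C + A + v'" "v' \<le> v" "2 * C + A \<le> u" for a b u v v' :: real
      using that by linarith
    ultimately show ?thesis unfolding e pv_None[OF None] using s1 s3 by blast
  next
    case (Some h)
    note h = prd_less[OF Some] prd_cut[OF Some] prd_wt[OF Some] prd_age[OF Some]
    \<comment> \<open>The predecessor lies below \<open>cut g\<close>, so the two windows have no
      starting point in common.\<close>
    have "card {k \<in> I. p k < h} + card ?I' = card ({k \<in> I. p k < h} \<union> ?I')"
      using fin h by (intro card_Un_disjoint[symmetric]) auto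
    also have "\<dots> \<le> card {k \<in> I. p k < g}"
      using fin h by (intro card_mono) auto
    finally have "real (card {k \<in> I. p k < h}) + card ?I' \<le> card {k \<in> I. p k < g}" by linarith
    then have "(real (card {k \<in> I. p k < h}) + card ?I') * E / mw (wt g) \<le> card {k \<in> I. p k < g} * E / mw (wt g)"
      using mp E by (intro divide_right_mono mult_right_mono) auto
    then have c: "card {k \<in> I. p k < h} * E / mw (wt g) + card ?I' * E / mw (wt g) \<le> card {k \<in> I. p k < g} * E / mw (wt g)"
      by (simp add: algebra_simps add_divide_distrib)
    have "\<bar>pv g (\<lambda>z. \<Sum>k\<in>I. ?y k z)\<bar> \<le> age h * (2 * C + A) + card {k \<in> I. p k < h} * E / mw (wt g)"
      using less.IH[OF h(1)] Some h(3) by (simp add: ev_sum)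
    moreover have "age g * (2 * C + A) = age h * (2 * C + A) + (2 * C + A)"
      using h(4) by (simp add: algebra_simps)
    ultimately show ?thesis using e s1 s3 c by linarith
  qed
qed

text \<open>Each expansion multiplies the constant part by at most \<open>2 * n\<close> and gains
  \<open>1 / 16\<close> in the part proportional to the number of vectors, as long as the weight
  index is below \<open>j0\<close>. From \<open>j0\<close> on the direct estimate \<open>H\<close>
  takes over, and its \<open>\<theta>\<close> limits the total gain. The second claim expands once
  more, keeping the actual weight in place of \<open>1 / 16\<close>.\<close>

lemma ris_sum:
  fixes A C \<theta> :: real
  assumes r: "ris C L x p q j" and AH: "A \<ge> 0" and th: "\<theta> \<ge> 0"
    and H: "\<And>g N \<phi> I. j0 \<le> wt g \<Longrightarrow> adm N \<phi> \<Longrightarrow> I \<subseteq> {..<L} \<Longrightarrow>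
      \<bar>\<Sum>k\<in>I. ev g (mul N \<phi> (x k))\<bar> \<le> A + card I * C * \<theta>"
    and n: "\<And>i. i < j0 \<Longrightarrow> nn i \<le> n" "n \<ge> 1"
    and N: "adm N \<phi>" and I: "I \<subseteq> {..<L}"
  shows "\<bar>\<Sum>k\<in>I. ev g (mul N \<phi> (x k))\<bar> \<le> (2 * C + A) * (2 * real n) ^ d + card I * (C * max (1 / 16 ^ d) \<theta>)"
    and "wt g < j0 \<Longrightarrow> \<bar>\<Sum>k\<in>I. ev g (mul N \<phi> (x k))\<bar> \<le>
      (2 * C + A) * (2 * real n) ^ Suc d + card I * (C * max (1 / 16 ^ d) \<theta>) / mw (wt g)"
proof -
  let ?c = "2 * C + A"
  let ?E = "\<lambda>d. C * max (1 / 16 ^ d) \<theta>"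
  let ?P = "\<lambda>d. \<forall>g N \<phi> I. adm N \<phi> \<longrightarrow> I \<subseteq> {..<L} \<longrightarrow>
    \<bar>\<Sum>k\<in>I. ev g (mul N \<phi> (x k))\<bar> \<le> ?c * (2 * real n) ^ d + card I * ?E d"
  have C: "C \<ge> 0" using r by (simp add: ris_def)
  have E0: "?E d \<ge> 0" for d using C th by (intro mult_nonneg_nonneg) auto
  have pw: "(2 * real n) ^ d \<ge> 1" for d using n(2) by (intro one_le_power) auto
  have low: "\<bar>\<Sum>k\<in>I. ev g (mul N \<phi> (x k))\<bar> \<le> n * (2 * C + ?c * (2 * real n) ^ d) + card I * ?E d / mw (wt g)"
    if d: "?P d" and g: "wt g < j0" and N: "adm N \<phi>" and I: "I \<subseteq> {..<L}" for d g N \<phi> I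
  proof -
    have A0: "?c * (2 * real n) ^ d \<ge> 0" using C AH by auto
    have "\<bar>\<Sum>k\<in>I. ev g (mul N \<phi> (x k))\<bar> \<le>
      age g * (2 * C + ?c * (2 * real n) ^ d) + card {k \<in> I. p k < g} * ?E d / mw (wt g)"
      by (rule ris_sum_step[OF r A0 E0 _ N I]) (use d in blast)
    also have "age g * (2 * C + ?c * (2 * real n) ^ d) \<le> n * (2 * C + ?c * (2 * real n) ^ d)"
      using age_le[of g] n(1)[OF g] C A0 by (intro mult_right_mono) auto
    also have "card {k \<in> I. p k < g} * ?E d / mw (wt g) \<le> card I * ?E d / mw (wt g)"
      using E0 mw_pos[of "wt g"] I finite_subset
      by (intro divide_right_mono mult_right_mono) (auto intro!: card_mono)
    finally show ?thesis by simp
  qed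
  have A1: "n * (2 * C + ?c * (2 * real n) ^ d) + A \<le> ?c * (2 * real n) ^ Suc d" for d
  proof -
    have "A \<le> n * A" using n(2) AH mult_right_mono[of 1 "real n" A] by simp
    then have "n * (2 * C + ?c * (2 * real n) ^ d) + A \<le> n * (?c * 1 + ?c * (2 * real n) ^ d)"
      by (simp add: algebra_simps)
    also have "\<dots> \<le> n * (?c * (2 * real n) ^ d + ?c * (2 * real n) ^ d)"
      using pw[of d] C AH by (intro mult_left_mono add_mono) auto
    also have "\<dots> = ?c * (2 * real n) ^ Suc d" by (simp add: algebra_simps)
    finally show ?thesis .
  qed
  have P: "?P d" for d
  proof (induction d)
    case 0
    show ?case
    proof (intro allI impI)
      fix g N \<phi> I assume a: "adm N \<phi>" "I \<subseteq> {..<L}"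
      have "\<bar>\<Sum>k\<in>I. ev g (mul N \<phi> (x k))\<bar> \<le> (\<Sum>k\<in>I. C)"
        using r a unfolding ris_def by (intro order_trans[OF sum_abs] sum_mono) (auto intro!: goodD1)
      also have "\<dots> \<le> card I * ?E 0"
        using C mult_left_mono[of 1 "max 1 \<theta>" C] by (auto intro!: mult_left_mono)
      finally show "\<bar>\<Sum>k\<in>I. ev g (mul N \<phi> (x k))\<bar> \<le> ?c * (2 * real n) ^ 0 + card I * ?E 0"
        using C AH by simp
    qed
  next
    case (Suc d)
    show ?case
    proof (intro allI impI)
      fix g N \<phi> I assume a: "adm N \<phi>" "I \<subseteq> {..<L}"
      show "\<bar>\<Sum>k\<in>I. ev g (mul N \<phi> (x k))\<bar> \<le> ?c * (2 * real n) ^ Suc d + card I * ?E (Suc d)"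
      proof (cases "wt g < j0")
        case True
        have "?E d / mw (wt g) \<le> ?E d / 16"
          using E0[of d] mw_ge[of "wt g"] by (intro divide_left_mono) auto
        also have "\<dots> \<le> ?E (Suc d)"
        proof -
          have "max (1 / 16 ^ d) \<theta> / 16 \<le> max (1 / 16 ^ Suc d) \<theta>" using th by (auto simp: max_def)
          from mult_left_mono[OF this C] show ?thesis by simp
        qed
        finally have "card I * (?E d / mw (wt g)) \<le> card I * ?E (Suc d)"
          by (intro mult_left_mono) auto
        then show ?thesis using low[OF Suc True a] A1[of d] AH by simp
      next
        case False
        have "card I * C * \<theta> \<le> card I * ?E (Suc d)"
          using C by (auto simp: mult.assoc intro!: mult_left_mono)
        moreover have "A \<le> ?c * (2 * real n) ^ Suc d"
          using pw[of "Suc d"] C AH mult_left_mono[of 1 "(2 * real n) ^ Suc d" ?c] by simp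
        ultimately show ?thesis using H[of g N \<phi> I] False a by simp
      qed
    qed
  qed
  show "\<bar>\<Sum>k\<in>I. ev g (mul N \<phi> (x k))\<bar> \<le> ?c * (2 * real n) ^ d + card I * ?E d"
    using P N I by blast
  show "\<bar>\<Sum>k\<in>I. ev g (mul N \<phi> (x k))\<bar> \<le> ?c * (2 * real n) ^ Suc d + card I * ?E d / mw (wt g)" if "wt g < j0"
    using low[OF P that N I, of d] A1[of d] AH by simp
qed

end

text \<open>With \<open>2 ^ Suc j\<close> expansions the gain is
  \<open>16 ^ 2 ^ Suc j = (mw j)\<^sup>2\<close>. The definition of \<open>nn j\<close> makes their
  cost, even with one further expansion, equal to \<open>nn j / (mw j)\<^sup>2\<close>.\<close>

lemma nn_power:
  assumes "j \<ge> 1"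
  shows "(2 * real (nn (j - 1))) ^ Suc (2 ^ Suc j) = nn j / (mw j)\<^sup>2"
    and "(2 * real (nn (j - 1))) ^ (2 ^ Suc j) \<le> nn j / (mw j)\<^sup>2"
proof -
  obtain i where i: "j = Suc i" using assms by (cases j) auto
  show e: "(2 * real (nn (j - 1))) ^ Suc (2 ^ Suc j) = nn j / (mw j)\<^sup>2"
    using mw_pos[of j] unfolding i nn_Suc by (simp add: field_simps)
  have "1 * (2 * real (nn (j - 1))) ^ (2 ^ Suc j) \<le> (2 * real (nn (j - 1))) * (2 * real (nn (j - 1))) ^ (2 ^ Suc j)"
    using nn_pos[of "j - 1"] by (intro mult_right_mono) auto
  then show "(2 * real (nn (j - 1))) ^ (2 ^ Suc j) \<le> nn j / (mw j)\<^sup>2"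
    using e by (metis mult_1 power_Suc)
qed

lemma nn_ge_mw: "j \<ge> 1 \<Longrightarrow> (mw j)\<^sup>2 \<le> nn j"
proof -
  assume j: "j \<ge> 1"
  have "1 \<le> (2 * real (nn (j - 1))) ^ (2 ^ Suc j)" using nn_pos[of "j - 1"] by (intro one_le_power) auto
  then have "1 \<le> nn j / (mw j)\<^sup>2" using nn_power(2)[OF j] by (rule order_trans)
  then show ?thesis using mw_pos[of j] by (simp add: field_simps)
qed

section \<open>Exact vectors as averages, and functionals on rapidly increasing sequences\<close>

context ah_system
begin

text \<open>The vector half of an exact pair in the sense of Argyros and Haydon: only elements of
  weight index \<open>j\<close> may see \<open>z\<close> without a factor that is small in terms of
  the weights.\<close>

definition exact :: "real \<Rightarrow> nat \<Rightarrow> (nat \<Rightarrow> real) \<Rightarrow> bool" where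
  "exact C j z \<longleftrightarrow> good C j z \<and> (\<forall>\<zeta>. \<bar>z \<zeta>\<bar> \<le> C / mw j) \<and>
     (\<forall>N \<phi> g. adm N \<phi> \<longrightarrow> j < wt g \<longrightarrow> \<bar>ev g (mul N \<phi> z)\<bar> \<le> C / mw j)"

lemma sum_split_bad:
  fixes f :: "nat \<Rightarrow> real" and C D :: real
  assumes "finite I" "\<And>k k'. k \<in> I \<Longrightarrow> k' \<in> I \<Longrightarrow> P k \<Longrightarrow> P k' \<Longrightarrow> k = k'"
    and "\<And>k. k \<in> I \<Longrightarrow> P k \<Longrightarrow> \<bar>f k\<bar> \<le> C" "\<And>k. k \<in> I \<Longrightarrow> \<not> P k \<Longrightarrow> \<bar>f k\<bar> \<le> D" "C \<ge> 0" "D \<ge> 0"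
  shows "\<bar>sum f I\<bar> \<le> C + card I * D"
proof -
  have "sum f I = (\<Sum>k\<in>I. if P k then f k else 0) + (\<Sum>k\<in>I. if P k then 0 else f k)"
    unfolding sum.distrib[symmetric] by (intro sum.cong) auto
  moreover have "\<bar>\<Sum>k\<in>I. if P k then f k else 0\<bar> \<le> C"
    using assms by (intro sum_at_most_one) auto
  moreover have "\<bar>\<Sum>k\<in>I. if P k then 0 else f k\<bar> \<le> (\<Sum>k\<in>I. D)"
    using assms by (intro order_trans[OF sum_abs] sum_mono) auto
  ultimately show ?thesis by simp
qed

text \<open>The weight index \<open>w\<close> of \<open>g\<close> is exceptional for
  \<open>x k\<close> only if \<open>j k \<le> w < q k\<close>: below, \<open>good\<close> gives the
  decay, above, \<open>high_weight\<close> does. Rapid increase leaves at most one exceptional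
  \<open>k\<close>, which costs \<open>C\<close>.\<close>

lemma ris_sum_high:
  fixes C :: real
  assumes r: "ris C L x p q j" and N: "adm N \<phi>" and I: "I \<subseteq> {..<L}"
  shows "\<bar>\<Sum>k\<in>I. ev g (mul N \<phi> (x k))\<bar> \<le> C + card I * (C / mw (wt g))"
proof (rule sum_split_bad[where P = "\<lambda>k. j k \<le> wt g \<and> wt g < q k"])
  show "finite I" using I finite_subset by blast
  have C: "C \<ge> 0" using r by (simp add: ris_def)
  show "C \<ge> 0" "C / mw (wt g) \<ge> 0" using C mw_pos[of "wt g"] by simp_all
  have gd: "good C (j k) (x k)" "supp (p k) (q k) (x k)" if "k \<in> I" for k
    using that r I unfolding ris_def by auto
  show "\<bar>ev g (mul N \<phi> (x k))\<bar> \<le> C" if "k \<in> I" for k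
    using gd(1)[OF that] N goodD1 by blast
  show "\<bar>ev g (mul N \<phi> (x k))\<bar> \<le> C / mw (wt g)" if "k \<in> I" "\<not> (j k \<le> wt g \<and> wt g < q k)" for k
    using that gd[OF that(1)] N goodD2 high_weight by (metis not_less)
  fix k k' assume a: "k \<in> I" "k' \<in> I" "j k \<le> wt g \<and> wt g < q k" "j k' \<le> wt g \<and> wt g < q k'"
  have "k < L" "k' < L" using a I by auto
  then have "k < k' \<Longrightarrow> q k \<le> j k'" "k' < k \<Longrightarrow> q k' \<le> j k" using r by (auto simp: ris_def)
  then show "k = k'" using a by linarith
qed

text \<open>The normalisation \<open>mw j / nn j\<close> turns the proportional part
  \<open>nn j * C / mw j\<close> of the sum into \<open>C\<close>, and the constant part
  \<open>3 * C * nn j / (mw j)\<^sup>2\<close> left by the expansions into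
  \<open>3 * C / mw j\<close>; this accounts for the 4. Weights above \<open>j\<close> are handled
  by \<open>ris_sum_high\<close> alone, using \<open>(mw j)\<^sup>2 \<le> nn j\<close>.\<close>

lemma exact_average:
  fixes C :: real
  assumes r: "ris C (nn j) x p q jj" and j: "j \<ge> 1"
  shows "exact (4 * C) j (\<lambda>\<zeta>. mw j / nn j * (\<Sum>k<nn j. x k \<zeta>))"
proof -
  let ?z = "\<lambda>\<zeta>. mw j / nn j * (\<Sum>k<nn j. x k \<zeta>)"
  let ?n = "nn (j - 1)"
  let ?d = "2 ^ Suc j"
  have C: "C \<ge> 0" using r by (simp add: ris_def)
  have mp: "mw j \<ge> 1" using mw_ge[of j] by simp
  have np: "real (nn j) \<ge> 1" using nn_pos[of j] by simp
  have nm: "mw j * mw j \<le> nn j" using nn_ge_mw[OF j] by (simp add: power2_eq_square)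
  have lz: "ev g (mul N \<phi> ?z) = mw j / nn j * (\<Sum>k<nn j. ev g (mul N \<phi> (x k)))" for g N \<phi>
    using mul_linear[of N \<phi> "mw j / nn j" "\<lambda>z. \<Sum>k<nn j. x k z" 0 "\<lambda>z. 0"]
      ev_cmult[of g "mw j / nn j" "\<lambda>z. \<Sum>k<nn j. mul N \<phi> (x k) z"]
    by (simp add: mul_sum ev_sum)
  \<comment> \<open>The expansions gain \<open>(mw j)\<^sup>2\<close>, more than the direct estimate
    for weights from \<open>j\<close> on, which is therefore the limiting one.\<close>
  have mx: "max (1 / 16 ^ ?d) (1 / mw j) = 1 / mw j"
    unfolding mw_power using mp by (simp add: max_def power2_eq_square field_simps)
  have H: "\<bar>\<Sum>k\<in>I. ev g (mul N \<phi> (x k))\<bar> \<le> C + card I * C * (1 / mw j)"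
    if "j \<le> wt g" "adm N \<phi>" "I \<subseteq> {..<nn j}" for g N \<phi> I
  proof -
    have "\<bar>\<Sum>k\<in>I. ev g (mul N \<phi> (x k))\<bar> \<le> C + card I * (C / mw (wt g))"
      by (rule ris_sum_high[OF r that(2,3)])
    also have "card I * (C / mw (wt g)) \<le> card I * (C / mw j)"
      using C mw_mono[OF that(1)] mw_pos by (intro mult_left_mono divide_left_mono) auto
    finally show ?thesis by simp
  qed
  have n: "i < j \<Longrightarrow> nn i \<le> ?n" "?n \<ge> 1" for i using nn_mono[of i "j - 1"] nn_pos by auto
  have th: "1 / mw j \<ge> 0" using mp by simp
  have S: "\<bar>\<Sum>k<nn j. ev g (mul N \<phi> (x k))\<bar> \<le> 3 * C * (2 * real ?n) ^ ?d + nn j * (C * (1 / mw j))"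
    "wt g < j \<Longrightarrow> \<bar>\<Sum>k<nn j. ev g (mul N \<phi> (x k))\<bar> \<le>
      3 * C * (2 * real ?n) ^ Suc ?d + nn j * (C * (1 / mw j)) / mw (wt g)" if N: "adm N \<phi>" for g N \<phi>
    using ris_sum[OF r C th H n N order_refl, where d = ?d, unfolded mx] by simp_all
  have all: "\<bar>ev g (mul N \<phi> ?z)\<bar> \<le> 4 * C" if N: "adm N \<phi>" for g N \<phi>
  proof -
    have "\<bar>\<Sum>k<nn j. ev g (mul N \<phi> (x k))\<bar> \<le> 3 * C * (nn j / (mw j)\<^sup>2) + nn j * (C * (1 / mw j))"
      using S(1)[OF N, of g] mult_left_mono[OF nn_power(2)[OF j], of "3 * C"] C by linarith
    then have "mw j / nn j * \<bar>\<Sum>k<nn j. ev g (mul N \<phi> (x k))\<bar> \<le>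
      mw j / nn j * (3 * C * (nn j / (mw j)\<^sup>2) + nn j * (C * (1 / mw j)))"
      using mp np by (intro mult_left_mono) auto
    also have "\<dots> = 3 * C / mw j + C" using mp np by (simp add: field_simps power2_eq_square)
    also have "3 * C / mw j \<le> 3 * C" using mp C by (simp add: field_simps mult_left_le_one_le mult_mono)
    finally show ?thesis unfolding lz abs_mult using mp np by simp
  qed
  have low: "\<bar>ev g (mul N \<phi> ?z)\<bar> \<le> 4 * C / mw (wt g)" if N: "adm N \<phi>" and g: "wt g < j" for g N \<phi>
  proof -
    have "\<bar>\<Sum>k<nn j. ev g (mul N \<phi> (x k))\<bar> \<le> 3 * C * (nn j / (mw j)\<^sup>2) + nn j * (C * (1 / mw j)) / mw (wt g)"
      using S(2)[OF N g] unfolding nn_power(1)[OF j] .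
    then have "mw j / nn j * \<bar>\<Sum>k<nn j. ev g (mul N \<phi> (x k))\<bar> \<le>
      mw j / nn j * (3 * C * (nn j / (mw j)\<^sup>2) + nn j * (C * (1 / mw j)) / mw (wt g))"
      using mp np by (intro mult_left_mono) auto
    also have "\<dots> = 3 * C / mw j + C / mw (wt g)" using mp np by (simp add: field_simps power2_eq_square)
    also have "3 * C / mw j \<le> 3 * C / mw (wt g)"
      using C mw_mono[of "wt g" j] g mw_pos[of "wt g"] by (intro divide_left_mono) auto
    finally show ?thesis unfolding lz abs_mult using mp np by simp
  qed
  have high: "\<bar>ev g (mul N \<phi> ?z)\<bar> \<le> 4 * C / mw j" if N: "adm N \<phi>" and g: "j < wt g" for g N \<phi>
  proof -
    have "\<bar>\<Sum>k<nn j. ev g (mul N \<phi> (x k))\<bar> \<le> C + nn j * (C / mw (wt g))"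
      using ris_sum_high[OF r N order_refl] by simp
    then have "mw j / nn j * \<bar>\<Sum>k<nn j. ev g (mul N \<phi> (x k))\<bar> \<le> mw j / nn j * (C + nn j * (C / mw (wt g)))"
      using mp np by (intro mult_left_mono) auto
    also have "\<dots> = mw j / nn j * C + mw j * C / mw (wt g)" using np by (simp add: field_simps)
    also have "mw j / nn j * C \<le> mw j / (mw j * mw j) * C"
      using C mp np nm by (intro mult_right_mono divide_left_mono) auto
    also have "mw j * C / mw (wt g) \<le> mw j * C / (mw j * mw j)"
      using mw_mono[of "Suc j" "wt g"] g C mp mw_pos[of "wt g"]
      by (intro divide_left_mono) (auto simp: mw_Suc power2_eq_square)
    finally have "mw j / nn j * \<bar>\<Sum>k<nn j. ev g (mul N \<phi> (x k))\<bar> \<le> 2 * C / mw j"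
      using mp by (simp add: field_simps)
    also have "\<dots> \<le> 4 * C / mw j" using mp C by (intro divide_right_mono) auto
    finally show ?thesis unfolding lz abs_mult using mp np by simp
  qed
  have co: "\<bar>?z \<zeta>\<bar> \<le> 4 * C / mw j" for \<zeta>
  proof -
    have "\<bar>\<Sum>k<nn j. x k \<zeta>\<bar> \<le> C"
    proof (rule sum_at_most_one)
      show "\<bar>x k \<zeta>\<bar> \<le> C" if "k \<in> {..<nn j}" for k
        using r that good_coef by (auto simp: ris_def)
      fix k k' assume k: "k \<in> {..<nn j}" "k' \<in> {..<nn j}" "k \<noteq> k'"
      have s: "supp (p k) (q k) (x k)" "supp (p k') (q k') (x k')" using r k by (auto simp: ris_def)
      have "k < k' \<Longrightarrow> q k \<le> p k'" "k' < k \<Longrightarrow> q k' \<le> p k" using r k by (auto simp: ris_def)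
      then have "\<zeta> < p k \<or> q k \<le> \<zeta> \<or> \<zeta> < p k' \<or> q k' \<le> \<zeta>" using k(3) by linarith
      then show "x k \<zeta> = 0 \<or> x k' \<zeta> = 0" using s by (auto simp: supp_def)
    qed (rule C)
    then have "\<bar>?z \<zeta>\<bar> \<le> mw j / nn j * C"
      unfolding abs_mult using mp np by (auto intro!: mult_left_mono divide_right_mono)
    also have "\<dots> \<le> mw j / (mw j * mw j) * C"
      using C mp np nm by (intro mult_right_mono divide_left_mono) auto
    also have "\<dots> \<le> 4 * C / mw j" using C mp by (simp add: field_simps)
    finally show ?thesis .
  qed
  show ?thesis unfolding exact_def good_def using all low high co by blast
qed

text \<open>Otherwise a subsequence has values of one sign and of modulus at least \<open>e\<close>.
  Its averages have norm at most \<open>4 * C\<close>, but \<open>f\<close> is at least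
  \<open>e * mw j\<close> on them up to sign, and this is unbounded in \<open>j\<close>.\<close>

lemma functional_null_ris:
  fixes f :: "(nat \<Rightarrow> real) \<Rightarrow> real"
  assumes add: "\<And>x y n m. supp 0 n x \<Longrightarrow> supp 0 m y \<Longrightarrow> f (\<lambda>z. x z + y z) = f x + f y"
    and sc: "\<And>x n a. supp 0 n x \<Longrightarrow> f (\<lambda>z. a * x z) = a * f x"
    and B: "\<And>x n b. supp 0 n x \<Longrightarrow> bnd b x \<Longrightarrow> \<bar>f x\<bar> \<le> B * b" "B \<ge> 0"
    and r: "\<And>L. ris C L x p q jj"
  shows "(\<lambda>k. f (x k)) \<longlonglongrightarrow> 0"
proof (rule ccontr)
  assume "\<not> ?thesis"
  then obtain e where e: "e > 0" "\<And>m. \<exists>k\<ge>m. \<bar>f (x k)\<bar> \<ge> e"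
    unfolding LIMSEQ_iff by (auto simp: not_less)
  have C: "C \<ge> 0" using r by (simp add: ris_def)
  have s: "supp (p k) (q k) (x k)" for k using r[of "Suc k"] by (auto simp: ris_def)
  have s0: "supp 0 (q k) (x k)" for k using s[of k] by (auto simp: supp_def)
  obtain \<sigma> where \<sigma>: "\<sigma> \<in> {1, -1}" "\<And>m. \<exists>k\<ge>m. \<sigma> * f (x k) \<ge> e"
  proof (cases "\<forall>m. \<exists>k\<ge>m. f (x k) \<ge> e")
    case True then show ?thesis using that[of 1] by auto
  next
    case False
    then obtain m0 where m0: "\<And>k. k \<ge> m0 \<Longrightarrow> f (x k) < e" by (meson not_le)
    have "\<exists>k\<ge>m. - 1 * f (x k) \<ge> e" for m
    proof -
      obtain k where k: "k \<ge> max m m0" "\<bar>f (x k)\<bar> \<ge> e" using e(2) by blast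
      then have "f (x k) < e" using m0 by auto
      then show ?thesis using k by (intro exI[of _ k]) auto
    qed
    then show ?thesis using that[of "-1"] by auto
  qed
  define S where "S = {k. \<sigma> * f (x k) \<ge> e}"
  have "infinite S" unfolding S_def infinite_nat_iff_unbounded_le using \<sigma>(2) by simp
  then have en: "strict_mono (enumerate S)" "\<And>k. enumerate S k \<in> S"
    by (simp_all add: strict_mono_enumerate enumerate_in_set)
  let ?u = "enumerate S"
  have r': "ris C L (\<lambda>k. x (?u k)) (\<lambda>k. p (?u k)) (\<lambda>k. q (?u k)) (\<lambda>k. jj (?u k))" for L
    unfolding ris_def
  proof (intro conjI allI impI C)
    fix k
    show "good C (jj (?u k)) (x (?u k))" "supp (p (?u k)) (q (?u k)) (x (?u k))" "p (?u k) < q (?u k)"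
      using r[of "Suc (?u k)"] by (auto simp: ris_def)
  next
    fix k k' :: nat assume "k < k'"
    then have "?u k < ?u k'" using en(1) strict_mono_less by blast
    then show "q (?u k) \<le> p (?u k')" "q (?u k) \<le> jj (?u k')"
      using r[of "Suc (?u k')"] by (auto simp: ris_def)
  qed
  have "e * mw j \<le> B * (4 * C)" if j: "j \<ge> 1" for j
  proof -
    let ?I = "{..<nn j}"
    have fs: "supp 0 (\<Sum>k\<in>J. q (?u k)) (\<lambda>\<zeta>. \<Sum>k\<in>J. x (?u k) \<zeta>) \<and> f (\<lambda>\<zeta>. \<Sum>k\<in>J. x (?u k) \<zeta>) = (\<Sum>k\<in>J. f (x (?u k)))"
      if "finite J" for J using that
    proof (induction J)
      case empty
      show ?case using sc[of 0 "\<lambda>_. 0" 0] by (simp add: supp_def)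
    next
      case (insert k J)
      then have "supp 0 (\<Sum>k\<in>insert k J. q (?u k)) (\<lambda>\<zeta>. x (?u k) \<zeta> + (\<Sum>k\<in>J. x (?u k) \<zeta>))"
        using s0[of "?u k"] by (auto simp: supp_def)
      then show ?case using insert add[OF s0] by auto
    qed
    have ex: "exact (4 * C) j (\<lambda>\<zeta>. mw j / nn j * (\<Sum>k<nn j. x (?u k) \<zeta>))"
      by (rule exact_average[OF r' j])
    then have "bnd (4 * C) (\<lambda>\<zeta>. mw j / nn j * (\<Sum>k<nn j. x (?u k) \<zeta>))"
      using good_bnd unfolding exact_def by blast
    then have b: "\<bar>f (\<lambda>\<zeta>. mw j / nn j * (\<Sum>k<nn j. x (?u k) \<zeta>))\<bar> \<le> B * (4 * C)"
      using fs[of ?I] by (intro B(1)[of "\<Sum>k\<in>?I. q (?u k)"]) (auto simp: supp_def)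
    have v: "f (\<lambda>\<zeta>. mw j / nn j * (\<Sum>k<nn j. x (?u k) \<zeta>)) = mw j / nn j * (\<Sum>k<nn j. f (x (?u k)))"
      using fs[of ?I] sc[of _ "\<lambda>\<zeta>. \<Sum>k<nn j. x (?u k) \<zeta>" "mw j / nn j"] by auto
    have "nn j * e = (\<Sum>k<nn j. e)" by simp
    also have "\<dots> \<le> (\<Sum>k<nn j. \<sigma> * f (x (?u k)))" using en(2) by (intro sum_mono) (auto simp: S_def)
    also have "\<dots> = \<sigma> * (\<Sum>k<nn j. f (x (?u k)))" by (simp add: sum_distrib_left)
    also have "\<dots> \<le> \<bar>\<Sum>k<nn j. f (x (?u k))\<bar>" using \<sigma>(1) by auto
    finally have "mw j / nn j * (nn j * e) \<le> mw j / nn j * \<bar>\<Sum>k<nn j. f (x (?u k))\<bar>"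
      using mw_pos[of j] by (intro mult_left_mono) auto
    also have "\<dots> \<le> B * (4 * C)" using b v mw_pos[of j] by (simp add: abs_mult)
    finally show ?thesis using nn_pos[of j] by (simp add: mult.commute)
  qed
  then have le: "e * mw (Suc j) \<le> B * (4 * C)" for j by simp
  obtain j where j: "B * (4 * C) / e < real j" using reals_Archimedean2 by blast
  have "real j \<le> mw (Suc j)" using mw_ge_self[of "Suc j"] by simp
  then have "B * (4 * C) / e < mw (Suc j)" using j by simp
  then have "B * (4 * C) < e * mw (Suc j)" using e(1) by (simp add: pos_divide_less_eq mult.commute)
  then show False using le[of j] by simp
qed

section \<open>Dependent sequences\<close>

lemma odd_weight_large:
  assumes "odd (wt g)"
  shows "(real (nn (wt g)))\<^sup>2 \<le> mw (wt (e1 g)) \<and> e1 g < g"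
  using assms
proof (induction g rule: less_induct)
  case (less g)
  have lt: "e1 g < g" using odd_c[OF less.prems] e1_less[of g] by auto
  show ?case
  proof (cases "prd g")
    case None
    then show ?thesis using odd_None[OF less.prems] lt by auto
  next
    case (Some h)
    note h = prd_less[OF Some] prd_wt[OF Some]
    have "(real (nn (wt h)))\<^sup>2 \<le> mw (wt (e1 h)) \<and> e1 h < h" using less.IH[OF h(1)] less.prems h by simp
    \<comment> \<open>The code \<open>4 * h + 4\<close> exceeds \<open>h\<close>, hence the weight
      index used at \<open>h\<close>, so the lower bound at the first element persists along the
      chain.\<close>
    moreover have "wt (e1 h) \<le> wt (e1 g)" if "e1 h < h"
      using odd_Some[OF less.prems Some] wt_le[of "e1 h"] that by simp
    ultimately show ?thesis using lt h mw_mono by (metis order_trans)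
  qed
qed

text \<open>Two elements of odd weight with the same predecessor have the same value \<open>wt (e1 g)\<close>, and
  otherwise these values differ. Hence, in the evaluation analysis of an element \<open>g\<close> of weight \<open>j\<close>, past
  the last common element with the chain \<open>\<xi>\<close>, no vector of the sequence has the matching weight.\<close>

lemma dependent_sum:
  fixes C :: real
  assumes j: "odd j" and L: "L = nn j"
    and r: "ris C L z p q w" and ex: "\<And>k. k < L \<Longrightarrow> exact C (w k) (z k)"
    and xi: "\<And>k. k < L \<Longrightarrow> wt (\<xi> k) = j \<and> prd (\<xi> k) = (if k = 0 then None else Some (\<xi> (k - 1))) \<and>
      cut (\<xi> k) = p k \<and> wt (e1 (\<xi> k)) = w k \<and> q k \<le> \<xi> k"
    and xip: "\<And>k k'. k < k' \<Longrightarrow> k' < L \<Longrightarrow> \<xi> k < p k'"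
    and small: "\<And>k. k < L \<Longrightarrow> \<bar>ev (e1 (\<xi> k)) (cutm (\<xi> k) (z k))\<bar> \<le> C / L"
  shows "\<bar>\<Sum>k<L. ev g (z k)\<bar> \<le> 8 * C * L / (mw j)\<^sup>2"
proof -
  have C: "C \<ge> 0" using r by (simp add: ris_def)
  have j1: "j \<ge> 1" using j by (cases j) auto
  have Lp: "real L \<ge> 1" using L nn_pos[of j] by simp
  have gd: "good C (w k) (z k)" "supp (p k) (q k) (z k)" "p k < q k" if "k < L" for k
    using r that by (auto simp: ris_def)
  have xinc: "\<xi> k < \<xi> k'" if "k < k'" "k' < L" for k k'
    using xip[OF that] gd(3)[of k'] xi[of k'] that by simp
  have w0: "\<exists>i. w 0 = 4 * i + 2" if "0 < L"
    using odd_None[of "\<xi> 0"] xi[OF that] j by auto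
  have wS: "w k = 4 * \<xi> (k - 1) + 4" if "0 < k" "k < L" for k
    using odd_Some[of "\<xi> k" "\<xi> (k - 1)"] xi[OF that(2)] j that by auto
  \<comment> \<open>The first weight index is 2 modulo 4, the later ones are divisible by 4 and
    encode the predecessor. So an index determines its position in the chain.\<close>
  have mod4: "4 * a + 2 \<noteq> 4 * b + (4::nat)" for a b by presburger
  have winj: "k = k'" if "k < L" "k' < L" "w k = w k'" for k k'
  proof -
    have "\<not> k < k'" if t: "k < L" "k' < L" "w k = w k'" for k k'
    proof
      assume l: "k < k'"
      then have wk': "w k' = 4 * \<xi> (k' - 1) + 4" using wS[of k'] that by auto
      show False
      proof (cases "k = 0")
        case True
        then obtain i where "w k = 4 * i + 2" using w0 t(1) by auto
        then show False using wk' that mod4[of i "\<xi> (k' - 1)"] by simp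
      next
        case False
        then have "w k = 4 * \<xi> (k - 1) + 4" using wS[of k] that by auto
        moreover have "\<xi> (k - 1) < \<xi> (k' - 1)" using l False that by (intro xinc) auto
        ultimately show False using wk' that by simp
      qed
    qed
    from this[OF that] this[OF that(2,1) that(3)[symmetric]] show ?thesis by linarith
  qed
  have mlarge: "(real L)\<^sup>2 \<le> mw (wt (e1 g))" if "wt g = j" for g
    using odd_weight_large[of g] that j L by simp
  have mlarge': "(real L)\<^sup>2 \<le> mw (w k)" if "k < L" for k
    using mlarge[of "\<xi> k"] xi[OF that] by simp
  have div: "C / m \<le> C / L / L" if "(real L)\<^sup>2 \<le> m" for m
  proof -
    have "0 < real L * real L" using Lp by simp
    then show ?thesis
      using C that by (simp add: power2_eq_square divide_divide_eq_left divide_left_mono)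
  qed
  \<comment> \<open>If the weight indices differ, the smaller of the two supplies the small factor,
    through \<open>good\<close> or through \<open>exact\<close>. Both weights are at least
    \<open>L\<^sup>2\<close>.\<close>
  have off: "\<bar>ev (e1 g) (mul N \<phi> (z k))\<bar> \<le> C / L / L" if "wt g = j" "adm N \<phi>" "k < L" "wt (e1 g) \<noteq> w k" for g N \<phi> k
  proof (cases "wt (e1 g) < w k")
    case True
    then show ?thesis using goodD2[OF gd(1)[OF that(3)] that(2) True] div[OF mlarge[OF that(1)]] by linarith
  next
    case False
    then have "\<bar>ev (e1 g) (mul N \<phi> (z k))\<bar> \<le> C / mw (w k)"
      using ex[OF that(3)] that unfolding exact_def by simp
    then show ?thesis using div[OF mlarge'[OF that(3)]] by linarith
  qed
  have bte: "bt g x = ev (e1 g) x" if "wt g = j" for g x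
    using odd_c[of g] j that by (simp add: bt_def)
  have cardI: "card I \<le> L" if "I \<subseteq> {..<L}" for I using card_mono[OF _ that] by simp
  have cL: "card I * (C / L / L) \<le> C / L" if "I \<subseteq> {..<L}" for I
  proof -
    have "card I * (C / L / L) \<le> L * (C / L / L)" using cardI[OF that] C Lp by (intro mult_right_mono) auto
    then show ?thesis using Lp by simp
  qed
  have mj: "mw j \<ge> 1" using mw_ge[of j] by simp
  \<comment> \<open>On the chain \<open>\<xi>\<close> each element meets only its own vector, with a
    value of at most \<open>C / L\<close>. The exception is the vector straddling \<open>N\<close>,
    where the multiplication does not act as a scalar; it costs \<open>C\<close>.\<close>
  have onchain: "\<bar>\<Sum>k\<in>I. ev (\<xi> l) (mul N \<phi> (z k))\<bar> \<le> 2 * C"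
    if N: "adm N \<phi>" and I: "I \<subseteq> {..<L}" and l: "l < L" for l N \<phi> I
  proof -
    let ?Z = "\<lambda>\<zeta>. \<Sum>k\<in>I. mul N \<phi> (z k) \<zeta>"
    let ?s = "\<lambda>r. if r \<in> I then ev (e1 (\<xi> r)) (cutm (\<xi> r) (mul N \<phi> (z r))) else 0"
    have fin: "finite I" using I finite_subset by blast
    have Z0: "?Z (\<xi> l) = 0" if "l < L" for l
    proof (intro sum.neutral ballI)
      fix k assume "k \<in> I"
      then have k: "k < L" using I by auto
      have "\<xi> l < p k \<or> q k \<le> \<xi> l"
      proof (cases "l < k")
        case True then show ?thesis using xip[OF True k] by simp
      next
        case False
        then show ?thesis using xi[OF k] xinc[of k l] that by (cases "k = l") auto
      qed
      then show "mul N \<phi> (z k) (\<xi> l) = 0" using gd(2)[OF k] by (auto simp: mul_def supp_def)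
    qed
    have b: "bt (\<xi> l) (cutm (\<xi> l) ?Z) = ?s l" if l: "l < L" for l
    proof -
      have "bt (\<xi> l) (cutm (\<xi> l) ?Z) = (\<Sum>k\<in>I. ev (e1 (\<xi> l)) (cutm (\<xi> l) (mul N \<phi> (z k))))"
        using xi[OF l] by (simp add: bte cutm_def mul_sum ev_sum)
      also have "\<dots> = (\<Sum>k\<in>I. if k = l then ev (e1 (\<xi> l)) (cutm (\<xi> l) (mul N \<phi> (z k))) else 0)"
      proof (intro sum.cong refl)
        fix k assume "k \<in> I"
        then have k: "k < L" using I by auto
        have "ev (e1 (\<xi> l)) (cutm (\<xi> l) (mul N \<phi> (z k))) = 0" if "k \<noteq> l"
        proof (cases "l < k")
          case True
          have "e1 (\<xi> l) < \<xi> l" using odd_weight_large[of "\<xi> l"] xi[OF l] j by auto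
          then have "e1 (\<xi> l) < p k" using xip[OF True k] by simp
          then show ?thesis using gd(2)[OF k] by (intro ev_zero_cong) (auto simp: mul_def cutm_def supp_def)
        next
          case False
          then have "q k \<le> cut (\<xi> l)" using xi[OF k] xi[OF l] xip[of k l] that l by force
          then show ?thesis using gd(2)[OF k] by (intro ev_zero_cong) (auto simp: mul_def cutm_def supp_def)
        qed
        then show "ev (e1 (\<xi> l)) (cutm (\<xi> l) (mul N \<phi> (z k))) =
          (if k = l then ev (e1 (\<xi> l)) (cutm (\<xi> l) (mul N \<phi> (z k))) else 0)" by simp
      qed
      also have "\<dots> = ?s l" using fin by simp
      finally show ?thesis .
    qed
    have T: "ev (\<xi> l) ?Z = (\<Sum>r\<le>l. ?s r) / mw j" if "l < L" for l
      using that
    proof (induction l)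
      case 0
      then show ?case using xi[OF 0] b[OF 0] Z0[OF 0] by (simp add: ev_eq[of "\<xi> 0"])
    next
      case (Suc l)
      then show ?case using xi[OF Suc.prems] b[OF Suc.prems] Z0[OF Suc.prems]
        by (simp add: ev_eq[of "\<xi> (Suc l)"] add_divide_distrib)
    qed
    have "\<bar>\<Sum>r\<in>{..l}. ?s r\<bar> \<le> C + card {..l} * (C / L)"
    proof (rule sum_split_bad[where P = "\<lambda>r. p r < N \<and> N < q r"])
      fix k k' assume a: "k \<in> {..l}" "k' \<in> {..l}" "p k < N \<and> N < q k" "p k' < N \<and> N < q k'"
      have "k < k' \<Longrightarrow> q k \<le> p k'" "k' < k \<Longrightarrow> q k' \<le> p k" using r a l by (auto simp: ris_def)
      then show "k = k'" using a by linarith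
    next
      fix k assume k: "k \<in> {..l}"
      then have kL: "k < L" using l by simp
      show "\<bar>?s k\<bar> \<le> C"
        using C good_bnd[OF good_mul[OF good_mul[OF gd(1)[OF kL] N] adm_cls]] by (auto simp: cutm_def bnd_def)
      assume b: "\<not> (p k < N \<and> N < q k)"
      show "\<bar>?s k\<bar> \<le> C / L"
      proof (cases "N \<le> p k")
        case True
        then have "cutm (\<xi> k) (mul N \<phi> (z k)) = (\<lambda>u. \<phi> (lab (\<xi> k)) * cutm (\<xi> k) (z k) u)"
          using xi[OF kL] N by (intro mul_cut_le) auto
        moreover have "\<bar>\<phi> (lab (\<xi> k)) * ev (e1 (\<xi> k)) (cutm (\<xi> k) (z k))\<bar> \<le> 1 * (C / L)"
          unfolding abs_mult using N small[OF kL] by (intro mult_mono) (auto simp: adm_def)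
        ultimately show ?thesis using C by (simp add: ev_cmult)
      next
        case False
        then have "mul N \<phi> (z k) = (\<lambda>_. 0)" using b gd(2)[OF kL] by (auto simp: mul_def supp_def)
        then show ?thesis using C by (simp add: cutm_def)
      qed
    qed (use C in auto)
    also have "card {..l} * (C / L) \<le> L * (C / L)" using l C by (intro mult_right_mono) auto
    finally have "\<bar>\<Sum>r\<le>l. ?s r\<bar> \<le> 2 * C" using Lp by simp
    moreover have "\<bar>\<Sum>r\<le>l. ?s r\<bar> / mw j \<le> \<bar>\<Sum>r\<le>l. ?s r\<bar> / 1" using mj by (intro divide_left_mono) auto
    ultimately show ?thesis using T[OF l] mj by (simp add: ev_sum abs_divide)
  qed
  \<comment> \<open>Any element of weight index \<open>j\<close>: coordinates and mismatched vectors
    contribute \<open>C / L / L\<close> each, and at most one vector has the matching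
    weight.\<close>
  have step: "\<bar>(\<Sum>k\<in>I. mul N \<phi> (z k) g) + bt g (cutm g (\<lambda>\<zeta>. \<Sum>k\<in>I. mul N \<phi> (z k) \<zeta>)) / mw j\<bar> \<le>
      2 * (C / L) + (if \<exists>k<L. w k = wt (e1 g) then C else 0)"
    if g: "wt g = j" and N: "adm N \<phi>" and I: "I \<subseteq> {..<L}" for g N \<phi> I
  proof -
    let ?D = "if \<exists>k<L. w k = wt (e1 g) then C else 0"
    have "\<bar>\<Sum>k\<in>I. mul N \<phi> (z k) g\<bar> \<le> (\<Sum>k\<in>I. C / L / L)"
    proof (intro order_trans[OF sum_abs] sum_mono)
      fix k assume "k \<in> I"
      then have k: "k < L" using I by auto
      have "\<bar>mul N \<phi> (z k) g\<bar> \<le> 1 * \<bar>z k g\<bar>"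
        using N mult_right_mono[of "\<bar>\<phi> (lab g)\<bar>" 1 "\<bar>z k g\<bar>"] by (auto simp: mul_def adm_def abs_mult)
      also have "\<dots> \<le> C / mw (w k)" using ex[OF k] by (simp add: exact_def)
      also have "\<dots> \<le> C / L / L" by (rule div[OF mlarge'[OF k]])
      finally show "\<bar>mul N \<phi> (z k) g\<bar> \<le> C / L / L" .
    qed
    then have a: "\<bar>\<Sum>k\<in>I. mul N \<phi> (z k) g\<bar> \<le> C / L" using cL[OF I] by simp
    obtain N' \<phi>' where N': "adm N' \<phi>'" "\<And>x. cutm g (mul N \<phi> x) = mul N' \<phi>' x"
      using cutm_mul[OF N] by blast
    have "bt g (cutm g (\<lambda>\<zeta>. \<Sum>k\<in>I. mul N \<phi> (z k) \<zeta>)) = (\<Sum>k\<in>I. ev (e1 g) (mul N' \<phi>' (z k)))"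
      by (simp add: bte[OF g] mul_sum[symmetric] N' ev_sum[symmetric])
    moreover have "\<bar>\<Sum>k\<in>I. ev (e1 g) (mul N' \<phi>' (z k))\<bar> \<le> ?D + card I * (C / L / L)"
    proof (rule sum_split_bad[where P = "\<lambda>k. w k = wt (e1 g)"])
      show "finite I" using I finite_subset by blast
      fix k assume "k \<in> I"
      then have k: "k < L" using I by auto
      show "w k = wt (e1 g) \<Longrightarrow> \<bar>ev (e1 g) (mul N' \<phi>' (z k))\<bar> \<le> ?D"
        using k goodD1[OF gd(1)[OF k] N'(1)] by auto
      show "w k \<noteq> wt (e1 g) \<Longrightarrow> \<bar>ev (e1 g) (mul N' \<phi>' (z k))\<bar> \<le> C / L / L"
        using off[OF g N'(1) k] by simp
    next
      fix k k' assume "k \<in> I" "k' \<in> I" "w k = wt (e1 g)" "w k' = wt (e1 g)"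
      then show "k = k'" using I winj[of k k'] by auto
    qed (use C in auto)
    ultimately have "\<bar>bt g (cutm g (\<lambda>\<zeta>. \<Sum>k\<in>I. mul N \<phi> (z k) \<zeta>))\<bar> \<le> ?D + C / L" using cL[OF I] by linarith
    moreover have "\<bar>v / mw j\<bar> \<le> \<bar>v\<bar>" for v
      using mj divide_left_mono[of 1 "mw j" "\<bar>v\<bar>"] by simp
    ultimately have "\<bar>bt g (cutm g (\<lambda>\<zeta>. \<Sum>k\<in>I. mul N \<phi> (z k) \<zeta>)) / mw j\<bar> \<le> ?D + C / L" using order_trans by blast
    then show ?thesis using a by linarith
  qed
  \<comment> \<open>Up to the last element shared with \<open>\<xi>\<close> the sum is at most
    \<open>2 * C\<close>, and the element after it may have a matching vector. Further on a match
    would identify the predecessor as a member of \<open>\<xi>\<close>. If nothing is shared, only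
    the first element of the chain of \<open>g\<close> can match.\<close>
  have A: "\<bar>\<Sum>k\<in>I. ev g (mul N \<phi> (z k))\<bar> \<le> 3 * C + age g * (2 * (C / L))"
    if g: "wt g = j" and N: "adm N \<phi>" and I: "I \<subseteq> {..<L}" for g N \<phi> I
    using g
  proof (induction g rule: less_induct)
    case (less g)
    let ?Z = "\<lambda>\<zeta>. \<Sum>k\<in>I. mul N \<phi> (z k) \<zeta>"
    have cl: "2 * (C / L) \<le> age g * (2 * (C / L))"
      using age_pos[of g] C mult_right_mono[of 1 "real (age g)" "2 * (C / L)"] by simp
    have st: "\<bar>?Z g + bt g (cutm g ?Z) / mw j\<bar> \<le> 2 * (C / L) + C" using step[OF less.prems N I] C by (auto split: if_splits)
    have e: "(\<Sum>k\<in>I. ev g (mul N \<phi> (z k))) = pv g ?Z + (?Z g + bt g (cutm g ?Z) / mw j)"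
      unfolding ev_sum[symmetric] using less.prems by (subst ev_eq) simp
    show ?case
    proof (cases "prd g")
      case None
      then show ?thesis using e st cl C by simp
    next
      case (Some h)
      note h = prd_less[OF Some] prd_wt[OF Some] prd_age[OF Some]
      have e': "(\<Sum>k\<in>I. ev g (mul N \<phi> (z k))) = (\<Sum>k\<in>I. ev h (mul N \<phi> (z k))) + (?Z g + bt g (cutm g ?Z) / mw j)"
        using e Some by (simp add: ev_sum)
      show ?thesis
      proof (cases "\<exists>l<L. h = \<xi> l")
        case True
        then obtain l where l: "l < L" "h = \<xi> l" by blast
        have "\<bar>\<Sum>k\<in>I. ev h (mul N \<phi> (z k))\<bar> \<le> 2 * C" using onchain[OF N I l(1)] l(2) by simp
        then show ?thesis using e' st cl by linarith
      next
        case False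
        have nb: "\<not> (\<exists>k<L. w k = wt (e1 g))"
        proof
          assume "\<exists>k<L. w k = wt (e1 g)"
          then obtain k where k: "k < L" "w k = 4 * h + 4" using odd_Some[OF _ Some] less.prems j by auto
          have "k \<noteq> 0"
          proof
            assume "k = 0"
            then obtain i where "4 * i + 2 = 4 * h + 4" using w0 k by auto
            then show False using mod4 by blast
          qed
          then have "h = \<xi> (k - 1)" "k - 1 < L" using wS[of k] k by auto
          then show False using False by blast
        qed
        have "\<bar>?Z g + bt g (cutm g ?Z) / mw j\<bar> \<le> 2 * (C / L)"
          using step[OF less.prems N I] unfolding if_not_P[OF nb] by simp
        moreover have "\<bar>\<Sum>k\<in>I. ev h (mul N \<phi> (z k))\<bar> \<le> 3 * C + age h * (2 * (C / L))"
          using less.IH[OF h(1)] h less.prems by simp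
        moreover have "age g * (2 * (C / L)) = age h * (2 * (C / L)) + 2 * (C / L)"
          using h(3) by (simp add: algebra_simps add_divide_distrib)
        ultimately show ?thesis using e' by linarith
      qed
    qed
  qed
  have A': "\<bar>\<Sum>k\<in>I. ev g (mul N \<phi> (z k))\<bar> \<le> 5 * C"
    if g: "wt g = j" and N: "adm N \<phi>" and I: "I \<subseteq> {..<L}" for g N \<phi> I
  proof -
    have "age g * (2 * (C / L)) \<le> L * (2 * (C / L))"
      using age_le[of g] g L C by (intro mult_right_mono) auto
    then show ?thesis using A[OF that] Lp by simp
  qed
  have H: "\<bar>\<Sum>k\<in>I. ev g (mul N \<phi> (z k))\<bar> \<le> 5 * C + card I * C * (1 / (mw j)\<^sup>2)"
    if g: "j \<le> wt g" and N: "adm N \<phi>" and I: "I \<subseteq> {..<L}" for g N \<phi> I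
  proof (cases "wt g = j")
    case True
    have "card I * C * (1 / (mw j)\<^sup>2) \<ge> 0" using C by simp
    then show ?thesis using A'[OF True N I] by linarith
  next
    case False
    then have "(mw j)\<^sup>2 \<le> mw (wt g)" using g mw_mono[of "Suc j" "wt g"] by (simp add: mw_Suc)
    then have "card I * (C / mw (wt g)) \<le> card I * (C / (mw j)\<^sup>2)"
      using C mj mw_pos[of "wt g"] by (intro mult_left_mono divide_left_mono) auto
    moreover have "\<bar>\<Sum>k\<in>I. ev g (mul N \<phi> (z k))\<bar> \<le> C + card I * (C / mw (wt g))"
      by (rule ris_sum_high[OF r N I])
    ultimately show ?thesis using C by simp
  qed
  have n: "i < j \<Longrightarrow> nn i \<le> nn (j - 1)" "nn (j - 1) \<ge> 1" for i using nn_mono[of i "j - 1"] nn_pos by auto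
  have mx: "max (1 / 16 ^ (2 ^ Suc j)) (1 / (mw j)\<^sup>2) = 1 / (mw j)\<^sup>2" unfolding mw_power by simp
  have th: "1 / (mw j)\<^sup>2 \<ge> 0" "5 * C \<ge> 0" using C by simp_all
  \<comment> \<open>The constant part \<open>(2 * C + 5 * C) * L / (mw j)\<^sup>2\<close> and the
    proportional part \<open>C * L / (mw j)\<^sup>2\<close> make the 8.\<close>
  have "\<bar>\<Sum>k<L. ev g (mul 0 (\<lambda>s. 1) (z k))\<bar> \<le>
     (2 * C + 5 * C) * (2 * real (nn (j - 1))) ^ (2 ^ Suc j) + card {..<L} * (C * (1 / (mw j)\<^sup>2))"
    using ris_sum(1)[OF r th(2,1) H n adm_const[of 1 0] order_refl, where d = "2 ^ Suc j", unfolded mx] by simp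
  also have "(2 * C + 5 * C) * (2 * real (nn (j - 1))) ^ (2 ^ Suc j) \<le> (2 * C + 5 * C) * (L / (mw j)\<^sup>2)"
    using nn_power(2)[OF j1] C unfolding L by (intro mult_left_mono) auto
  finally show ?thesis by (simp add: mul_1 algebra_simps)
qed

end

text \<open>Helly's theorem on the line. The coordinate \<open>k\<close> admits the scalars
  \<open>l\<close> with \<open>\<bar>g k - l * f k\<bar> \<le> d\<close>, an interval. If any two of
  these intervals met, all would have a common point; two disjoint ones yield the combination that
  annihilates \<open>f\<close>. For this reason two terms suffice in the functionals of even
  weight.\<close>

lemma two_coordinates:
  fixes f g :: "nat \<Rightarrow> real"
  assumes "\<And>l. \<exists>k. \<bar>g k - l * f k\<bar> > d" and d: "d > 0"
  shows "\<exists>k l a b. \<bar>a\<bar> + \<bar>b\<bar> \<le> 1 \<and> a * f k + b * f l = 0 \<and> a * g k + b * g l \<ge> d"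
proof (rule ccontr)
  assume "\<not> ?thesis"
  then have no: "\<And>k l a b. \<bar>a\<bar> + \<bar>b\<bar> \<le> 1 \<Longrightarrow> a * f k + b * f l = 0 \<Longrightarrow> a * g k + b * g l < d"
    by (meson not_less)
  have z: "\<bar>g k\<bar> < d" if "f k = 0" for k
    using no[of 1 0 k k] no[of "-1" 0 k k] that by auto
  have c: "\<bar>g k * f l - g l * f k\<bar> \<le> d * (\<bar>f k\<bar> + \<bar>f l\<bar>)" if "f k \<noteq> 0" "f l \<noteq> 0" for k l
  proof -
    define s where "s = \<bar>f k\<bar> + \<bar>f l\<bar>"
    have s: "s > 0" using that by (simp add: s_def)
    have n: "\<bar>f l / s\<bar> + \<bar>- f k / s\<bar> \<le> 1" "\<bar>- f l / s\<bar> + \<bar>f k / s\<bar> \<le> 1"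
      using s by (simp_all add: s_def add_divide_distrib[symmetric])
    have "f l / s * g k + (- f k / s) * g l < d" "- f l / s * g k + (f k / s) * g l < d"
    proof -
      show "f l / s * g k + (- f k / s) * g l < d" using n(1) by (rule no) simp
      show "- f l / s * g k + (f k / s) * g l < d" using n(2) by (rule no) simp
    qed
    then have "(g k * f l - g l * f k) / s < d" "- (g k * f l - g l * f k) / s < d"
      by (simp_all add: diff_divide_distrib mult.commute)
    then show ?thesis using s unfolding s_def[symmetric] by (simp add: pos_divide_less_eq abs_le_iff)
  qed
  show False
  proof (cases "\<exists>k. f k \<noteq> 0")
    case False
    obtain k where k: "\<bar>g k - 0 * f k\<bar> > d" using assms(1)[of 0] by blast
    have "f k = 0" using False by blast
    then show False using z[of k] k by simp
  next
    case True
    then obtain k0 where k0: "f k0 \<noteq> 0" by blast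
    define lo where "lo k = g k / f k - d / \<bar>f k\<bar>" for k
    define up where "up k = g k / f k + d / \<bar>f k\<bar>" for k
    have lu: "lo k \<le> up l" if "f k \<noteq> 0" "f l \<noteq> 0" for k l
    proof -
      have "\<bar>g k / f k - g l / f l\<bar> = \<bar>g k * f l - g l * f k\<bar> / (\<bar>f k\<bar> * \<bar>f l\<bar>)"
        using diff_frac_eq[OF that, of "g k" "g l"] by (simp add: abs_mult)
      also have "\<dots> \<le> d * (\<bar>f k\<bar> + \<bar>f l\<bar>) / (\<bar>f k\<bar> * \<bar>f l\<bar>)"
        using c[OF that] by (intro divide_right_mono) auto
      also have "\<dots> = d / \<bar>f k\<bar> + d / \<bar>f l\<bar>" using that by (simp add: field_simps)
      finally show ?thesis unfolding lo_def up_def by linarith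
    qed
    define L where "L = (SUP k\<in>{k. f k \<noteq> 0}. lo k)"
    have bd: "bdd_above (lo ` {k. f k \<noteq> 0})" using lu[OF _ k0] by (intro bdd_aboveI[of _ "up k0"]) auto
    have "\<bar>g k - L * f k\<bar> \<le> d" for k
    proof (cases "f k = 0")
      case True
      then show ?thesis using z[of k] by simp
    next
      case False
      have "lo k \<le> L" unfolding L_def using False by (intro cSUP_upper bd) auto
      moreover have "L \<le> up k" unfolding L_def using False k0 lu by (intro cSUP_least) auto
      ultimately have "\<bar>g k / f k - L\<bar> \<le> d / \<bar>f k\<bar>" unfolding lo_def up_def by linarith
      then have "\<bar>g k / f k - L\<bar> * \<bar>f k\<bar> \<le> d" using False by (simp add: field_simps)
      moreover have "\<bar>g k / f k - L\<bar> * \<bar>f k\<bar> = \<bar>g k - L * f k\<bar>"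
        using False by (subst abs_mult[symmetric]) (simp add: left_diff_distrib)
      ultimately show ?thesis by simp
    qed
    then show False using assms(1)[of L] by (meson not_less)
  qed
qed

text \<open>Rounding towards zero keeps \<open>\<bar>a1\<bar> + \<bar>a2\<bar> \<le> 1\<close>,
  which \<open>rich_even\<close> demands of rational coefficients.\<close>

lemma Rats_below:
  fixes a e :: real
  assumes "e > 0"
  shows "\<exists>r\<in>\<rat>. \<bar>r\<bar> \<le> \<bar>a\<bar> \<and> \<bar>r - a\<bar> \<le> e"
proof (cases a "0 :: real" rule: linorder_cases)
  case equal then show ?thesis using assms by (intro bexI[of _ 0]) auto
next
  case greater
  then obtain r where "r \<in> \<rat>" "max 0 (a - e) < r" "r < a" using Rats_dense_in_real[of "max 0 (a - e)" a] assms by auto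
  then show ?thesis by (intro bexI[of _ r]) auto
next
  case less
  then obtain r where "r \<in> \<rat>" "a < r" "r < min 0 (a + e)" using Rats_dense_in_real[of a "min 0 (a + e)"] assms by auto
  then show ?thesis by (intro bexI[of _ r]) auto
qed

section \<open>Vectors with prescribed values; splitting blocks by weights\<close>

context ah_system
begin

definition unit :: "nat \<Rightarrow> nat \<Rightarrow> real" where "unit g = (\<lambda>u. if u = g then 1 else 0)"

lemma ev_unit: "ev g (unit g) = 1"
proof -
  have "ev g (unit g) = ev g (mul g (cls g (lab g)) (unit g))"
    by (intro ev_cong) (auto simp: unit_def mul_def cls_def sim_refl)
  also have "\<dots> = unit g g" by (rule coef_ev[symmetric])
  finally show ?thesis by (simp add: unit_def)
qed

text \<open>The system is triangular with ones on the diagonal: \<open>ev n\<close> is 1 at the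
  basis vector of \<open>n\<close>, and the earlier functionals do not see it.\<close>

lemma local_ext: "\<exists>x. supp 0 n x \<and> (\<forall>h<n. ev h x = u h)"
proof (induction n)
  case 0
  show ?case by (intro exI[of _ "\<lambda>_. 0"]) (simp add: supp_def)
next
  case (Suc n)
  then obtain x where x: "supp 0 n x" "\<forall>h<n. ev h x = u h" by blast
  define y where "y = (\<lambda>z. x z + (u n - ev n x) * unit n z)"
  have "ev n y = u n" by (simp add: y_def ev_add ev_cmult ev_unit)
  moreover have "ev h y = u h" if "h < n" for h
  proof -
    have "ev h y = ev h x" using that by (intro ev_cong) (auto simp: y_def unit_def)
    then show ?thesis using x that by simp
  qed
  ultimately have "ev h y = u h" if "h < Suc n" for h
    using that by (cases "h = n") auto
  moreover have "supp 0 (Suc n) y" using x by (auto simp: y_def supp_def unit_def)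
  ultimately show ?case by blast
qed

lemma supp_ev_zero:
  assumes "\<And>h. h < p \<Longrightarrow> ev h x = 0" "z < p"
  shows "x z = 0"
  using coef_bound[of z x 0] assms by simp

text \<open>\<open>local_weight\<close> bounds the functionals of an absent weight by
  \<open>3 / mw\<close>. Passing to multiplications by \<open>mul_wt_bound\<close> doubles this and
  adds \<open>6 * 3 / mw\<close>, in total 24.\<close>

lemma local_weights:
  assumes y: "supp p q y" and pq: "p < q" and h1: "\<And>h. h < q \<Longrightarrow> \<bar>ev h y\<bar> \<le> 1"
    and A: "\<And>h. h < q \<Longrightarrow> \<not> A (wt h) \<Longrightarrow> ev h y = 0"
  shows "bnd 3 y \<and> (\<forall>g N \<phi>. adm N \<phi> \<longrightarrow> \<not> A (wt g) \<longrightarrow> \<bar>ev g (mul N \<phi> y)\<bar> \<le> 24 / mw (wt g))"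
proof -
  have h1': "h \<le> q - 1 \<Longrightarrow> \<bar>ev h y\<bar> \<le> 1" for h using h1 pq by simp
  have y0: "z > q - 1 \<Longrightarrow> y z = 0" for z using y by (auto simp: supp_def)
  have b: "bnd 3 y"
    using ext_bound[of 1 "q - 1" y, OF _ h1' y0 adm_const[of 1 0]] by (simp add: bnd_def mul_1)
  have "\<bar>ev g (mul N \<phi> y)\<bar> \<le> 24 / mw (wt g)" if "adm N \<phi>" "\<not> A (wt g)" for g N \<phi>
  proof -
    have "\<bar>ev h y\<bar> \<le> 3 * 1 / mw (wt h)" if "wt h = wt g" for h
      using A pq that \<open>\<not> A (wt g)\<close> by (intro local_weight[of 1 "q - 1"] h1' y0) auto
    then have "\<bar>ev g (mul N \<phi> y)\<bar> \<le> 2 * (3 / mw (wt g)) + 6 * 3 / mw (wt g)"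
      using b that(1) by (intro mul_wt_bound) auto
    then show ?thesis by (simp add: add_divide_distrib[symmetric])
  qed
  then show ?thesis using b by blast
qed

text \<open>The extension operator makes it possible to cut a vector along a set of coordinates; here it is
  cut into the coordinates of weight less than \<open>N\<close> and the remaining ones.\<close>

lemma weight_split:
  assumes s: "supp p q x" and b: "bnd 1 x" and pq: "p < q"
  shows "\<exists>v w. x = (\<lambda>z. v z + w z) \<and> supp p q v \<and> supp p q w \<and>
     (\<forall>j. good (24 * mw N) j v) \<and> good 24 N w"
proof -
  obtain v where v: "supp 0 q v" "\<forall>h<q. ev h v = (if wt h < N then ev h x else 0)"
    using local_ext[of q "\<lambda>h. if wt h < N then ev h x else 0"] by blast
  let ?w = "\<lambda>z. x z - v z"
  have w: "\<forall>h<q. ev h ?w = (if wt h < N then 0 else ev h x)" using v by (simp add: ev_diff)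
  have x0: "ev h x = 0" if "h < p" for h using s that by (intro ev_zero_cong) (auto simp: supp_def)
  have sv: "supp p q v" unfolding supp_def
  proof (intro allI impI)
    fix z assume "z < p \<or> q \<le> z"
    then show "v z = 0"
    proof
      assume "z < p"
      moreover have "ev h v = 0" if "h < p" for h using v(2) x0[OF that] that pq by simp
      ultimately show ?thesis using supp_ev_zero by blast
    qed (use v in \<open>auto simp: supp_def\<close>)
  qed
  have sw: "supp p q ?w" using s sv by (auto simp: supp_def)
  have gv: "bnd 3 v \<and> (\<forall>g N' \<phi>. adm N' \<phi> \<longrightarrow> \<not> wt g < N \<longrightarrow> \<bar>ev g (mul N' \<phi> v)\<bar> \<le> 24 / mw (wt g))"
    using local_weights[OF sv pq, of "\<lambda>i. i < N"] v b by (simp add: bnd_def)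
  have gw: "bnd 3 ?w \<and> (\<forall>g N' \<phi>. adm N' \<phi> \<longrightarrow> wt g < N \<longrightarrow> \<bar>ev g (mul N' \<phi> ?w)\<bar> \<le> 24 / mw (wt g))"
    using local_weights[OF sw pq, of "\<lambda>i. \<not> i < N"] w b by (simp add: bnd_def)
  \<comment> \<open>The large constant pays for the weight indices below \<open>N\<close>, whose
    weights are at most \<open>mw N\<close>. So \<open>v\<close> is good for every index, at the
    price of a constant that depends on \<open>N\<close>.\<close>
  have "good (24 * mw N) j v" for j
    unfolding good_def
  proof (intro allI impI conjI)
    fix N' \<phi> g assume a: "adm N' \<phi>"
    have m: "mw N \<ge> 1" using mw_ge[of N] by simp
    have l: "\<bar>ev g (mul N' \<phi> v)\<bar> \<le> 3 * 3" using bnd_mul[OF conjunct1[OF gv] a] by (simp add: bnd_def)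
    then show "\<bar>ev g (mul N' \<phi> v)\<bar> \<le> 24 * mw N" using m by linarith
    show "\<bar>ev g (mul N' \<phi> v)\<bar> \<le> 24 * mw N / mw (wt g)"
    proof (cases "wt g < N")
      case True
      then have "1 \<le> mw N / mw (wt g)" using mw_mono[of "wt g" N] mw_pos[of "wt g"] by simp
      then show ?thesis using l by simp
    next
      case False
      then have "\<bar>ev g (mul N' \<phi> v)\<bar> \<le> 24 / mw (wt g)" using gv a by blast
      also have "\<dots> \<le> 24 * mw N / mw (wt g)" using m mw_pos[of "wt g"] by (intro divide_right_mono) auto
      finally show ?thesis .
    qed
  qed
  moreover have "good 24 N ?w"
    unfolding good_def
  proof (intro allI impI conjI)
    fix N' \<phi> g assume a: "adm N' \<phi>"
    have "\<bar>ev g (mul N' \<phi> ?w)\<bar> \<le> 3 * 3" using bnd_mul[OF conjunct1[OF gw] a] by (simp add: bnd_def)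
    then show "\<bar>ev g (mul N' \<phi> ?w)\<bar> \<le> 24" by simp
    show "wt g < N \<Longrightarrow> \<bar>ev g (mul N' \<phi> ?w)\<bar> \<le> 24 / mw (wt g)" using gw a by blast
  qed
  ultimately show ?thesis using sv sw by (intro exI[of _ v] exI[of _ ?w]) auto
qed

text \<open>Blocks need not increase rapidly, but their two halves can be made to. For fixed
  \<open>N\<close> the halves \<open>v N\<close> do, with a constant depending on \<open>N\<close>,
  so \<open>\<nu>\<close> is small on them far out. Splitting each block at the end of the previous
  one makes the other halves a rapidly increasing sequence with constant 24. A block with
  \<open>\<nu>\<close> at least \<open>e\<close> cannot be the sum of two halves below
  \<open>e / 2\<close>.\<close>

lemma null_on_blocks:
  fixes \<nu> :: "(nat \<Rightarrow> real) \<Rightarrow> real"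
  assumes sub: "\<And>x y p q. supp p q x \<Longrightarrow> supp p q y \<Longrightarrow> \<nu> (\<lambda>z. x z + y z) \<le> \<nu> x + \<nu> y"
    and ris: "\<And>C x p q j. (\<And>L. ris C L x p q j) \<Longrightarrow> (\<lambda>k. \<nu> (x k)) \<longlonglongrightarrow> 0"
    and e: "e > 0"
  shows "\<exists>n. \<forall>x q. supp n q x \<longrightarrow> bnd 1 x \<longrightarrow> \<nu> x < e"
proof (rule ccontr)
  assume "\<not> ?thesis"
  then have ex: "\<And>n. \<exists>x q. supp n q x \<and> bnd 1 x \<and> \<nu> x \<ge> e" by (meson not_less)
  have "\<exists>s. \<forall>k. (supp (fst (snd (s k))) (snd (snd (s k))) (fst (s k)) \<and> bnd 1 (fst (s k)) \<and> \<nu> (fst (s k)) \<ge> e \<and>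
      fst (snd (s k)) < snd (snd (s k))) \<and> snd (snd (s k)) \<le> fst (snd (s (Suc k)))"
  proof (rule dependent_nat_choice)
    have st: "\<exists>s. (supp (fst (snd s)) (snd (snd s)) (fst s) \<and> bnd 1 (fst s) \<and> \<nu> (fst s) \<ge> e \<and>
      fst (snd s) < snd (snd s)) \<and> n \<le> fst (snd s)" for n
    proof -
      obtain x q where "supp n q x" "bnd 1 x" "\<nu> x \<ge> e" using ex by blast
      then show ?thesis by (intro exI[of _ "(x, n, max (Suc n) q)"]) (auto simp: supp_def)
    qed
    show "\<exists>s. supp (fst (snd s)) (snd (snd s)) (fst s) \<and> bnd 1 (fst s) \<and> \<nu> (fst s) \<ge> e \<and>
      fst (snd s) < snd (snd s)" using st[of 0] by blast
    show "\<exists>y. (supp (fst (snd y)) (snd (snd y)) (fst y) \<and> bnd 1 (fst y) \<and> \<nu> (fst y) \<ge> e \<and>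
      fst (snd y) < snd (snd y)) \<and> snd (snd x) \<le> fst (snd y)" for x :: "(nat \<Rightarrow> real) \<times> nat \<times> nat"
      using st by blast
  qed
  then obtain s where s: "\<And>k. (supp (fst (snd (s k))) (snd (snd (s k))) (fst (s k)) \<and> bnd 1 (fst (s k)) \<and>
      \<nu> (fst (s k)) \<ge> e \<and> fst (snd (s k)) < snd (snd (s k))) \<and> snd (snd (s k)) \<le> fst (snd (s (Suc k)))"
    by blast
  define x where "x k = fst (s k)" for k
  define p where "p k = fst (snd (s k))" for k
  define q where "q k = snd (snd (s k))" for k
  have x: "supp (p k) (q k) (x k)" "bnd 1 (x k)" "\<nu> (x k) \<ge> e" "p k < q k" "q k \<le> p (Suc k)" for k
    using s[of k] by (auto simp: x_def p_def q_def)
  have qp: "q k \<le> p k'" if "k < k'" for k k'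
    using that
  proof (induction k')
    case (Suc k')
    then show ?case using x(4)[of k'] x(5)[of k'] by (cases "k = k'") auto
  qed simp
  have q_mono: "q k \<le> q k'" if "k \<le> k'" for k k'
    using qp[of k k'] x(4)[of k'] that by (cases "k = k'") auto
  define R where "R N k vw \<longleftrightarrow> x k = (\<lambda>z. fst vw z + snd vw z) \<and> supp (p k) (q k) (fst vw) \<and>
    supp (p k) (q k) (snd vw) \<and> (\<forall>j. good (24 * mw N) j (fst vw)) \<and> good 24 N (snd vw)" for N k vw
  have "\<exists>vw. R N k vw" for N k
    using weight_split[OF x(1,2,4), of k N] unfolding R_def by auto
  then obtain f where f: "\<And>N k. R N k (f N k)" by metis
  define v where "v N k = fst (f N k)" for N k
  define w where "w N k = snd (f N k)" for N k
  have vw: "\<And>N k. x k = (\<lambda>z. v N k z + w N k z)" "\<And>N k. supp (p k) (q k) (v N k)"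
    "\<And>N k. supp (p k) (q k) (w N k)" "\<And>N k j. good (24 * mw N) j (v N k)" "\<And>N k. good 24 N (w N k)"
    using f unfolding R_def v_def w_def by blast+
  have "ris (24 * mw N) L (v N) p q p" for N L
    using vw qp x(4) mw_pos[of N] by (auto simp: ris_def)
  then have vlim: "(\<lambda>k. \<nu> (v N k)) \<longlonglongrightarrow> 0" for N by (rule ris)
  have vex: "\<exists>k'>k. \<nu> (v N k') < e / 2" for N k
  proof -
    have "eventually (\<lambda>k'. \<nu> (v N k') < e / 2) sequentially"
      using order_tendstoD(2)[OF vlim, of "e / 2"] e by simp
    then obtain m where "\<And>k'. k' \<ge> m \<Longrightarrow> \<nu> (v N k') < e / 2" by (auto simp: eventually_sequentially)
    then show ?thesis by (intro exI[of _ "max m (Suc k)"]) auto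
  qed
  \<comment> \<open>The block \<open>u (Suc i)\<close> is split at the weight index
    \<open>q (u i)\<close>, known before the block is chosen.\<close>
  obtain u where u: "\<And>i. u i < u (Suc i) \<and> \<nu> (v (q (u i)) (u (Suc i))) < e / 2"
  proof -
    have "\<exists>u. \<forall>i. True \<and> (u i < u (Suc i) \<and> \<nu> (v (q (u i)) (u (Suc i))) < e / 2)"
      by (rule dependent_nat_choice) (use vex in auto)
    then show ?thesis using that by blast
  qed
  have um: "u i < u i'" if "i < i'" for i i' using that u lift_Suc_mono_less[of u] by blast
  have "ris 24 L (\<lambda>i. w (q (u i)) (u (Suc i))) (\<lambda>i. p (u (Suc i))) (\<lambda>i. q (u (Suc i))) (\<lambda>i. q (u i))" for L
    unfolding ris_def
  proof (intro conjI allI impI)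
    fix i i' :: nat assume "i < i'"
    then have "u (Suc i) < u (Suc i')" "u (Suc i) \<le> u i'" using um[of "Suc i" "Suc i'"] um[of "Suc i" i'] by (auto, cases "Suc i = i'", auto)
    then show "q (u (Suc i)) \<le> p (u (Suc i'))" "q (u (Suc i)) \<le> q (u i')" using qp q_mono by auto
  qed (use vw x in auto)
  then have "(\<lambda>i. \<nu> (w (q (u i)) (u (Suc i)))) \<longlonglongrightarrow> 0" by (rule ris)
  then have "eventually (\<lambda>i. \<nu> (w (q (u i)) (u (Suc i))) < e / 2) sequentially"
    using order_tendstoD(2)[of _ 0 sequentially "e / 2"] e by simp
  then obtain i where "\<nu> (w (q (u i)) (u (Suc i))) < e / 2" by (auto simp: eventually_sequentially)
  moreover have "\<nu> (x (u (Suc i))) \<le> \<nu> (v (q (u i)) (u (Suc i))) + \<nu> (w (q (u i)) (u (Suc i)))"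
    using sub[OF vw(2,3)] vw(1) by metis
  ultimately show False using u[of i] x(3)[of "u (Suc i)"] by linarith
qed

section \<open>Chains of elements and their evaluation analysis\<close>

definition chain :: "nat \<Rightarrow> 'k \<Rightarrow> nat \<Rightarrow> (nat \<Rightarrow> nat) \<Rightarrow> (nat \<Rightarrow> nat) \<Rightarrow> bool" where
  "chain j t n P \<xi> \<longleftrightarrow> (\<forall>r<n. wt (\<xi> r) = j \<and> lab (\<xi> r) = t \<and> cut (\<xi> r) = P r \<and> age (\<xi> r) = Suc r \<and>
     prd (\<xi> r) = (if r = 0 then None else Some (\<xi> (r - 1))) \<and> (r > 0 \<longrightarrow> P r = Suc (\<xi> (r - 1))))"

lemma chain_less: "chain j t n P \<xi> \<Longrightarrow> s < r \<Longrightarrow> r < n \<Longrightarrow> \<xi> s < P r"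
proof (induction r)
  case (Suc r)
  then have P: "P (Suc r) = Suc (\<xi> r)" by (simp add: chain_def)
  show ?case
  proof (cases "s = r")
    case False
    then have "\<xi> s < P r" "P r \<le> \<xi> r" using Suc cut_le[of "\<xi> r"] by (auto simp: chain_def)
    then show ?thesis using P by simp
  qed (use P in simp)
qed simp

lemma chain_P_le: "chain j t n P \<xi> \<Longrightarrow> r < n \<Longrightarrow> P 0 \<le> P r"
  using chain_less[of j t n P \<xi> 0 r] cut_le[of "\<xi> 0"] by (cases "r = 0") (auto simp: chain_def)

lemma chain_ev:
  "chain j t n P \<xi> \<Longrightarrow> r < n \<Longrightarrow> ev (\<xi> r) y = (\<Sum>s\<le>r. y (\<xi> s) + bt (\<xi> s) (cutm (\<xi> s) y) / mw j)"
proof (induction r)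
  case 0
  then show ?case by (subst ev_eq) (simp add: chain_def)
next
  case (Suc r)
  then have "prd (\<xi> (Suc r)) = Some (\<xi> r)" "wt (\<xi> (Suc r)) = j" by (auto simp: chain_def)
  then show ?case using Suc by (subst ev_eq) simp
qed

text \<open>Up to \<open>e\<close>, each \<open>Y r\<close> lives in the window from
  \<open>P r\<close> to \<open>\<xi> r\<close>, so in the double sum of the evaluation analysis only
  equal indices matter. Each pair of indices adds an error of at most \<open>3 * e\<close> from the
  coordinate at \<open>\<xi> s\<close> and \<open>3 * e\<close> from the cut.\<close>

lemma chain_sum:
  fixes e :: real
  assumes ch: "chain j t (Suc n) P \<xi>" and tl: "\<And>r. r \<le> n \<Longrightarrow> bnd e (tail (\<xi> r) (Y r))"
    and hd: "\<And>r. r \<le> n \<Longrightarrow> bnd e (head (P r) (Y r))"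
  shows "\<bar>ev (\<xi> n) (\<lambda>z. \<Sum>r\<le>n. Y r z) - (\<Sum>r\<le>n. bt (\<xi> r) (cutm (\<xi> r) (Y r))) / mw j\<bar> \<le> (Suc n)\<^sup>2 * (6 * e)"
proof -
  let ?b = "\<lambda>s r. bt (\<xi> s) (cutm (\<xi> s) (Y r)) / mw j"
  have e: "e \<ge> 0" using tl[of 0] bnd_nonneg by blast
  have mj: "mw j \<ge> 1" using mw_ge[of j] by simp
  have c1: "\<bar>Y r (\<xi> s)\<bar> \<le> 3 * e" if "r \<le> n" "s \<le> n" for r s
  proof (cases "s < r")
    case True
    then have "\<xi> s < P r" using chain_less[OF ch] that by auto
    then show ?thesis using bnd_coef[OF hd[OF that(1)], of "\<xi> s"] by (simp add: head_def)
  next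
    case False
    then have "\<xi> r \<le> \<xi> s"
      using chain_less[OF ch, of r s] cut_le[of "\<xi> s"] ch that by (cases "r = s") (auto simp: chain_def)
    then show ?thesis using bnd_coef[OF tl[OF that(1)], of "\<xi> s"] by (simp add: tail_def mul_def)
  qed
  have c2: "\<bar>?b s r\<bar> \<le> 3 * e" if "r \<le> n" "s \<le> n" "r \<noteq> s" for r s
  proof -
    have "\<bar>bt (\<xi> s) (cutm (\<xi> s) (Y r))\<bar> \<le> 3 * e"
    proof (cases "s < r")
      case True
      then have l: "\<xi> s < P r" using chain_less[OF ch] that by auto
      have "bt (\<xi> s) (cutm (\<xi> s) (Y r)) = bt (\<xi> s) (cutm (\<xi> s) (head (P r) (Y r)))"
        using l by (intro bt_cong ev_cong) (auto simp: cutm_def mul_def head_def)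
      also have "\<bar>\<dots>\<bar> \<le> 3 * e"
        using bnd_mul[OF hd[OF that(1)] adm_cls] e by (intro bt_bound) (auto simp: cutm_def bnd_def)
      finally show ?thesis .
    next
      case False
      then have l: "\<xi> r < P s" using chain_less[OF ch, of r s] that by auto
      have cs: "cut (\<xi> s) = P s" using ch that by (auto simp: chain_def)
      have "bt (\<xi> s) (cutm (\<xi> s) (Y r)) = bt (\<xi> s) (cutm (\<xi> s) (tail (\<xi> r) (Y r)))"
        using l cs by (intro bt_cong ev_cong) (auto simp: cutm_def mul_def tail_def)
      also have "\<bar>\<dots>\<bar> \<le> 3 * e"
        using bnd_mul[OF tl[OF that(1)] adm_cls] e by (intro bt_bound) (auto simp: cutm_def bnd_def)
      finally show ?thesis .
    qed
    moreover have "\<bar>?b s r\<bar> \<le> \<bar>bt (\<xi> s) (cutm (\<xi> s) (Y r))\<bar> / 1"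
      unfolding abs_divide using mj by (intro frac_le) auto
    ultimately show ?thesis by simp
  qed
  have "ev (\<xi> n) (\<lambda>z. \<Sum>r\<le>n. Y r z) = (\<Sum>r\<le>n. \<Sum>s\<le>n. Y r (\<xi> s) + ?b s r)"
    by (simp add: ev_sum chain_ev[OF ch])
  also have "\<dots> = (\<Sum>r\<le>n. ?b r r + (\<Sum>s\<le>n. Y r (\<xi> s) + (if s = r then 0 else ?b s r)))"
  proof (intro sum.cong refl)
    fix r assume r: "r \<in> {..n}"
    have "(\<Sum>s\<le>n. ?b s r) = ?b r r + (\<Sum>s\<in>{..n} - {r}. ?b s r)"
      using r by (simp add: sum.remove)
    also have "(\<Sum>s\<in>{..n} - {r}. ?b s r) = (\<Sum>s\<le>n. if s = r then 0 else ?b s r)"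
      by (rule sum.mono_neutral_cong_left) auto
    finally show "(\<Sum>s\<le>n. Y r (\<xi> s) + ?b s r) = ?b r r + (\<Sum>s\<le>n. Y r (\<xi> s) + (if s = r then 0 else ?b s r))"
      by (simp add: sum.distrib)
  qed
  finally have eq: "ev (\<xi> n) (\<lambda>z. \<Sum>r\<le>n. Y r z) - (\<Sum>r\<le>n. bt (\<xi> r) (cutm (\<xi> r) (Y r))) / mw j =
    (\<Sum>r\<le>n. \<Sum>s\<le>n. Y r (\<xi> s) + (if s = r then 0 else ?b s r))"
    by (simp add: sum.distrib sum_divide_distrib)
  have "\<bar>\<Sum>r\<le>n. \<Sum>s\<le>n. Y r (\<xi> s) + (if s = r then 0 else ?b s r)\<bar> \<le> (\<Sum>r\<le>n. \<Sum>s\<le>n. 6 * e)"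
  proof (intro order_trans[OF sum_abs] sum_mono)
    fix r s assume "r \<in> {..n}" "s \<in> {..n}"
    then have rs: "r \<le> n" "s \<le> n" by simp_all
    show "\<bar>Y r (\<xi> s) + (if s = r then 0 else ?b s r)\<bar> \<le> 6 * e"
    proof (cases "s = r")
      case True
      then show ?thesis using c1[OF rs] e by simp
    next
      case False
      then have "\<bar>Y r (\<xi> s)\<bar> \<le> 3 * e" "\<bar>?b s r\<bar> \<le> 3 * e" using c1[OF rs] c2[OF rs] by auto
      then have "\<bar>Y r (\<xi> s) + ?b s r\<bar> \<le> 6 * e" by linarith
      then show ?thesis unfolding if_not_P[OF False] .
    qed
  qed
  also have "\<dots> = (Suc n)\<^sup>2 * (6 * e)"
    by (simp only: sum_constant card_atMost of_nat_mult power2_eq_square mult.assoc)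
  finally show ?thesis unfolding eq .
qed

lemma chain_exists:
  fixes G :: "bool \<Rightarrow> nat \<Rightarrow> 's \<Rightarrow> bool" and Q :: "'s \<Rightarrow> nat \<Rightarrow> bool" and M :: "'s \<Rightarrow> nat"
  assumes g0: "\<exists>s. G True P0 s" and g1: "\<And>h. \<exists>s. G False (Suc h) s"
    and x0: "\<And>s. G True P0 s \<Longrightarrow> \<exists>g\<ge>M s. wt g = j \<and> lab g = t \<and> prd g = None \<and> cut g = P0 \<and> Q s g"
    and x1: "\<And>s h. G False (Suc h) s \<Longrightarrow> wt h = j \<Longrightarrow> lab h = t \<Longrightarrow> age h < nn j \<Longrightarrow>
      \<exists>g\<ge>M s. wt g = j \<and> lab g = t \<and> prd g = Some h \<and> cut g = Suc h \<and> Q s g"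
    and n: "n \<le> nn j"
  shows "\<exists>S \<xi> P. P 0 = P0 \<and> chain j t n P \<xi> \<and> (\<forall>r<n. G (r = 0) (P r) (S r) \<and> Q (S r) (\<xi> r) \<and> M (S r) \<le> \<xi> r)"
  using n
proof (induction n)
  case 0
  show ?case by (rule exI, rule exI, rule exI[of _ "\<lambda>_. P0"]) (simp add: chain_def)
next
  case (Suc n)
  then obtain S \<xi> P where IH: "P 0 = P0" "chain j t n P \<xi>"
    "\<forall>r<n. G (r = 0) (P r) (S r) \<and> Q (S r) (\<xi> r) \<and> M (S r) \<le> \<xi> r" by auto
  show ?case
  proof (cases n)
    case 0
    obtain s where s: "G True P0 s" using g0 by blast
    obtain g where g: "g \<ge> M s" "wt g = j" "lab g = t" "prd g = None" "cut g = P0" "Q s g" using x0[OF s] by blast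
    show ?thesis
      by (rule exI[of _ "\<lambda>_. s"], rule exI[of _ "\<lambda>_. g"], rule exI[of _ "\<lambda>_. P0"])
        (use 0 s g age_None[OF g(4)] in \<open>auto simp: chain_def\<close>)
  next
    case (Suc m)
    let ?h = "\<xi> m"
    have h: "wt ?h = j" "lab ?h = t" "age ?h = Suc m" using IH(2) Suc by (auto simp: chain_def)
    obtain s where s: "G False (Suc ?h) s" using g1 by blast
    have "age ?h < nn j" using h \<open>Suc n \<le> nn j\<close> Suc by simp
    then obtain g where g: "g \<ge> M s" "wt g = j" "lab g = t" "prd g = Some ?h" "cut g = Suc ?h" "Q s g"
      using x1[OF s h(1,2)] by blast
    have ag: "age g = Suc n" using prd_age[OF g(4)] h Suc by simp
    show ?thesis
      by (rule exI[of _ "S(n := s)"], rule exI[of _ "\<xi>(n := g)"], rule exI[of _ "P(n := Suc ?h)"])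
        (use Suc s g ag IH in \<open>auto simp: chain_def less_Suc_eq\<close>)
  qed
qed

section \<open>Bounded operators\<close>

text \<open>The coefficient sequences whose expansion in the unit vectors converges in norm, that
  is, the closed span of these vectors seen through coefficients.\<close>

definition XX :: "(nat \<Rightarrow> real) set" where
  "XX = {x. \<forall>e>0. \<exists>N. bnd e (tail N x)}"

lemma tail_tail: "N \<le> M \<Longrightarrow> tail M (tail N x) = tail M x"
  by (auto simp: tail_def mul_def)

lemma tail_mul: "tail N (mul M \<phi> x) = mul M \<phi> (tail N x)"
  unfolding tail_def by (rule mul_commute)

lemma head_mul: "head N (mul M \<phi> x) = mul M \<phi> (head N x)"
  by (auto simp: head_def mul_def)

lemma tail_linear: "tail N (\<lambda>z. a * x z + b * y z) = (\<lambda>z. a * tail N x z + b * tail N y z)"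
  unfolding tail_def by (rule mul_linear)

lemma XX_tail: "x \<in> XX \<Longrightarrow> e > 0 \<Longrightarrow> \<exists>N. \<forall>M\<ge>N. bnd e (tail M x)"
proof -
  assume "x \<in> XX" "e > 0"
  then obtain N where "bnd (e / 3) (tail N x)" unfolding XX_def by (auto dest!: spec[of _ "e / 3"])
  then have "bnd (3 * (e / 3)) (tail M x)" if "M \<ge> N" for M
    using bnd_tail tail_tail[OF that] by metis
  then show ?thesis by auto
qed

lemma XX_mul: "x \<in> XX \<Longrightarrow> adm M \<phi> \<Longrightarrow> mul M \<phi> x \<in> XX"
  unfolding XX_def
proof (intro CollectI allI impI)
  fix e :: real assume a: "x \<in> {x. \<forall>e>0. \<exists>N. bnd e (tail N x)}" "adm M \<phi>" "e > 0"
  then obtain N where "bnd (e / 3) (tail N x)" by (auto dest!: spec[of _ "e / 3"])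
  then have "bnd (3 * (e / 3)) (tail N (mul M \<phi> x))" unfolding tail_mul by (rule bnd_mul[OF _ a(2)])
  then show "\<exists>N. bnd e (tail N (mul M \<phi> x))" by auto
qed

lemma XX_linear:
  assumes "x \<in> XX" "y \<in> XX"
  shows "(\<lambda>z. a * x z + b * y z) \<in> XX"
  unfolding XX_def
proof (intro CollectI allI impI)
  fix e :: real assume e: "e > 0"
  let ?e = "e / (\<bar>a\<bar> + \<bar>b\<bar> + 1)"
  have "?e > 0" using e by (simp add: add_nonneg_pos)
  obtain N1 N2 where "\<forall>M\<ge>N1. bnd ?e (tail M x)" "\<forall>M\<ge>N2. bnd ?e (tail M y)"
    using XX_tail[OF assms(1) \<open>?e > 0\<close>] XX_tail[OF assms(2) \<open>?e > 0\<close>] by blast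
  then obtain N where N: "bnd ?e (tail N x)" "bnd ?e (tail N y)"
    by (meson max.cobounded1 max.cobounded2)
  have "bnd (\<bar>a\<bar> * ?e + \<bar>b\<bar> * ?e) (tail N (\<lambda>z. a * x z + b * y z))"
    unfolding tail_linear using N by (intro bnd_add bnd_cmult)
  moreover have "\<bar>a\<bar> * ?e + \<bar>b\<bar> * ?e \<le> e"
  proof -
    have "\<bar>a\<bar> * ?e + \<bar>b\<bar> * ?e = (\<bar>a\<bar> + \<bar>b\<bar>) * e / (\<bar>a\<bar> + \<bar>b\<bar> + 1)"
      by (simp add: add_divide_distrib distrib_right)
    also have "\<dots> \<le> e" using e by (simp add: divide_le_eq add_nonneg_pos algebra_simps)
    finally show ?thesis .
  qed
  ultimately show "\<exists>N. bnd e (tail N (\<lambda>z. a * x z + b * y z))" using bnd_mono by blast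
qed

lemma XX_supp: "supp p q x \<Longrightarrow> x \<in> XX"
  unfolding XX_def
proof (intro CollectI allI impI)
  fix e :: real assume a: "supp p q x" "e > 0"
  then have "tail q x = (\<lambda>_. 0)" by (auto simp: tail_def mul_def supp_def)
  then show "\<exists>N. bnd e (tail N x)" using bnd_zero[of e] a by (intro exI[of _ q]) simp
qed

lemma XX_zero: "(\<lambda>z. 0) \<in> XX" using XX_supp[of 0 0] by (simp add: supp_def)

lemma XX_sum: "(\<And>k. k \<in> I \<Longrightarrow> x k \<in> XX) \<Longrightarrow> (\<lambda>z. \<Sum>k\<in>I. x k z) \<in> XX"
proof (induction I rule: infinite_finite_induct)
  case (insert k I)
  then have "(\<lambda>z. 1 * x k z + 1 * (\<Sum>k\<in>I. x k z)) \<in> XX" by (intro XX_linear) auto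
  then show ?case using insert by simp
qed (auto simp: XX_zero)

lemma XX_cmult: "x \<in> XX \<Longrightarrow> (\<lambda>z. a * x z) \<in> XX"
  using XX_linear[of x x a 0] by simp

lemma XX_diff: "x \<in> XX \<Longrightarrow> y \<in> XX \<Longrightarrow> (\<lambda>z. x z - y z) \<in> XX"
  using XX_linear[of x y 1 "-1"] by simp

lemma XX_bnd: "x \<in> XX \<Longrightarrow> \<exists>b. bnd b x"
proof -
  assume "x \<in> XX"
  then obtain N where N: "bnd 1 (tail N x)" using XX_tail zero_less_one by blast
  have "bnd (3 * (\<Sum>h<N. \<bar>ev h x\<bar>)) (head N x)"
    by (intro head_bnd) (auto intro!: member_le_sum sum_nonneg)
  from bnd_add[OF this N] show ?thesis using head_tail[of x N] by auto
qed

lemma ris_p_ge: "(\<And>L. ris C L x p q j) \<Longrightarrow> k \<le> p k"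
proof (induction k)
  case (Suc k)
  have "p k < q k" "q k \<le> p (Suc k)" using Suc(2)[of "Suc (Suc k)"] by (auto simp: ris_def)
  then show ?case using Suc by simp
qed simp

end

section \<open>Bounded operators are nearly scalar on rapidly increasing sequences\<close>

locale ah_operator = ah_system +
  fixes T :: "(nat \<Rightarrow> real) \<Rightarrow> nat \<Rightarrow> real" and B :: real
  assumes T_in: "x \<in> XX \<Longrightarrow> T x \<in> XX"
    and T_linear: "x \<in> XX \<Longrightarrow> y \<in> XX \<Longrightarrow> T (\<lambda>z. a * x z + b * y z) = (\<lambda>z. a * T x z + b * T y z)"
    and T_bnd: "x \<in> XX \<Longrightarrow> bnd b x \<Longrightarrow> bnd (B * b) (T x)"
    and B_nonneg: "B \<ge> 0"
begin

lemma T_add: "x \<in> XX \<Longrightarrow> y \<in> XX \<Longrightarrow> T (\<lambda>z. x z + y z) = (\<lambda>z. T x z + T y z)"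
  using T_linear[of x y 1 1] by simp

lemma T_cmult: "x \<in> XX \<Longrightarrow> T (\<lambda>z. a * x z) = (\<lambda>z. a * T x z)"
  using T_linear[of x x a 0] by simp

lemma T_zero: "T (\<lambda>z. 0) = (\<lambda>z. 0)"
  using T_cmult[OF XX_zero, of 0] by simp

lemma T_sum: "(\<And>k. k \<in> I \<Longrightarrow> x k \<in> XX) \<Longrightarrow> T (\<lambda>z. \<Sum>k\<in>I. x k z) = (\<lambda>z. \<Sum>k\<in>I. T (x k) z)"
proof (induction I rule: infinite_finite_induct)
  case (insert k I)
  then show ?case using T_add[of "x k" "\<lambda>z. \<Sum>k\<in>I. x k z"] XX_sum[of I x] by simp
qed (auto simp: T_zero)

text \<open>For each fixed \<open>h\<close>, \<open>ev h\<close> after \<open>T\<close> is a bounded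
  functional, hence null on the sequence. The initial part up to \<open>P\<close> is controlled by
  finitely many of these.\<close>

lemma T_head_null:
  assumes r: "\<And>L. ris C L x p q j" and e: "e > 0"
  shows "eventually (\<lambda>k. bnd e (head P (T (x k)))) sequentially"
proof -
  have "eventually (\<lambda>k. \<bar>ev h (T (x k))\<bar> < e / 3) sequentially" for h
  proof -
    have "(\<lambda>k. ev h (T (x k))) \<longlonglongrightarrow> 0"
    proof (rule functional_null_ris[OF _ _ _ _ r])
      show "ev h (T (\<lambda>z. x z + y z)) = ev h (T x) + ev h (T y)" if "supp 0 n x" "supp 0 m y" for x y n m
        using that T_add[of x y] XX_supp by (simp add: ev_add)
      show "ev h (T (\<lambda>z. a * x z)) = a * ev h (T x)" if "supp 0 n x" for a x n
        using that T_cmult[of x] XX_supp by (simp add: ev_cmult)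
      show "\<bar>ev h (T x)\<bar> \<le> B * b" if "supp 0 n x" "bnd b x" for x n b
        using T_bnd[OF XX_supp that(2)] that by (auto simp: bnd_def)
    qed (rule B_nonneg)
    then show ?thesis using e unfolding tendsto_iff by (auto dest!: spec[of _ "e / 3"])
  qed
  then have "eventually (\<lambda>k. \<forall>h\<in>{..<P}. \<bar>ev h (T (x k))\<bar> < e / 3) sequentially"
    by (intro eventually_ball_finite) auto
  then show ?thesis
  proof eventually_elim
    case (elim k)
    then have "bnd (3 * (e / 3)) (head P (T (x k)))" using e by (intro head_bnd) (auto intro: less_imp_le)
    then show ?case by simp
  qed
qed

text \<open>The ingredients of one element of an even chain: with these coefficients and targets,
  its weighted term nearly annihilates \<open>x k\<close> but not its image. The head condition
  keeps the image from interfering with earlier elements.\<close>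

definition even_step :: "real \<Rightarrow> real \<Rightarrow> 'a \<Rightarrow> (nat \<Rightarrow> nat \<Rightarrow> real) \<Rightarrow> nat \<Rightarrow> nat \<times> real \<times> real \<times> nat \<times> nat \<Rightarrow> bool" where
  "even_step d e t x P = (\<lambda>(k, a1, a2, b1, b2). a1 \<in> \<rat> \<and> a2 \<in> \<rat> \<and> \<bar>a1\<bar> + \<bar>a2\<bar> \<le> 1 \<and>
     \<bar>a1 * ev b1 (mul P (cls P t) (x k)) + a2 * ev b2 (mul P (cls P t) (x k))\<bar> \<le> e \<and>
     a1 * ev b1 (mul P (cls P t) (T (x k))) + a2 * ev b2 (mul P (cls P t) (T (x k))) \<ge> d / 2 \<and>
     bnd e (head P (T (x k))))"

lemma even_step_exists:
  assumes r: "\<And>L. ris C L x p q j" and d: "d > 0" and e: "e > 0"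
    and far: "\<And>P k0. \<exists>k\<ge>k0. \<forall>l. \<not> bnd d (mul P (cls P t) (\<lambda>z. T (x k) z - l * x k z))"
  shows "\<exists>s. even_step d e t x P s \<and> P \<le> p (fst s)"
proof -
  obtain k0 where k0: "\<And>k. k \<ge> k0 \<Longrightarrow> bnd e (head P (T (x k)))"
    using T_head_null[OF r e, of P] by (auto simp: eventually_sequentially)
  obtain k where k: "k \<ge> max k0 P" "\<And>l. \<not> bnd d (mul P (cls P t) (\<lambda>z. T (x k) z - l * x k z))"
    using far by blast
  let ?f = "\<lambda>g. ev g (mul P (cls P t) (x k))"
  let ?g = "\<lambda>g. ev g (mul P (cls P t) (T (x k)))"
  have "\<exists>g. \<bar>?g g - l * ?f g\<bar> > d" for l
  proof -
    have "mul P (cls P t) (\<lambda>z. T (x k) z - l * x k z) =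
      (\<lambda>z. mul P (cls P t) (T (x k)) z - l * mul P (cls P t) (x k) z)"
      using mul_linear[of P "cls P t" 1 "T (x k)" "- l" "x k"] by simp
    then show ?thesis using k(2)[of l] unfolding bnd_def by (auto simp: ev_diff ev_cmult not_le)
  qed
  from two_coordinates[OF this d] obtain g1 g2 a b where
    ab: "\<bar>a\<bar> + \<bar>b\<bar> \<le> 1" "a * ?f g1 + b * ?f g2 = 0" "a * ?g g1 + b * ?g g2 \<ge> d" by blast
  \<comment> \<open>\<open>c\<close> dominates the four values involved, so rounding both
    coefficients by at most \<open>e'\<close> changes either combination by at most
    \<open>min e (d / 2)\<close>.\<close>
  define c where "c = \<bar>?f g1\<bar> + \<bar>?f g2\<bar> + \<bar>?g g1\<bar> + \<bar>?g g2\<bar> + 1"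
  have c: "c \<ge> 1" unfolding c_def by simp
  define e' where "e' = min e (d / 2) / c"
  have e': "e' > 0" using e d c by (simp add: e'_def)
  obtain r1 r2 where r: "r1 \<in> \<rat>" "\<bar>r1\<bar> \<le> \<bar>a\<bar>" "\<bar>r1 - a\<bar> \<le> e'" "r2 \<in> \<rat>" "\<bar>r2\<bar> \<le> \<bar>b\<bar>" "\<bar>r2 - b\<bar> \<le> e'"
    using Rats_below[OF e', of a] Rats_below[OF e', of b] by blast
  have close: "\<bar>(r1 * u + r2 * v) - (a * u + b * v)\<bar> \<le> min e (d / 2)" if "\<bar>u\<bar> + \<bar>v\<bar> \<le> c" for u v
  proof -
    have "\<bar>(r1 - a) * u + (r2 - b) * v\<bar> \<le> \<bar>r1 - a\<bar> * \<bar>u\<bar> + \<bar>r2 - b\<bar> * \<bar>v\<bar>"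
      by (metis abs_mult abs_triangle_ineq)
    also have "\<dots> \<le> e' * \<bar>u\<bar> + e' * \<bar>v\<bar>" using r by (intro add_mono mult_right_mono) auto
    also have "\<dots> = e' * (\<bar>u\<bar> + \<bar>v\<bar>)" by (simp add: algebra_simps)
    also have "\<dots> \<le> e' * c" using that e' by (intro mult_left_mono) auto
    finally show ?thesis using c by (simp add: e'_def algebra_simps)
  qed
  have f: "\<bar>r1 * ?f g1 + r2 * ?f g2\<bar> \<le> e" 
  proof -
    have "\<bar>(r1 * ?f g1 + r2 * ?f g2) - (a * ?f g1 + b * ?f g2)\<bar> \<le> min e (d / 2)"
      by (rule close) (simp add: c_def)
    then show ?thesis using ab(2) by simp
  qed
  have g: "r1 * ?g g1 + r2 * ?g g2 \<ge> d / 2" 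
  proof -
    have "\<bar>(r1 * ?g g1 + r2 * ?g g2) - (a * ?g g1 + b * ?g g2)\<bar> \<le> min e (d / 2)"
      by (rule close) (simp add: c_def)
    then have "\<bar>(r1 * ?g g1 + r2 * ?g g2) - (a * ?g g1 + b * ?g g2)\<bar> \<le> d / 2" by simp
    then show ?thesis using ab(3) by linarith
  qed
  have "even_step d e t x P (k, r1, r2, g1, g2)" unfolding even_step_def using r f g ab(1) k0 k(1) by auto
  moreover have "P \<le> p k" using ris_p_ge[OF assms(1), of k] k(1) by simp
  ultimately show ?thesis by (intro exI[of _ "(k, r1, r2, g1, g2)"]) simp
qed

text \<open>Averaging multiplies by \<open>mw j / nn j\<close>, while the chain of weight
  \<open>mw j\<close> sums \<open>nn j\<close> terms divided by \<open>mw j\<close>. So the nearly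
  vanishing values on the vectors stay small and the values \<open>d / 2\<close> on their images
  survive. The cut at \<open>P0\<close> to the class of \<open>t\<close> is the form in which an
  element of odd weight will see the pair.\<close>

lemma exact_pair_exists:
  assumes r: "\<And>L. ris C L x p q jj" and d: "d > 0" and e: "e > 0" and t: "t \<in> K"
    and far: "\<And>P k0. \<exists>k\<ge>k0. \<forall>l. \<not> bnd d (mul P (cls P t) (\<lambda>z. T (x k) z - l * x k z))"
    and j: "even j" "j \<noteq> 0"
  shows "\<exists>z \<eta> Q. P0 < Q \<and> supp P0 Q z \<and> exact (4 * C) j z \<and> wt \<eta> = j \<and>
    \<bar>ev \<eta> (mul P0 (cls P0 t) z)\<bar> \<le> e \<and> ev \<eta> (mul P0 (cls P0 t) (T z)) \<ge> d / 4 \<and> bnd e (head P0 (T z))"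
proof -
  define N where "N = nn j"
  have N1: "real N \<ge> 1" using nn_pos[of j] by (simp add: N_def)
  have m1: "mw j \<ge> 1" using mw_ge[of j] by simp
  \<comment> \<open>The first bound is for the value on \<open>z\<close> and the head of
    \<open>T z\<close>. The second is for the cross terms of \<open>chain_sum\<close>, which after
    averaging amount to \<open>18 * mw j * N * e1'\<close> and may use up
    \<open>d / 4\<close>.\<close>
  define e1' where "e1' = min (e / (3 * mw j)) (d / (72 * mw j * N))"
  have e1p: "e1' > 0" using e d N1 m1 by (simp add: e1'_def)
  have e1a: "3 * mw j * e1' \<le> e"
  proof -
    have "3 * mw j * e1' \<le> 3 * mw j * (e / (3 * mw j))" using m1 by (intro mult_left_mono) (auto simp: e1'_def)
    then show ?thesis using m1 by simp
  qed
  have e1b: "72 * mw j * N * e1' \<le> d"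
  proof -
    have "72 * mw j * N * e1' \<le> 72 * mw j * N * (d / (72 * mw j * N))"
      using m1 by (intro mult_left_mono) (auto simp: e1'_def)
    then show ?thesis using m1 N1 by simp
  qed
  have gd: "good C (jj k) (x k)" "supp (p k) (q k) (x k)" "p k < q k" for k
    using r[of "Suc k"] by (auto simp: ris_def)
  have xX: "x k \<in> XX" for k using XX_supp gd(2) by blast
  have "\<forall>k. \<exists>m. \<forall>m'\<ge>m. bnd e1' (tail m' (T (x k)))" using XX_tail[OF T_in[OF xX] e1p] by blast
  then obtain m where m: "\<And>k m'. m' \<ge> m k \<Longrightarrow> bnd e1' (tail m' (T (x k)))" by metis
  let ?G = "\<lambda>(b::bool) P s. even_step d e1' t x P s \<and> P \<le> p (fst s)"
  define Q where "Q s g \<longleftrightarrow> (case s of (k::nat, a1, a2, b1, b2) \<Rightarrow> c1 g = a1 \<and> c2 g = a2 \<and> e1 g = b1 \<and> e2 g = b2)"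
    for s g
  let ?M = "\<lambda>s. max (q (fst s)) (m (fst s))"
  have gex: "\<exists>s. ?G b P s" for b P by (rule even_step_exists[OF r d e1p far])
  have "\<exists>S \<xi> P. P 0 = P0 \<and> chain j t N P \<xi> \<and> (\<forall>r<N. ?G (r = 0) (P r) (S r) \<and> Q (S r) (\<xi> r) \<and> ?M (S r) \<le> \<xi> r)"
  proof (rule chain_exists)
    fix s assume a: "?G True P0 s"
    show "\<exists>g\<ge>?M s. wt g = j \<and> lab g = t \<and> prd g = None \<and> cut g = P0 \<and> Q s g"
    proof (cases s)
      case (fields k a1 a2 b1 b2)
      then show ?thesis
        using rich_even[OF j t, where po = None and p = P0 and M = "?M s" and ?a1.0 = a1 and ?a2.0 = a2 and ?b1.0 = b1 and ?b2.0 = b2]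
          a unfolding even_step_def Q_def by auto
    qed
  next
    fix s h assume a: "?G False (Suc h) s" "wt h = j" "lab h = t" "age h < nn j"
    show "\<exists>g\<ge>?M s. wt g = j \<and> lab g = t \<and> prd g = Some h \<and> cut g = Suc h \<and> Q s g"
    proof (cases s)
      case (fields k a1 a2 b1 b2)
      then show ?thesis
        using rich_even[OF j t, where po = "Some h" and p = "Suc h" and M = "?M s" and ?a1.0 = a1 and ?a2.0 = a2 and ?b1.0 = b1 and ?b2.0 = b2]
          a unfolding even_step_def Q_def by auto
    qed
  qed (use gex in \<open>auto simp: N_def\<close>)
  then obtain S \<xi> P where P: "P 0 = P0" and ch: "chain j t N P \<xi>"
    and S: "\<And>r. r < N \<Longrightarrow> even_step d e1' t x (P r) (S r) \<and> P r \<le> p (fst (S r)) \<and> Q (S r) (\<xi> r) \<and> ?M (S r) \<le> \<xi> r" by blast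
  define k where "k r = fst (S r)" for r
  let ?X = "\<lambda>r. x (k r)"
  have chr: "wt (\<xi> r) = j" "lab (\<xi> r) = t" "cut (\<xi> r) = P r" if "r < N" for r
    using ch that by (auto simp: chain_def)
  have Pp: "P r \<le> p (k r)" "q (k r) \<le> \<xi> r" "m (k r) \<le> \<xi> r" if "r < N" for r
    using S[OF that] by (auto simp: k_def)
  have bt_eq: "bt (\<xi> r) y = (case S r of (k, a1, a2, b1, b2) \<Rightarrow> a1 * ev b1 y + a2 * ev b2 y)" if "r < N" for r y
    using S[OF that] unfolding Q_def by (auto simp: bt_def split: prod.splits)
  have cutm_eq: "cutm (\<xi> r) y = mul (P r) (cls (P r) t) y" if "r < N" for r y
    unfolding cutm_def using chr[OF that] by simp
  have b1: "\<bar>bt (\<xi> r) (cutm (\<xi> r) (?X r))\<bar> \<le> e1'" if "r < N" for r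
    using S[OF that] unfolding bt_eq[OF that] cutm_eq[OF that] even_step_def k_def by (auto split: prod.splits)
  have b2: "bt (\<xi> r) (cutm (\<xi> r) (T (?X r))) \<ge> d / 2" if "r < N" for r
    using S[OF that] unfolding bt_eq[OF that] cutm_eq[OF that] even_step_def k_def by (auto split: prod.splits)
  have hd: "bnd e1' (head (P r) (T (?X r)))" if "r < N" for r
    using S[OF that] unfolding even_step_def k_def by (auto split: prod.splits)
  \<comment> \<open>The indices were chosen separately in each window; their order follows from the
    order of the windows.\<close>
  have kk: "k r < k r'" if "r < r'" "r' < N" for r r'
  proof (rule ccontr)
    assume "\<not> k r < k r'"
    then have "k r' = k r \<or> k r' < k r" by auto
    then have "p (k r') \<le> p (k r)"
    proof
      assume "k r' < k r"
      then have "q (k r') \<le> p (k r)" using r[of "Suc (k r)"] by (auto simp: ris_def)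
      then show ?thesis using gd(3)[of "k r'"] by simp
    qed simp
    moreover have "q (k r) < P r'" using Pp(2)[of r] chain_less[OF ch that] that by simp
    ultimately show False using Pp(1)[OF that(2)] gd(3)[of "k r"] by simp
  qed
  have r': "ris C N ?X (\<lambda>r. p (k r)) (\<lambda>r. q (k r)) (\<lambda>r. jj (k r))"
    unfolding ris_def
  proof (intro conjI allI impI)
    show "C \<ge> 0" using r[of 0] by (simp add: ris_def)
    fix i i' :: nat assume "i < i'" "i' < N"
    then have "k i < k i'" by (rule kk)
    then show "q (k i) \<le> p (k i')" "q (k i) \<le> jj (k i')" using r[of "Suc (k i')"] by (auto simp: ris_def)
  qed (use gd in auto)
  define z where "z = (\<lambda>\<zeta>. mw j / nn j * (\<Sum>r<nn j. ?X r \<zeta>))"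
  have j1: "j \<ge> 1" using j by simp
  have ex: "exact (4 * C) j z" unfolding z_def using exact_average[OF r'[unfolded N_def] j1] .
  obtain n where n: "N = Suc n" using N1 by (cases N) auto
  have zn: "z = (\<lambda>\<zeta>. mw j / N * (\<Sum>r\<le>n. ?X r \<zeta>))"
    unfolding z_def N_def[symmetric] by (simp add: n lessThan_Suc_atMost)
  have SX: "(\<lambda>\<zeta>. \<Sum>r\<le>n. ?X r \<zeta>) \<in> XX" using xX by (intro XX_sum)
  have Tz: "T z = (\<lambda>\<zeta>. mw j / N * (\<Sum>r\<le>n. T (?X r) \<zeta>))"
    unfolding zn T_cmult[OF SX] using T_sum[of "{..n}" ?X] xX by simp
  let ?Q0 = "Suc P0 + (\<Sum>r\<le>n. q (k r))"
  have sz: "supp P0 ?Q0 z"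
    unfolding supp_def
  proof (intro allI impI)
    fix \<zeta> assume a: "\<zeta> < P0 \<or> ?Q0 \<le> \<zeta>"
    have "?X r \<zeta> = 0" if "r \<le> n" for r
    proof -
      have "q (k r) \<le> (\<Sum>r\<le>n. q (k r))" using that by (intro member_le_sum) auto
      moreover have "P0 \<le> p (k r)" using chain_P_le[OF ch, of r] Pp(1)[of r] that n P by simp
      ultimately have "\<zeta> < p (k r) \<or> q (k r) \<le> \<zeta>" using a by auto
      then show ?thesis using gd(2) by (auto simp: supp_def)
    qed
    then show "z \<zeta> = 0" unfolding zn by simp
  qed
  let ?c = "mul P0 (cls P0 t)"
  \<comment> \<open>A later cut to a finer class absorbs the cut at \<open>P0\<close> to the class
    of level \<open>P0\<close>.\<close>
  have cutc: "cutm (\<xi> r) (?c y) = cutm (\<xi> r) y" if "r < N" for r y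
    using mul_cut_le[of P0 "\<xi> r" "cls P0 t" y] adm_cls chr[OF that] chain_P_le[OF ch that] P
    by (simp add: cls_def sim_refl)
  have cl: "?c (\<lambda>\<zeta>. a * (\<Sum>r\<le>n. Y r \<zeta>)) = (\<lambda>\<zeta>. a * (\<Sum>r\<le>n. ?c (Y r) \<zeta>))" for a Y
    using mul_linear[of P0 "cls P0 t" a "\<lambda>\<zeta>. \<Sum>r\<le>n. Y r \<zeta>" 0 "\<lambda>_. 0"] by (simp add: mul_sum)
  let ?\<eta> = "\<xi> n"
  have nN: "n < N" "\<And>r. r \<le> n \<Longrightarrow> r < N" using n by auto
  have v1: "\<bar>ev ?\<eta> (?c z)\<bar> \<le> e"
  proof -
    have "bnd 0 (tail (\<xi> r) (?c (?X r)))" "bnd 0 (head (P r) (?c (?X r)))" if "r \<le> n" for r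
    proof -
      have "tail (\<xi> r) (?c (?X r)) = (\<lambda>_. 0)" "head (P r) (?c (?X r)) = (\<lambda>_. 0)"
        using gd(2)[of "k r"] Pp[OF nN(2)[OF that]] by (auto simp: tail_def mul_def head_def supp_def)
      then show "bnd 0 (tail (\<xi> r) (?c (?X r)))" "bnd 0 (head (P r) (?c (?X r)))" by (simp_all add: bnd_def)
    qed
    from chain_sum[OF ch[unfolded n] this]
    have "ev ?\<eta> (\<lambda>\<zeta>. \<Sum>r\<le>n. ?c (?X r) \<zeta>) = (\<Sum>r\<le>n. bt (\<xi> r) (cutm (\<xi> r) (?X r))) / mw j"
      using cutc nN by simp
    then have "ev ?\<eta> (?c z) = (\<Sum>r\<le>n. bt (\<xi> r) (cutm (\<xi> r) (?X r))) / N"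
      unfolding zn cl ev_cmult using m1 by simp
    moreover have "\<bar>\<Sum>r\<le>n. bt (\<xi> r) (cutm (\<xi> r) (?X r))\<bar> \<le> (\<Sum>r\<le>n. e1')"
      using b1 nN by (intro order_trans[OF sum_abs] sum_mono) auto
    then have "\<bar>\<Sum>r\<le>n. bt (\<xi> r) (cutm (\<xi> r) (?X r))\<bar> / N \<le> N * e1' / N"
      using n by (intro divide_right_mono) auto
    ultimately have "\<bar>ev ?\<eta> (?c z)\<bar> \<le> N * e1' / N" by (simp add: abs_divide)
    also have "\<dots> = 1 * e1'" using N1 by simp
    also have "\<dots> \<le> 3 * mw j * e1'" using m1 e1p by (intro mult_right_mono) auto
    finally show ?thesis using e1a by simp
  qed
  have v2: "ev ?\<eta> (?c (T z)) \<ge> d / 4"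
  proof -
    have tl: "bnd (3 * e1') (tail (\<xi> r) (?c (T (?X r))))" "bnd (3 * e1') (head (P r) (?c (T (?X r))))" if "r \<le> n" for r
      unfolding tail_mul head_mul using m[OF Pp(3)] hd nN(2)[OF that] adm_cls by (auto intro!: bnd_mul)
    from chain_sum[OF ch[unfolded n] tl]
    have "\<bar>ev ?\<eta> (\<lambda>\<zeta>. \<Sum>r\<le>n. ?c (T (?X r)) \<zeta>) - (\<Sum>r\<le>n. bt (\<xi> r) (cutm (\<xi> r) (T (?X r)))) / mw j\<bar> \<le> N\<^sup>2 * (6 * (3 * e1'))"
      using cutc nN n by simp
    moreover have "(\<Sum>r\<le>n. d / 2) \<le> (\<Sum>r\<le>n. bt (\<xi> r) (cutm (\<xi> r) (T (?X r))))"
      using b2 nN by (intro sum_mono) auto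
    then have "N * (d / 2) / mw j \<le> (\<Sum>r\<le>n. bt (\<xi> r) (cutm (\<xi> r) (T (?X r)))) / mw j"
      using m1 n by (intro divide_right_mono) auto
    ultimately have "ev ?\<eta> (\<lambda>\<zeta>. \<Sum>r\<le>n. ?c (T (?X r)) \<zeta>) \<ge> N * (d / 2) / mw j - N\<^sup>2 * (6 * (3 * e1'))"
      by (simp only: abs_le_iff) linarith
    then have "mw j / N * ev ?\<eta> (\<lambda>\<zeta>. \<Sum>r\<le>n. ?c (T (?X r)) \<zeta>) \<ge> mw j / N * (N * (d / 2) / mw j - N\<^sup>2 * (6 * (3 * e1')))"
      using m1 N1 by (intro mult_left_mono) auto
    also have "mw j / N * (N * (d / 2) / mw j - N\<^sup>2 * (6 * (3 * e1'))) = d / 2 - 72 * mw j * N * e1' / 4"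
      using m1 N1 by (simp add: field_simps power2_eq_square)
    finally show ?thesis unfolding Tz cl ev_cmult using e1b by linarith
  qed
  have v3: "bnd e (head P0 (T z))"
  proof -
    have "head P0 (T z) = (\<lambda>\<zeta>. mw j / N * (\<Sum>r\<le>n. head P0 (head (P r) (T (?X r))) \<zeta>))"
    proof
      fix \<zeta>
      show "head P0 (T z) \<zeta> = mw j / N * (\<Sum>r\<le>n. head P0 (head (P r) (T (?X r))) \<zeta>)"
      proof (cases "\<zeta> < P0")
        case True
        then have "\<zeta> < P r" if "r \<le> n" for r using chain_P_le[OF ch nN(2)[OF that]] P by simp
        then show ?thesis unfolding Tz using True by (simp add: head_def)
      qed (simp add: head_def)
    qed
    moreover have "bnd (\<bar>mw j / N\<bar> * (\<Sum>r\<le>n. 3 * e1')) (\<lambda>\<zeta>. mw j / N * (\<Sum>r\<le>n. head P0 (head (P r) (T (?X r))) \<zeta>))"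
      using hd nN by (intro bnd_cmult bnd_sum bnd_head) auto
    moreover have "\<bar>mw j / N\<bar> * (\<Sum>r\<le>n. 3 * e1') = 3 * mw j * e1'" using m1 N1 n by simp
    ultimately show ?thesis using e1a bnd_mono by auto
  qed
  show ?thesis using sz ex v1 v2 v3 chr(1)[OF nN(1)] by (intro exI[of _ z] exI[of _ ?\<eta>] exI[of _ ?Q0]) auto
qed

definition odd_step :: "real \<Rightarrow> real \<Rightarrow> real \<Rightarrow> 'a \<Rightarrow> nat \<Rightarrow> nat \<Rightarrow> (nat \<Rightarrow> real) \<times> nat \<times> nat \<Rightarrow> bool" where
  "odd_step C d e t w P = (\<lambda>(z, \<eta>, Q). P < Q \<and> supp P Q z \<and> exact C w z \<and> wt \<eta> = w \<and>
    \<bar>ev \<eta> (mul P (cls P t) z)\<bar> \<le> e \<and> ev \<eta> (mul P (cls P t) (T z)) \<ge> d \<and> bnd e (head P (T z)))"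

lemma exact_mono: "exact C j z \<Longrightarrow> C \<le> C' \<Longrightarrow> exact C' j z"
  unfolding exact_def using good_mono mw_pos[of j] by (meson divide_right_mono less_imp_le order_trans)

text \<open>The image of the sum of a dependent sequence is estimated twice. The sum has norm at
  most \<open>8 * C * N / (mw j)\<^sup>2\<close>, whereas the odd chain takes a value of about
  \<open>N * d / mw j\<close> on the image. Comparing the two leaves one factor
  \<open>1 / mw j\<close>.\<close>

lemma dependent_lower:
  assumes g2: "\<And>P w e. even w \<Longrightarrow> w \<noteq> 0 \<Longrightarrow> e > 0 \<Longrightarrow> \<exists>s. odd_step C d e t w P s"
    and d: "d > 0" and C: "C \<ge> 1" and t: "t \<in> K" and j: "odd j"
  shows "d \<le> 16 * B * C / mw j"
proof -
  define N where "N = nn j"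
  have N1: "real N \<ge> 1" using nn_pos[of j] by (simp add: N_def)
  have m1: "mw j \<ge> 1" using mw_ge[of j] by simp
  define e where "e = min (C / N) (d / (12 * mw j * N))"
  have e: "e > 0" using d N1 m1 C by (simp add: e_def)
  have eC: "e \<le> C / N" by (simp add: e_def)
  have eb: "12 * mw j * N * e \<le> d"
  proof -
    have "12 * mw j * N * e \<le> 12 * mw j * N * (d / (12 * mw j * N))"
      using m1 by (intro mult_left_mono) (auto simp: e_def)
    then show ?thesis using m1 N1 by simp
  qed
  obtain i where i: "(real N)\<^sup>2 \<le> mw (4 * i + 2)"
  proof -
    have "(real N)\<^sup>2 \<le> real (4 * N\<^sup>2 + 2)" by simp
    also have "\<dots> \<le> mw (4 * N\<^sup>2 + 2)" by (rule mw_ge_self)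
    finally show ?thesis by (rule that)
  qed
  \<comment> \<open>A window after the first starts at \<open>P = Suc h\<close> with
    \<open>h\<close> the predecessor, so \<open>4 * P\<close> is the code \<open>4 * h + 4\<close>.
    The first index is 2 modulo 4.\<close>
  let ?W = "\<lambda>b P. if b then 4 * i + 2 else 4 * P"
  let ?G = "\<lambda>b P s. odd_step C d e t (?W b P) P s"
  define Q where "Q s g \<longleftrightarrow> e1 g = fst (snd s)" for s :: "(nat \<Rightarrow> real) \<times> nat \<times> nat" and g
  have gz: "fst s \<in> XX" if "?G b P s" for b P s
    using that XX_supp unfolding odd_step_def by (auto split: prod.splits)
  \<comment> \<open>\<open>chain_exists\<close> needs this end point as a function of the chosen
    data alone: beyond it lie neither the support of the vector nor a noticeable part of its
    image.\<close>
  define M where "M s = (SOME m. snd (snd s) \<le> m \<and> (\<forall>m'\<ge>m. bnd e (tail m' (T (fst s)))))"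
    for s :: "(nat \<Rightarrow> real) \<times> nat \<times> nat"
  have M: "snd (snd s) \<le> M s \<and> (\<forall>m'\<ge>M s. bnd e (tail m' (T (fst s))))" if G: "?G b P s" for b P s
  proof -
    obtain m where "\<forall>m'\<ge>m. bnd e (tail m' (T (fst s)))" using XX_tail[OF T_in[OF gz[OF G]] e] by blast
    then have "snd (snd s) \<le> max m (snd (snd s)) \<and> (\<forall>m'\<ge>max m (snd (snd s)). bnd e (tail m' (T (fst s))))" by auto
    then show ?thesis unfolding M_def by (rule someI)
  qed
  have wts: "wt (fst (snd s)) = w" if "odd_step C d e t w P s" for w P s
    using that unfolding odd_step_def by (auto split: prod.splits)
  have "\<exists>S \<xi> P. P 0 = (0::nat) \<and> chain j t N P \<xi> \<and>
    (\<forall>r<N. ?G (r = 0) (P r) (S r) \<and> Q (S r) (\<xi> r) \<and> M (S r) \<le> \<xi> r)"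
  proof (rule chain_exists)
    show "\<exists>s. ?G True 0 s" using g2[OF _ _ e] by simp
    show "\<exists>s. ?G False (Suc h) s" for h using g2[OF _ _ e, of "4 * Suc h"] by simp
  next
    fix s assume s: "?G True 0 s"
    have "\<exists>g\<ge>M s. wt g = j \<and> lab g = t \<and> prd g = None \<and> cut g = 0 \<and> e1 g = fst (snd s) \<and> c1 g = 1 \<and> c2 g = 0"
      using wts[OF s] i by (intro rich_odd j t) (auto simp: N_def intro: exI[of _ i])
    then show "\<exists>g\<ge>M s. wt g = j \<and> lab g = t \<and> prd g = None \<and> cut g = 0 \<and> Q s g"
      unfolding Q_def by blast
  next
    fix s h assume s: "?G False (Suc h) s" and h: "wt h = j" "lab h = t" "age h < nn j"
    have "\<exists>g\<ge>M s. wt g = j \<and> lab g = t \<and> prd g = Some h \<and> cut g = Suc h \<and> e1 g = fst (snd s) \<and> c1 g = 1 \<and> c2 g = 0"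
      using wts[OF s] h by (intro rich_odd j t) auto
    then show "\<exists>g\<ge>M s. wt g = j \<and> lab g = t \<and> prd g = Some h \<and> cut g = Suc h \<and> Q s g"
      unfolding Q_def by blast
  qed (simp add: N_def)
  then obtain S \<xi> P where P: "P 0 = (0::nat)" and ch: "chain j t N P \<xi>"
    and S: "\<And>r. r < N \<Longrightarrow> ?G (r = 0) (P r) (S r) \<and> Q (S r) (\<xi> r) \<and> M (S r) \<le> \<xi> r" by blast
  define z where "z r = fst (S r)" for r
  define \<eta> where "\<eta> r = fst (snd (S r))" for r
  define q where "q r = snd (snd (S r))" for r
  define w where "w r = ?W (r = 0) (P r)" for r
  have S': "P r < q r" "supp (P r) (q r) (z r)" "exact C (w r) (z r)" "wt (\<eta> r) = w r"
    "\<bar>ev (\<eta> r) (mul (P r) (cls (P r) t) (z r))\<bar> \<le> e" "ev (\<eta> r) (mul (P r) (cls (P r) t) (T (z r))) \<ge> d"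
    "bnd e (head (P r) (T (z r)))" "e1 (\<xi> r) = \<eta> r" "q r \<le> \<xi> r" "bnd e (tail (\<xi> r) (T (z r)))" if "r < N" for r
    using S[OF that] M[of "r = 0" "P r" "S r"]
    unfolding odd_step_def z_def \<eta>_def q_def w_def Q_def by (auto split: prod.splits)
  have chr: "wt (\<xi> r) = j" "lab (\<xi> r) = t" "cut (\<xi> r) = P r" "prd (\<xi> r) = (if r = 0 then None else Some (\<xi> (r - 1)))"
    "r > 0 \<Longrightarrow> P r = Suc (\<xi> (r - 1))" if "r < N" for r
    using ch that by (auto simp: chain_def)
  have cutm_eq: "cutm (\<xi> r) y = mul (P r) (cls (P r) t) y" if "r < N" for r y
    unfolding cutm_def using chr[OF that] by simp
  have bt_eq: "bt (\<xi> r) y = ev (\<eta> r) y" if "r < N" for r y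
    using S'(8)[OF that] odd_c[of "\<xi> r"] chr[OF that] j by (simp add: bt_def)
  have zX: "z r \<in> XX" if "r < N" for r using XX_supp S'(2)[OF that] by blast
  have r: "ris C N z P q w"
    unfolding ris_def
  proof (intro conjI allI impI)
    fix k k' :: nat assume k: "k < k'" "k' < N"
    have "q k \<le> \<xi> k" "\<xi> k < P k'" using S'(9)[of k] chain_less[OF ch k] k by auto
    then show "q k \<le> P k'" "q k \<le> w k'" using k by (auto simp: w_def)
  qed (use S' C in \<open>auto simp: exact_def\<close>)
  obtain n where n: "N = Suc n" using N1 by (cases N) auto
  have nN: "n < N" "\<And>r. r \<le> n \<Longrightarrow> r < N" using n by auto
  let ?Z = "\<lambda>\<zeta>. \<Sum>r\<le>n. z r \<zeta>"
  have "bnd (8 * C * N / (mw j)\<^sup>2) ?Z"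
    unfolding bnd_def
  proof
    fix g
    have "\<bar>\<Sum>k<N. ev g (z k)\<bar> \<le> 8 * C * N / (mw j)\<^sup>2"
    proof (rule dependent_sum[OF j N_def r])
      show "exact C (w k) (z k)" if "k < N" for k using S'(3)[OF that] .
      show "wt (\<xi> k) = j \<and> prd (\<xi> k) = (if k = 0 then None else Some (\<xi> (k - 1))) \<and>
        cut (\<xi> k) = P k \<and> wt (e1 (\<xi> k)) = w k \<and> q k \<le> \<xi> k" if "k < N" for k
        using chr[OF that] S'[OF that] by auto
      show "\<xi> k < P k'" if "k < k'" "k' < N" for k k' using chain_less[OF ch that] .
      show "\<bar>ev (e1 (\<xi> k)) (cutm (\<xi> k) (z k))\<bar> \<le> C / N" if "k < N" for k
        using S'(5,8)[OF that] eC unfolding cutm_eq[OF that] by simp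
    qed
    then show "\<bar>ev g ?Z\<bar> \<le> 8 * C * N / (mw j)\<^sup>2" by (simp add: ev_sum n lessThan_Suc_atMost)
  qed
  then have "bnd (B * (8 * C * N / (mw j)\<^sup>2)) (T ?Z)" using zX nN by (intro T_bnd XX_sum) auto
  then have up: "ev (\<xi> n) (T ?Z) \<le> B * (8 * C * N / (mw j)\<^sup>2)" unfolding bnd_def by (auto simp: abs_le_iff)
  have TZ: "T ?Z = (\<lambda>\<zeta>. \<Sum>r\<le>n. T (z r) \<zeta>)" using zX nN by (intro T_sum) auto
  have "\<bar>ev (\<xi> n) (T ?Z) - (\<Sum>r\<le>n. bt (\<xi> r) (cutm (\<xi> r) (T (z r)))) / mw j\<bar> \<le> N\<^sup>2 * (6 * e)"
    unfolding TZ using chain_sum[OF ch[unfolded n], of e "\<lambda>r. T (z r)"] S' nN n by simp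
  moreover have "(\<Sum>r\<le>n. d) \<le> (\<Sum>r\<le>n. bt (\<xi> r) (cutm (\<xi> r) (T (z r))))"
    using S'(6) nN by (intro sum_mono) (simp add: bt_eq cutm_eq)
  then have "N * d / mw j \<le> (\<Sum>r\<le>n. bt (\<xi> r) (cutm (\<xi> r) (T (z r)))) / mw j"
    using m1 n by (intro divide_right_mono) auto
  ultimately have "N * d / mw j - N\<^sup>2 * (6 * e) \<le> B * (8 * C * N / (mw j)\<^sup>2)"
    using up by (simp only: abs_le_iff) linarith
  then have "mw j / N * (N * d / mw j - N\<^sup>2 * (6 * e)) \<le> mw j / N * (B * (8 * C * N / (mw j)\<^sup>2))"
    using m1 N1 by (intro mult_left_mono) auto
  also have "mw j / N * (N * d / mw j - N\<^sup>2 * (6 * e)) = d - 12 * mw j * N * e / 2"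
    using m1 N1 by (simp add: field_simps power2_eq_square)
  also have "mw j / N * (B * (8 * C * N / (mw j)\<^sup>2)) = 8 * B * C / mw j"
    using m1 N1 by (simp add: field_simps power2_eq_square)
  finally have "d / 2 \<le> 8 * B * C / mw j" using eb by linarith
  then have "2 * (d / 2) \<le> 2 * (8 * B * C / mw j)" by linarith
  then show ?thesis by simp
qed

text \<open>If this fails, separating pairs exist from every start and for every even weight, so
  that \<open>d / 4 \<le> 16 * B * C' / mw j\<close> for all odd \<open>j\<close>, which is absurd
  for large \<open>j\<close>. The scalar may still vary with \<open>k\<close>.\<close>

lemma ris_eigen:
  assumes r: "\<And>L. ris C L x p q jj" and d: "d > 0" and t: "t \<in> K"
  shows "\<exists>P. eventually (\<lambda>k. \<exists>l. bnd d (mul P (cls P t) (\<lambda>z. T (x k) z - l * x k z))) sequentially"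
proof (rule ccontr)
  assume "\<not> ?thesis"
  then have far: "\<And>P k0. \<exists>k\<ge>k0. \<forall>l. \<not> bnd d (mul P (cls P t) (\<lambda>z. T (x k) z - l * x k z))"
    unfolding eventually_sequentially by blast
  define C' where "C' = max 1 (4 * C)"
  have C': "C' \<ge> 1" by (simp add: C'_def)
  have "\<exists>s. odd_step C' (d / 4) e t w P s" if w: "even w" "w \<noteq> 0" "e > 0" for P w e
  proof -
    obtain z \<eta> Q where "P < Q" "supp P Q z" "exact (4 * C) w z" "wt \<eta> = w"
      "\<bar>ev \<eta> (mul P (cls P t) z)\<bar> \<le> e" "ev \<eta> (mul P (cls P t) (T z)) \<ge> d / 4" "bnd e (head P (T z))"
      using exact_pair_exists[OF r d w(3) t far w(1,2)] by blast
    then have "odd_step C' (d / 4) e t w P (z, \<eta>, Q)"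
      unfolding odd_step_def using exact_mono[of "4 * C" w z C'] by (simp add: C'_def)
    then show ?thesis by blast
  qed
  then have low: "d / 4 \<le> 16 * B * C' / mw j" if "odd j" for j
    using dependent_lower[OF _ _ C' t that, of "d / 4"] d by simp
  obtain n where n: "64 * B * C' / d < real n" using reals_Archimedean2 by blast
  have "real n \<le> mw (2 * n + 1)" using mw_ge_self[of "2 * n + 1"] by simp
  then have "64 * B * C' / d < mw (2 * n + 1)" using n by simp
  then have "64 * B * C' / mw (2 * n + 1) < d" using d mw_pos[of "2 * n + 1"] by (simp add: field_simps)
  then show False using low[of "2 * n + 1"] by simp
qed

end

section \<open>Diagonal coefficients\<close>

context ah_system
begin

text \<open>For such \<open>g\<close> the functional \<open>ev g\<close> is just the coordinate at
  \<open>g\<close>. These elements occur with every label arbitrarily far out and serve as probes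
  for operators.\<close>

definition junk_element :: "nat \<Rightarrow> bool" where
  "junk_element g \<longleftrightarrow> wt g = 0 \<and> prd g = None \<and> c1 g = 0 \<and> c2 g = 0"

lemma junk_element_exists: "t \<in> K \<Longrightarrow> \<exists>g\<ge>M. junk_element g \<and> lab g = t"
  unfolding junk_element_def using rich_junk[of t M] by blast

lemma supp_unit: "supp g (Suc g) (unit g)" by (auto simp: supp_def unit_def)

lemma unit_XX: "unit g \<in> XX" using XX_supp supp_unit by blast

text \<open>The constant is \<open>9 * 16\<close>: at weight index 0, the one of \<open>g\<close>
  itself, only the norm bound 9 is available, and \<open>mw 0 = 16\<close>.\<close>

lemma good_unit: assumes "junk_element g" shows "good 144 j (unit g)"
proof -
  have e0: "ev h (unit g) = 0" if "h < g" for h using that by (intro ev_zero_cong) (auto simp: unit_def)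
  have w: "bnd 3 (unit g) \<and> (\<forall>h N \<phi>. adm N \<phi> \<longrightarrow> \<not> wt h = 0 \<longrightarrow> \<bar>ev h (mul N \<phi> (unit g))\<bar> \<le> 24 / mw (wt h))"
  proof (rule local_weights[OF supp_unit])
    show "\<bar>ev h (unit g)\<bar> \<le> 1" if "h < Suc g" for h
      using that e0[of h] ev_unit[of g] by (cases "h = g") auto
    show "ev h (unit g) = 0" if "h < Suc g" "\<not> wt h = 0" for h
      using that e0[of h] assms by (cases "h = g") (auto simp: junk_element_def)
  qed simp
  show ?thesis unfolding good_def
  proof (intro allI impI conjI)
    fix N \<phi> h assume a: "adm N \<phi>"
    have l: "\<bar>ev h (mul N \<phi> (unit g))\<bar> \<le> 3 * 3" using bnd_mul[OF conjunct1[OF w] a] by (simp add: bnd_def)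
    then show "\<bar>ev h (mul N \<phi> (unit g))\<bar> \<le> 144" by simp
    show "\<bar>ev h (mul N \<phi> (unit g))\<bar> \<le> 144 / mw (wt h)"
    proof (cases "wt h = 0")
      case True
      then show ?thesis using l by (simp add: mw_def)
    next
      case False
      then have "\<bar>ev h (mul N \<phi> (unit g))\<bar> \<le> 24 / mw (wt h)" using w a by blast
      also have "\<dots> \<le> 144 / mw (wt h)" using mw_pos[of "wt h"] by (intro divide_right_mono) auto
      finally show ?thesis .
    qed
  qed
qed

lemma ris_unit:
  assumes "\<And>i. junk_element (\<gamma> i)" "strict_mono \<gamma>"
  shows "ris 144 L (\<lambda>i. unit (\<gamma> i)) \<gamma> (\<lambda>i. Suc (\<gamma> i)) \<gamma>"
  unfolding ris_def using assms good_unit supp_unit strict_mono_less[OF assms(2)] by (auto simp: Suc_le_eq)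

lemma mul_cls_cls: "P' \<le> P \<Longrightarrow> mul P (cls P t) (mul P' (cls P' t) x) = mul P (cls P t) x"
  using sim_mono by (auto simp: mul_def cls_def)

lemma mul_cls_at: "P \<le> z \<Longrightarrow> sim P (lab z) t \<Longrightarrow> mul P (cls P t) x z = x z"
  by (simp add: mul_def cls_def)

lemma XX_coef_null: "x \<in> XX \<Longrightarrow> e > 0 \<Longrightarrow> \<exists>N. \<forall>z\<ge>N. \<bar>x z\<bar> \<le> e"
proof -
  assume "x \<in> XX" "e > 0"
  then obtain N where "\<forall>M\<ge>N. bnd (e / 3) (tail M x)" using XX_tail[of x "e / 3"] by auto
  then have "bnd (e / 3) (tail N x)" by blast
  from bnd_coef[OF this] have "\<bar>tail N x z\<bar> \<le> e" for z by simp
  then have "\<bar>x z\<bar> \<le> e" if "z \<ge> N" for z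
    using that \<open>\<And>z. \<bar>tail N x z\<bar> \<le> e\<close>[of z] by (simp add: tail_def mul_def)
  then show ?thesis by blast
qed

definition diag_coeff :: "((nat \<Rightarrow> real) \<Rightarrow> nat \<Rightarrow> real) \<Rightarrow> nat \<Rightarrow> real" where "diag_coeff T g = T (unit g) g"

text \<open>A cluster value of the diagonal coefficients along junk elements labelled exactly
  \<open>t\<close>. Existence is a matter of boundedness; that it is a limit, and hence unique, is
  shown by \<open>diag_limit\<close>.\<close>

definition diag_at :: "((nat \<Rightarrow> real) \<Rightarrow> nat \<Rightarrow> real) \<Rightarrow> 'k \<Rightarrow> real \<Rightarrow> bool" where
  "diag_at T t \<phi> \<longleftrightarrow> (\<forall>M e. e > 0 \<longrightarrow> (\<exists>\<delta>\<ge>M. junk_element \<delta> \<and> lab \<delta> = t \<and> \<bar>diag_coeff T \<delta> - \<phi>\<bar> \<le> e))"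

definition dfun :: "((nat \<Rightarrow> real) \<Rightarrow> nat \<Rightarrow> real) \<Rightarrow> 'k \<Rightarrow> real" where
  "dfun T t = (SOME \<phi>. diag_at T t \<phi>)"

end

section \<open>The scalar function of an operator\<close>

context ah_operator
begin

lemma diag_at_exists:
  assumes t: "t \<in> K"
  shows "\<exists>\<phi>. diag_at T t \<phi>"
proof -
  have "\<forall>k. \<exists>g\<ge>k. junk_element g \<and> lab g = t" using junk_element_exists[OF t] by blast
  then obtain \<gamma> where g: "\<And>k. \<gamma> k \<ge> k \<and> junk_element (\<gamma> k) \<and> lab (\<gamma> k) = t" by metis
  have "bnd (B * 144) (T (unit (\<gamma> k)))" for k
    using T_bnd[OF unit_XX good_bnd[OF good_unit]] g by blast
  then have "diag_coeff T (\<gamma> k) \<in> {-(3 * (B * 144))..3 * (B * 144)}" for k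
    unfolding diag_coeff_def using bnd_coef[of "B * 144" "T (unit (\<gamma> k))" "\<gamma> k"] by (auto simp: abs_le_iff)
  then obtain \<phi> r where r: "strict_mono (r :: nat \<Rightarrow> nat)" "((\<lambda>k. diag_coeff T (\<gamma> k)) \<circ> r) \<longlonglongrightarrow> \<phi>"
    using compact_Icc[unfolded compact_def] by meson
  have "\<exists>\<delta>\<ge>M. junk_element \<delta> \<and> lab \<delta> = t \<and> \<bar>diag_coeff T \<delta> - \<phi>\<bar> \<le> e" if "e > 0" for M e
  proof -
    obtain N where N: "\<forall>k\<ge>N. dist (diag_coeff T (\<gamma> (r k))) \<phi> < e" using r(2) \<open>e > 0\<close> by (auto simp: lim_sequentially)
    let ?k = "max N M"
    have "?k \<le> r ?k" using r(1) by (rule seq_suble)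
    then have "M \<le> \<gamma> (r ?k)" using g[of "r ?k"] by linarith
    moreover have "\<bar>diag_coeff T (\<gamma> (r ?k)) - \<phi>\<bar> \<le> e" using N[rule_format, of ?k] by (simp add: dist_real_def)
    ultimately show ?thesis using g by blast
  qed
  then show ?thesis unfolding diag_at_def by blast
qed

text \<open>The scalars of \<open>ris_eigen\<close> may vary with the vector. Adding to
  \<open>x k\<close> the basis vector of a junk element beyond its support gives another rapidly
  increasing sequence. At the coordinate of that element \<open>x k\<close> vanishes and its image
  is small, so the scalar of the sum is close to the diagonal coefficient there, hence to
  \<open>\<phi>\<close>.\<close>

lemma ris_diag:
  assumes r: "\<And>L. ris C L x p q jj" and t: "t \<in> K" and \<phi>: "diag_at T t \<phi>" and e: "e > 0"
  shows "\<exists>P. eventually (\<lambda>k. bnd e (mul P (cls P t) (\<lambda>z. T (x k) z - \<phi> * x k z))) sequentially"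
proof (rule ccontr)
  assume "\<not> ?thesis"
  then have far: "\<exists>k\<ge>k0. \<not> bnd e (mul P (cls P t) (\<lambda>z. T (x k) z - \<phi> * x k z))" for P k0
    unfolding eventually_sequentially by blast
  have C: "C \<ge> 0" using r[of 0] by (simp add: ris_def)
  define d where "d = e / (3 * (6 + 11 * C + 21 * 144))"
  have d: "d > 0" using e C by (simp add: d_def)
  have gd: "good C (jj k) (x k)" "supp (p k) (q k) (x k)" "p k < q k" for k
    using r[of "Suc k"] by (auto simp: ris_def)
  have xX: "x k \<in> XX" for k using XX_supp gd(2) by blast
  have dex: "\<exists>\<delta>. q k \<le> \<delta> \<and> junk_element \<delta> \<and> lab \<delta> = t \<and> \<bar>diag_coeff T \<delta> - \<phi>\<bar> \<le> d \<and> \<bar>T (x k) \<delta>\<bar> \<le> d" for k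
  proof -
    obtain N where N: "\<forall>z\<ge>N. \<bar>T (x k) z\<bar> \<le> d" using XX_coef_null[OF T_in[OF xX] d] by blast
    obtain \<delta> where "\<delta> \<ge> max N (q k)" "junk_element \<delta>" "lab \<delta> = t" "\<bar>diag_coeff T \<delta> - \<phi>\<bar> \<le> d"
      using \<phi> d unfolding diag_at_def by blast
    then show ?thesis using N by auto
  qed
  \<comment> \<open>The \<open>i\<close>-th pair violates the claim at level \<open>i\<close>. So
    whatever levels \<open>ris_eigen\<close> returns below, a later pair contradicts them.\<close>
  define R where "R i s \<longleftrightarrow> \<not> bnd e (mul i (cls i t) (\<lambda>z. T (x (fst s)) z - \<phi> * x (fst s) z)) \<and>
    q (fst s) \<le> snd s \<and> junk_element (snd s) \<and> lab (snd s) = t \<and> \<bar>diag_coeff T (snd s) - \<phi>\<bar> \<le> d \<and> \<bar>T (x (fst s)) (snd s)\<bar> \<le> d" for i and s :: "nat \<times> nat"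
  have Rex: "\<exists>s. R i s \<and> k0 \<le> fst s" for i k0
  proof -
    obtain k where "k \<ge> k0" "\<not> bnd e (mul i (cls i t) (\<lambda>z. T (x k) z - \<phi> * x k z))" using far by blast
    moreover obtain \<delta> where "q k \<le> \<delta> \<and> junk_element \<delta> \<and> lab \<delta> = t \<and> \<bar>diag_coeff T \<delta> - \<phi>\<bar> \<le> d \<and> \<bar>T (x k) \<delta>\<bar> \<le> d" using dex by blast
    ultimately show ?thesis by (intro exI[of _ "(k, \<delta>)"]) (simp add: R_def)
  qed
  have "\<exists>s. \<forall>i. R i (s i) \<and> Suc (max (fst (s i)) (snd (s i))) \<le> fst (s (Suc i))"
  proof (rule dependent_nat_choice)
    show "\<exists>s. R 0 s" using Rex by blast
    show "\<exists>y. R (Suc n) y \<and> Suc (max (fst x) (snd x)) \<le> fst y" for x :: "nat \<times> nat" and n using Rex by blast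
  qed
  then obtain s where s: "\<And>i. R i (s i)" "\<And>i. Suc (max (fst (s i)) (snd (s i))) \<le> fst (s (Suc i))" by blast
  define k where "k i = fst (s i)" for i
  define \<delta> where "\<delta> i = snd (s i)" for i
  have kd: "\<not> bnd e (mul i (cls i t) (\<lambda>z. T (x (k i)) z - \<phi> * x (k i) z))" "q (k i) \<le> \<delta> i" "junk_element (\<delta> i)" "lab (\<delta> i) = t"
    "\<bar>diag_coeff T (\<delta> i) - \<phi>\<bar> \<le> d" "\<bar>T (x (k i)) (\<delta> i)\<bar> \<le> d" "k i < k (Suc i)" "Suc (\<delta> i) \<le> k (Suc i)" for i
    using s(1)[of i] s(2)[of i] by (auto simp: R_def k_def \<delta>_def)
  have km: "k i < k i'" if "i < i'" for i i' using that kd(7) lift_Suc_mono_less[of k] by blast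
  have pk: "m \<le> p m" for m using ris_p_ge[OF r] .
  have dk: "Suc (\<delta> i) \<le> k i'" if "i < i'" for i i'
    using kd(8)[of i] km[of "Suc i" i'] that by (cases "Suc i = i'") auto
  have \<delta>m: "\<delta> i < \<delta> i'" if "i < i'" for i i'
    using dk[OF that] pk[of "k i'"] gd(3)[of "k i'"] kd(2)[of i'] by linarith
  have qp: "q (k i) \<le> jj (k i')" if "i < i'" for i i'
    using km[OF that] r[of "Suc (k i')"] by (auto simp: ris_def)
  let ?u = "\<lambda>i. unit (\<delta> i)"
  let ?y = "\<lambda>i. x (k i)"
  let ?w = "\<lambda>i z. ?y i z + ?u i z"
  have ru: "ris 144 L ?u \<delta> (\<lambda>i. Suc (\<delta> i)) \<delta>" for L
    using kd(3) \<delta>m by (intro ris_unit) (auto intro: strict_monoI)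
  have rw: "ris (C + 144) L ?w (\<lambda>i. p (k i)) (\<lambda>i. Suc (\<delta> i)) (\<lambda>i. jj (k i))" for L
    unfolding ris_def
  proof (intro conjI allI impI)
    fix i
    show "good (C + 144) (jj (k i)) (?w i)" using good_add gd(1) good_unit kd(3) by blast
    show "supp (p (k i)) (Suc (\<delta> i)) (?w i)"
      using gd(2,3)[of "k i"] kd(2)[of i] by (auto simp: supp_def unit_def)
    show "p (k i) < Suc (\<delta> i)" using gd(3)[of "k i"] kd(2)[of i] by simp
  next
    fix i i' :: nat assume "i < i'"
    then have l: "Suc (\<delta> i) \<le> k i'" by (rule dk)
    then show "Suc (\<delta> i) \<le> p (k i')" using pk[of "k i'"] by simp
    have "k i' - 1 \<le> p (k i' - 1)" "p (k i' - 1) < q (k i' - 1)" "q (k i' - 1) \<le> jj (k i')"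
      using l pk gd(3) r[of "Suc (k i')"] by (auto simp: ris_def)
    then show "Suc (\<delta> i) \<le> jj (k i')" using l by linarith
  qed (use C in auto)
  obtain P1 i1 where P1: "\<And>i. i \<ge> i1 \<Longrightarrow> \<exists>l. bnd d (mul P1 (cls P1 t) (\<lambda>z. T (?w i) z - l * ?w i z))"
    using ris_eigen[OF rw d t] unfolding eventually_sequentially by blast
  obtain P2 i2 where P2: "\<And>i. i \<ge> i2 \<Longrightarrow> \<exists>l. bnd d (mul P2 (cls P2 t) (\<lambda>z. T (?u i) z - l * ?u i z))"
    using ris_eigen[OF ru d t] unfolding eventually_sequentially by blast
  define i where "i = Max {i1, i2, P1, P2}"
  have i: "i1 \<le> i" "i2 \<le> i" "P1 \<le> i" "P2 \<le> i" by (auto simp: i_def)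
  let ?m = "mul i (cls i t)"
  obtain l where l: "bnd d (mul P1 (cls P1 t) (\<lambda>z. T (?w i) z - l * ?w i z))" using P1 i by blast
  obtain l' where l': "bnd d (mul P2 (cls P2 t) (\<lambda>z. T (?u i) z - l' * ?u i z))" using P2 i by blast
  have A: "bnd (3 * d) (?m (\<lambda>z. T (?w i) z - l * ?w i z))"
    using bnd_mul[OF l adm_cls, of i t] mul_cls_cls[OF i(3)] by simp
  have A': "bnd (3 * d) (?m (\<lambda>z. T (?u i) z - l' * ?u i z))"
    using bnd_mul[OF l' adm_cls, of i t] mul_cls_cls[OF i(4)] by simp
  have i\<delta>: "i \<le> \<delta> i" using \<delta>m by (intro seq_suble strict_monoI) auto
  have at: "?m v (\<delta> i) = v (\<delta> i)" for v using i\<delta> kd(4) by (intro mul_cls_at) (auto simp: sim_refl)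
  have Tw: "T (?w i) = (\<lambda>z. T (?y i) z + T (?u i) z)" by (rule T_add[OF xX unit_XX])
  have y0: "?y i (\<delta> i) = 0" using gd(2)[of "k i"] kd(2)[of i] by (auto simp: supp_def)
  have b1: "\<bar>T (?y i) (\<delta> i) + diag_coeff T (\<delta> i) - l\<bar> \<le> 9 * d"
    using bnd_coef[OF A, of "\<delta> i"] y0 unfolding at Tw by (simp add: diag_coeff_def unit_def)
  have b2: "\<bar>diag_coeff T (\<delta> i) - l'\<bar> \<le> 9 * d"
    using bnd_coef[OF A', of "\<delta> i"] unfolding at by (simp add: diag_coeff_def unit_def)
  have b3: "\<bar>l - \<phi>\<bar> \<le> 11 * d" "\<bar>l - l'\<bar> \<le> 19 * d"
    using b1 b2 kd(5)[of i] kd(6)[of i] by linarith+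
  \<comment> \<open>\<open>T y\<close> is written as the difference of the images of the sum and of
    the unit vector, and both scalars are exchanged for \<open>\<phi>\<close>. The differences of
    scalars are at most \<open>11 * d\<close> and \<open>19 * d\<close>.\<close>
  have eq: "?m (\<lambda>z. T (?y i) z - \<phi> * ?y i z) = (\<lambda>z. (?m (\<lambda>z. T (?w i) z - l * ?w i z) z - ?m (\<lambda>z. T (?u i) z - l' * ?u i z) z)
    + ((l - \<phi>) * ?m (?y i) z + (l - l') * ?m (?u i) z))"
    unfolding Tw by (auto simp: mul_def algebra_simps)
  have "bnd ((3 * d + 3 * d) + (\<bar>l - \<phi>\<bar> * C + \<bar>l - l'\<bar> * 144)) (?m (\<lambda>z. T (?y i) z - \<phi> * ?y i z))"
    unfolding eq
    by (intro bnd_add[OF bnd_diff[OF A A'] bnd_add[OF bnd_cmult bnd_cmult]]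
      good_bnd[OF good_mul[OF gd(1) adm_cls]] good_bnd[OF good_mul[OF good_unit[OF kd(3)] adm_cls]])
  moreover have "(3 * d + 3 * d) + (\<bar>l - \<phi>\<bar> * C + \<bar>l - l'\<bar> * 144) \<le> (3 * d + 3 * d) + (11 * d * C + 19 * d * 144)"
    using b3 C by (intro add_mono mult_right_mono) auto
  moreover have "\<dots> \<le> d * (3 * (6 + 11 * C + 21 * 144))"
    using d C mult_nonneg_nonneg[of d C] by (simp add: algebra_simps)
  moreover have "\<dots> = e" using C by (simp add: d_def)
  ultimately have "bnd e (?m (\<lambda>z. T (?y i) z - \<phi> * ?y i z))" 
    by (elim bnd_mono) linarith
  then show False using kd(1)[of i] by simp
qed

text \<open>Junk elements with labels merely near \<open>t\<close> are included, which gives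
  continuity of the scalar function. Counterexamples with labels in ever smaller classes around
  \<open>t\<close> would have unit vectors forming a rapidly increasing sequence, to which
  \<open>ris_diag\<close> applies at \<open>t\<close>.\<close>

lemma diag_limit:
  assumes t: "t \<in> K" and \<phi>: "diag_at T t \<phi>" and e: "e > 0"
  shows "\<exists>P. \<forall>g\<ge>P. junk_element g \<longrightarrow> sim P (lab g) t \<longrightarrow> \<bar>diag_coeff T g - \<phi>\<bar> \<le> e"
proof (rule ccontr)
  assume "\<not> ?thesis"
  then have far: "\<exists>g\<ge>P. junk_element g \<and> sim P (lab g) t \<and> \<bar>diag_coeff T g - \<phi>\<bar> > e" for P by (meson not_le)
  have "\<exists>\<gamma>. \<forall>i. (junk_element (\<gamma> i) \<and> sim i (lab (\<gamma> i)) t \<and> \<bar>diag_coeff T (\<gamma> i) - \<phi>\<bar> > e) \<and> \<gamma> i < \<gamma> (Suc i)"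
  proof (rule dependent_nat_choice)
    show "\<exists>g. junk_element g \<and> sim 0 (lab g) t \<and> \<bar>diag_coeff T g - \<phi>\<bar> > e" using far[of 0] by blast
    fix g n
    obtain g' where "g' \<ge> max (Suc n) (Suc g)" "junk_element g'" "sim (max (Suc n) (Suc g)) (lab g') t" "\<bar>diag_coeff T g' - \<phi>\<bar> > e"
      using far by blast
    then show "\<exists>y. (junk_element y \<and> sim (Suc n) (lab y) t \<and> \<bar>diag_coeff T y - \<phi>\<bar> > e) \<and> g < y"
      using sim_mono[of "Suc n" "max (Suc n) (Suc g)"] by (intro exI[of _ g']) auto
  qed
  then obtain \<gamma> where \<gamma>: "\<And>i. junk_element (\<gamma> i)" "\<And>i. sim i (lab (\<gamma> i)) t" "\<And>i. \<bar>diag_coeff T (\<gamma> i) - \<phi>\<bar> > e" "\<And>i. \<gamma> i < \<gamma> (Suc i)"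
    by blast
  have sm: "strict_mono \<gamma>" using \<gamma>(4) strict_mono_Suc_iff by blast
  obtain P i0 where "\<And>i. i \<ge> i0 \<Longrightarrow> bnd (e / 3) (mul P (cls P t) (\<lambda>z. T (unit (\<gamma> i)) z - \<phi> * unit (\<gamma> i) z))"
    using ris_diag[OF ris_unit[OF \<gamma>(1) sm] t \<phi>, of "e / 3"] e unfolding eventually_sequentially by auto
  then have b: "bnd (e / 3) (mul P (cls P t) (\<lambda>z. T (unit (\<gamma> (max i0 P))) z - \<phi> * unit (\<gamma> (max i0 P)) z))" by simp
  let ?i = "max i0 P"
  have "P \<le> \<gamma> ?i" using seq_suble[OF sm, of ?i] by simp
  moreover have "sim P (lab (\<gamma> ?i)) t" using \<gamma>(2)[of ?i] sim_mono[of P ?i] by simp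
  ultimately have "\<bar>diag_coeff T (\<gamma> ?i) - \<phi>\<bar> \<le> e"
    using bnd_coef[OF b, of "\<gamma> ?i"] by (simp add: mul_cls_at diag_coeff_def unit_def)
  then show False using \<gamma>(3)[of ?i] by simp
qed

lemma diag_at_unique: "t \<in> K \<Longrightarrow> diag_at T t \<phi> \<Longrightarrow> diag_at T t \<phi>' \<Longrightarrow> \<phi> = \<phi>'"
proof (rule ccontr)
  assume a: "t \<in> K" "diag_at T t \<phi>" "diag_at T t \<phi>'" "\<phi> \<noteq> \<phi>'"
  define e where "e = \<bar>\<phi> - \<phi>'\<bar> / 3"
  have e: "e > 0" using a(4) by (simp add: e_def)
  obtain P where P: "\<forall>g\<ge>P. junk_element g \<longrightarrow> sim P (lab g) t \<longrightarrow> \<bar>diag_coeff T g - \<phi>\<bar> \<le> e" using diag_limit[OF a(1,2) e] by blast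
  obtain g where "g \<ge> P" "junk_element g" "lab g = t" "\<bar>diag_coeff T g - \<phi>'\<bar> \<le> e" using a(3) e unfolding diag_at_def by blast
  then have "\<bar>diag_coeff T g - \<phi>\<bar> \<le> e" "\<bar>diag_coeff T g - \<phi>'\<bar> \<le> e" using P sim_refl by auto
  then have "\<bar>\<phi> - \<phi>'\<bar> \<le> 2 * e" by linarith
  moreover have "\<bar>\<phi> - \<phi>'\<bar> = 3 * e" by (simp add: e_def)
  ultimately show False using e by simp
qed

lemma diag_at_dfun: "t \<in> K \<Longrightarrow> diag_at T t (dfun T t)"
  unfolding dfun_def using diag_at_exists by (rule someI_ex)

lemma dfun_eq: "t \<in> K \<Longrightarrow> diag_at T t \<phi> \<Longrightarrow> dfun T t = \<phi>"
  using diag_at_unique diag_at_dfun by blast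

lemma dfun_eqI:
  assumes t: "t \<in> K" and "\<And>e. e > 0 \<Longrightarrow> \<exists>P. \<forall>g\<ge>P. junk_element g \<longrightarrow> lab g = t \<longrightarrow> \<bar>diag_coeff T g - \<phi>\<bar> \<le> e"
  shows "dfun T t = \<phi>"
proof (rule dfun_eq[OF t], unfold diag_at_def, intro allI impI)
  fix M and e :: real assume "e > 0"
  then obtain P where P: "\<forall>g\<ge>P. junk_element g \<longrightarrow> lab g = t \<longrightarrow> \<bar>diag_coeff T g - \<phi>\<bar> \<le> e" using assms(2) by blast
  obtain g where "g \<ge> max M P" "junk_element g" "lab g = t" using junk_element_exists[OF t] by blast
  then show "\<exists>\<delta>\<ge>M. junk_element \<delta> \<and> lab \<delta> = t \<and> \<bar>diag_coeff T \<delta> - \<phi>\<bar> \<le> e" using P by auto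
qed

lemma dfun_limit: "t \<in> K \<Longrightarrow> e > 0 \<Longrightarrow> \<exists>P. \<forall>g\<ge>P. junk_element g \<longrightarrow> sim P (lab g) t \<longrightarrow> \<bar>diag_coeff T g - dfun T t\<bar> \<le> e"
  using diag_limit diag_at_dfun by blast

lemma dfun_continuous: "continuous_on K (dfun T)"
  unfolding continuous_on_def
proof (intro ballI, rule tendstoI)
  fix t and e :: real assume t: "t \<in> K" and e: "e > 0"
  obtain P where P: "\<forall>g\<ge>P. junk_element g \<longrightarrow> sim P (lab g) t \<longrightarrow> \<bar>diag_coeff T g - dfun T t\<bar> \<le> e / 3"
    using dfun_limit[OF t, of "e / 3"] e by auto
  have "dist (dfun T s) (dfun T t) < e" if s: "s \<in> K" "sim P s t" for s
  proof -
    obtain P' where P': "\<forall>g\<ge>P'. junk_element g \<longrightarrow> sim P' (lab g) s \<longrightarrow> \<bar>diag_coeff T g - dfun T s\<bar> \<le> e / 3"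
      using dfun_limit[OF s(1), of "e / 3"] e by auto
    obtain g where "g \<ge> max P P'" "junk_element g" "lab g = s" using junk_element_exists[OF s(1)] by blast
    then have "\<bar>diag_coeff T g - dfun T t\<bar> \<le> e / 3" "\<bar>diag_coeff T g - dfun T s\<bar> \<le> e / 3" using P P' s(2) sim_refl by auto
    then show ?thesis using e unfolding dist_real_def by linarith
  qed
  then show "eventually (\<lambda>s. dist (dfun T s) (dfun T t) < e) (at t within K)"
    using sim_nhds[OF t, of P] by (auto simp: eventually_at_topological elim: eventually_mono)
qed

lemma dfun_bound: "t \<in> K \<Longrightarrow> \<bar>dfun T t\<bar> \<le> 3 * (B * 144)"
proof (rule field_le_epsilon)
  fix e :: real assume t: "t \<in> K" and e: "e > 0"
  obtain g where g: "junk_element g" "\<bar>diag_coeff T g - dfun T t\<bar> \<le> e" using diag_at_dfun[OF t] e unfolding diag_at_def by blast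
  have "\<bar>diag_coeff T g\<bar> \<le> 3 * (B * 144)"
    unfolding diag_coeff_def by (intro bnd_coef T_bnd unit_XX good_bnd[OF good_unit[OF g(1)]])
  then show "\<bar>dfun T t\<bar> \<le> 3 * (B * 144) + e" using g(2) by linarith
qed

end

section \<open>From rapidly increasing sequences to tails; multipliers of continuous
  functions\<close>

context ah_system
begin

definition ev_norm :: "(nat \<Rightarrow> real) \<Rightarrow> real" where "ev_norm x = (SUP g. \<bar>ev g x\<bar>)"

lemma ev_norm_le: "bnd b x \<Longrightarrow> ev_norm x \<le> b"
  unfolding ev_norm_def bnd_def by (intro cSUP_least) auto

lemma bnd_ev_norm: "bnd b x \<Longrightarrow> bnd (ev_norm x) x"
  unfolding bnd_def ev_norm_def by (auto intro!: cSUP_upper bdd_aboveI[of _ b])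

lemma ev_norm_nonneg: "bnd b x \<Longrightarrow> ev_norm x \<ge> 0"
  using bnd_ev_norm bnd_nonneg by blast

text \<open>A tail of a unit vector has norm at most 3 and need not be finitely supported. Cutting
  it off far out leaves a block of norm at most 9, which accounts for \<open>9 * (e / 10)\<close>;
  the remainder is small in norm and takes \<open>e / 10\<close>.\<close>

lemma null_tail:
  fixes \<nu> :: "(nat \<Rightarrow> real) \<Rightarrow> real"
  assumes sub: "\<And>x y. x \<in> XX \<Longrightarrow> y \<in> XX \<Longrightarrow> \<nu> (\<lambda>z. x z + y z) \<le> \<nu> x + \<nu> y"
    and sc: "\<And>x a. x \<in> XX \<Longrightarrow> a > 0 \<Longrightarrow> \<nu> (\<lambda>z. a * x z) \<le> a * \<nu> x"
    and B: "\<And>x b. x \<in> XX \<Longrightarrow> bnd b x \<Longrightarrow> \<nu> x \<le> B * b" "B \<ge> 0"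
    and ris: "\<And>C x p q j. (\<And>L. ris C L x p q j) \<Longrightarrow> (\<lambda>k. \<nu> (x k)) \<longlonglongrightarrow> 0"
    and e: "e > 0"
  shows "\<exists>n. \<forall>x\<in>XX. bnd 1 x \<longrightarrow> \<nu> (tail n x) \<le> e"
proof -
  have "e / 10 > 0" using e by simp
  have "\<exists>n. \<forall>x q. supp n q x \<longrightarrow> bnd 1 x \<longrightarrow> \<nu> x < e / 10"
    by (rule null_on_blocks[OF _ ris \<open>e / 10 > 0\<close>]) (use sub XX_supp in blast)+
  then obtain n where n: "\<And>x q. supp n q x \<Longrightarrow> bnd 1 x \<Longrightarrow> \<nu> x < e / 10" by blast
  have "\<nu> (tail n x) \<le> e" if x: "x \<in> XX" "bnd 1 x" for x
  proof -
    let ?y = "tail n x"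
    have y: "?y \<in> XX" "bnd 3 ?y"
      using XX_mul[OF x(1) adm_const[of 1]] bnd_tail[OF x(2)] by (auto simp: tail_def)
    define e' where "e' = e / (10 * (B + 1))"
    have e': "e' > 0" using e B(2) by (simp add: e'_def)
    obtain m where m: "bnd e' (tail m ?y)" using XX_tail[OF y(1) e'] by blast
    let ?h = "\<lambda>z. 1 / 9 * head m ?y z"
    have sh: "supp n m ?h" by (auto simp: supp_def head_def tail_def mul_def)
    have bh: "bnd (\<bar>1 / 9\<bar> * (3 * 3)) ?h" using bnd_head[OF y(2)] by (rule bnd_cmult)
    have "\<nu> (\<lambda>z. 9 * ?h z) \<le> 9 * \<nu> ?h" by (rule sc[OF XX_supp[OF sh]]) simp
    moreover have "\<nu> ?h < e / 10" using n[OF sh] bh by simp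
    ultimately have h: "\<nu> (head m ?y) \<le> 9 * (e / 10)" by simp
    have tX: "tail m ?y \<in> XX" using XX_mul[OF y(1) adm_const[of 1]] by (simp add: tail_def)
    have "\<nu> (tail m ?y) \<le> B * e'" by (rule B(1)[OF tX m])
    also have "\<dots> \<le> (B + 1) * e'" using e' by (intro mult_right_mono) auto
    also have "\<dots> = e / 10"
    proof -
      have "u * (e / (10 * u)) = e / 10" if "u > 0" for u :: real using that by simp
      from this[of "B + 1"] show ?thesis unfolding e'_def using B(2) by simp
    qed
    finally have t: "\<nu> (tail m ?y) \<le> e / 10" .
    have hX: "head m ?y \<in> XX" by (rule XX_supp[of 0 m]) (auto simp: supp_def head_def)
    have "\<nu> ?y \<le> \<nu> (head m ?y) + \<nu> (tail m ?y)"
      using sub[OF hX tX] head_tail[of ?y m] by simp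
    then show ?thesis using h t by simp
  qed
  then show ?thesis by blast
qed

text \<open>In other words, the basis of unit vectors is shrinking. This is what forces functionals
  to be norm limits of combinations of the \<open>ev g\<close>.\<close>

lemma functional_null_tail:
  fixes f :: "(nat \<Rightarrow> real) \<Rightarrow> real"
  assumes lin: "\<And>x y a b. x \<in> XX \<Longrightarrow> y \<in> XX \<Longrightarrow> f (\<lambda>z. a * x z + b * y z) = a * f x + b * f y"
    and B: "\<And>x b. x \<in> XX \<Longrightarrow> bnd b x \<Longrightarrow> \<bar>f x\<bar> \<le> B * b" "B \<ge> 0"
    and e: "e > 0"
  shows "\<exists>n. \<forall>x\<in>XX. bnd 1 x \<longrightarrow> \<bar>f (tail n x)\<bar> \<le> e"
proof (rule null_tail[OF _ _ B _ e])
  have add: "f (\<lambda>z. x z + y z) = f x + f y" if "x \<in> XX" "y \<in> XX" for x y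
    using lin[OF that, of 1 1] by simp
  have sc: "f (\<lambda>z. a * x z) = a * f x" if "x \<in> XX" for x a
    using lin[OF that that, of a 0] by simp
  show "\<bar>f (\<lambda>z. x z + y z)\<bar> \<le> \<bar>f x\<bar> + \<bar>f y\<bar>" if "x \<in> XX" "y \<in> XX" for x y using add[OF that] by simp
  show "\<bar>f (\<lambda>z. a * x z)\<bar> \<le> a * \<bar>f x\<bar>" if "x \<in> XX" "a > 0" for x a
    using sc[OF that(1)] that by (simp add: abs_mult)
  show "(\<lambda>k. \<bar>f (x k)\<bar>) \<longlonglongrightarrow> 0" if r: "\<And>L. ris C L x p q j" for C x p q j
  proof -
    have "(\<lambda>k. f (x k)) \<longlonglongrightarrow> 0"
      by (rule functional_null_ris[OF _ _ _ B(2) r]) (use add sc B XX_supp in auto)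
    then show ?thesis by (rule tendsto_rabs_zero)
  qed
qed

text \<open>For continuous \<open>\<phi>\<close> the multiplier need not be \<open>\<phi> (lab z)\<close> itself: \<open>\<phi>\<close> is replaced at \<open>z\<close> by
  an approximation that is constant on the classes of a level depending on \<open>z\<close>.\<close>

lemma multiplier_exists:
  assumes \<phi>: "continuous_on K \<phi>" and M: "\<And>s. s \<in> K \<Longrightarrow> \<bar>\<phi> s\<bar> \<le> M" "M > 0"
  shows "\<exists>\<psi>. (\<forall>x b. bnd b x \<longrightarrow> bnd (12 * M * b) (\<lambda>z. \<psi> z * x z)) \<and>
    (\<forall>e>0. \<exists>N. \<forall>z\<ge>N. \<bar>\<psi> z - \<phi> (lab z)\<bar> \<le> e)"
proof -
  have "\<exists>p. \<forall>s\<in>K. \<forall>t\<in>K. sim p s t \<longrightarrow> \<bar>\<phi> s - \<phi> t\<bar> \<le> M / 2 ^ n" for n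
  proof -
    have "uniformly_continuous_on K \<phi>" using \<phi> compact_K by (rule compact_uniformly_continuous)
    moreover have "M / 2 ^ n > 0" using M by simp
    ultimately obtain d where d: "d > 0" "\<forall>s\<in>K. \<forall>t\<in>K. dist t s < d \<longrightarrow> dist (\<phi> t) (\<phi> s) < M / 2 ^ n"
      unfolding uniformly_continuous_on_def by metis
    obtain p where p: "\<forall>s\<in>K. \<forall>t\<in>K. sim p s t \<longrightarrow> dist s t < d" using sim_dist[OF d(1)] by blast
    have "\<bar>\<phi> s - \<phi> t\<bar> \<le> M / 2 ^ n" if "s \<in> K" "t \<in> K" "sim p s t" for s t
      using d(2) p that by (force simp: dist_real_def)
    then show ?thesis by blast
  qed
  then obtain p0 where p0: "\<And>n s t. s \<in> K \<Longrightarrow> t \<in> K \<Longrightarrow> sim (p0 n) s t \<Longrightarrow> \<bar>\<phi> s - \<phi> t\<bar> \<le> M / 2 ^ n" by metis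
  define p where "p n = (\<Sum>i\<le>n. Suc (p0 i))" for n
  have p_less: "p n < p (Suc n)" for n by (simp add: p_def)
  have p_mono: "p n \<le> p m" if "n \<le> m" for n m using that p_less lift_Suc_mono_le[of p] by (simp add: less_imp_le)
  have p_ge: "n \<le> p n" for n by (induction n) (auto intro: le_trans Suc_leI p_less le_less_trans[OF _ p_less])
  have p0p: "p0 n \<le> p n" for n unfolding p_def using member_le_sum[of n "{..n}" "\<lambda>i. Suc (p0 i)"] by simp
  have near: "\<bar>\<phi> s - \<phi> t\<bar> \<le> M / 2 ^ n" if "s \<in> K" "t \<in> K" "sim (p n) s t" for s t n
    using p0[OF that(1,2)] sim_mono[OF p0p that(3)] by blast
  \<comment> \<open>Classes are formed on the whole type. A class missing \<open>K\<close> gets the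
    value 0, since admissible functions must be bounded everywhere.\<close>
  define meets where "meets n s \<longleftrightarrow> (\<exists>t\<in>K. sim (p n) t s)" for n s
  define rep where "rep n s = (SOME t. t \<in> K \<and> sim (p n) t s)" for n s
  define f where "f n s = (if meets n s then \<phi> (rep n s) else 0)" for n s
  \<comment> \<open>Telescoping differences: \<open>g n\<close> is constant on the classes of level
    \<open>p n\<close> and at most \<open>2 * M / 2 ^ n\<close>, so multiplication by it from
    \<open>p n\<close> on has norm at most \<open>6 * M / 2 ^ n\<close>. Summing over
    \<open>n\<close> gives \<open>12 * M\<close>.\<close>
  define g where "g n s = (case n of 0 \<Rightarrow> f 0 s | Suc m \<Rightarrow> if meets n s then f n s - f m s else 0)" for n s
  have rep: "rep n s \<in> K \<and> sim (p n) (rep n s) s" if "meets n s" for n s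
    unfolding rep_def by (rule someI_ex[where P = "\<lambda>t. t \<in> K \<and> sim (p n) t s"]) (use that in \<open>auto simp: meets_def\<close>)
  have fconst: "meets n s = meets n s' \<and> f n s = f n s'" if "sim (p n) s s'" for n s s'
  proof -
    have "sim (p n) t s = sim (p n) t s'" for t using that sim_sym sim_trans by blast
    then show ?thesis by (simp add: meets_def f_def rep_def)
  qed
  have gconst: "g n s = g n s'" if "sim (p n) s s'" for n s s'
  proof (cases n)
    case (Suc m)
    then have "sim (p m) s s'" using sim_mono[OF less_imp_le[OF p_less]] that by simp
    then show ?thesis using fconst[OF that] fconst[of m s s'] Suc by (simp add: g_def)
  qed (use fconst[OF that] in \<open>simp add: g_def\<close>)
  have gb: "\<bar>g n s\<bar> \<le> 2 * M / 2 ^ n" for n s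
  proof (cases n)
    case 0
    show ?thesis
    proof (cases "meets 0 s")
      case True
      then have "\<bar>\<phi> (rep 0 s)\<bar> \<le> M" using M(1) rep by blast
      then show ?thesis using 0 True M(2) by (simp add: g_def f_def)
    next
      case False
      then show ?thesis using 0 M(2) by (simp add: g_def f_def)
    qed
  next
    case (Suc m)
    show ?thesis
    proof (cases "meets n s")
      case True
      have r: "rep n s \<in> K" "sim (p n) (rep n s) s" using rep[OF True] by auto
      then have "sim (p m) (rep n s) s" using sim_mono[OF less_imp_le[OF p_less]] Suc by blast
      then have mm: "meets m s" using r by (auto simp: meets_def)
      then have "sim (p m) (rep n s) (rep m s)"
        using rep[OF mm] \<open>sim (p m) (rep n s) s\<close> sim_sym sim_trans by blast
      then have "\<bar>f n s - f m s\<bar> \<le> M / 2 ^ m" using near r rep[OF mm] True mm by (simp add: f_def)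
      then show ?thesis using Suc True by (simp add: g_def)
    next
      case False
      then show ?thesis using Suc M by (simp add: g_def)
    qed
  qed
  \<comment> \<open>At \<open>z\<close> the sum telescopes to the approximation of the highest level
    \<open>p m\<close> not exceeding \<open>z\<close>.\<close>
  define \<psi> where "\<psi> z = (\<Sum>n\<in>{n. p n \<le> z}. g n (lab z))" for z
  have sub: "{n. p n \<le> z} \<subseteq> {..z}" for z using p_ge le_trans by blast
  have "bnd (12 * M * b) (\<lambda>z. \<psi> z * x z)" if b: "bnd b x" for x b
    unfolding bnd_def
  proof
    fix h
    have "ev h (\<lambda>z. \<psi> z * x z) = ev h (\<lambda>z. \<Sum>n\<le>h. mul (p n) (g n) x z)"
    proof (rule ev_cong)
      fix z assume z: "z \<le> h"
      have "(\<Sum>n\<le>h. mul (p n) (g n) x z) = (\<Sum>n\<in>{n. p n \<le> z}. g n (lab z) * x z)"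
        using sub[of z] z by (intro sum.mono_neutral_cong_right) (auto simp: mul_def)
      then show "\<psi> z * x z = (\<Sum>n\<le>h. mul (p n) (g n) x z)" by (simp add: \<psi>_def sum_distrib_right)
    qed
    also have "\<dots> = (\<Sum>n\<le>h. ev h (mul (p n) (g n) x))" by (simp add: ev_sum)
    finally have e: "ev h (\<lambda>z. \<psi> z * x z) = (\<Sum>n\<le>h. ev h (mul (p n) (g n) x))" .
    have t: "\<bar>ev h (mul (p n) (g n) x)\<bar> \<le> 6 * M * b * (1 / 2) ^ n" for n
    proof -
      let ?c = "2 * M / 2 ^ n"
      have c: "?c > 0" using M by simp
      have "\<bar>g n s / ?c\<bar> \<le> 1" for s
        using gb[of n s] c by (simp only: abs_divide[of _ ?c] abs_of_pos[OF c] divide_le_eq_1_pos)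
      then have a: "adm (p n) (\<lambda>s. g n s / ?c)" unfolding adm_def using gconst[of n] by auto
      have "mul (p n) (g n) x = (\<lambda>z. ?c * mul (p n) (\<lambda>s. g n s / ?c) x z)" using M by (auto simp: mul_def)
      then have "ev h (mul (p n) (g n) x) = ?c * ev h (mul (p n) (\<lambda>s. g n s / ?c) x)" by (simp only: ev_cmult)
      moreover have "\<bar>ev h (mul (p n) (\<lambda>s. g n s / ?c) x)\<bar> \<le> 3 * b" using bnd_mul[OF b a] by (simp add: bnd_def)
      moreover have "\<bar>d * v\<bar> \<le> d * w" if "d > 0" "\<bar>v\<bar> \<le> w" for d v w :: real
        using that by (simp add: abs_mult)
      ultimately have "\<bar>ev h (mul (p n) (g n) x)\<bar> \<le> ?c * (3 * b)" using c by presburger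
      moreover have "?c * (3 * b) = 6 * M * b * (1 / 2) ^ n" by (simp add: power_one_over)
      ultimately show ?thesis by simp
    qed
    have "\<bar>ev h (\<lambda>z. \<psi> z * x z)\<bar> \<le> (\<Sum>n\<le>h. 6 * M * b * (1 / 2) ^ n)"
      unfolding e using t by (intro order_trans[OF sum_abs] sum_mono) auto
    also have "\<dots> = 6 * M * b * (\<Sum>n\<le>h. (1 / 2) ^ n)" by (simp add: sum_distrib_left)
    also have "\<dots> \<le> 6 * M * b * 2"
    proof (intro mult_left_mono)
      have "(\<Sum>n\<le>h. (1 / 2 :: real) ^ n) \<le> (\<Sum>n. (1 / 2) ^ n)" by (intro sum_le_suminf summable_geometric) auto
      then show "(\<Sum>n\<le>h. (1 / 2 :: real) ^ n) \<le> 2" by (simp add: suminf_geometric)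
      show "0 \<le> 6 * M * b" using M bnd_nonneg[OF b] by simp
    qed
    finally show "\<bar>ev h (\<lambda>z. \<psi> z * x z)\<bar> \<le> 12 * M * b" by simp
  qed
  moreover have "\<exists>N. \<forall>z\<ge>N. \<bar>\<psi> z - \<phi> (lab z)\<bar> \<le> e" if "e > 0" for e
  proof -
    obtain N where N: "M / e < 2 ^ N" using real_arch_pow[of 2 "M / e"] by auto
    have "\<bar>\<psi> z - \<phi> (lab z)\<bar> \<le> e" if z: "z \<ge> p N" for z
    proof -
      define m where "m = Max {n. p n \<le> z}"
      have fin: "finite {n. p n \<le> z}" using sub finite_subset by blast
      have "p m \<le> z" using Max_in[OF fin] z unfolding m_def by blast
      moreover have "n \<le> m" if "p n \<le> z" for n using Max_ge[OF fin, of n] that by (simp add: m_def)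
      ultimately have s: "{n. p n \<le> z} = {..m}" using p_mono by (auto intro: le_trans)
      then have Nm: "N \<le> m" using z by auto
      have me: "meets n (lab z)" for n using lab_in sim_refl by (auto simp: meets_def)
      have "(\<Sum>n\<le>k. g n (lab z)) = f k (lab z)" for k
        by (induction k) (auto simp: g_def me)
      then have "\<psi> z = f m (lab z)" by (simp add: \<psi>_def s)
      then have "\<bar>\<psi> z - \<phi> (lab z)\<bar> \<le> M / 2 ^ m" using near rep[OF me] lab_in me by (simp add: f_def)
      also have "\<dots> \<le> M / 2 ^ N" using M Nm by (intro divide_left_mono power_increasing) auto
      also have "\<dots> \<le> e" using N \<open>e > 0\<close> by (simp add: field_simps)
      finally show ?thesis .
    qed
    then show ?thesis by blast
  qed
  ultimately show ?thesis by blast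
qed

lemma multiplier_XX:
  assumes \<psi>: "\<And>x b. bnd b x \<Longrightarrow> bnd (c * b) (\<lambda>z. \<psi> z * x z)" and c: "c > 0" and x: "x \<in> XX"
  shows "(\<lambda>z. \<psi> z * x z) \<in> XX"
  unfolding XX_def
proof (intro CollectI allI impI)
  fix e :: real assume "e > 0"
  then have "e / c > 0" using c by simp
  from XX_tail[OF x this] obtain N where "bnd (e / c) (tail N x)" by blast
  moreover have "tail N (\<lambda>z. \<psi> z * x z) = (\<lambda>z. \<psi> z * tail N x z)" by (auto simp: tail_def mul_def)
  ultimately show "\<exists>N. bnd e (tail N (\<lambda>z. \<psi> z * x z))" using \<psi>[of "e / c" "tail N x"] c
    by (intro exI[of _ N]) simp
qed

end

section \<open>Operators with vanishing scalar function\<close>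

context ah_operator
begin

text \<open>Pieces on different classes can be added only by the triangle inequality, and each
  passage to a tail costs a factor 3. With errors \<open>e / 12\<close> times powers of
  \<open>1 / 2\<close>, the pieces amount to at most \<open>3 * (e / 12) * 2 = e / 2\<close>, which
  leaves \<open>e / 2\<close> for the head.\<close>

lemma dfun_zero_ris:
  assumes z: "\<And>t. t \<in> K \<Longrightarrow> dfun T t = 0" and r: "\<And>L. ris C L x p q j" and e: "e > 0"
  shows "eventually (\<lambda>k. bnd e (T (x k))) sequentially"
proof -
  let ?e = "\<lambda>t. e / 12 * (1 / 2) ^ to_nat_on K t"
  have ep: "?e t > 0" for t using e by simp
  have "\<exists>P. eventually (\<lambda>k. bnd (?e t) (mul P (cls P t) (T (x k)))) sequentially" if "t \<in> K" for t
    using ris_diag[OF r that diag_at_dfun[OF that] ep[of t]] z[OF that] by simp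
  then obtain P where P: "\<And>t. t \<in> K \<Longrightarrow> eventually (\<lambda>k. bnd (?e t) (mul (P t) (cls (P t) t) (T (x k)))) sequentially"
    by metis
  obtain F where F: "finite F" "F \<subseteq> K" "\<And>s. s \<in> K \<Longrightarrow> \<exists>!\<tau>. \<tau> \<in> F \<and> sim (P \<tau>) s \<tau>" using sim_cover by metis
  define N where "N = (\<Sum>t\<in>F. P t)"
  have PN: "P t \<le> N" if "t \<in> F" for t unfolding N_def using F(1) that by (intro member_le_sum) auto
  \<comment> \<open>From \<open>N\<close> on all chosen cuts are passed, and each label lies in
    exactly one of the chosen classes; without uniqueness coordinates would be counted
    repeatedly.\<close>
  have dec: "y = (\<lambda>z. head N y z + (\<Sum>t\<in>F. tail N (mul (P t) (cls (P t) t) y) z))" for y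
  proof
    fix z
    show "y z = head N y z + (\<Sum>t\<in>F. tail N (mul (P t) (cls (P t) t) y) z)"
    proof (cases "z < N")
      case True
      then show ?thesis by (simp add: head_def tail_def mul_def)
    next
      case False
      obtain \<tau> where \<tau>: "\<tau> \<in> F" "sim (P \<tau>) (lab z) \<tau>" "\<And>t. t \<in> F \<Longrightarrow> sim (P t) (lab z) t \<Longrightarrow> t = \<tau>"
        using F(3)[OF lab_in] by blast
      have "(\<Sum>t\<in>F. tail N (mul (P t) (cls (P t) t) y) z) = (\<Sum>t\<in>F. if t = \<tau> then y z else 0)"
      proof (intro sum.cong refl)
        fix t assume t: "t \<in> F"
        have "tail N (mul (P t) (cls (P t) t) y) z = (if sim (P t) (lab z) t then y z else 0)"
          using False PN[OF t] by (simp add: tail_def mul_def cls_def)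
        moreover have "sim (P t) (lab z) t \<longleftrightarrow> t = \<tau>" using \<tau>(2) \<tau>(3)[OF t] by blast
        ultimately show "tail N (mul (P t) (cls (P t) t) y) z = (if t = \<tau> then y z else 0)" by simp
      qed
      also have "\<dots> = y z" using F(1) \<tau>(1) by simp
      finally show ?thesis using False by (simp add: head_def)
    qed
  qed
  have "(\<Sum>t\<in>F. (1 / 2 :: real) ^ to_nat_on K t) = (\<Sum>n\<in>to_nat_on K ` F. (1 / 2) ^ n)"
    using F(2) inj_on_to_nat_on[OF countable_K] by (subst sum.reindex) (auto intro: inj_on_subset)
  also have "\<dots> \<le> (\<Sum>n. (1 / 2) ^ n)" using F(1) by (intro sum_le_suminf summable_geometric) auto
  finally have s2: "(\<Sum>t\<in>F. (1 / 2 :: real) ^ to_nat_on K t) \<le> 2" by (simp add: suminf_geometric)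
  have "eventually (\<lambda>k. \<forall>t\<in>F. bnd (?e t) (mul (P t) (cls (P t) t) (T (x k)))) sequentially"
    using F P by (intro eventually_ball_finite) auto
  moreover have "eventually (\<lambda>k. bnd (e / 2) (head N (T (x k)))) sequentially"
    by (rule T_head_null[OF r]) (use e in simp)
  ultimately show ?thesis
  proof eventually_elim
    case (elim k)
    have "bnd (e / 2 + (\<Sum>t\<in>F. 3 * ?e t)) (T (x k))"
      by (subst dec) (use elim in \<open>intro bnd_add bnd_sum bnd_tail, auto\<close>)
    moreover have "(\<Sum>t\<in>F. 3 * ?e t) = e / 4 * (\<Sum>t\<in>F. (1 / 2) ^ to_nat_on K t)"
      by (simp add: sum_distrib_left)
    then have "(\<Sum>t\<in>F. 3 * ?e t) \<le> e / 4 * 2" using s2 e by (simp only:) (intro mult_left_mono, auto)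
    ultimately show ?case by (elim bnd_mono) simp
  qed
qed

theorem dfun_zero_tail:
  assumes z: "\<And>t. t \<in> K \<Longrightarrow> dfun T t = 0" and e: "e > 0"
  shows "\<exists>n. \<forall>x\<in>XX. bnd 1 x \<longrightarrow> bnd e (T (tail n x))"
proof -
  have Tb: "\<exists>b. bnd b (T x)" if "x \<in> XX" for x using XX_bnd T_in that by blast
  have "\<exists>n. \<forall>x\<in>XX. bnd 1 x \<longrightarrow> ev_norm (T (tail n x)) \<le> e"
  proof (rule null_tail[OF _ _ _ B_nonneg _ e])
    show "ev_norm (T (\<lambda>z. x z + y z)) \<le> ev_norm (T x) + ev_norm (T y)" if "x \<in> XX" "y \<in> XX" for x y
      unfolding T_add[OF that] using Tb that by (intro ev_norm_le bnd_add) (blast intro: bnd_ev_norm)+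
    show "ev_norm (T (\<lambda>z. a * x z)) \<le> a * ev_norm (T x)" if "x \<in> XX" "a > 0" for x a
    proof -
      have "bnd (\<bar>a\<bar> * ev_norm (T x)) (\<lambda>z. a * T x z)" using Tb[OF that(1)] bnd_ev_norm bnd_cmult by blast
      then show ?thesis unfolding T_cmult[OF that(1)] using that(2) ev_norm_le by fastforce
    qed
    show "ev_norm (T x) \<le> B * b" if "x \<in> XX" "bnd b x" for x b using T_bnd that ev_norm_le by blast
    show "(\<lambda>k. ev_norm (T (x k))) \<longlonglongrightarrow> 0" if r: "\<And>L. ris C L x p q j" for C x p q j
    proof (rule tendstoI)
      fix e :: real assume e: "e > 0"
      have xX: "x k \<in> XX" for k using r[of "Suc k"] XX_supp by (auto simp: ris_def)
      have "eventually (\<lambda>k. bnd (e / 2) (T (x k))) sequentially" by (rule dfun_zero_ris[OF z r]) (use e in auto)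
      then show "eventually (\<lambda>k. dist (ev_norm (T (x k))) 0 < e) sequentially"
      proof eventually_elim
        case (elim k)
        then have "ev_norm (T (x k)) \<le> e / 2" "ev_norm (T (x k)) \<ge> 0" using ev_norm_le ev_norm_nonneg by blast+
        then show ?case using e by simp
      qed
    qed
  qed
  then obtain n where n: "\<And>x. x \<in> XX \<Longrightarrow> bnd 1 x \<Longrightarrow> ev_norm (T (tail n x)) \<le> e" by blast
  have "bnd e (T (tail n x))" if "x \<in> XX" "bnd 1 x" for x
  proof -
    have "tail n x \<in> XX" using XX_mul[OF that(1) adm_const[of 1]] by (simp add: tail_def)
    then show ?thesis using Tb bnd_ev_norm n[OF that] bnd_mono by blast
  qed
  then show ?thesis by blast
qed

text \<open>Subtracting the multiplier of \<open>dfun T\<close> leaves an operator with vanishing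
  scalar function, which is small on far tails and so on far unit vectors. Unlike
  \<open>ris_diag\<close> this holds in the full norm and not only on a class, as multiplicativity
  of the scalar function requires.\<close>

lemma eigen_unit:
  assumes e: "e > 0"
  shows "\<exists>P. \<forall>g\<ge>P. junk_element g \<longrightarrow> bnd e (\<lambda>z. T (unit g) z - dfun T (lab g) * unit g z)"
proof -
  define M where "M = 3 * (B * 144) + 1"
  have M: "M > 0" "\<And>s. s \<in> K \<Longrightarrow> \<bar>dfun T s\<bar> \<le> M"
    using B_nonneg by (auto simp: M_def dest: dfun_bound)
  obtain \<psi> where \<psi>: "\<And>x b. bnd b x \<Longrightarrow> bnd (12 * M * b) (\<lambda>z. \<psi> z * x z)"
    "\<And>e. e > 0 \<Longrightarrow> \<exists>N. \<forall>z\<ge>N. \<bar>\<psi> z - dfun T (lab z)\<bar> \<le> e"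
    using multiplier_exists[OF dfun_continuous M(2,1)] by blast
  let ?T = "\<lambda>x z. T x z - \<psi> z * x z"
  have pX: "(\<lambda>z. \<psi> z * x z) \<in> XX" if x: "x \<in> XX" for x
    using multiplier_XX[OF \<psi>(1) _ x] M by simp
  interpret T0: ah_operator K sim lab wt age cut e1 e2 prd c1 c2 ?T "B + 12 * M"
  proof
    show "?T x \<in> XX" if "x \<in> XX" for x using T_in[OF that] pX[OF that] by (rule XX_diff)
    show "?T (\<lambda>z. a * x z + b * y z) = (\<lambda>z. a * ?T x z + b * ?T y z)" if "x \<in> XX" "y \<in> XX" for x y a b
      unfolding T_linear[OF that] by (auto simp: algebra_simps)
    show "bnd ((B + 12 * M) * b) (?T x)" if "x \<in> XX" "bnd b x" for x b
      using bnd_diff[OF T_bnd[OF that] \<psi>(1)[OF that(2)]] by (simp add: algebra_simps)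
  qed (use B_nonneg M in auto)
  have z: "dfun ?T t = 0" if t: "t \<in> K" for t
  proof (rule T0.dfun_eqI[OF t])
    fix e :: real assume e: "e > 0"
    obtain P where P: "\<forall>g\<ge>P. junk_element g \<longrightarrow> sim P (lab g) t \<longrightarrow> \<bar>diag_coeff T g - dfun T t\<bar> \<le> e / 2"
      using dfun_limit[OF t, of "e / 2"] e by auto
    obtain N where N: "\<forall>z\<ge>N. \<bar>\<psi> z - dfun T (lab z)\<bar> \<le> e / 2" using \<psi>(2)[of "e / 2"] e by auto
    have "\<bar>diag_coeff ?T g - 0\<bar> \<le> e" if "g \<ge> max P N" "junk_element g" "lab g = t" for g
    proof -
      have "\<bar>diag_coeff T g - dfun T t\<bar> \<le> e / 2" using P that sim_refl by auto
      moreover have "\<bar>\<psi> g - dfun T t\<bar> \<le> e / 2" using N that by auto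
      moreover have "diag_coeff ?T g = diag_coeff T g - \<psi> g" by (simp add: diag_coeff_def unit_def)
      ultimately show ?thesis by linarith
    qed
    then show "\<exists>P. \<forall>g\<ge>P. junk_element g \<longrightarrow> lab g = t \<longrightarrow> \<bar>diag_coeff ?T g - 0\<bar> \<le> e" by blast
  qed
  have "e / 288 > 0" using e by simp
  from T0.dfun_zero_tail[OF z this] obtain n where
    n: "\<And>x. x \<in> XX \<Longrightarrow> bnd 1 x \<Longrightarrow> bnd (e / 288) (?T (tail n x))" by blast
  obtain N where N: "\<forall>z\<ge>N. \<bar>\<psi> z - dfun T (lab z)\<bar> \<le> e / 288" using \<psi>(2)[OF \<open>e / 288 > 0\<close>] by blast
  have "bnd e (\<lambda>z. T (unit g) z - dfun T (lab g) * unit g z)" if g: "g \<ge> max n N" "junk_element g" for g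
  proof -
    let ?u = "\<lambda>z. (1 / 144) * unit g z"
    have u: "bnd 144 (unit g)" using good_bnd[OF good_unit[OF g(2)]] .
    have uX: "?u \<in> XX" by (rule XX_cmult[OF unit_XX])
    have "bnd (\<bar>1 / 144\<bar> * 144) ?u" by (rule bnd_cmult[OF u])
    then have "bnd (e / 288) (?T (tail n ?u))" using n[OF uX] by simp
    moreover have "tail n ?u = ?u" using g(1) by (auto simp: tail_def mul_def unit_def)
    ultimately have "bnd (\<bar>144\<bar> * (e / 288)) (\<lambda>z. 144 * ?T ?u z)" by (simp only:) (rule bnd_cmult)
    moreover have "(\<lambda>z. 144 * ?T ?u z) = ?T (unit g)"
      using T_cmult[OF unit_XX, of "1 / 144"] by (auto simp: algebra_simps)
    ultimately have 1: "bnd (e / 2) (?T (unit g))" by simp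
    have "bnd (\<bar>\<psi> g - dfun T (lab g)\<bar> * 144) (\<lambda>z. (\<psi> g - dfun T (lab g)) * unit g z)" by (rule bnd_cmult[OF u])
    moreover have "\<bar>\<psi> g - dfun T (lab g)\<bar> * 144 \<le> e / 288 * 144" using N g by (intro mult_right_mono) auto
    ultimately have 2: "bnd (e / 2) (\<lambda>z. (\<psi> g - dfun T (lab g)) * unit g z)" by (elim bnd_mono) simp
    have "(\<lambda>z. T (unit g) z - dfun T (lab g) * unit g z) = (\<lambda>z. ?T (unit g) z + (\<psi> g - dfun T (lab g)) * unit g z)"
      by (auto simp: unit_def)
    then show ?thesis using bnd_add[OF 1 2] by simp
  qed
  then show ?thesis by blast
qed

end

section \<open>Existence of the system\<close>

text \<open>Classes of different levels are nested or disjoint. In a cover of least cardinality no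
  class is contained in another, so the classes are disjoint.\<close>

lemma partition_of_cover:
  fixes sim :: "nat \<Rightarrow> 'k \<Rightarrow> 'k \<Rightarrow> bool"
  assumes sym: "\<And>p s t. sim p s t \<Longrightarrow> sim p t s"
    and trans: "\<And>p s t u. sim p s t \<Longrightarrow> sim p t u \<Longrightarrow> sim p s u"
    and mono: "\<And>p q s t. p \<le> q \<Longrightarrow> sim q s t \<Longrightarrow> sim p s t"
    and F0: "finite F0" "F0 \<subseteq> K" "\<forall>s\<in>K. \<exists>\<tau>\<in>F0. sim (P \<tau>) s \<tau>"
  shows "\<exists>F. finite F \<and> F \<subseteq> K \<and> (\<forall>s\<in>K. \<exists>!\<tau>. \<tau> \<in> F \<and> sim (P \<tau>) s \<tau>)"
proof -
  define Q where "Q F \<longleftrightarrow> finite F \<and> F \<subseteq> K \<and> (\<forall>s\<in>K. \<exists>\<tau>\<in>F. sim (P \<tau>) s \<tau>)" for F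
  have "Q F0" using F0 by (simp add: Q_def)
  then obtain F where F: "Q F" "\<And>G. Q G \<Longrightarrow> card F \<le> card G"
    using ex_has_least_nat[of Q F0 card] by blast
  have "\<tau> = \<tau>'" if a: "s \<in> K" "\<tau> \<in> F" "\<tau>' \<in> F" "sim (P \<tau>) s \<tau>" "sim (P \<tau>') s \<tau>'" "P \<tau> \<le> P \<tau>'" for s \<tau> \<tau>'
  proof (rule ccontr)
    assume ne: "\<tau> \<noteq> \<tau>'"
    have "sim (P \<tau>) \<tau>' \<tau>" using mono[OF a(6) a(5)] a(4) sym trans by blast
    then have "sim (P \<tau>) u \<tau>" if "sim (P \<tau>') u \<tau>'" for u using mono[OF a(6) that] trans by blast
    then have "Q (F - {\<tau>'})" using F(1) ne a(2) unfolding Q_def by fastforce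
    moreover have "card (F - {\<tau>'}) < card F" using F(1) a(3) unfolding Q_def by (intro psubset_card_mono) auto
    ultimately show False using F(2) by fastforce
  qed
  then have "\<tau> = \<tau>'" if "s \<in> K" "\<tau> \<in> F" "\<tau>' \<in> F" "sim (P \<tau>) s \<tau>" "sim (P \<tau>') s \<tau>'" for s \<tau> \<tau>'
    using that by (metis nat_le_linear)
  then show ?thesis using F(1) unfolding Q_def by (intro exI[of _ F]) blast
qed

definition clopen_partitions :: "'k::metric_space set \<Rightarrow> (nat \<Rightarrow> 'k \<Rightarrow> 'k \<Rightarrow> bool) \<Rightarrow> bool" where
  "clopen_partitions K sim \<longleftrightarrow> (\<forall>p s. sim p s s) \<and> (\<forall>p s t. sim p s t \<longrightarrow> sim p t s) \<and>
    (\<forall>p s t u. sim p s t \<longrightarrow> sim p t u \<longrightarrow> sim p s u) \<and> (\<forall>p q s t. p \<le> q \<longrightarrow> sim q s t \<longrightarrow> sim p s t) \<and>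
    (\<forall>P. \<exists>F. finite F \<and> F \<subseteq> K \<and> (\<forall>s\<in>K. \<exists>!\<tau>. \<tau> \<in> F \<and> sim (P \<tau>) s \<tau>)) \<and>
    (\<forall>p. \<forall>\<tau>\<in>K. eventually (\<lambda>s. sim p s \<tau>) (at \<tau> within K)) \<and>
    (\<forall>e>0. \<exists>p. \<forall>s\<in>K. \<forall>t\<in>K. sim p s t \<longrightarrow> dist s t < e)"

text \<open>Radii avoiding the countably many distances in \<open>K\<close> make all balls around
  points of \<open>K\<close> clopen in \<open>K\<close>. Points are equivalent at level
  \<open>p\<close> if they lie in the same balls among those with the first \<open>p\<close>
  radii.\<close>

lemma clopen_partitions_exist:
  fixes K :: "'k::metric_space set"
  assumes "compact K" "countable K"
  shows "\<exists>sim. clopen_partitions K sim"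
proof -
  let ?D = "(\<lambda>(u, s). dist u s) ` (K \<times> K)"
  have cD: "countable ?D" using assms(2) by simp
  have "\<exists>r. r \<in> {0<..<1 / (real q + 1)} - ?D" for q
  proof -
    have "uncountable ({0<..<1 / (real q + 1)} - ?D)"
      using cD by (intro uncountable_minus_countable) (simp_all add: uncountable_open_interval)
    then show ?thesis by (metis countable_empty ex_in_conv)
  qed
  then obtain \<rho> where \<rho>: "\<And>q. 0 < \<rho> q" "\<And>q. \<rho> q < 1 / (real q + 1)" "\<And>q u s. u \<in> K \<Longrightarrow> s \<in> K \<Longrightarrow> dist u s \<noteq> \<rho> q"
    by (auto simp: image_iff) (metis)
  define sim where "sim p s t \<longleftrightarrow> (\<forall>q<p. \<forall>u\<in>K. dist u s < \<rho> q \<longleftrightarrow> dist u t < \<rho> q)" for p and s t :: 'k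
  \<comment> \<open>All centres have to be treated at once: by compactness, the distance of
    \<open>dist u \<tau>\<close> from the radius has a positive minimum over
    \<open>u\<close>.\<close>
  have gap: "\<exists>e>0. \<forall>s. dist s \<tau> < e \<longrightarrow> (\<forall>u\<in>K. dist u s < \<rho> q \<longleftrightarrow> dist u \<tau> < \<rho> q)" if t: "\<tau> \<in> K" for \<tau> q
  proof -
    have "continuous_on K (\<lambda>u. \<bar>dist u \<tau> - \<rho> q\<bar>)" by (intro continuous_intros)
    then obtain u0 where u0: "u0 \<in> K" "\<And>u. u \<in> K \<Longrightarrow> \<bar>dist u0 \<tau> - \<rho> q\<bar> \<le> \<bar>dist u \<tau> - \<rho> q\<bar>"
      using continuous_attains_inf[OF assms(1)] t by blast
    show ?thesis
    proof (intro exI[of _ "\<bar>dist u0 \<tau> - \<rho> q\<bar>"] conjI allI impI ballI)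
      show "\<bar>dist u0 \<tau> - \<rho> q\<bar> > 0" using \<rho>(3)[OF u0(1) t] by simp
      fix s u assume a: "dist s \<tau> < \<bar>dist u0 \<tau> - \<rho> q\<bar>" "u \<in> K"
      then have "dist s \<tau> < \<bar>dist u \<tau> - \<rho> q\<bar>" using u0(2)[of u] by linarith
      moreover have "dist u s \<le> dist u \<tau> + dist s \<tau>" "dist u \<tau> \<le> dist u s + dist s \<tau>"
        by (metis dist_triangle dist_commute)+
      ultimately show "dist u s < \<rho> q \<longleftrightarrow> dist u \<tau> < \<rho> q" by linarith
    qed
  qed
  have nb: "\<exists>e>0. \<forall>s. dist s \<tau> < e \<longrightarrow> sim p s \<tau>" if t: "\<tau> \<in> K" for \<tau> p
  proof (induction p)
    case 0 then show ?case by (intro exI[of _ 1]) (simp add: sim_def)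
  next
    case (Suc p)
    then obtain e where e: "e > 0" "\<And>s. dist s \<tau> < e \<Longrightarrow> sim p s \<tau>" by blast
    obtain e' where e': "e' > 0" "\<And>s. dist s \<tau> < e' \<Longrightarrow> (\<forall>u\<in>K. dist u s < \<rho> p \<longleftrightarrow> dist u \<tau> < \<rho> p)"
      using gap[OF t] by blast
    have "sim (Suc p) s \<tau>" if "dist s \<tau> < min e e'" for s
    proof -
      have "sim p s \<tau>" using e(2) that by simp
      moreover have "\<forall>u\<in>K. dist u s < \<rho> p \<longleftrightarrow> dist u \<tau> < \<rho> p" using that by (intro e'(2)) simp
      ultimately show ?thesis unfolding sim_def less_Suc_eq by blast
    qed
    then show ?case using e(1) e'(1) by (intro exI[of _ "min e e'"]) auto
  qed
  have sym: "sim p s t \<Longrightarrow> sim p t s" for p s t by (auto simp: sim_def)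
  have trans: "sim p s t \<Longrightarrow> sim p t u \<Longrightarrow> sim p s u" for p s t u by (auto simp: sim_def)
  have mono: "p \<le> q \<Longrightarrow> sim q s t \<Longrightarrow> sim p s t" for p q s t by (auto simp: sim_def)
  have cover: "\<exists>F. finite F \<and> F \<subseteq> K \<and> (\<forall>s\<in>K. \<exists>!\<tau>. \<tau> \<in> F \<and> sim (P \<tau>) s \<tau>)" for P
  proof -
    obtain e where e: "\<And>\<tau>. \<tau> \<in> K \<Longrightarrow> e \<tau> > 0 \<and> (\<forall>s. dist s \<tau> < e \<tau> \<longrightarrow> sim (P \<tau>) s \<tau>)"
    proof -
      have "\<forall>\<tau>\<in>K. \<exists>e>0. \<forall>s. dist s \<tau> < e \<longrightarrow> sim (P \<tau>) s \<tau>" using nb by blast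
      from bchoice[OF this] show ?thesis using that by blast
    qed
    have "K \<subseteq> (\<Union>\<tau>\<in>K. ball \<tau> (e \<tau>))" using e by fastforce
    then obtain F0 where F0: "F0 \<subseteq> K" "finite F0" "K \<subseteq> (\<Union>\<tau>\<in>F0. ball \<tau> (e \<tau>))"
      using compactE_image[OF assms(1), of K "\<lambda>\<tau>. ball \<tau> (e \<tau>)"] by (auto intro: open_ball)
    have "\<forall>s\<in>K. \<exists>\<tau>\<in>F0. sim (P \<tau>) s \<tau>"
    proof
      fix s assume "s \<in> K"
      then obtain \<tau> where "\<tau> \<in> F0" "dist s \<tau> < e \<tau>" using F0(3) by (auto simp: dist_commute)
      then show "\<exists>\<tau>\<in>F0. sim (P \<tau>) s \<tau>" using e F0(1) by blast
    qed
    then show ?thesis using partition_of_cover[of sim F0 K P] sym trans mono F0 by blast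
  qed
  have nhds: "eventually (\<lambda>s. sim p s \<tau>) (at \<tau> within K)" if "\<tau> \<in> K" for p \<tau>
    using nb[OF that, of p] by (auto simp: eventually_at)
  have small: "\<exists>p. \<forall>s\<in>K. \<forall>t\<in>K. sim p s t \<longrightarrow> dist s t < e" if e: "e > 0" for e
  proof -
    obtain n where n: "1 / (real n + 1) < e" using e reals_Archimedean by (metis add.commute inverse_eq_divide of_nat_Suc)
    have "dist s t < e" if "s \<in> K" "sim (Suc n) s t" for s t
    proof -
      have "dist s s < \<rho> n \<longleftrightarrow> dist s t < \<rho> n" using that unfolding sim_def by blast
      then have "dist s t < \<rho> n" using \<rho>(1) by simp
      then show ?thesis using \<rho>(2)[of n] n by linarith
    qed
    then show ?thesis by blast
  qed
  show ?thesis
    unfolding clopen_partitions_def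
  proof (intro exI[of _ sim] conjI allI impI ballI)
    show "sim p s s" for p s by (simp add: sim_def)
    show "\<exists>F. finite F \<and> F \<subseteq> K \<and> (\<forall>s\<in>K. \<exists>!\<tau>. \<tau> \<in> F \<and> sim (P \<tau>) s \<tau>)" for P by (rule cover)
    show "eventually (\<lambda>s. sim p s \<tau>) (at \<tau> within K)" if "\<tau> \<in> K" for p \<tau> by (rule nhds[OF that])
    show "\<exists>p. \<forall>s\<in>K. \<forall>t\<in>K. sim p s t \<longrightarrow> dist s t < e" if "0 < e" for e by (rule small[OF that])
    show "sim p t s" if "sim p s t" for p s t by (rule sym[OF that])
    show "sim p s u" if "sim p s t" "sim p t u" for p s t u by (rule trans[OF that])
    show "sim p s t" if "p \<le> q" "sim q s t" for p q s t by (rule mono[OF that])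
  qed
qed

section \<open>Coding the elements by natural numbers\<close>

datatype code = Code (rj: nat) (ra: nat) (rp: "nat option") (rc: nat) (rb1: nat) (rb2: nat)
  (ra1: rat) (ra2: rat) (rl: nat)

instance code :: countable by countable_datatype

definition code_of :: "nat \<Rightarrow> code" where "code_of g = from_nat (snd (prod_decode g))"

lemma code_of_exists: "\<exists>g\<ge>M. code_of g = c"
proof -
  let ?g = "prod_encode (M, to_nat c)"
  have "M \<le> ?g" by (rule le_prod_encode_1)
  moreover have "code_of ?g = c" by (simp add: code_of_def)
  ultimately show ?thesis by blast
qed

text \<open>Every natural number is decoded, and every code occurs infinitely often. A number whose code
  is not valid is a junk element, with weight index \<open>0\<close> and \<open>e\<^sub>g\<^sup>* = d\<^sub>g\<^sup>*\<close>.\<close>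

inductive valid :: "(nat \<Rightarrow> 'k) \<Rightarrow> nat \<Rightarrow> bool" for lb where
  "rj (code_of g) \<noteq> 0 \<Longrightarrow> rj (code_of g) \<le> g \<Longrightarrow> rc (code_of g) \<le> g \<Longrightarrow> rb1 (code_of g) < g \<Longrightarrow> rb2 (code_of g) < g \<Longrightarrow>
   \<bar>ra1 (code_of g)\<bar> + \<bar>ra2 (code_of g)\<bar> \<le> 1 \<Longrightarrow>
   rp (code_of g) = None \<and> ra (code_of g) = 1 \<or>
   (\<exists>h. rp (code_of g) = Some h \<and> h < rc (code_of g) \<and> valid lb h \<and> rj (code_of h) = rj (code_of g) \<and>
      ra (code_of g) = Suc (ra (code_of h)) \<and> ra (code_of g) \<le> nn (rj (code_of g)) \<and> lb h = lb g) \<Longrightarrow>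
   odd (rj (code_of g)) \<longrightarrow> ra1 (code_of g) = 1 \<and> ra2 (code_of g) = 0 \<and> valid lb (rb1 (code_of g)) \<and>
     (rp (code_of g) = None \<and> (\<exists>i. rj (code_of (rb1 (code_of g))) = 4 * i + 2 \<and>
        (real (nn (rj (code_of g))))\<^sup>2 \<le> mw (rj (code_of (rb1 (code_of g))))) \<or>
      (\<exists>h. rp (code_of g) = Some h \<and> rj (code_of (rb1 (code_of g))) = 4 * h + 4)) \<Longrightarrow>
   valid lb g"

theorem ah_system_exists:
  fixes K :: "'k::metric_space set"
  assumes "compact K" "countable K" "K \<noteq> {}"
  shows "\<exists>sim lab wt age cut e1 e2 prd c1 c2. ah_system K sim lab wt age cut e1 e2 prd c1 c2"
proof -
  obtain sim where sim: "clopen_partitions K sim" using clopen_partitions_exist[OF assms(1,2)] by blast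
  note sim = sim[unfolded clopen_partitions_def]
  define lb where "lb g = from_nat_into K (rl (code_of g))" for g
  let ?v = "valid lb"
  define wt where "wt g = (if ?v g then rj (code_of g) else 0)" for g
  define age where "age g = (if ?v g then ra (code_of g) else 1)" for g
  define cut where "cut g = (if ?v g then rc (code_of g) else 0)" for g
  define e1 where "e1 g = rb1 (code_of g)" for g
  define e2 where "e2 g = rb2 (code_of g)" for g
  define prd where "prd g = (if ?v g then rp (code_of g) else None)" for g
  define c1 where "c1 g = (if ?v g then real_of_rat (ra1 (code_of g)) else 0)" for g
  define c2 where "c2 g = (if ?v g then real_of_rat (ra2 (code_of g)) else 0)" for g
  note defs = wt_def age_def cut_def e1_def e2_def prd_def c1_def c2_def
  have v: "rj (code_of g) \<noteq> 0 \<and> rj (code_of g) \<le> g \<and> rc (code_of g) \<le> g \<and> rb1 (code_of g) < g \<and> rb2 (code_of g) < g \<and>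
    \<bar>ra1 (code_of g)\<bar> + \<bar>ra2 (code_of g)\<bar> \<le> 1" if "?v g" for g using that by (cases rule: valid.cases) auto
  have vp: "rp (code_of g) = None \<and> ra (code_of g) = 1 \<or>
   (\<exists>h. rp (code_of g) = Some h \<and> h < rc (code_of g) \<and> ?v h \<and> rj (code_of h) = rj (code_of g) \<and>
      ra (code_of g) = Suc (ra (code_of h)) \<and> ra (code_of g) \<le> nn (rj (code_of g)) \<and> lb h = lb g)" if "?v g" for g
    using that by (cases rule: valid.cases) blast
  have vo: "ra1 (code_of g) = 1 \<and> ra2 (code_of g) = 0 \<and> ?v (rb1 (code_of g)) \<and>
     (rp (code_of g) = None \<and> (\<exists>i. rj (code_of (rb1 (code_of g))) = 4 * i + 2 \<and>
        (real (nn (rj (code_of g))))\<^sup>2 \<le> mw (rj (code_of (rb1 (code_of g))))) \<or>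
      (\<exists>h. rp (code_of g) = Some h \<and> rj (code_of (rb1 (code_of g))) = 4 * h + 4))" if "?v g" "odd (rj (code_of g))" for g
    using that by (cases rule: valid.cases) blast
  have lbK: "\<exists>l. from_nat_into K l = t" if "t \<in> K" for t
    using that assms(2) by (intro exI[of _ "to_nat_on K t"]) simp
  \<comment> \<open>Both parities in one statement. The element is taken beyond all the data, so the
    order conditions of \<open>valid\<close> hold, and its label enters through the enumeration of
    \<open>K\<close>.\<close>
  have rich: "\<exists>g\<ge>M. wt g = j \<and> lb g = t \<and> prd g = po \<and> cut g = p \<and> e1 g = b1 \<and> e2 g = b2 \<and>
      c1 g = real_of_rat a1 \<and> c2 g = real_of_rat a2"
    if t: "t \<in> K" and j: "j \<noteq> 0" and a: "\<bar>a1\<bar> + \<bar>a2\<bar> \<le> 1"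
      and po: "case po of None \<Rightarrow> True | Some h \<Rightarrow> h < p \<and> lb h = t \<and> wt h = j \<and> age h < nn j"
      and od: "odd j \<Longrightarrow> a1 = 1 \<and> a2 = 0 \<and> (case po of None \<Rightarrow> \<exists>i. wt b1 = 4 * i + 2 \<and> (real (nn j))\<^sup>2 \<le> mw (wt b1)
         | Some h \<Rightarrow> wt b1 = 4 * h + 4)" for M j t po p b1 b2 a1 a2
  proof -
    obtain l where l: "from_nat_into K l = t" using lbK[OF t] by blast
    define ag where "ag = (case po of None \<Rightarrow> 1 | Some h \<Rightarrow> Suc (ra (code_of h)))"
    obtain g where g: "g \<ge> M + j + p + b1 + b2 + 1" "code_of g = Code j ag po p b1 b2 a1 a2 l" using code_of_exists by blast
    have lg: "lb g = t" using g l by (simp add: lb_def)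
    \<comment> \<open>A nonzero weight index certifies validity, since invalid codes receive the
      index 0.\<close>
    have vh: "?v h \<and> rj (code_of h) = j \<and> age h = ra (code_of h)" if "wt h = j" for h
      using that j by (auto simp: wt_def age_def split: if_splits)
    have P: "rp (code_of g) = None \<and> ra (code_of g) = 1 \<or>
     (\<exists>h. rp (code_of g) = Some h \<and> h < rc (code_of g) \<and> ?v h \<and> rj (code_of h) = rj (code_of g) \<and>
      ra (code_of g) = Suc (ra (code_of h)) \<and> ra (code_of g) \<le> nn (rj (code_of g)) \<and> lb h = lb g)"
    proof (cases po)
      case None then show ?thesis using g by (simp add: ag_def)
    next
      case (Some h)
      then have h: "h < p" "lb h = t" "wt h = j" "age h < nn j" using po by auto
      then show ?thesis using vh[OF h(3)] Some g lg by (simp add: ag_def)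
    qed
    have O: "odd (rj (code_of g)) \<longrightarrow> ra1 (code_of g) = 1 \<and> ra2 (code_of g) = 0 \<and> ?v (rb1 (code_of g)) \<and>
     (rp (code_of g) = None \<and> (\<exists>i. rj (code_of (rb1 (code_of g))) = 4 * i + 2 \<and>
        (real (nn (rj (code_of g))))\<^sup>2 \<le> mw (rj (code_of (rb1 (code_of g))))) \<or>
      (\<exists>h. rp (code_of g) = Some h \<and> rj (code_of (rb1 (code_of g))) = 4 * h + 4))"
    proof
      assume "odd (rj (code_of g))"
      then have o: "odd j" using g by simp
      have vb: "?v b1 \<and> rj (code_of b1) = wt b1" if "wt b1 \<noteq> 0" using that by (auto simp: wt_def split: if_splits)
      show "ra1 (code_of g) = 1 \<and> ra2 (code_of g) = 0 \<and> ?v (rb1 (code_of g)) \<and>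
       (rp (code_of g) = None \<and> (\<exists>i. rj (code_of (rb1 (code_of g))) = 4 * i + 2 \<and>
        (real (nn (rj (code_of g))))\<^sup>2 \<le> mw (rj (code_of (rb1 (code_of g))))) \<or>
        (\<exists>h. rp (code_of g) = Some h \<and> rj (code_of (rb1 (code_of g))) = 4 * h + 4))"
      proof (cases po)
        case None
        then obtain i where i: "wt b1 = 4 * i + 2" "(real (nn j))\<^sup>2 \<le> mw (wt b1)" using od[OF o] by auto
        then show ?thesis using vb od[OF o] None g by auto
      next
        case (Some h)
        then have "wt b1 = 4 * h + 4" using od[OF o] by auto
        then show ?thesis using vb od[OF o] Some g by auto
      qed
    qed
    have "?v g"
      by (rule valid.intros[OF _ _ _ _ _ _ P O]) (use g a j in auto)
    then show ?thesis using g lg by (intro exI[of _ g]) (simp add: defs)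
  qed
  have "ah_system K sim lb wt age cut e1 e2 prd c1 c2"
  proof
    show "countable K" "compact K" "K \<noteq> {}" using assms by auto
    show "lb g \<in> K" for g unfolding lb_def using assms(3) by (rule from_nat_into)
    show "wt g \<le> g" "cut g \<le> g" for g using v[of g] by (auto simp: defs)
    show "e1 g < g \<or> c1 g = 0" "e2 g < g \<or> c2 g = 0" for g using v[of g] by (auto simp: defs)
    show "\<bar>c1 g\<bar> + \<bar>c2 g\<bar> \<le> 1" for g
    proof (cases "?v g")
      case True
      then have "real_of_rat (\<bar>ra1 (code_of g)\<bar> + \<bar>ra2 (code_of g)\<bar>) \<le> 1" using v[OF True] by simp
      then show ?thesis using True by (simp add: defs of_rat_add)
    qed (simp add: defs)
    show "age g \<le> nn (wt g)" "age g \<ge> 1" for g using vp[of g] nn_pos[of "rj (code_of g)"] by (auto simp: defs)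
    show "prd g = None \<Longrightarrow> age g = 1" for g using vp[of g] by (auto simp: defs split: if_splits)
    show "h < cut g" "lb h = lb g" "wt h = wt g" "age g = Suc (age h)" if "prd g = Some h" for g h
      using that vp[of g] by (auto simp: defs split: if_splits)
    show "c1 g = 1 \<and> c2 g = 0" if "odd (wt g)" for g
      using that vo[of g] by (auto simp: defs split: if_splits)
    show "\<exists>i. wt (e1 g) = 4 * i + 2 \<and> (real (nn (wt g)))\<^sup>2 \<le> mw (wt (e1 g))" if "odd (wt g)" "prd g = None" for g
      using that vo[of g] by (auto simp: defs split: if_splits)
    show "wt (e1 g) = 4 * h + 4" if "odd (wt g)" "prd g = Some h" for g h
      using that vo[of g] by (auto simp: defs split: if_splits)
    show "\<exists>g\<ge>M. wt g = j \<and> lb g = t \<and> prd g = po \<and> cut g = p \<and> e1 g = b1 \<and> e2 g = b2 \<and> c1 g = a1 \<and> c2 g = a2"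
      if h: "even j" "j \<noteq> 0" "t \<in> K" "a1 \<in> \<rat>" "a2 \<in> \<rat>" "\<bar>a1\<bar> + \<bar>a2\<bar> \<le> 1"
        "case po of None \<Rightarrow> True | Some h \<Rightarrow> h < p \<and> lb h = t \<and> wt h = j \<and> age h < nn j" for M j t a1 a2 po p b1 b2
    proof -
      obtain q1 q2 where q: "a1 = real_of_rat q1" "a2 = real_of_rat q2" using h(4,5) by (auto elim!: Rats_cases)
      then have "real_of_rat (\<bar>q1\<bar> + \<bar>q2\<bar>) \<le> 1" using h(6) by (simp add: of_rat_add)
      then have "\<bar>q1\<bar> + \<bar>q2\<bar> \<le> 1" by simp
      from rich[OF h(3,2) this h(7)] h(1) show ?thesis unfolding q by blast
    qed
    show "\<exists>g\<ge>M. wt g = j \<and> lb g = t \<and> prd g = po \<and> cut g = p \<and> e1 g = b1 \<and> c1 g = 1 \<and> c2 g = 0"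
      if "odd j" "t \<in> K" "case po of None \<Rightarrow> \<exists>i. wt b1 = 4 * i + 2 \<and> (real (nn j))\<^sup>2 \<le> mw (wt b1)
         | Some h \<Rightarrow> h < p \<and> lb h = t \<and> wt h = j \<and> age h < nn j \<and> wt b1 = 4 * h + 4" for M j t po p b1
    proof -
      have "\<exists>g\<ge>M. wt g = j \<and> lb g = t \<and> prd g = po \<and> cut g = p \<and> e1 g = b1 \<and> e2 g = 0 \<and>
        c1 g = real_of_rat 1 \<and> c2 g = real_of_rat 0"
        using that by (intro rich) (auto split: option.splits elim: oddE)
      then show ?thesis by auto
    qed
    show "\<exists>g\<ge>M. wt g = 0 \<and> lb g = t \<and> prd g = None \<and> c1 g = 0 \<and> c2 g = 0" if t: "t \<in> K" for M t
    proof -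
      obtain l where l: "from_nat_into K l = t" using lbK[OF t] by blast
      obtain g where g: "g \<ge> M" "code_of g = Code 0 0 None 0 0 0 0 0 l" using code_of_exists by blast
      then have "\<not> ?v g" using v[of g] by auto
      then show ?thesis using g l by (intro exI[of _ g]) (simp add: defs lb_def)
    qed
  next
    note s2 = sim[THEN conjunct2]
    note s3 = s2[THEN conjunct2]
    note s4 = s3[THEN conjunct2]
    note s5 = s4[THEN conjunct2]
    note s6 = s5[THEN conjunct2]
    show "sim p s s" for p s using sim[THEN conjunct1] by blast
    show "sim p t s" if "sim p s t" for p s t using s2[THEN conjunct1] that by blast
    show "sim p s u" if "sim p s t" "sim p t u" for p s t u using s3[THEN conjunct1] that by blast
    show "sim p s t" if "p \<le> q" "sim q s t" for p q s t using s4[THEN conjunct1] that by blast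
    show "\<exists>F. finite F \<and> F \<subseteq> K \<and> (\<forall>s\<in>K. \<exists>!\<tau>. \<tau> \<in> F \<and> sim (P \<tau>) s \<tau>)" for P
      by (rule s5[THEN conjunct1, rule_format])
    show "eventually (\<lambda>s. sim p s \<tau>) (at \<tau> within K)" if "\<tau> \<in> K" for p \<tau>
      by (rule s6[THEN conjunct1, rule_format, OF that])
    show "\<exists>p. \<forall>s\<in>K. \<forall>t\<in>K. sim p s t \<longrightarrow> dist s t < e" if "0 < e" for e
      using s6[THEN conjunct2, rule_format, OF that] by blast
  qed
  then show ?thesis by blast
qed

section \<open>The Banach space\<close>

text \<open>Both directions are stated because the explicit map for the dual starts at
  \<open>ell1\<close>, while the isomorphism to be shown starts at the dual.\<close>

lemma normed_iso_criterion:
  assumes bl: "bounded_linear_map V W T" and inj: "inj_on T (carrier V)"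
    and im: "T ` carrier V = carrier W"
    and low: "\<And>x. x \<in> carrier V \<Longrightarrow> nrm V x \<le> c * nrm W (T x)"
    and cl: "\<And>x y. x \<in> carrier V \<Longrightarrow> y \<in> carrier V \<Longrightarrow> x \<oplus>\<^bsub>V\<^esub> y \<in> carrier V"
      "\<And>a x. x \<in> carrier V \<Longrightarrow> a \<odot>\<^bsub>V\<^esub> x \<in> carrier V"
  shows "normed_iso V W T" and "normed_iso W V (inv_into (carrier V) T)"
proof -
  let ?S = "inv_into (carrier V) T"
  have S: "?S y \<in> carrier V" "T (?S y) = y" if "y \<in> carrier W" for y
    using that im by (auto intro: inv_into_into f_inv_into_f)
  have ST: "?S (T x) = x" if "x \<in> carrier V" for x using inj that by (rule inv_into_f_f)
  have bij: "bij_betw T (carrier V) (carrier W)" using inj im by (simp add: bij_betw_def)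
  have Sb: "bounded_linear_map W V ?S"
    unfolding bounded_linear_map_def
  proof (intro conjI ballI allI)
    show "?S \<in> carrier W \<rightarrow> carrier V" using S by auto
    fix x y assume a: "x \<in> carrier W" "y \<in> carrier W"
    have "T (?S x \<oplus>\<^bsub>V\<^esub> ?S y) = x \<oplus>\<^bsub>W\<^esub> y" using bl S a unfolding bounded_linear_map_def by auto
    then show "?S (x \<oplus>\<^bsub>W\<^esub> y) = ?S x \<oplus>\<^bsub>V\<^esub> ?S y" using ST[OF cl(1)[OF S(1)[OF a(1)] S(1)[OF a(2)]]] by simp
  next
    fix a x assume x: "x \<in> carrier W"
    have "T (a \<odot>\<^bsub>V\<^esub> ?S x) = a \<odot>\<^bsub>W\<^esub> x" using bl S x unfolding bounded_linear_map_def by auto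
    then show "?S (a \<odot>\<^bsub>W\<^esub> x) = a \<odot>\<^bsub>V\<^esub> ?S x" using ST[OF cl(2)[OF S(1)[OF x], of a]] by simp
  next
    show "\<exists>B. \<forall>y\<in>carrier W. nrm V (?S y) \<le> B * nrm W y"
    proof (intro exI[of _ c] ballI)
      fix y assume "y \<in> carrier W"
      then show "nrm V (?S y) \<le> c * nrm W y" using low[OF S(1)] S(2) by metis
    qed
  qed
  show "normed_iso V W T" unfolding normed_iso_def using bij bl Sb by blast
  have TT: "inv_into (carrier W) ?S x = T x" if "x \<in> carrier V" for x
    using inv_into_inv_into_eq[OF bij that] .
  have "bounded_linear_map V W (inv_into (carrier W) ?S)"
    using bl cl unfolding bounded_linear_map_def by (simp add: TT Pi_iff)
  then show "normed_iso W V ?S" unfolding normed_iso_def using Sb bij_betw_inv_into[OF bij] by blast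
qed

context ah_system
begin

text \<open>By triangularity the finite solutions of \<open>local_ext\<close> agree where both are
  determined, and so they fit together.\<close>

lemma coef_exists: "\<exists>x. \<forall>g. ev g x = u g"
proof -
  obtain y where y: "\<And>n. supp 0 n (y n) \<and> (\<forall>h<n. ev h (y n) = u h)"
    using choice[of "\<lambda>n x. supp 0 n x \<and> (\<forall>h<n. ev h x = u h)"] local_ext[of _ u] by blast
  have eq: "y (Suc z) z = y n z" if "z < n" for z n
  proof -
    have "ev h (\<lambda>z'. y (Suc z) z' - y n z') = 0" if "h < Suc z" for h
      using y[of "Suc z"] y[of n] that \<open>z < n\<close> by (simp add: ev_diff)
    from supp_ev_zero[OF this, of "Suc z" z] show ?thesis by simp
  qed
  have "ev g (\<lambda>z. y (Suc z) z) = u g" for g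
  proof -
    have "ev g (\<lambda>z. y (Suc z) z) = ev g (y (Suc g))" by (intro ev_cong eq) simp
    then show ?thesis using y by simp
  qed
  then show ?thesis by blast
qed

text \<open>A vector is represented by its values under all functionals, which turns its norm into
  the supremum norm.\<close>

definition emb :: "(nat \<Rightarrow> real) \<Rightarrow> (nat \<Rightarrow>\<^sub>C real)" where "emb x = Bcontfun (\<lambda>g. ev g x)"

lemma emb_apply: "bnd b x \<Longrightarrow> apply_bcontfun (emb x) g = ev g x"
  unfolding emb_def bnd_def
  by (subst Bcontfun_inverse) (auto simp: bcontfun_def continuous_on_discrete bounded_iff)

lemma emb_apply_XX: "x \<in> XX \<Longrightarrow> apply_bcontfun (emb x) g = ev g x"
  using XX_bnd emb_apply by blast

lemma norm_emb_le: "bnd b x \<Longrightarrow> norm (emb x) \<le> b"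
  by (rule norm_bound) (simp add: emb_apply bnd_def)

lemma bnd_norm_emb: "x \<in> XX \<Longrightarrow> bnd (norm (emb x)) x"
  unfolding bnd_def using norm_bounded[of "emb x"] by (simp add: emb_apply_XX)

lemma emb_linear: "x \<in> XX \<Longrightarrow> y \<in> XX \<Longrightarrow> emb (\<lambda>z. a * x z + b * y z) = a *\<^sub>R emb x + b *\<^sub>R emb y"
  by (rule bcontfun_eqI) (simp add: emb_apply_XX XX_linear ev_linear)

lemma emb_add: "x \<in> XX \<Longrightarrow> y \<in> XX \<Longrightarrow> emb (\<lambda>z. x z + y z) = emb x + emb y"
  using emb_linear[of x y 1 1] by simp

lemma emb_diff: "x \<in> XX \<Longrightarrow> y \<in> XX \<Longrightarrow> emb (\<lambda>z. x z - y z) = emb x - emb y"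
  using emb_linear[of x y 1 "-1"] by simp

lemma emb_cmult: "x \<in> XX \<Longrightarrow> emb (\<lambda>z. a * x z) = a *\<^sub>R emb x"
  using emb_linear[of x x a 0] by simp

lemma emb_zero: "emb (\<lambda>z. 0) = 0"
  using emb_cmult[OF XX_zero, of 0] by simp

lemma emb_sum: "(\<And>k. k \<in> I \<Longrightarrow> x k \<in> XX) \<Longrightarrow> emb (\<lambda>z. \<Sum>k\<in>I. x k z) = (\<Sum>k\<in>I. emb (x k))"
proof (induction I rule: infinite_finite_induct)
  case (insert k I)
  then show ?case using emb_add[of "x k" "\<lambda>z. \<Sum>k\<in>I. x k z"] XX_sum[of I x] by simp
qed (auto simp: emb_zero)

lemma emb_inj: "inj_on emb XX"
  by (rule inj_onI, rule ev_inj) (metis emb_apply_XX)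

definition X :: "(nat \<Rightarrow>\<^sub>C real) set" where "X = emb ` XX"

definition co :: "(nat \<Rightarrow>\<^sub>C real) \<Rightarrow> nat \<Rightarrow> real" where "co = inv_into XX emb"

lemma co_emb: "x \<in> XX \<Longrightarrow> co (emb x) = x"
  unfolding co_def by (rule inv_into_f_f[OF emb_inj])

lemma co_X: "y \<in> X \<Longrightarrow> co y \<in> XX" and emb_co: "y \<in> X \<Longrightarrow> emb (co y) = y"
  unfolding X_def co_def by (fact inv_into_into, fact f_inv_into_f)

lemma co_linear:
  assumes "x \<in> X" "y \<in> X"
  shows "co (a *\<^sub>R x + b *\<^sub>R y) = (\<lambda>z. a * co x z + b * co y z)"
  using emb_linear[OF co_X co_X, OF assms, of a b] emb_co[OF assms(1)] emb_co[OF assms(2)]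
    co_emb[OF XX_linear[OF co_X co_X, OF assms, of a b]] by simp

lemma co_apply: "y \<in> X \<Longrightarrow> ev g (co y) = apply_bcontfun y g"
  using emb_apply_XX[OF co_X] emb_co by metis

lemma co_bnd: "y \<in> X \<Longrightarrow> bnd (norm y) (co y)"
  using bnd_norm_emb[OF co_X] emb_co by metis

lemma X_linear:
  assumes "x \<in> X" "y \<in> X"
  shows "a *\<^sub>R x + b *\<^sub>R y \<in> X"
proof -
  have "emb (\<lambda>z. a * co x z + b * co y z) = a *\<^sub>R x + b *\<^sub>R y"
    using emb_linear[OF co_X co_X, OF assms, of a b] assms by (simp add: emb_co)
  then show ?thesis unfolding X_def using imageI[OF XX_linear[OF co_X co_X, OF assms, of a b], of emb] by simp
qed

lemma X_subspace: "subspace X"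
proof (rule subspaceI)
  show "0 \<in> X" unfolding X_def using imageI[OF XX_zero, of emb] by (simp add: emb_zero)
  show "x + y \<in> X" if "x \<in> X" "y \<in> X" for x y using X_linear[OF that, of 1 1] by simp
  show "c *\<^sub>R x \<in> X" if "x \<in> X" for x c using X_linear[OF that that, of c 0] by simp
qed

lemma X_closed: "closed X"
  unfolding closed_sequential_limits
proof (intro allI impI, elim conjE)
  fix f y assume f: "\<forall>n. f n \<in> X" and lim: "f \<longlonglongrightarrow> y"
  \<comment> \<open>Every sequence of values has coefficients; what remains is the decay of their
    tails.\<close>
  obtain x where x: "\<And>g. ev g x = apply_bcontfun y g" using coef_exists by metis
  have d: "bnd (norm (y - f n)) (\<lambda>z. x z - co (f n) z)" for n
    unfolding bnd_def using norm_bounded[of "y - f n"] by (simp add: ev_diff x co_apply f)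
  have "x \<in> XX" unfolding XX_def
  proof (intro CollectI allI impI)
    fix e :: real assume e: "e > 0"
    obtain n where "dist (f n) y < e / 6" using lim e unfolding lim_sequentially by (metis divide_pos_pos order_refl zero_less_numeral)
    then have n: "bnd (e / 6) (\<lambda>z. x z - co (f n) z)"
      using bnd_mono[OF d[of n]] by (simp add: dist_norm norm_minus_commute)
    obtain N where N: "bnd (e / 2) (tail N (co (f n)))" using XX_tail[OF co_X, of "f n" "e / 2"] f e by auto
    have "tail N x = (\<lambda>z. tail N (\<lambda>z. x z - co (f n) z) z + tail N (co (f n)) z)"
      by (auto simp: tail_def mul_def)
    then have "bnd (3 * (e / 6) + e / 2) (tail N x)" using bnd_add[OF bnd_tail[OF n] N] by simp
    then show "\<exists>N. bnd e (tail N x)" by auto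
  qed
  moreover have "emb x = y" using calculation by (intro bcontfun_eqI) (simp add: emb_apply_XX x)
  ultimately show "y \<in> X" unfolding X_def by blast
qed

lemma X_closure_finite: "X \<subseteq> closure (emb ` {x. \<exists>n. supp 0 n x})"
proof
  fix y assume y: "y \<in> X"
  show "y \<in> closure (emb ` {x. \<exists>n. supp 0 n x})"
    unfolding closure_approachable
  proof (intro allI impI)
    fix e :: real assume e: "e > 0"
    obtain N where N: "bnd (e / 2) (tail N (co y))" using XX_tail[OF co_X[OF y], of "e / 2"] e by auto
    have s: "supp 0 N (head N (co y))" by (auto simp: supp_def head_def)
    have "(\<lambda>z. co y z - head N (co y) z) = tail N (co y)" by (auto simp: head_def tail_def mul_def)
    then have "norm (y - emb (head N (co y))) \<le> e / 2"
      using norm_emb_le[OF N] emb_diff[OF co_X[OF y] XX_supp[OF s]] emb_co[OF y] by simp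
    then show "\<exists>u\<in>emb ` {x. \<exists>n. supp 0 n x}. dist u y < e"
      using s e by (intro bexI[of _ "emb (head N (co y))"]) (auto simp: dist_norm norm_minus_commute)
  qed
qed

lemma supp_decomp: "supp 0 n x \<Longrightarrow> x = (\<lambda>u. \<Sum>z<n. x z * unit z u)"
proof
  fix u assume s: "supp 0 n x"
  have "(\<Sum>z<n. x z * unit z u) = (\<Sum>z<n. if z = u then x u else 0)"
    by (intro sum.cong) (auto simp: unit_def)
  then show "x u = (\<Sum>z<n. x z * unit z u)" using s by (auto simp: supp_def)
qed

lemma emb_decomp: "supp 0 n x \<Longrightarrow> emb x = (\<Sum>z<n. x z *\<^sub>R emb (unit z))"
  using supp_decomp[of n x] emb_sum[of "{..<n}" "\<lambda>z u. x z * unit z u"] XX_cmult[OF unit_XX] emb_cmult[OF unit_XX]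
  by simp

lemma X_separable: "separable_space (top_of_set X)"
proof -
  define q where "q l = (\<lambda>z. if z < length l then real_of_rat (l ! z) else 0)" for l
  define C where "C = emb ` range q"
  have qs: "supp 0 (length l) (q l)" for l by (auto simp: supp_def q_def)
  have cC: "countable C" unfolding C_def by simp
  have CX: "C \<subseteq> X" unfolding C_def X_def using XX_supp[OF qs] by auto
  have "X \<subseteq> closure C"
  proof -
    have "emb ` {x. \<exists>n. supp 0 n x} \<subseteq> closure C"
    proof (intro image_subsetI, unfold closure_approachable, intro allI impI)
      fix x and e :: real assume "x \<in> {x. \<exists>n. supp 0 n x}" and e: "e > 0"
      then obtain n where n: "supp 0 n x" by blast
      define c where "c = (\<Sum>z<n. norm (emb (unit z))) + 1"
      have c: "c > 0" unfolding c_def by (intro add_nonneg_pos sum_nonneg) auto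
      have "\<exists>r. \<bar>real_of_rat r - x z\<bar> < e / c" for z
      proof -
        obtain r where "r \<in> \<rat>" "x z < r" "r < x z + e / c" using Rats_dense_in_real[of "x z" "x z + e / c"] e c by auto
        moreover obtain r' where "r = real_of_rat r'" using \<open>r \<in> \<rat>\<close> by (auto elim!: Rats_cases)
        ultimately have "\<bar>real_of_rat r' - x z\<bar> < e / c" by (simp add: abs_less_iff)
        then show ?thesis by blast
      qed
      then obtain r where r: "\<And>z. \<bar>real_of_rat (r z) - x z\<bar> < e / c" by metis
      define l where "l = map r [0..<n]"
      have ql: "q l z = (if z < n then real_of_rat (r z) else 0)" for z by (simp add: q_def l_def)
      have s2: "supp 0 n (q l)" by (auto simp: supp_def ql)
      have eq: "emb (q l) - emb x = (\<Sum>z<n. (q l z - x z) *\<^sub>R emb (unit z))"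
        unfolding emb_decomp[OF n] emb_decomp[OF s2] by (simp add: sum_subtractf scaleR_diff_left)
      have "norm (\<Sum>z<n. (q l z - x z) *\<^sub>R emb (unit z)) \<le> (\<Sum>z<n. e / c * norm (emb (unit z)))"
      proof (intro order_trans[OF norm_sum] sum_mono)
        fix z assume "z \<in> {..<n}"
        then have "\<bar>q l z - x z\<bar> \<le> e / c" using less_imp_le[OF r[of z]] by (simp add: ql)
        then show "norm ((q l z - x z) *\<^sub>R emb (unit z)) \<le> e / c * norm (emb (unit z))"
          unfolding norm_scaleR by (rule mult_right_mono) simp
      qed
      also have "\<dots> = e / c * (c - 1)" by (simp add: c_def sum_distrib_left)
      also have "\<dots> < e" using e c by (simp add: field_simps)
      finally have "dist (emb (q l)) (emb x) < e" unfolding dist_norm eq .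
      then show "\<exists>y\<in>C. dist y (emb x) < e" unfolding C_def by blast
    qed
    then have "closure (emb ` {x. \<exists>n. supp 0 n x}) \<subseteq> closure C" by (rule closure_minimal) simp
    then show ?thesis using X_closure_finite by blast
  qed
  then have "top_of_set X closure_of C = topspace (top_of_set X)"
    using CX by (simp add: closure_of_subtopology Int_absorb1 Int_absorb2)
  then show ?thesis unfolding separable_space_def using cC CX by auto
qed

section \<open>Finite dimensional subspaces and the script L-infinity property\<close>

definition YY :: "nat \<Rightarrow> (nat \<Rightarrow>\<^sub>C real) set" where "YY n = emb ` {x. supp 0 (Suc n) x}"

lemma YY_span: "YY n = span ((\<lambda>z. emb (unit z)) ` {..<Suc n})"
proof
  show "YY n \<subseteq> span ((\<lambda>z. emb (unit z)) ` {..<Suc n})"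
  proof
    fix y assume "y \<in> YY n"
    then obtain x where "y = emb x" "supp 0 (Suc n) x" by (auto simp: YY_def)
    then have "y = (\<Sum>z<Suc n. x z *\<^sub>R emb (unit z))" using emb_decomp by blast
    then show "y \<in> span ((\<lambda>z. emb (unit z)) ` {..<Suc n})"
      by (simp only:) (intro span_sum span_scale span_base imageI)
  qed
  show "span ((\<lambda>z. emb (unit z)) ` {..<Suc n}) \<subseteq> YY n"
  proof (rule span_minimal)
    show "(\<lambda>z. emb (unit z)) ` {..<Suc n} \<subseteq> YY n" unfolding YY_def by (auto simp: supp_def unit_def)
    show "subspace (YY n)"
    proof (rule subspaceI)
      show "0 \<in> YY n" unfolding YY_def using emb_zero by (intro image_eqI[of _ _ "\<lambda>_. 0"]) (auto simp: supp_def)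
      show "u + v \<in> YY n" if uv: "u \<in> YY n" "v \<in> YY n" for u v
      proof -
        obtain x y where "u = emb x" "v = emb y" "supp 0 (Suc n) x" "supp 0 (Suc n) y" using uv by (auto simp: YY_def)
        moreover from this have "emb (\<lambda>z. x z + y z) = emb x + emb y" using XX_supp by (intro emb_add) blast+
        ultimately show ?thesis unfolding YY_def
          by (intro image_eqI[of _ _ "\<lambda>z. x z + y z"]) (auto simp: supp_def)
      qed
      show "c *\<^sub>R u \<in> YY n" if u: "u \<in> YY n" for u c
      proof -
        obtain x where "u = emb x" "supp 0 (Suc n) x" using u by (auto simp: YY_def)
        moreover from this have "emb (\<lambda>z. c * x z) = c *\<^sub>R emb x" using XX_supp by (intro emb_cmult) blast
        ultimately show ?thesis unfolding YY_def
          by (intro image_eqI[of _ _ "\<lambda>z. c * x z"]) (auto simp: supp_def)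
      qed
    qed
  qed
qed

lemma YY_dim: "dim (YY n) = Suc n"
proof -
  let ?b = "\<lambda>z. emb (unit z)"
  have inj: "inj_on ?b {..<Suc n}"
  proof (rule inj_onI)
    fix z z' assume "?b z = ?b z'"
    then have "unit z = unit z'" using co_emb[OF unit_XX] by metis
    then have "unit z z = unit z' z" by simp
    then show "z = z'" by (auto simp: unit_def split: if_splits)
  qed
  have "independent (?b ` {..<Suc n})"
  proof (rule independent_if_scalars_zero)
    fix f y assume s: "(\<Sum>x\<in>?b ` {..<Suc n}. f x *\<^sub>R x) = 0" and y: "y \<in> ?b ` {..<Suc n}"
    obtain z where z: "z < Suc n" "y = ?b z" using y by auto
    let ?x = "\<lambda>u. if u < Suc n then f (?b u) else 0"
    have sx: "supp 0 (Suc n) ?x" by (auto simp: supp_def)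
    have "emb ?x = (\<Sum>z<Suc n. f (?b z) *\<^sub>R ?b z)"
      unfolding emb_decomp[OF sx] by (intro sum.cong) auto
    also have "\<dots> = 0" using s sum.reindex[OF inj, of "\<lambda>x. f x *\<^sub>R x"] by simp
    finally have "emb ?x = emb (\<lambda>_. 0)" by (simp add: emb_zero)
    then have "?x = (\<lambda>_. 0)" using co_emb[OF XX_supp[OF sx]] co_emb[OF XX_zero] by metis
    then have "?x z = 0" by meson
    then show "f y = 0" using z by simp
  qed simp
  then have "dim (span (?b ` {..<Suc n})) = card (?b ` {..<Suc n})" by (rule dim_span_eq_card_independent)
  then show ?thesis unfolding YY_span using card_image[OF inj] by simp
qed

lemma operator_norm_le:
  assumes "carrier V \<noteq> {}" "\<And>x. x \<in> carrier V \<Longrightarrow> nrm W (T x) \<le> b * nrm V x" "\<And>x. x \<in> carrier V \<Longrightarrow> nrm V x \<ge> 0" "b \<ge> 0"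
  shows "operator_norm V W T \<le> b"
  unfolding operator_norm_def
proof (rule cSUP_least[OF assms(1)])
  fix x assume x: "x \<in> carrier V"
  show "nrm W (T x) / nrm V x \<le> b"
    using assms(2,3)[OF x] assms(4) by (cases "nrm V x = 0") (auto simp: divide_le_eq)
qed

lemma operator_norm_nonneg:
  assumes x0: "x0 \<in> carrier V" and b: "\<And>x. x \<in> carrier V \<Longrightarrow> nrm W (T x) \<le> b * nrm V x"
    and n: "\<And>x. x \<in> carrier V \<Longrightarrow> nrm V x \<ge> 0" "\<And>x. x \<in> carrier V \<Longrightarrow> nrm W (T x) \<ge> 0" and b0: "b \<ge> 0"
  shows "operator_norm V W T \<ge> 0" and "x \<in> carrier V \<Longrightarrow> (nrm V x = 0 \<Longrightarrow> nrm W (T x) = 0) \<Longrightarrow> nrm W (T x) \<le> operator_norm V W T * nrm V x"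
proof -
  have bd: "bdd_above ((\<lambda>x. nrm W (T x) / nrm V x) ` carrier V)"
  proof (rule bdd_aboveI2[of _ _ b])
    fix x assume x: "x \<in> carrier V"
    show "nrm W (T x) / nrm V x \<le> b"
      using b[OF x] n(1)[OF x] b0 by (cases "nrm V x = 0") (auto simp: divide_le_eq)
  qed
  have up: "nrm W (T x) / nrm V x \<le> operator_norm V W T" if "x \<in> carrier V" for x
    unfolding operator_norm_def by (rule cSUP_upper[OF that bd])
  have "0 \<le> nrm W (T x0) / nrm V x0" using n x0 by simp
  then show "operator_norm V W T \<ge> 0" using up[OF x0] by linarith
  show "nrm W (T x) \<le> operator_norm V W T * nrm V x" if "x \<in> carrier V" "nrm V x = 0 \<Longrightarrow> nrm W (T x) = 0"
    using up[OF that(1)] n(1)[OF that(1)] that(2) by (cases "nrm V x = 0") (auto simp: divide_le_eq mult.commute)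
qed

text \<open>On \<open>YY n\<close> the first \<open>Suc n\<close> values are arbitrary and determine
  the vector. Restriction to them has norm at most 1, and its inverse is the extension from the
  first coordinates, hence the constant 3.\<close>

lemma script_L_infty_X: "script_L_infty X"
  unfolding script_L_infty_def
proof (intro exI[of _ 3] conjI)
  show "(3::real) > 0" by simp
  show "script_L_infty_const 3 X"
    unfolding script_L_infty_const_def
  proof (intro conjI exI[of _ YY] allI)
    show "separable_space (top_of_set X)" by (rule X_separable)
    show "strict_mono YY"
    proof (rule strict_mono_Suc_iff[THEN iffD2], intro allI)
      fix n
      have "YY n \<subseteq> YY (Suc n)" unfolding YY_def by (auto simp: supp_def)
      moreover have "YY n \<noteq> YY (Suc n)" using YY_dim[of n] YY_dim[of "Suc n"] by auto
      ultimately show "YY n < YY (Suc n)" by blast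
    qed
    show "X = closure (\<Union>n. YY n)"
    proof
      have "supp 0 (Suc n) x" if "supp 0 n x" for n x using that by (auto simp: supp_def)
      then have "emb ` {x. \<exists>n. supp 0 n x} \<subseteq> (\<Union>n. YY n)" unfolding YY_def by blast
      then show "X \<subseteq> closure (\<Union>n. YY n)" using X_closure_finite closure_mono by blast
      have "(\<Union>n. YY n) \<subseteq> X" unfolding YY_def X_def using XX_supp by auto
      then show "closure (\<Union>n. YY n) \<subseteq> X" using X_closed by (rule closure_minimal)
    qed
    fix n
    show "subspace (YY n)" unfolding YY_span by simp
    show "YY n \<subseteq> X" unfolding YY_def X_def using XX_supp by auto
    show "\<exists>B. finite B \<and> span B = YY n" unfolding YY_span by (intro exI[of _ "(\<lambda>z. emb (unit z)) ` {..<Suc n}"]) simp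
    let ?V = "normed_subspace (YY n)" and ?W = "ell_infty_dim (Suc n)"
    let ?T = "\<lambda>y. \<lambda>i\<in>{..<Suc n}. apply_bcontfun y i"
    have cV: "carrier ?V = YY n" "nrm ?V = norm" "\<And>x y. x \<oplus>\<^bsub>?V\<^esub> y = x + y" "\<And>a x. a \<odot>\<^bsub>?V\<^esub> x = a *\<^sub>R x"
      by (simp_all add: normed_subspace_def)
    have cW: "carrier ?W = {..<Suc n} \<rightarrow>\<^sub>E UNIV" "\<And>x y. x \<oplus>\<^bsub>?W\<^esub> y = (\<lambda>i\<in>{..<Suc n}. x i + y i)"
      "\<And>c x. c \<odot>\<^bsub>?W\<^esub> x = (\<lambda>i\<in>{..<Suc n}. c * x i)"
      "\<And>a. nrm ?W a = Max (insert 0 ((\<lambda>i. \<bar>a i\<bar>) ` {..<Suc n}))"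
      by (simp_all add: ell_infty_dim_def)
    have Wle: "nrm ?W a \<le> b \<longleftrightarrow> b \<ge> 0 \<and> (\<forall>i<Suc n. \<bar>a i\<bar> \<le> b)" for a b
      unfolding cW by (subst Max_le_iff) auto
    have sub: "subspace (YY n)" unfolding YY_span by simp
    have up: "nrm ?W (?T y) \<le> 1 * norm y" if "y \<in> YY n" for y
      unfolding Wle using norm_bounded[of y] by simp
    have low: "norm y \<le> 3 * nrm ?W (?T y)" if y: "y \<in> YY n" for y
    proof -
      obtain x where x: "y = emb x" "supp 0 (Suc n) x" using y by (auto simp: YY_def)
      have "\<bar>ev h x\<bar> \<le> nrm ?W (?T y)" if "h < Suc n" for h
        using Wle[of "?T y" "nrm ?W (?T y)"] that emb_apply_XX[OF XX_supp[OF x(2)]] x(1) by auto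
      moreover have "nrm ?W (?T y) \<ge> 0" using Wle[of "?T y" "nrm ?W (?T y)"] by simp
      ultimately have "bnd (3 * nrm ?W (?T y)) (head (Suc n) x)" by (intro head_bnd) auto
      moreover have "head (Suc n) x = x" using x(2) by (auto simp: head_def supp_def)
      ultimately show ?thesis using norm_emb_le x(1) by metis
    qed
    have bl: "bounded_linear_map ?V ?W ?T"
      unfolding bounded_linear_map_def cV cW(1-3)
      using up by (auto intro!: exI[of _ 1] restrict_ext)
    have inj: "inj_on ?T (carrier ?V)"
    proof (rule inj_onI)
      fix u v assume uv: "u \<in> carrier ?V" "v \<in> carrier ?V" "?T u = ?T v"
      have "?T u i = ?T v i" for i using uv(3) by simp
      then have e: "apply_bcontfun u i = apply_bcontfun v i" if "i < Suc n" for i using that by (metis lessThan_iff restrict_apply')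
      have d: "u - v \<in> YY n" using uv sub subspace_diff by (simp add: cV)
      have "nrm ?W (?T (u - v)) \<le> 0" unfolding Wle using e by simp
      then have "norm (u - v) \<le> 0" using low[OF d] by linarith
      then show "u = v" by simp
    qed
    have im: "?T ` carrier ?V = carrier ?W"
    proof
      show "?T ` carrier ?V \<subseteq> carrier ?W" unfolding cW by (rule image_subsetI) (simp add: PiE_iff)
      show "carrier ?W \<subseteq> ?T ` carrier ?V"
      proof
        fix a assume a: "a \<in> carrier ?W"
        obtain x where x: "supp 0 (Suc n) x" "\<forall>h<Suc n. ev h x = a h" using local_ext[of "Suc n" a] by blast
        have "?T (emb x) = a"
        proof
          fix i show "?T (emb x) i = a i"
          proof (cases "i < Suc n")
            case True
            then show ?thesis using x(2) emb_apply_XX[OF XX_supp[OF x(1)], of i] by simp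
          next
            case False
            then show ?thesis using PiE_arb[OF a[unfolded cW], of i] by simp
          qed
        qed
        moreover have "emb x \<in> carrier ?V" unfolding cV(1) using x(1) by (simp add: YY_def)
        ultimately show "a \<in> ?T ` carrier ?V" by (rule image_eqI[OF sym])
      qed
    qed
    have iso: "normed_iso ?V ?W ?T"
    proof (rule normed_iso_criterion(1)[OF bl inj im])
      show "nrm ?V x \<le> 3 * nrm ?W (?T x)" if "x \<in> carrier ?V" for x using low that by (simp add: cV)
      show "x \<oplus>\<^bsub>?V\<^esub> y \<in> carrier ?V" if "x \<in> carrier ?V" "y \<in> carrier ?V" for x y
        using that sub subspace_add by (simp add: cV)
      show "a \<odot>\<^bsub>?V\<^esub> x \<in> carrier ?V" if "x \<in> carrier ?V" for x a
        using that sub subspace_scale by (simp add: cV)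
    qed
    let ?S = "inv_into (carrier ?V) ?T"
    have S: "?S a \<in> YY n" "?T (?S a) = a" if "a \<in> carrier ?W" for a
      using inv_into_into[of a ?T "carrier ?V"] f_inv_into_f[of a ?T "carrier ?V"] that im by (auto simp: cV)
    have V0: "0 \<in> YY n" using sub by (rule subspace_0)
    have W0: "?T 0 \<in> carrier ?W" by (simp add: cW)
    have Wn: "nrm ?W a \<ge> 0" for a using Wle[of a "nrm ?W a"] by simp
    have 1: "operator_norm ?V ?W ?T \<le> 1"
      using V0 up by (intro operator_norm_le) (auto simp: cV)
    have Slow: "norm (?S a) \<le> 3 * nrm ?W a" if "a \<in> carrier ?W" for a using low[OF S(1)[OF that]] S(2)[OF that] by simp
    have 2: "operator_norm ?W ?V ?S \<le> 3" "0 \<le> operator_norm ?W ?V ?S"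
      using W0 Slow Wn by (auto simp: cV intro!: operator_norm_le operator_norm_nonneg(1)[where b = 3])
    have "operator_norm ?V ?W ?T * operator_norm ?W ?V ?S \<le> 1 * 3"
      using 1 2 by (intro mult_mono) auto
    then show "normed_isomorphic_const 3 (normed_subspace (YY n)) (ell_infty_dim (dim (YY n)))"
      unfolding normed_isomorphic_const_def YY_dim using iso by (intro exI[of _ ?T]) simp
  qed
qed

end

section \<open>The dual space\<close>

lemma ell1_complete:
  fixes \<alpha> :: "nat \<Rightarrow> nat \<Rightarrow> real"
  assumes s: "\<And>n. summable (\<lambda>g. \<bar>\<alpha> n g\<bar>)"
    and c: "\<And>e. e > 0 \<Longrightarrow> \<exists>N. \<forall>m\<ge>N. \<forall>n\<ge>N. (\<Sum>g. \<bar>\<alpha> m g - \<alpha> n g\<bar>) \<le> e"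
  shows "\<exists>a. summable (\<lambda>g. \<bar>a g\<bar>) \<and> (\<forall>e>0. \<exists>N. \<forall>n\<ge>N. (\<Sum>g. \<bar>\<alpha> n g - a g\<bar>) \<le> e \<and> summable (\<lambda>g. \<bar>\<alpha> n g - a g\<bar>))"
proof -
  have sd: "summable (\<lambda>g. \<bar>\<alpha> m g - \<alpha> n g\<bar>)" for m n
    by (rule summable_comparison_test[OF _ summable_add[OF s[of m] s[of n]]]) (auto intro!: exI[of _ 0])
  have fin: "(\<Sum>g<G. \<bar>\<alpha> m g - \<alpha> n g\<bar>) \<le> (\<Sum>g. \<bar>\<alpha> m g - \<alpha> n g\<bar>)" for m n G
    by (intro sum_le_suminf sd) auto
  have "Cauchy (\<lambda>n. \<alpha> n g)" for g
  proof (rule metric_CauchyI)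
    fix e :: real assume e: "e > 0"
    obtain N where N: "\<forall>m\<ge>N. \<forall>n\<ge>N. (\<Sum>g. \<bar>\<alpha> m g - \<alpha> n g\<bar>) \<le> e / 2" using c[of "e / 2"] e by auto
    have "dist (\<alpha> m g) (\<alpha> n g) < e" if "m \<ge> N" "n \<ge> N" for m n
    proof -
      have "\<bar>\<alpha> m g - \<alpha> n g\<bar> \<le> (\<Sum>g<Suc g. \<bar>\<alpha> m g - \<alpha> n g\<bar>)" by (intro member_le_sum) auto
      then have "\<bar>\<alpha> m g - \<alpha> n g\<bar> \<le> e / 2" using fin[of m n "Suc g"] N that by (meson order_trans)
      then show ?thesis using e by (simp add: dist_real_def)
    qed
    then show "\<exists>M. \<forall>m\<ge>M. \<forall>n\<ge>M. dist (\<alpha> m g) (\<alpha> n g) < e" by blast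
  qed
  then have "\<forall>g. \<exists>l. (\<lambda>n. \<alpha> n g) \<longlonglongrightarrow> l" using Cauchy_convergent convergent_def by blast
  then obtain a where a: "\<And>g. (\<lambda>n. \<alpha> n g) \<longlonglongrightarrow> a g" by metis
  have lim: "\<exists>N. \<forall>n\<ge>N. \<forall>G. (\<Sum>g<G. \<bar>\<alpha> n g - a g\<bar>) \<le> e" if e: "e > 0" for e
  proof -
    obtain N where N: "\<forall>m\<ge>N. \<forall>n\<ge>N. (\<Sum>g. \<bar>\<alpha> m g - \<alpha> n g\<bar>) \<le> e" using c[OF e] by blast
    have "(\<Sum>g<G. \<bar>\<alpha> n g - a g\<bar>) \<le> e" if n: "n \<ge> N" for n G
    proof (rule LIMSEQ_le_const2)
      show "(\<lambda>m. \<Sum>g<G. \<bar>\<alpha> n g - \<alpha> m g\<bar>) \<longlonglongrightarrow> (\<Sum>g<G. \<bar>\<alpha> n g - a g\<bar>)"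
        by (intro tendsto_sum tendsto_rabs tendsto_diff tendsto_const a)
      show "\<exists>M. \<forall>m\<ge>M. (\<Sum>g<G. \<bar>\<alpha> n g - \<alpha> m g\<bar>) \<le> e"
        using fin[of n _ G] N n by (intro exI[of _ N]) (meson order_trans)
    qed
    then show ?thesis by blast
  qed
  have lim': "\<exists>N. \<forall>n\<ge>N. (\<Sum>g. \<bar>\<alpha> n g - a g\<bar>) \<le> e \<and> summable (\<lambda>g. \<bar>\<alpha> n g - a g\<bar>)" if e: "e > 0" for e
  proof -
    obtain N where N: "\<forall>n\<ge>N. \<forall>G. (\<Sum>g<G. \<bar>\<alpha> n g - a g\<bar>) \<le> e" using lim[OF e] by blast
    have "(\<Sum>g. \<bar>\<alpha> n g - a g\<bar>) \<le> e \<and> summable (\<lambda>g. \<bar>\<alpha> n g - a g\<bar>)" if "n \<ge> N" for n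
    proof -
      have "summable (\<lambda>g. \<bar>\<alpha> n g - a g\<bar>)" using N that by (intro summableI_nonneg_bounded[of _ e]) auto
      then show ?thesis using N that by (auto intro!: suminf_le_const)
    qed
    then show ?thesis by blast
  qed
  obtain n where n: "summable (\<lambda>g. \<bar>\<alpha> n g - a g\<bar>)" using lim'[of 1] by auto
  have "summable (\<lambda>g. \<bar>a g\<bar>)"
    by (rule summable_comparison_test[OF _ summable_add[OF n s[of n]]]) (auto intro!: exI[of _ 0])
  then show ?thesis using lim' by blast
qed

context ah_system
begin

definition ell1_functional :: "(nat \<Rightarrow> real) \<Rightarrow> (nat \<Rightarrow>\<^sub>C real) \<Rightarrow> real" where
  "ell1_functional a = (\<lambda>y\<in>X. \<Sum>g. a g * apply_bcontfun y g)"

lemma ell1_functional_summable: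
  assumes "summable (\<lambda>g. \<bar>a g\<bar>)"
  shows "summable (\<lambda>g. a g * apply_bcontfun y g)" and "\<bar>\<Sum>g. a g * apply_bcontfun y g\<bar> \<le> (\<Sum>g. \<bar>a g\<bar>) * norm y"
proof -
  have b: "norm (a g * apply_bcontfun y g) \<le> \<bar>a g\<bar> * norm y" for g
    using norm_bounded[of y g] by (simp add: abs_mult mult_left_mono)
  have s: "summable (\<lambda>g. \<bar>a g\<bar> * norm y)" using assms by (rule summable_mult2)
  show "summable (\<lambda>g. a g * apply_bcontfun y g)" by (rule summable_comparison_test[OF _ s]) (use b in auto)
  have "norm (\<Sum>g. a g * apply_bcontfun y g) \<le> (\<Sum>g. \<bar>a g\<bar> * norm y)" by (rule norm_suminf_le[OF b s])
  also have "\<dots> = (\<Sum>g. \<bar>a g\<bar>) * norm y" using suminf_mult2[OF assms] by simp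
  finally show "\<bar>\<Sum>g. a g * apply_bcontfun y g\<bar> \<le> (\<Sum>g. \<bar>a g\<bar>) * norm y" by simp
qed

text \<open>The test vector has norm at most 3, and its first \<open>N\<close> values are the signs
  of \<open>a\<close>. Its other values cost at most three times the rest of the series, which
  vanishes as \<open>N\<close> grows.\<close>

lemma ell1_functional_lower:
  assumes s: "summable (\<lambda>g. \<bar>a g\<bar>)" and b: "\<And>y. y \<in> X \<Longrightarrow> \<bar>ell1_functional a y\<bar> \<le> b * norm y" "b \<ge> 0"
  shows "(\<Sum>g. \<bar>a g\<bar>) \<le> 3 * b"
proof -
  let ?t = "\<Sum>g. \<bar>a g\<bar>"
  have fin: "(\<Sum>g<N. \<bar>a g\<bar>) \<le> 3 * b + 3 * (?t - (\<Sum>g<N. \<bar>a g\<bar>))" for N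
  proof -
    obtain x where x: "supp 0 N x" "\<forall>h<N. ev h x = sgn (a h)" using local_ext[of N "\<lambda>h. sgn (a h)"] by blast
    have "bnd (3 * 1) (head N x)" using x(2) by (intro head_bnd) (auto simp: sgn_if)
    moreover have "head N x = x" using x(1) by (auto simp: head_def supp_def)
    ultimately have bx: "bnd 3 x" by simp
    let ?y = "emb x"
    have yX: "?y \<in> X" unfolding X_def using XX_supp[OF x(1)] by blast
    have ap: "apply_bcontfun ?y g = ev g x" for g by (rule emb_apply[OF bx])
    have ny: "norm ?y \<le> 3" by (rule norm_emb_le[OF bx])
    have "(\<Sum>g. a g * apply_bcontfun ?y g) = (\<Sum>g. a (g + N) * apply_bcontfun ?y (g + N)) + (\<Sum>g<N. a g * apply_bcontfun ?y g)"
      by (rule suminf_split_initial_segment[OF ell1_functional_summable(1)[OF s]])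
    moreover have "(\<Sum>g<N. a g * apply_bcontfun ?y g) = (\<Sum>g<N. \<bar>a g\<bar>)"
      using x(2) by (intro sum.cong) (auto simp: ap abs_sgn)
    moreover have "\<bar>\<Sum>g. a (g + N) * apply_bcontfun ?y (g + N)\<bar> \<le> 3 * (?t - (\<Sum>g<N. \<bar>a g\<bar>))"
    proof -
      have sN: "summable (\<lambda>g. \<bar>a (g + N)\<bar>)" using s by (simp add: summable_iff_shift[of "\<lambda>g. \<bar>a g\<bar>" N])
      have "norm (\<Sum>g. a (g + N) * apply_bcontfun ?y (g + N)) \<le> (\<Sum>g. \<bar>a (g + N)\<bar> * 3)"
      proof (rule norm_suminf_le)
        show "norm (a (g + N) * apply_bcontfun ?y (g + N)) \<le> \<bar>a (g + N)\<bar> * 3" for g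
          using bx unfolding ap bnd_def by (simp add: abs_mult mult_left_mono)
      qed (rule summable_mult2[OF sN])
      also have "\<dots> = (\<Sum>g. \<bar>a (g + N)\<bar>) * 3" using suminf_mult2[OF sN] by simp
      also have "(\<Sum>g. \<bar>a (g + N)\<bar>) = ?t - (\<Sum>g<N. \<bar>a g\<bar>)" by (rule suminf_minus_initial_segment[OF s])
      finally show ?thesis by simp
    qed
    moreover have "\<bar>\<Sum>g. a g * apply_bcontfun ?y g\<bar> \<le> b * 3"
      using b(1)[OF yX] mult_left_mono[OF ny b(2)] yX by (simp add: ell1_functional_def)
    ultimately show ?thesis by linarith
  qed
  have "(\<lambda>N. \<Sum>g<N. \<bar>a g\<bar>) \<longlonglongrightarrow> ?t" by (rule summable_LIMSEQ[OF s])
  moreover have "(\<lambda>N. 3 * b + 3 * (?t - (\<Sum>g<N. \<bar>a g\<bar>))) \<longlonglongrightarrow> 3 * b + 3 * (?t - ?t)"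
    by (intro tendsto_add tendsto_mult tendsto_diff tendsto_const summable_LIMSEQ[OF s])
  ultimately have "?t \<le> 3 * b + 3 * (?t - ?t)" using fin by (intro LIMSEQ_le) auto
  then show ?thesis by simp
qed

text \<open>On initial parts \<open>f\<close> is a finite combination of the \<open>ev g\<close>,
  with coefficients \<open>\<alpha> n\<close>. Since the tails vanish uniformly, these combinations
  converge to \<open>f\<close> in norm, and by \<open>ell1_functional_lower\<close> their
  coefficients form a Cauchy sequence in ell_1.\<close>

lemma ell1_functional_surj:
  fixes f :: "(nat \<Rightarrow>\<^sub>C real) \<Rightarrow> real"
  assumes ext: "f \<in> extensional X"
    and lin: "\<And>x y a b. x \<in> X \<Longrightarrow> y \<in> X \<Longrightarrow> f (a *\<^sub>R x + b *\<^sub>R y) = a * f x + b * f y"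
    and B: "\<And>x. x \<in> X \<Longrightarrow> \<bar>f x\<bar> \<le> B * norm x" "B \<ge> 0"
  shows "\<exists>a. summable (\<lambda>g. \<bar>a g\<bar>) \<and> f = ell1_functional a"
proof -
  let ?F = "\<lambda>x. f (emb x)"
  have eX: "emb x \<in> X" if "x \<in> XX" for x using that by (simp add: X_def)
  have Flin: "?F (\<lambda>z. a * x z + b * y z) = a * ?F x + b * ?F y" if "x \<in> XX" "y \<in> XX" for x y a b
    using lin[OF eX eX, OF that, of a b] emb_linear[OF that, of a b] by simp
  have FB: "\<bar>?F x\<bar> \<le> B * b" if "x \<in> XX" "bnd b x" for x b
    using B(1)[OF eX[OF that(1)]] mult_left_mono[OF norm_emb_le[OF that(2)] B(2)] by linarith
  have tl: "\<exists>n0. \<forall>n\<ge>n0. \<forall>x\<in>XX. \<bar>?F (tail n x)\<bar> \<le> e * norm (emb x)" if e: "e > 0" for e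
  proof -
    have "\<exists>n. \<forall>x\<in>XX. bnd 1 x \<longrightarrow> \<bar>?F (tail n x)\<bar> \<le> e / 3"
    proof (rule functional_null_tail[of ?F])
      show "?F (\<lambda>z. a * x z + b * y z) = a * ?F x + b * ?F y" if "x \<in> XX" "y \<in> XX" for x y a b by (rule Flin[OF that])
      show "\<bar>?F x\<bar> \<le> B * b" if "x \<in> XX" "bnd b x" for x b by (rule FB[OF that])
    qed (use B(2) e in auto)
    then obtain n0 where n0: "\<And>x. x \<in> XX \<Longrightarrow> bnd 1 x \<Longrightarrow> \<bar>?F (tail n0 x)\<bar> \<le> e / 3" by blast
    have "\<bar>?F (tail n x)\<bar> \<le> e * norm (emb x)" if n: "n \<ge> n0" and x: "x \<in> XX" for n x
    proof -
      let ?t = "tail n x"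
      have tX: "?t \<in> XX" using XX_mul[OF x adm_const[of 1]] by (simp add: tail_def)
      have bt: "bnd (3 * norm (emb x)) ?t" by (rule bnd_tail[OF bnd_norm_emb[OF x]])
      show ?thesis
      proof (cases "norm (emb x) = 0")
        case True
        then have "bnd 0 ?t" using bt by simp
        then show ?thesis using FB[OF tX] True by fastforce
      next
        case False
        let ?c = "3 * norm (emb x)"
        have c: "?c > 0" using False by simp
        let ?s = "\<lambda>z. (1 / ?c) * ?t z"
        have "bnd (\<bar>1 / ?c\<bar> * ?c) ?s" by (rule bnd_cmult[OF bt])
        then have "bnd 1 ?s" using c by simp
        then have "\<bar>?F (tail n0 ?s)\<bar> \<le> e / 3" using n0 XX_cmult[OF tX] by blast
        moreover have "tail n0 ?s = ?s" using n by (auto simp: tail_def mul_def)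
        moreover have "?F ?s = 1 / ?c * ?F ?t" using Flin[OF tX tX, of "1 / ?c" 0] by simp
        ultimately have "\<bar>?F ?t\<bar> / ?c \<le> e / 3" using c by (simp add: abs_mult)
        then show ?thesis using c by (simp add: field_simps)
      qed
    qed
    then show ?thesis by blast
  qed
  \<comment> \<open>The basis of the span of the first \<open>n\<close> unit vectors dual to the
    functionals \<open>ev h\<close> with \<open>h < n\<close>. It changes with \<open>n\<close>, and
    therefore so do the coefficients \<open>\<alpha> n g\<close>.\<close>
  obtain \<delta> where \<delta>: "\<And>n g. supp 0 n (\<delta> n g) \<and> (\<forall>h<n. ev h (\<delta> n g) = (if h = g then 1 else 0))"
  proof -
    have "\<forall>p. \<exists>x. supp 0 (fst p) x \<and> (\<forall>h<fst p. ev h x = (if h = snd p then 1 else 0))"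
      by (intro allI local_ext)
    from choice[OF this] obtain d where d: "\<forall>p. supp 0 (fst p) (d p) \<and> (\<forall>h<fst p. ev h (d p) = (if h = snd p then 1 else 0))" by blast
    have "supp 0 n (d (n, g)) \<and> (\<forall>h<n. ev h (d (n, g)) = (if h = g then 1 else 0))" for n g
      using spec[OF d, of "(n, g)"] by simp
    then show ?thesis by (rule that)
  qed
  define \<alpha> where "\<alpha> n g = (if g < n then ?F (\<delta> n g) else 0)" for n g
  have hd: "head n x = (\<lambda>z. \<Sum>g<n. ev g x * \<delta> n g z)" for n x
  proof
    fix z
    let ?d = "\<lambda>z. head n x z - (\<Sum>g<n. ev g x * \<delta> n g z)"
    have "ev h ?d = 0" if h: "h < n" for h
    proof -
      have "ev h (head n x) = ev h x" using h by (intro ev_cong) (auto simp: head_def)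
      moreover have "ev h (\<lambda>z. \<Sum>g<n. ev g x * \<delta> n g z) = (\<Sum>g<n. if g = h then ev h x else 0)"
        unfolding ev_sum ev_cmult using \<delta> h by (intro sum.cong) auto
      ultimately show ?thesis using h by (simp add: ev_diff)
    qed
    then have "?d z = 0" if "z < n" using that by (rule supp_ev_zero)
    moreover have "?d z = 0" if "\<not> z < n" using that \<delta>[of n] by (auto simp: head_def supp_def)
    ultimately show "head n x z = (\<Sum>g<n. ev g x * \<delta> n g z)" by fastforce
  qed
  have Fsum: "?F (\<lambda>z. \<Sum>k\<in>I. x k z) = (\<Sum>k\<in>I. ?F (x k))" if "finite I" "\<And>k. k \<in> I \<Longrightarrow> x k \<in> XX" for I and x :: "nat \<Rightarrow> nat \<Rightarrow> real"
    using that
  proof (induction I)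
    case empty
    show ?case using Flin[OF XX_zero XX_zero, of 0 0] by simp
  next
    case (insert k I)
    then show ?case using Flin[of "x k" "\<lambda>z. \<Sum>k\<in>I. x k z" 1 1] XX_sum[of I x] by simp
  qed
  have dX: "\<delta> n g \<in> XX" for n g using \<delta> XX_supp by blast
  have Fh: "?F (head n x) = (\<Sum>g<n. \<alpha> n g * ev g x)" for n x
  proof -
    have "?F (head n x) = (\<Sum>g<n. ?F (\<lambda>z. ev g x * \<delta> n g z))" unfolding hd using dX XX_cmult by (intro Fsum) auto
    also have "\<dots> = (\<Sum>g<n. \<alpha> n g * ev g x)"
    proof (intro sum.cong refl)
      fix g assume "g \<in> {..<n}"
      then show "?F (\<lambda>z. ev g x * \<delta> n g z) = \<alpha> n g * ev g x"
        using Flin[OF dX dX, of "ev g x" n g 0 n g] by (simp add: \<alpha>_def mult.commute)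
    qed
    finally show ?thesis .
  qed
  have sa: "summable (\<lambda>g. \<bar>\<alpha> n g\<bar>)" for n by (rule summable_finite[of "{..<n}"]) (auto simp: \<alpha>_def)
  have fa: "ell1_functional (\<alpha> n) (emb x) = ?F (head n x)" if x: "x \<in> XX" for n x
  proof -
    have "(\<Sum>g. \<alpha> n g * apply_bcontfun (emb x) g) = (\<Sum>g<n. \<alpha> n g * apply_bcontfun (emb x) g)"
      by (intro suminf_finite) (auto simp: \<alpha>_def)
    then show ?thesis unfolding Fh using eX[OF x] by (simp add: ell1_functional_def emb_apply_XX[OF x])
  qed
  have F_head: "?F (head n x) = ?F x - ?F (tail n x)" if x: "x \<in> XX" for n x
  proof -
    have tX: "tail n x \<in> XX" using XX_mul[OF x adm_const[of 1]] by (simp add: tail_def)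
    have "head n x = (\<lambda>z. 1 * x z + (-1) * tail n x z)" by (auto simp: head_def tail_def mul_def)
    then show ?thesis using Flin[OF x tX, of 1 "-1"] by simp
  qed
  have fd: "ell1_functional (\<lambda>g. a g - b g) y = ell1_functional a y - ell1_functional b y" if "summable (\<lambda>g. \<bar>a g\<bar>)" "summable (\<lambda>g. \<bar>b g\<bar>)" "y \<in> X" for a b y
    using suminf_diff[OF ell1_functional_summable(1)[OF that(1), of y] ell1_functional_summable(1)[OF that(2), of y]] that(3)
    by (simp add: ell1_functional_def left_diff_distrib)
  have sdiff: "summable (\<lambda>g. \<bar>a g - b g\<bar>)" if "summable (\<lambda>g. \<bar>a g\<bar>)" "summable (\<lambda>g. \<bar>b g\<bar>)" for a b :: "nat \<Rightarrow> real"
    by (rule summable_comparison_test[OF _ summable_add[OF that]]) (auto intro!: exI[of _ 0])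
  have "\<exists>N. \<forall>m\<ge>N. \<forall>n\<ge>N. (\<Sum>g. \<bar>\<alpha> m g - \<alpha> n g\<bar>) \<le> e" if e: "e > 0" for e
  proof -
    obtain N where N: "\<And>n x. n \<ge> N \<Longrightarrow> x \<in> XX \<Longrightarrow> \<bar>?F (tail n x)\<bar> \<le> e / 6 * norm (emb x)" using tl[of "e / 6"] e by auto
    have "(\<Sum>g. \<bar>\<alpha> m g - \<alpha> n g\<bar>) \<le> 3 * (e / 3)" if mn: "m \<ge> N" "n \<ge> N" for m n
    proof (rule ell1_functional_lower[OF sdiff[OF sa sa]])
      fix y assume y: "y \<in> X"
      then obtain x where x: "x \<in> XX" "y = emb x" by (auto simp: X_def)
      have "ell1_functional (\<lambda>g. \<alpha> m g - \<alpha> n g) y = ?F (tail n x) - ?F (tail m x)"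
        unfolding fd[OF sa sa y] using fa[OF x(1)] F_head[OF x(1)] x(2) by simp
      moreover have "\<bar>?F (tail n x)\<bar> \<le> e / 6 * norm y" "\<bar>?F (tail m x)\<bar> \<le> e / 6 * norm y" using N mn x by auto
      ultimately show "\<bar>ell1_functional (\<lambda>g. \<alpha> m g - \<alpha> n g) y\<bar> \<le> e / 3 * norm y" by linarith
    qed (use e in simp)
    then show ?thesis by auto
  qed
  from ell1_complete[OF sa this] obtain a where a: "summable (\<lambda>g. \<bar>a g\<bar>)"
    "\<And>e. e > 0 \<Longrightarrow> \<exists>N. \<forall>n\<ge>N. (\<Sum>g. \<bar>\<alpha> n g - a g\<bar>) \<le> e \<and> summable (\<lambda>g. \<bar>\<alpha> n g - a g\<bar>)" by blast
  have "f y = ell1_functional a y" for y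
  proof (cases "y \<in> X")
    case True
    then obtain x where x: "x \<in> XX" "y = emb x" by (auto simp: X_def)
    have "\<bar>f y - ell1_functional a y\<bar> \<le> 0"
    proof (rule field_le_epsilon)
      fix e :: real assume e: "e > 0"
      define e' where "e' = e / (2 * (norm y + 1))"
      have e': "e' > 0" using e by (simp add: e'_def add_nonneg_pos)
      obtain N1 where N1: "\<forall>n\<ge>N1. (\<Sum>g. \<bar>\<alpha> n g - a g\<bar>) \<le> e' \<and> summable (\<lambda>g. \<bar>\<alpha> n g - a g\<bar>)" using a(2)[OF e'] by blast
      obtain N2 where N2: "\<forall>n\<ge>N2. \<forall>x\<in>XX. \<bar>?F (tail n x)\<bar> \<le> e' * norm (emb x)" using tl[OF e'] by blast
      let ?n = "max N1 N2"
      have "\<bar>ell1_functional (\<lambda>g. \<alpha> ?n g - a g) y\<bar> \<le> (\<Sum>g. \<bar>\<alpha> ?n g - a g\<bar>) * norm y"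
        using ell1_functional_summable(2)[OF sdiff[OF sa a(1)], of ?n y] True by (simp add: ell1_functional_def)
      also have "\<dots> \<le> e' * norm y" using N1 by (intro mult_right_mono) auto
      finally have 1: "\<bar>ell1_functional (\<alpha> ?n) y - ell1_functional a y\<bar> \<le> e' * norm y" unfolding fd[OF sa a(1) True] .
      have "\<bar>?F (tail ?n x)\<bar> \<le> e' * norm (emb x)" using N2 x(1) by simp
      then have 2: "\<bar>f y - ell1_functional (\<alpha> ?n) y\<bar> \<le> e' * norm y" using fa[OF x(1)] F_head[OF x(1)] x(2) by simp
      have "\<bar>f y - ell1_functional a y\<bar> \<le> e' * (2 * norm y)" using 1 2 by linarith
      also have "\<dots> \<le> e' * (2 * (norm y + 1))" using e' by (intro mult_left_mono) auto
      also have "\<dots> = e"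
      proof -
        have "norm y + 1 > 0" by (simp add: add_nonneg_pos)
        then show ?thesis unfolding e'_def by simp
      qed
      finally show "\<bar>f y - ell1_functional a y\<bar> \<le> 0 + e" by simp
    qed
    then show ?thesis by simp
  next
    case False
    then show ?thesis using ext by (simp add: ell1_functional_def extensional_def)
  qed
  then show ?thesis using a(1) by blast
qed

lemma dual_isomorphic: "normed_isomorphic (dual_space X) ell1"
proof -
  have cE: "carrier ell1 = {a. summable (\<lambda>n. \<bar>a n\<bar>)}" "nrm ell1 = (\<lambda>a. \<Sum>n. \<bar>a n\<bar>)"
    "\<And>a b. a \<oplus>\<^bsub>ell1\<^esub> b = (\<lambda>n. a n + b n)" "\<And>c a. c \<odot>\<^bsub>ell1\<^esub> a = (\<lambda>n. c * a n)" by (simp_all add: ell1_def)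
  let ?U = "normed_subspace UNIV :: real normed_module" and ?X = "normed_subspace X"
  have cX: "carrier ?X = X" "nrm ?X = norm" "\<And>x y. x \<oplus>\<^bsub>?X\<^esub> y = x + y" "\<And>a x. a \<odot>\<^bsub>?X\<^esub> x = a *\<^sub>R x"
    by (simp_all add: normed_subspace_def)
  have cU: "carrier ?U = UNIV" "nrm ?U = norm" "\<And>x y. x \<oplus>\<^bsub>?U\<^esub> y = x + y" "\<And>a x. a \<odot>\<^bsub>?U\<^esub> x = a *\<^sub>R x"
    by (simp_all add: normed_subspace_def)
  have cD: "carrier (dual_space X) = {f \<in> extensional X. bounded_linear_map ?X ?U f}"
    "nrm (dual_space X) = operator_norm ?X ?U"
    "\<And>f g. f \<oplus>\<^bsub>dual_space X\<^esub> g = (\<lambda>x\<in>X. f x + g x)" "\<And>c f. c \<odot>\<^bsub>dual_space X\<^esub> f = (\<lambda>x\<in>X. c * f x)"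
    by (simp_all add: dual_space_def operator_space_def cX(1) cU(3,4))
  have X0: "0 \<in> X" using X_subspace by (rule subspace_0)
  have up: "\<bar>ell1_functional a y\<bar> \<le> (\<Sum>g. \<bar>a g\<bar>) * norm y" if "summable (\<lambda>g. \<bar>a g\<bar>)" "y \<in> X" for a y
    using ell1_functional_summable(2)[OF that(1), of y] that(2) by (simp add: ell1_functional_def)
  have lin: "ell1_functional a (c *\<^sub>R x + d *\<^sub>R y) = c * ell1_functional a x + d * ell1_functional a y" if "summable (\<lambda>g. \<bar>a g\<bar>)" "x \<in> X" "y \<in> X" for a c d x y
  proof -
    have "(\<Sum>g. a g * apply_bcontfun (c *\<^sub>R x + d *\<^sub>R y) g) =
      (\<Sum>g. c * (a g * apply_bcontfun x g) + d * (a g * apply_bcontfun y g))" by (simp add: algebra_simps)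
    also have "\<dots> = c * (\<Sum>g. a g * apply_bcontfun x g) + d * (\<Sum>g. a g * apply_bcontfun y g)"
      using ell1_functional_summable(1)[OF that(1)] by (simp add: suminf_add[symmetric] suminf_mult summable_mult)
    finally show ?thesis using X_linear[OF that(2,3), of c d] that by (simp add: ell1_functional_def)
  qed
  have inD: "ell1_functional a \<in> carrier (dual_space X)" if "summable (\<lambda>g. \<bar>a g\<bar>)" for a
    unfolding cD mem_Collect_eq bounded_linear_map_def cX cU
  proof (intro conjI ballI allI)
    show "ell1_functional a \<in> extensional X" by (simp add: ell1_functional_def)
    show "ell1_functional a (x + y) = ell1_functional a x + ell1_functional a y" if "x \<in> X" "y \<in> X" for x y using lin[OF \<open>summable _\<close> that, of 1 1] by simp
    show "ell1_functional a (c *\<^sub>R x) = c *\<^sub>R ell1_functional a x" if "x \<in> X" for c x using lin[OF \<open>summable _\<close> that that, of c 0] by simp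
    show "\<exists>B. \<forall>x\<in>X. norm (ell1_functional a x) \<le> B * norm x" using up[OF that] by auto
  qed simp
  have bl: "bounded_linear_map ell1 (dual_space X) ell1_functional"
    unfolding bounded_linear_map_def cE cD(2-4)
  proof (intro conjI ballI allI)
    show "ell1_functional \<in> {a. summable (\<lambda>n. \<bar>a n\<bar>)} \<rightarrow> carrier (dual_space X)" using inD by auto
    fix a assume "a \<in> {a::nat \<Rightarrow> real. summable (\<lambda>n. \<bar>a n\<bar>)}"
    then have a: "summable (\<lambda>n. \<bar>a n\<bar>)" by simp
    show "ell1_functional (\<lambda>n. c * a n) = (\<lambda>x\<in>X. c * ell1_functional a x)" for c
    proof
      fix y show "ell1_functional (\<lambda>n. c * a n) y = (\<lambda>x\<in>X. c * ell1_functional a x) y"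
        using suminf_mult[OF ell1_functional_summable(1)[OF a, of y], of c] by (simp add: ell1_functional_def mult.assoc)
    qed
    fix b assume "b \<in> {a::nat \<Rightarrow> real. summable (\<lambda>n. \<bar>a n\<bar>)}"
    then have b: "summable (\<lambda>n. \<bar>b n\<bar>)" by simp
    show "ell1_functional (\<lambda>n. a n + b n) = (\<lambda>x\<in>X. ell1_functional a x + ell1_functional b x)"
    proof
      fix y show "ell1_functional (\<lambda>n. a n + b n) y = (\<lambda>x\<in>X. ell1_functional a x + ell1_functional b x) y"
        using suminf_add[OF ell1_functional_summable(1)[OF a, of y] ell1_functional_summable(1)[OF b, of y]] by (simp add: ell1_functional_def distrib_right)
    qed
  next
    show "\<exists>B. \<forall>a\<in>{a. summable (\<lambda>n. \<bar>a n\<bar>)}. operator_norm ?X ?U (ell1_functional a) \<le> B * (\<Sum>n. \<bar>a n\<bar>)"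
    proof (intro exI[of _ 1] ballI)
      fix a assume "a \<in> {a::nat \<Rightarrow> real. summable (\<lambda>n. \<bar>a n\<bar>)}"
      then have a: "summable (\<lambda>n. \<bar>a n\<bar>)" by simp
      have "operator_norm ?X ?U (ell1_functional a) \<le> (\<Sum>n. \<bar>a n\<bar>)"
        using X0 up[OF a] suminf_nonneg[OF a] by (intro operator_norm_le) (auto simp: cX cU)
      then show "operator_norm ?X ?U (ell1_functional a) \<le> 1 * (\<Sum>n. \<bar>a n\<bar>)" by simp
    qed
  qed
  have low: "(\<Sum>n. \<bar>a n\<bar>) \<le> 3 * operator_norm ?X ?U (ell1_functional a)" if a: "summable (\<lambda>n. \<bar>a n\<bar>)" for a
  proof (rule ell1_functional_lower[OF a])
    note N = operator_norm_nonneg[of 0 ?X ?U "ell1_functional a" "\<Sum>n. \<bar>a n\<bar>"]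
    show "operator_norm ?X ?U (ell1_functional a) \<ge> 0"
      using X0 up[OF a] suminf_nonneg[OF a] by (intro N(1)) (auto simp: cX cU)
    show "\<bar>ell1_functional a y\<bar> \<le> operator_norm ?X ?U (ell1_functional a) * norm y" if "y \<in> X" for y
      using X0 up[OF a] suminf_nonneg[OF a] N(2)[of y] that lin[OF a X0 X0, of 0 0] by (simp add: cX cU)
  qed
  have inj: "inj_on ell1_functional (carrier ell1)"
  proof (rule inj_onI)
    fix a b assume "a \<in> carrier ell1" "b \<in> carrier ell1" and e: "ell1_functional a = ell1_functional b"
    then have a: "summable (\<lambda>n. \<bar>a n\<bar>)" and b: "summable (\<lambda>n. \<bar>b n\<bar>)" by (auto simp: cE)
    have s: "summable (\<lambda>n. \<bar>a n - b n\<bar>)"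
      by (rule summable_comparison_test[OF _ summable_add[OF a b]]) (auto intro!: exI[of _ 0])
    have "(\<Sum>n. \<bar>a n - b n\<bar>) \<le> 3 * 0"
    proof (rule ell1_functional_lower[OF s])
      fix y assume y: "y \<in> X"
      have "ell1_functional (\<lambda>n. a n - b n) y = ell1_functional a y - ell1_functional b y"
        using suminf_diff[OF ell1_functional_summable(1)[OF a, of y] ell1_functional_summable(1)[OF b, of y]] y by (simp add: ell1_functional_def left_diff_distrib)
      then show "\<bar>ell1_functional (\<lambda>n. a n - b n) y\<bar> \<le> 0 * norm y" using e by simp
    qed simp
    then have "(\<Sum>n. \<bar>a n - b n\<bar>) = 0" using suminf_nonneg[OF s] by simp
    then have "\<forall>n. \<bar>a n - b n\<bar> = 0" using suminf_eq_zero_iff[OF s] by simp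
    then show "a = b" by auto
  qed
  have im: "ell1_functional ` carrier ell1 = carrier (dual_space X)"
  proof
    show "ell1_functional ` carrier ell1 \<subseteq> carrier (dual_space X)" using inD by (auto simp: cE)
    show "carrier (dual_space X) \<subseteq> ell1_functional ` carrier ell1"
    proof
      fix f assume "f \<in> carrier (dual_space X)"
      then have f: "f \<in> extensional X" "\<And>x y. x \<in> X \<Longrightarrow> y \<in> X \<Longrightarrow> f (x + y) = f x + f y"
        "\<And>c x. x \<in> X \<Longrightarrow> f (c *\<^sub>R x) = c * f x" "\<exists>B. \<forall>x\<in>X. norm (f x) \<le> B * norm x"
        unfolding cD mem_Collect_eq bounded_linear_map_def cX cU by auto
      obtain B where B: "\<forall>x\<in>X. norm (f x) \<le> B * norm x" using f(4) by blast
      have "\<exists>a. summable (\<lambda>g. \<bar>a g\<bar>) \<and> f = ell1_functional a"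
      proof (rule ell1_functional_surj[OF f(1)])
        show "f (c *\<^sub>R x + d *\<^sub>R y) = c * f x + d * f y" if "x \<in> X" "y \<in> X" for x y c d
          using f(2,3) that X_subspace subspace_scale by metis
        show "\<bar>f x\<bar> \<le> max B 0 * norm x" if "x \<in> X" for x
          using B that mult_right_mono[of B "max B 0" "norm x"] by force
      qed simp
      then show "f \<in> ell1_functional ` carrier ell1" by (auto simp: cE)
    qed
  qed
  have "normed_iso (dual_space X) ell1 (inv_into (carrier ell1) ell1_functional)"
  proof (rule normed_iso_criterion(2)[OF bl inj im])
    show "nrm ell1 a \<le> 3 * nrm (dual_space X) (ell1_functional a)" if "a \<in> carrier ell1" for a
      using low that by (simp add: cE cD)
    show "a \<oplus>\<^bsub>ell1\<^esub> b \<in> carrier ell1" if "a \<in> carrier ell1" "b \<in> carrier ell1" for a b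
    proof -
      have "summable (\<lambda>n. \<bar>a n\<bar> + \<bar>b n\<bar>)" using that by (auto simp: cE intro: summable_add)
      then have "summable (\<lambda>n. \<bar>a n + b n\<bar>)" by (rule summable_comparison_test[rotated]) (auto intro!: exI[of _ 0])
      then show ?thesis by (simp add: cE)
    qed
    show "c \<odot>\<^bsub>ell1\<^esub> a \<in> carrier ell1" if "a \<in> carrier ell1" for a c
      using that by (auto simp: cE abs_mult intro: summable_mult)
  qed
  then show ?thesis unfolding normed_isomorphic_def by blast
qed

end

section \<open>The Calkin algebra\<close>

text \<open>The library instance requires a metric on the domain, which \<^typ>\<open>nat\<close> does not have.\<close>

lemma complete_bcontfun: "complete (UNIV :: ('a::topological_space \<Rightarrow>\<^sub>C 'b::complete_space) set)"
proof (rule completeI)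
  fix f :: "nat \<Rightarrow> 'a \<Rightarrow>\<^sub>C 'b" assume f: "Cauchy f"
  have ex: "\<exists>N. \<forall>m\<ge>N. \<forall>n\<ge>N. \<forall>x. dist (apply_bcontfun (f m) x) (apply_bcontfun (f n) x) < e" if e: "e > 0" for e :: real
  proof -
    obtain N where N: "\<And>m n. N \<le> m \<Longrightarrow> N \<le> n \<Longrightarrow> dist (f m) (f n) < e"
      using metric_CauchyD[OF f e] by auto
    show ?thesis
    proof (intro exI[of _ N] allI impI)
      fix m n x assume "m \<ge> N" "n \<ge> N"
      then show "dist (apply_bcontfun (f m) x) (apply_bcontfun (f n) x) < e"
        using dist_bounded[of "f m" x "f n"] N[of m n] by linarith
    qed
  qed
  define g where "g = (\<lambda>x. lim (\<lambda>n. apply_bcontfun (f n) x))"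
  have g: "(\<lambda>n. apply_bcontfun (f n) x) \<longlonglongrightarrow> g x" for x
  proof -
    have "Cauchy (\<lambda>n. apply_bcontfun (f n) x)"
    proof (rule metric_CauchyI)
      fix e :: real assume "e > 0"
      show "\<exists>N. \<forall>m\<ge>N. \<forall>n\<ge>N. dist (apply_bcontfun (f m) x) (apply_bcontfun (f n) x) < e"
        using ex[OF \<open>e > 0\<close>] by auto
    qed
    then show ?thesis unfolding g_def by (simp add: Cauchy_convergent convergent_LIMSEQ_iff[symmetric])
  qed
  have "uniform_limit UNIV (\<lambda>n. apply_bcontfun (f n)) g sequentially"
  proof (rule uniform_limitI)
    fix e :: real assume "e > 0"
    then obtain N where N: "\<forall>m\<ge>N. \<forall>n\<ge>N. \<forall>x. dist (apply_bcontfun (f m) x) (apply_bcontfun (f n) x) < e/2"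
      using ex[of "e/2"] by auto
    have "dist (apply_bcontfun (f n) x) (g x) \<le> e/2" if "n \<ge> N" for n x
    proof (rule tendsto_upperbound[OF tendsto_dist[OF tendsto_const g] _ sequentially_bot])
      show "\<forall>\<^sub>F m in sequentially. dist (apply_bcontfun (f n) x) (apply_bcontfun (f m) x) \<le> e/2"
        using eventually_ge_at_top[of N] by eventually_elim (use N that in \<open>auto intro: less_imp_le\<close>)
    qed
    moreover have "e/2 < e" using \<open>e > 0\<close> by simp
    ultimately show "\<forall>\<^sub>F n in sequentially. \<forall>x\<in>UNIV. dist (apply_bcontfun (f n) x) (g x) < e"
      unfolding eventually_sequentially by (meson le_less_trans)
  qed
  from uniform_limit_bcontfunE[OF this sequentially_bot]
  obtain h where "f \<longlonglongrightarrow> h" by auto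
  then show "\<exists>l\<in>UNIV. f \<longlonglongrightarrow> l" by auto
qed

section \<open>The rings of operators and of continuous functions\<close>

context ah_system
begin

abbreviation "LL \<equiv> operator_algebra X"

abbreviation "CK \<equiv> continuous_function_algebra K"

lemma X_zero: "0 \<in> X" using X_subspace by (rule subspace_0)

lemma X_add: "x \<in> X \<Longrightarrow> y \<in> X \<Longrightarrow> x + y \<in> X" using X_subspace by (rule subspace_add)

lemma X_scale: "x \<in> X \<Longrightarrow> c *\<^sub>R x \<in> X" using X_subspace by (rule subspace_scale)

lemma LL_sel:
  "nrm LL = operator_norm (normed_subspace X) (normed_subspace X)"
  "S \<oplus>\<^bsub>LL\<^esub> T = (\<lambda>x\<in>X. S x + T x)" "S \<otimes>\<^bsub>LL\<^esub> T = compose X S T" "\<one>\<^bsub>LL\<^esub> = (\<lambda>x\<in>X. x)"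
  "\<zero>\<^bsub>LL\<^esub> = (\<lambda>x\<in>X. 0)" "c \<odot>\<^bsub>LL\<^esub> T = (\<lambda>x\<in>X. c *\<^sub>R T x)"
  by (simp_all add: operator_algebra_def operator_space_def normed_subspace_def)

lemma LL_carrier: "T \<in> carrier LL \<longleftrightarrow> T \<in> extensional X \<and> (\<forall>x\<in>X. T x \<in> X) \<and>
    (\<forall>x\<in>X. \<forall>y\<in>X. T (x + y) = T x + T y) \<and> (\<forall>c. \<forall>x\<in>X. T (c *\<^sub>R x) = c *\<^sub>R T x) \<and>
    (\<exists>B. \<forall>x\<in>X. norm (T x) \<le> B * norm x)"
  by (simp add: operator_algebra_def operator_space_def normed_subspace_def bounded_linear_map_def Pi_iff)

lemma LL_D:
  assumes "T \<in> carrier LL"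
  shows "x \<in> X \<Longrightarrow> T x \<in> X" and "x \<in> X \<Longrightarrow> y \<in> X \<Longrightarrow> T (x + y) = T x + T y"
    and "x \<in> X \<Longrightarrow> T (c *\<^sub>R x) = c *\<^sub>R T x" and "x \<notin> X \<Longrightarrow> T x = undefined"
  using assms unfolding LL_carrier by (auto simp: extensional_def)

lemma LL_D0: "T \<in> carrier LL \<Longrightarrow> T 0 = 0"
  using LL_D(3)[of T 0 0] X_zero by simp

lemma LL_eqI: "S \<in> carrier LL \<Longrightarrow> T \<in> carrier LL \<Longrightarrow> (\<And>x. x \<in> X \<Longrightarrow> S x = T x) \<Longrightarrow> S = T"
  unfolding LL_carrier by (blast intro: extensionalityI)

lemma LL_norm:
  assumes T: "T \<in> carrier LL"
  shows "nrm LL T \<ge> 0" and "x \<in> X \<Longrightarrow> norm (T x) \<le> nrm LL T * norm x"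
proof -
  let ?V = "normed_subspace X"
  have V: "carrier ?V = X" "nrm ?V = norm" by (simp_all add: normed_subspace_def)
  obtain B where B: "\<And>x. x \<in> X \<Longrightarrow> norm (T x) \<le> B * norm x" using T unfolding LL_carrier by blast
  have B': "norm (T x) \<le> max B 0 * norm x" if "x \<in> X" for x
    using B[OF that] mult_right_mono[of B "max B 0" "norm x"] by force
  note N = operator_norm_nonneg[of 0 ?V ?V T "max B 0"]
  show "nrm LL T \<ge> 0" unfolding LL_sel using X_zero B' by (intro N(1)) (auto simp: V)
  show "norm (T x) \<le> nrm LL T * norm x" if "x \<in> X"
    unfolding LL_sel using N(2)[of x] X_zero B' that LL_D0[OF T] by (simp add: V)
qed

lemma LL_norm_le: "b \<ge> 0 \<Longrightarrow> (\<And>x. x \<in> X \<Longrightarrow> norm (T x) \<le> b * norm x) \<Longrightarrow> nrm LL T \<le> b"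
  unfolding LL_sel using X_zero by (intro operator_norm_le) (auto simp: normed_subspace_def)

lemma LL_I:
  assumes "T \<in> extensional X" "\<And>x. x \<in> X \<Longrightarrow> T x \<in> X"
    and "\<And>x y. x \<in> X \<Longrightarrow> y \<in> X \<Longrightarrow> T (x + y) = T x + T y" "\<And>c x. x \<in> X \<Longrightarrow> T (c *\<^sub>R x) = c *\<^sub>R T x"
    and "\<And>x. x \<in> X \<Longrightarrow> norm (T x) \<le> B * norm x"
  shows "T \<in> carrier LL"
  unfolding LL_carrier using assms(1-4) exI[of "\<lambda>B. \<forall>x\<in>X. norm (T x) \<le> B * norm x", of B] assms(5)
  by (intro conjI ballI allI) simp_all

lemma LL_add: "S \<in> carrier LL \<Longrightarrow> T \<in> carrier LL \<Longrightarrow> S \<oplus>\<^bsub>LL\<^esub> T \<in> carrier LL"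
proof (rule LL_I[where B = "nrm LL S + nrm LL T"])
  fix x assume "S \<in> carrier LL" "T \<in> carrier LL" "x \<in> X"
  then have "norm (S x) \<le> nrm LL S * norm x" "norm (T x) \<le> nrm LL T * norm x" by (auto intro: LL_norm)
  then show "norm ((S \<oplus>\<^bsub>LL\<^esub> T) x) \<le> (nrm LL S + nrm LL T) * norm x"
    using norm_triangle_ineq[of "S x" "T x"] \<open>x \<in> X\<close> by (simp add: LL_sel distrib_right)
qed (auto simp: LL_sel LL_D X_add X_scale scaleR_add_right)

lemma LL_smult: "T \<in> carrier LL \<Longrightarrow> c \<odot>\<^bsub>LL\<^esub> T \<in> carrier LL"
proof (rule LL_I[where B = "\<bar>c\<bar> * nrm LL T"])
  fix x assume "T \<in> carrier LL" "x \<in> X"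
  then have "norm (T x) \<le> nrm LL T * norm x" by (auto intro: LL_norm)
  then show "norm ((c \<odot>\<^bsub>LL\<^esub> T) x) \<le> \<bar>c\<bar> * nrm LL T * norm x"
    using \<open>x \<in> X\<close> by (simp add: LL_sel mult.assoc mult_left_mono)
qed (auto simp: LL_sel LL_D X_add X_scale scaleR_add_right)

lemma LL_mult: "S \<in> carrier LL \<Longrightarrow> T \<in> carrier LL \<Longrightarrow> S \<otimes>\<^bsub>LL\<^esub> T \<in> carrier LL"
proof (rule LL_I[where B = "nrm LL S * nrm LL T"])
  fix x assume a: "S \<in> carrier LL" "T \<in> carrier LL" "x \<in> X"
  then have "norm (S (T x)) \<le> nrm LL S * norm (T x)" by (auto intro: LL_norm LL_D)
  also have "\<dots> \<le> nrm LL S * (nrm LL T * norm x)" using a by (intro mult_left_mono LL_norm) auto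
  finally show "norm ((S \<otimes>\<^bsub>LL\<^esub> T) x) \<le> nrm LL S * nrm LL T * norm x"
    using a by (simp add: LL_sel compose_def mult.assoc)
qed (auto simp: LL_sel compose_def LL_D X_add X_scale)

lemma LL_zero: "\<zero>\<^bsub>LL\<^esub> \<in> carrier LL"
  by (rule LL_I[where B = 0]) (auto simp: LL_sel X_zero X_add X_scale)

lemma LL_one: "\<one>\<^bsub>LL\<^esub> \<in> carrier LL"
  by (rule LL_I[where B = 1]) (auto simp: LL_sel X_add X_scale)

lemmas LL_closed = LL_add LL_smult LL_mult LL_zero LL_one

lemma LL_ring: "ring LL"
proof (rule ringI)
  show "abelian_group LL"
  proof (rule abelian_groupI)
    show "\<exists>y\<in>carrier LL. y \<oplus>\<^bsub>LL\<^esub> T = \<zero>\<^bsub>LL\<^esub>" if T: "T \<in> carrier LL" for T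
      by (rule bexI[OF _ LL_smult[OF T, of "-1"]], rule LL_eqI)
        (auto simp: T LL_closed, auto simp: LL_sel)
  qed (auto simp: LL_closed intro!: LL_eqI, auto simp: LL_sel LL_D X_add algebra_simps)
  show "monoid LL"
    by (rule monoidI) (auto simp: LL_closed intro!: LL_eqI, auto simp: LL_sel compose_def LL_D)
qed (auto simp: LL_closed intro!: LL_eqI, auto simp: LL_sel compose_def LL_D X_add)

lemma CK_sel:
  "carrier CK = {f \<in> extensional K. continuous_on K f}"
  "nrm CK f = (SUP x\<in>K. \<bar>f x\<bar>)" "f \<oplus>\<^bsub>CK\<^esub> g = (\<lambda>x\<in>K. f x + g x)" "f \<otimes>\<^bsub>CK\<^esub> g = (\<lambda>x\<in>K. f x * g x)"
  "\<one>\<^bsub>CK\<^esub> = (\<lambda>x\<in>K. 1)" "\<zero>\<^bsub>CK\<^esub> = (\<lambda>x\<in>K. 0)" "c \<odot>\<^bsub>CK\<^esub> f = (\<lambda>x\<in>K. c * f x)"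
  by (simp_all add: continuous_function_algebra_def)

lemma CK_I: "continuous_on K f \<Longrightarrow> (\<lambda>x\<in>K. f x) \<in> carrier CK"
  by (auto simp: CK_sel cong: continuous_on_cong)

lemma CK_cont: "f \<in> carrier CK \<Longrightarrow> continuous_on K f" by (simp add: CK_sel)

lemma CK_eqI: "f \<in> carrier CK \<Longrightarrow> g \<in> carrier CK \<Longrightarrow> (\<And>x. x \<in> K \<Longrightarrow> f x = g x) \<Longrightarrow> f = g"
  by (auto simp: CK_sel intro: extensionalityI)

lemma CK_closed:
  "f \<in> carrier CK \<Longrightarrow> g \<in> carrier CK \<Longrightarrow> f \<oplus>\<^bsub>CK\<^esub> g \<in> carrier CK"
  "f \<in> carrier CK \<Longrightarrow> g \<in> carrier CK \<Longrightarrow> f \<otimes>\<^bsub>CK\<^esub> g \<in> carrier CK"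
  "f \<in> carrier CK \<Longrightarrow> c \<odot>\<^bsub>CK\<^esub> f \<in> carrier CK"
  "\<zero>\<^bsub>CK\<^esub> \<in> carrier CK" "\<one>\<^bsub>CK\<^esub> \<in> carrier CK"
  unfolding CK_sel(3-7) by (rule CK_I, intro continuous_intros; simp add: CK_cont)+

lemma CK_ring: "ring CK"
proof (rule ringI)
  show "abelian_group CK"
  proof (rule abelian_groupI)
    show "\<exists>y\<in>carrier CK. y \<oplus>\<^bsub>CK\<^esub> f = \<zero>\<^bsub>CK\<^esub>" if f: "f \<in> carrier CK" for f
      by (rule bexI[OF _ CK_closed(3)[OF f, of "-1"]], rule CK_eqI)
        (auto simp: f CK_closed, auto simp: CK_sel)
  qed (auto simp: CK_closed intro!: CK_eqI, auto simp: CK_sel(3-7))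
  show "monoid CK"
    by (rule monoidI) (auto simp: CK_closed intro!: CK_eqI, auto simp: CK_sel(3-7))
qed (auto simp: CK_closed intro!: CK_eqI, auto simp: CK_sel(3-7) algebra_simps)

lemma CK_norm: "f \<in> carrier CK \<Longrightarrow> t \<in> K \<Longrightarrow> \<bar>f t\<bar> \<le> nrm CK f"
proof -
  assume f: "f \<in> carrier CK" and t: "t \<in> K"
  have "compact ((\<lambda>x. \<bar>f x\<bar>) ` K)" using CK_cont[OF f] compact_K by (intro compact_continuous_image continuous_intros)
  then have "bdd_above ((\<lambda>x. \<bar>f x\<bar>) ` K)" by (intro bounded_imp_bdd_above compact_imp_bounded)
  then show ?thesis unfolding CK_sel by (rule cSUP_upper[OF t])
qed

lemma CK_norm_le: "(\<And>t. t \<in> K \<Longrightarrow> \<bar>f t\<bar> \<le> b) \<Longrightarrow> nrm CK f \<le> b"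
  unfolding CK_sel using K_ne by (rule cSUP_least)

section \<open>The homomorphism onto the continuous functions and its kernel\<close>

definition opc :: "((nat \<Rightarrow>\<^sub>C real) \<Rightarrow> (nat \<Rightarrow>\<^sub>C real)) \<Rightarrow> (nat \<Rightarrow> real) \<Rightarrow> nat \<Rightarrow> real" where
  "opc T x = co (T (emb x))"

lemma emb_X: "x \<in> XX \<Longrightarrow> emb x \<in> X" by (simp add: X_def)

lemma emb_opc: "T \<in> carrier LL \<Longrightarrow> x \<in> XX \<Longrightarrow> emb (opc T x) = T (emb x)"
  unfolding opc_def by (rule emb_co[OF LL_D(1)[OF _ emb_X]])

lemma op_ah:
  assumes T: "T \<in> carrier LL"
  shows "ah_operator K sim lab wt age cut e1 e2 prd c1 c2 (opc T) (nrm LL T)"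
proof unfold_locales
  show "opc T x \<in> XX" if "x \<in> XX" for x unfolding opc_def by (rule co_X[OF LL_D(1)[OF T emb_X[OF that]]])
  show "opc T (\<lambda>z. a * x z + b * y z) = (\<lambda>z. a * opc T x z + b * opc T y z)" if "x \<in> XX" "y \<in> XX" for x y a b
  proof -
    have "T (emb (\<lambda>z. a * x z + b * y z)) = a *\<^sub>R T (emb x) + b *\<^sub>R T (emb y)"
      using that by (simp add: emb_linear LL_D[OF T] X_scale emb_X)
    then show ?thesis unfolding opc_def
      by (simp only: co_linear[OF LL_D(1)[OF T emb_X[OF that(1)]] LL_D(1)[OF T emb_X[OF that(2)]]])
  qed
  show "bnd (nrm LL T * b) (opc T x)" if "x \<in> XX" "bnd b x" for x b
  proof -
    have "norm (T (emb x)) \<le> nrm LL T * norm (emb x)" using T that emb_X LL_norm by blast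
    also have "\<dots> \<le> nrm LL T * b" using LL_norm(1)[OF T] norm_emb_le[OF that(2)] by (intro mult_left_mono)
    finally show ?thesis unfolding opc_def using co_bnd[OF LL_D(1)[OF T emb_X[OF that(1)]]] bnd_mono by blast
  qed
qed (rule LL_norm(1)[OF T])

lemma opc_linear:
  assumes S: "S \<in> carrier LL" and T: "T \<in> carrier LL" and U: "\<And>x. x \<in> X \<Longrightarrow> U x = a *\<^sub>R S x + b *\<^sub>R T x" and x: "x \<in> XX"
  shows "opc U x = (\<lambda>z. a * opc S x z + b * opc T x z)"
  unfolding opc_def using U[OF emb_X[OF x]] co_linear LL_D(1)[OF S emb_X[OF x]] LL_D(1)[OF T emb_X[OF x]] by simp

lemma dfun_opc_linear:
  assumes S: "S \<in> carrier LL" and T: "T \<in> carrier LL" and U: "U \<in> carrier LL"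
    and eq: "\<And>x. x \<in> X \<Longrightarrow> U x = a *\<^sub>R S x + b *\<^sub>R T x" and t: "t \<in> K"
  shows "dfun (opc U) t = a * dfun (opc S) t + b * dfun (opc T) t"
proof (rule ah_operator.dfun_eqI[OF op_ah[OF U] t])
  fix e :: real assume e: "e > 0"
  let ?d = "e / (\<bar>a\<bar> + \<bar>b\<bar> + 1)"
  have d: "?d > 0" using e by (simp add: add_nonneg_pos)
  obtain P where P: "\<forall>g\<ge>P. junk_element g \<longrightarrow> sim P (lab g) t \<longrightarrow> \<bar>diag_coeff (opc S) g - dfun (opc S) t\<bar> \<le> ?d"
    using ah_operator.dfun_limit[OF op_ah[OF S] t d] by blast
  obtain Q where Q: "\<forall>g\<ge>Q. junk_element g \<longrightarrow> sim Q (lab g) t \<longrightarrow> \<bar>diag_coeff (opc T) g - dfun (opc T) t\<bar> \<le> ?d"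
    using ah_operator.dfun_limit[OF op_ah[OF T] t d] by blast
  have "\<bar>diag_coeff (opc U) g - (a * dfun (opc S) t + b * dfun (opc T) t)\<bar> \<le> e" if g: "g \<ge> max P Q" "junk_element g" "lab g = t" for g
  proof -
    have 1: "\<bar>diag_coeff (opc S) g - dfun (opc S) t\<bar> \<le> ?d" "\<bar>diag_coeff (opc T) g - dfun (opc T) t\<bar> \<le> ?d"
      using P Q g sim_refl by auto
    have "diag_coeff (opc U) g = a * diag_coeff (opc S) g + b * diag_coeff (opc T) g"
      unfolding diag_coeff_def using opc_linear[OF S T eq unit_XX] by simp
    then have eq: "diag_coeff (opc U) g - (a * dfun (opc S) t + b * dfun (opc T) t) =
      a * (diag_coeff (opc S) g - dfun (opc S) t) + b * (diag_coeff (opc T) g - dfun (opc T) t)" by (simp add: algebra_simps)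
    have "\<bar>diag_coeff (opc U) g - (a * dfun (opc S) t + b * dfun (opc T) t)\<bar> \<le>
      \<bar>a\<bar> * \<bar>diag_coeff (opc S) g - dfun (opc S) t\<bar> + \<bar>b\<bar> * \<bar>diag_coeff (opc T) g - dfun (opc T) t\<bar>"
      unfolding eq abs_mult[symmetric] by (rule abs_triangle_ineq)
    also have "\<dots> \<le> \<bar>a\<bar> * ?d + \<bar>b\<bar> * ?d" using 1 by (intro add_mono mult_left_mono) auto
    also have "\<dots> = (\<bar>a\<bar> + \<bar>b\<bar>) * ?d" by (simp only: distrib_right)
    also have "\<dots> \<le> (\<bar>a\<bar> + \<bar>b\<bar> + 1) * ?d" using d by (intro mult_right_mono) auto
    also have "\<dots> = e"
    proof -
      have "\<bar>a\<bar> + \<bar>b\<bar> + 1 > 0" by (simp add: add_nonneg_pos)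
      then show ?thesis by simp
    qed
    finally show ?thesis .
  qed
  then show "\<exists>P. \<forall>g\<ge>P. junk_element g \<longrightarrow> lab g = t \<longrightarrow> \<bar>diag_coeff (opc U) g - (a * dfun (opc S) t + b * dfun (opc T) t)\<bar> \<le> e"
    by blast
qed

text \<open>By \<open>eigen_unit\<close>, \<open>T\<close> maps the unit vector of a far junk
  element nearly to a multiple of it, with a remainder small in norm. So \<open>S\<close> is
  evaluated on the same unit vector.\<close>

lemma dfun_opc_mult:
  assumes S: "S \<in> carrier LL" and T: "T \<in> carrier LL" and t: "t \<in> K"
  shows "dfun (opc (S \<otimes>\<^bsub>LL\<^esub> T)) t = dfun (opc S) t * dfun (opc T) t"
proof (rule ah_operator.dfun_eqI[OF op_ah[OF LL_mult[OF S T]] t])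
  fix e :: real assume e: "e > 0"
  interpret S: ah_operator K sim lab wt age cut e1 e2 prd c1 c2 "opc S" "nrm LL S" by (rule op_ah[OF S])
  interpret T: ah_operator K sim lab wt age cut e1 e2 prd c1 c2 "opc T" "nrm LL T" by (rule op_ah[OF T])
  let ?f = "dfun (opc T) t"
  define c where "c = \<bar>?f\<bar> + 3 * nrm LL S + 1"
  have c: "c > 0" using S.B_nonneg by (simp add: c_def add_nonneg_pos)
  let ?d = "e / c"
  have d: "?d > 0" using e c by simp
  obtain P where P: "\<forall>g\<ge>P. junk_element g \<longrightarrow> sim P (lab g) t \<longrightarrow> \<bar>diag_coeff (opc S) g - dfun (opc S) t\<bar> \<le> ?d"
    using S.dfun_limit[OF t d] by blast
  obtain Q where Q: "\<forall>g\<ge>Q. junk_element g \<longrightarrow> bnd ?d (\<lambda>z. opc T (unit g) z - dfun (opc T) (lab g) * unit g z)"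
    using T.eigen_unit[OF d] by blast
  have "\<bar>diag_coeff (opc (S \<otimes>\<^bsub>LL\<^esub> T)) g - dfun (opc S) t * ?f\<bar> \<le> e" if g: "g \<ge> max P Q" "junk_element g" "lab g = t" for g
  proof -
    let ?r = "\<lambda>z. opc T (unit g) z - ?f * unit g z"
    have r: "bnd ?d ?r" using Q g by auto
    have TX: "opc T (unit g) \<in> XX" by (rule T.T_in[OF unit_XX])
    have rX: "?r \<in> XX" by (rule XX_diff[OF TX XX_cmult[OF unit_XX]])
    have "opc (S \<otimes>\<^bsub>LL\<^esub> T) (unit g) = opc S (opc T (unit g))"
      unfolding opc_def LL_sel using emb_co[OF LL_D(1)[OF T emb_X[OF unit_XX]]] emb_X[OF unit_XX] by (simp add: compose_def)
    also have "\<dots> = opc S (\<lambda>z. ?f * unit g z + 1 * ?r z)" by simp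
    also have "\<dots> = (\<lambda>z. ?f * opc S (unit g) z + 1 * opc S ?r z)" by (rule S.T_linear[OF unit_XX rX])
    finally have eq: "diag_coeff (opc (S \<otimes>\<^bsub>LL\<^esub> T)) g - dfun (opc S) t * ?f = ?f * (diag_coeff (opc S) g - dfun (opc S) t) + opc S ?r g"
      unfolding diag_coeff_def by (simp add: algebra_simps)
    have "\<bar>diag_coeff (opc (S \<otimes>\<^bsub>LL\<^esub> T)) g - dfun (opc S) t * ?f\<bar> \<le> \<bar>?f\<bar> * \<bar>diag_coeff (opc S) g - dfun (opc S) t\<bar> + \<bar>opc S ?r g\<bar>"
      unfolding eq abs_mult[symmetric] by (rule abs_triangle_ineq)
    also have "\<bar>opc S ?r g\<bar> \<le> 3 * (nrm LL S * ?d)" by (rule bnd_coef[OF S.T_bnd[OF rX r]])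
    also have "\<bar>?f\<bar> * \<bar>diag_coeff (opc S) g - dfun (opc S) t\<bar> \<le> \<bar>?f\<bar> * ?d" using P g sim_refl by (intro mult_left_mono) auto
    finally have "\<bar>diag_coeff (opc (S \<otimes>\<^bsub>LL\<^esub> T)) g - dfun (opc S) t * ?f\<bar> \<le> (\<bar>?f\<bar> + 3 * nrm LL S) * ?d"
      by (simp only: distrib_right mult.assoc)
    also have "\<dots> \<le> c * ?d" using d by (intro mult_right_mono) (auto simp: c_def)
    also have "\<dots> = e" using c by simp
    finally show ?thesis .
  qed
  then show "\<exists>P. \<forall>g\<ge>P. junk_element g \<longrightarrow> lab g = t \<longrightarrow> \<bar>diag_coeff (opc (S \<otimes>\<^bsub>LL\<^esub> T)) g - dfun (opc S) t * ?f\<bar> \<le> e"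
    by blast
qed

definition hh :: "((nat \<Rightarrow>\<^sub>C real) \<Rightarrow> (nat \<Rightarrow>\<^sub>C real)) \<Rightarrow> 'k \<Rightarrow> real" where
  "hh T = (\<lambda>t\<in>K. dfun (opc T) t)"

lemma hh_carrier: "T \<in> carrier LL \<Longrightarrow> hh T \<in> carrier CK"
  unfolding hh_def using ah_operator.dfun_continuous[OF op_ah] by (intro CK_I)

lemma hh_add: "S \<in> carrier LL \<Longrightarrow> T \<in> carrier LL \<Longrightarrow> hh (S \<oplus>\<^bsub>LL\<^esub> T) = hh S \<oplus>\<^bsub>CK\<^esub> hh T"
  unfolding CK_sel using dfun_opc_linear[of S T "S \<oplus>\<^bsub>LL\<^esub> T" 1 1] LL_add by (auto simp: hh_def LL_sel)

lemma hh_smult: "T \<in> carrier LL \<Longrightarrow> hh (c \<odot>\<^bsub>LL\<^esub> T) = c \<odot>\<^bsub>CK\<^esub> hh T"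
  unfolding CK_sel using dfun_opc_linear[of T T "c \<odot>\<^bsub>LL\<^esub> T" c 0] LL_smult by (auto simp: hh_def LL_sel)

lemma hh_mult: "S \<in> carrier LL \<Longrightarrow> T \<in> carrier LL \<Longrightarrow> hh (S \<otimes>\<^bsub>LL\<^esub> T) = hh S \<otimes>\<^bsub>CK\<^esub> hh T"
  unfolding CK_sel using dfun_opc_mult[of S T] by (auto simp: hh_def)

lemma hh_one: "hh \<one>\<^bsub>LL\<^esub> = \<one>\<^bsub>CK\<^esub>"
proof -
  have "dfun (opc \<one>\<^bsub>LL\<^esub>) t = 1" if "t \<in> K" for t
  proof (rule ah_operator.dfun_eqI[OF op_ah[OF LL_one] that])
    have "diag_coeff (opc \<one>\<^bsub>LL\<^esub>) g = 1" for g
      unfolding diag_coeff_def opc_def LL_sel using emb_X[OF unit_XX, of g] co_emb[OF unit_XX, of g] by (simp add: unit_def)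
    then show "\<exists>P. \<forall>g\<ge>P. junk_element g \<longrightarrow> lab g = t \<longrightarrow> \<bar>diag_coeff (opc \<one>\<^bsub>LL\<^esub>) g - 1\<bar> \<le> e" if "e > 0" for e using that by simp
  qed
  then show ?thesis unfolding CK_sel by (auto simp: hh_def)
qed

lemma hh_ring_hom: "ring_hom_ring LL CK hh"
  using LL_ring CK_ring by (rule ring_hom_ringI2) (auto intro!: ring_hom_memI simp: hh_carrier hh_add hh_mult hh_one)

text \<open>\<open>432 = 3 * 144\<close>: the bound for coordinates times the norm bound for a junk
  unit vector.\<close>

lemma hh_norm: "T \<in> carrier LL \<Longrightarrow> nrm CK (hh T) \<le> 432 * nrm LL T"
  using ah_operator.dfun_bound[OF op_ah] by (intro CK_norm_le) (auto simp: hh_def)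

lemma hh_lift:
  assumes f: "f \<in> carrier CK"
  shows "\<exists>T\<in>carrier LL. hh T = f \<and> nrm LL T \<le> 12 * nrm CK f"
proof (cases "nrm CK f > 0")
  case True
  define M where "M = nrm CK f"
  have M: "M > 0" using True by (simp add: M_def)
  obtain \<psi> where \<psi>: "\<And>x b. bnd b x \<Longrightarrow> bnd (12 * M * b) (\<lambda>z. \<psi> z * x z)"
    "\<And>e. e > 0 \<Longrightarrow> \<exists>N. \<forall>z\<ge>N. \<bar>\<psi> z - f (lab z)\<bar> \<le> e"
    using multiplier_exists[OF CK_cont[OF f] _ M] CK_norm[OF f] unfolding M_def by blast
  have pX: "(\<lambda>z. \<psi> z * x z) \<in> XX" if "x \<in> XX" for x using multiplier_XX[OF \<psi>(1) _ that] M by simp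
  define T where "T = (\<lambda>y\<in>X. emb (\<lambda>z. \<psi> z * co y z))"
  have Tb: "norm (T y) \<le> 12 * M * norm y" if "y \<in> X" for y
    unfolding T_def using norm_emb_le[OF \<psi>(1)[OF co_bnd[OF that]]] that by simp
  have T: "T \<in> carrier LL"
  proof (rule LL_I[OF _ _ _ _ Tb])
    show "T \<in> extensional X" by (simp add: T_def)
    show "T y \<in> X" if "y \<in> X" for y unfolding T_def using that emb_X pX co_X by simp
    have lin: "T (a *\<^sub>R x + b *\<^sub>R y) = a *\<^sub>R T x + b *\<^sub>R T y" if "x \<in> X" "y \<in> X" for x y a b
    proof -
      have "(\<lambda>z. \<psi> z * co (a *\<^sub>R x + b *\<^sub>R y) z) = (\<lambda>z. a * (\<psi> z * co x z) + b * (\<psi> z * co y z))"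
        by (simp add: co_linear[OF that] algebra_simps)
      then show ?thesis unfolding T_def using that X_linear[OF that] emb_linear[OF pX pX, OF co_X co_X, OF that] by simp
    qed
    show "T (x + y) = T x + T y" if "x \<in> X" "y \<in> X" for x y using lin[OF that, of 1 1] by simp
    show "T (c *\<^sub>R x) = c *\<^sub>R T x" if "x \<in> X" for x c using lin[OF that that, of c 0] by simp
  qed
  have "dfun (opc T) t = f t" if t: "t \<in> K" for t
  proof (rule ah_operator.dfun_eqI[OF op_ah[OF T] t])
    fix e :: real assume "e > 0"
    then obtain N where N: "\<forall>z\<ge>N. \<bar>\<psi> z - f (lab z)\<bar> \<le> e" using \<psi>(2) by blast
    have "diag_coeff (opc T) g = \<psi> g" for g
      unfolding diag_coeff_def opc_def T_def using emb_X[OF unit_XX, of g] co_emb[OF unit_XX, of g] co_emb[OF pX[OF unit_XX], of g]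
      by (simp add: unit_def)
    then show "\<exists>P. \<forall>g\<ge>P. junk_element g \<longrightarrow> lab g = t \<longrightarrow> \<bar>diag_coeff (opc T) g - f t\<bar> \<le> e" using N by auto
  qed
  then have "hh T = f" using hh_carrier[OF T] f by (intro CK_eqI) (auto simp: hh_def)
  moreover have "nrm LL T \<le> 12 * M" using Tb M by (intro LL_norm_le) auto
  ultimately show ?thesis using T unfolding M_def by blast
next
  case False
  \<comment> \<open>\<open>multiplier_exists\<close> asks for a positive bound; the remaining case
    is \<open>f = 0\<close>, lifted to the zero operator.\<close>
  have "f t = 0" if "t \<in> K" for t using CK_norm[OF f that] False by simp
  then have "f = hh \<zero>\<^bsub>LL\<^esub>"
    using ring_hom_ring.homh[OF hh_ring_hom] f CK_closed(4) ring_hom_zero[OF _ LL_ring CK_ring, of hh]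
    by (intro CK_eqI) (auto simp: CK_sel(6) hh_carrier LL_zero)
  moreover have "nrm LL \<zero>\<^bsub>LL\<^esub> \<le> 0" by (rule LL_norm_le) (auto simp: LL_sel)
  moreover have "nrm CK f \<ge> 0" using CK_norm[OF f] K_ne by (metis abs_ge_zero ex_in_conv order_trans)
  ultimately show ?thesis using LL_zero by (intro bexI[of _ "\<zero>\<^bsub>LL\<^esub>"]) auto
qed

text \<open>The images of far junk unit vectors have a convergent subsequence. The coordinates of
  its limit tend to zero, and therefore so do the diagonal coefficients along that
  subsequence.\<close>

lemma compact_dfun_zero:
  assumes T: "T \<in> compact_operators X" and t: "t \<in> K"
  shows "dfun (opc T) t = 0"
proof -
  have TL: "T \<in> carrier LL" and cT: "compact (closure (T ` (X \<inter> cball 0 1)))"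
    using T by (auto simp: compact_operators_def)
  show ?thesis
  proof (rule ah_operator.dfun_eqI[OF op_ah[OF TL] t], rule ccontr)
    fix e :: real assume e: "e > 0" and "\<not> (\<exists>P. \<forall>g\<ge>P. junk_element g \<longrightarrow> lab g = t \<longrightarrow> \<bar>diag_coeff (opc T) g - 0\<bar> \<le> e)"
    then have "\<forall>P. \<exists>g\<ge>P. junk_element g \<and> \<bar>diag_coeff (opc T) g\<bar> > e" by (simp add: not_le) blast
    then obtain \<gamma> where \<gamma>: "\<And>i. i \<le> \<gamma> i" "\<And>i. junk_element (\<gamma> i)" "\<And>i. \<bar>diag_coeff (opc T) (\<gamma> i)\<bar> > e" by metis
    let ?u = "\<lambda>i. (1 / 144) *\<^sub>R emb (unit (\<gamma> i))"
    have "norm (emb (unit (\<gamma> i))) \<le> 144" for i by (rule norm_emb_le[OF good_bnd[OF good_unit[OF \<gamma>(2)]]])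
    then have u: "?u i \<in> X \<inter> cball 0 1" for i using X_scale[OF emb_X[OF unit_XX]] by simp
    have "T (?u i) \<in> closure (T ` (X \<inter> cball 0 1))" for i
      by (rule subsetD[OF closure_subset imageI[OF u]])
    then have "\<forall>i. T (?u i) \<in> closure (T ` (X \<inter> cball 0 1))" ..
    then obtain y r where y: "y \<in> closure (T ` (X \<inter> cball 0 1))" "strict_mono (r :: nat \<Rightarrow> nat)" "((\<lambda>i. T (?u i)) \<circ> r) \<longlonglongrightarrow> y"
      using cT unfolding compact_def by metis
    have "T ` (X \<inter> cball 0 1) \<subseteq> X" using LL_D(1)[OF TL] by auto
    then have yX: "y \<in> X" using y(1) closure_minimal[OF _ X_closed] by blast
    obtain N where N: "\<forall>z\<ge>N. \<bar>co y z\<bar> \<le> e / 576" using XX_coef_null[OF co_X[OF yX], of "e / 576"] e by auto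
    obtain N' where N': "\<forall>i\<ge>N'. dist (T (?u (r i))) y < e / 1728" using y(3) e unfolding lim_sequentially o_def
      by (metis divide_pos_pos zero_less_numeral)
    define i where "i = max N N'"
    let ?g = "\<gamma> (r i)"
    have "i \<le> r i" by (rule seq_suble[OF y(2)])
    then have Ng: "N \<le> ?g" using \<gamma>(1)[of "r i"] by (simp add: i_def)
    have TuX: "T (?u (r i)) \<in> X" using LL_D(1)[OF TL] u by blast
    have "co (T (?u (r i)) - y) = (\<lambda>z. 1 * co (T (?u (r i))) z + (-1) * co y z)"
      using co_linear[OF TuX yX, of 1 "-1"] by simp
    moreover have "bnd (norm (T (?u (r i)) - y)) (co (T (?u (r i)) - y))"
      using subspace_diff[OF X_subspace TuX yX] by (rule co_bnd)
    ultimately have "\<bar>co (T (?u (r i))) ?g - co y ?g\<bar> \<le> 3 * norm (T (?u (r i)) - y)" using bnd_coef by fastforce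
    moreover have "norm (T (?u (r i)) - y) < e / 1728" using N' by (simp add: i_def dist_norm)
    moreover have "\<bar>co y ?g\<bar> \<le> e / 576" using N Ng by blast
    moreover have "co (T (?u (r i))) ?g = 1 / 144 * diag_coeff (opc T) ?g"
    proof -
      have eX: "emb (unit ?g) \<in> X" by (rule emb_X[OF unit_XX])
      have "T (?u (r i)) = (1 / 144) *\<^sub>R T (emb (unit ?g))" by (rule LL_D(3)[OF TL eX])
      then show ?thesis unfolding diag_coeff_def opc_def
        using co_linear[OF LL_D(1)[OF TL eX] LL_D(1)[OF TL eX], of "1 / 144" 0] by simp
    qed
    \<comment> \<open>\<open>3 * (e / 1728) + e / 576 = e / 288\<close>, half of the lower bound
      \<open>e / 144\<close> that the choice of \<open>\<gamma>\<close> provides.\<close>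
    ultimately have "\<bar>1 / 144 * diag_coeff (opc T) ?g\<bar> < e / 288" by linarith
    then show False using \<gamma>(3)[of "r i"] e by (simp add: abs_mult)
  qed
qed

text \<open>On the unit ball \<open>T\<close> is uniformly close to its values on initial parts.
  These lie in the compact set \<open>A n\<close>, because coordinates are bounded by 3, and the
  image is totally bounded.\<close>

lemma dfun_zero_compact:
  assumes T: "T \<in> carrier LL" and z: "\<And>t. t \<in> K \<Longrightarrow> dfun (opc T) t = 0"
  shows "T \<in> compact_operators X"
proof -
  interpret T: ah_operator K sim lab wt age cut e1 e2 prd c1 c2 "opc T" "nrm LL T" by (rule op_ah[OF T])
  define v where "v z = T (emb (unit z))" for z
  define A where "A n = {y. \<exists>c. (\<forall>z<n. \<bar>c z\<bar> \<le> (3::real)) \<and> y = (\<Sum>z<n. c z *\<^sub>R v z)}" for n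
  have cA: "compact (A n)" for n
  proof (induction n)
    case 0
    have "A 0 = {0}" by (auto simp: A_def)
    then show ?case by simp
  next
    case (Suc n)
    have "A (Suc n) = (\<lambda>p. fst p + snd p *\<^sub>R v n) ` (A n \<times> {-3..3})"
    proof
      show "A (Suc n) \<subseteq> (\<lambda>p. fst p + snd p *\<^sub>R v n) ` (A n \<times> {-3..3})"
      proof
        fix y assume "y \<in> A (Suc n)"
        then obtain c where c: "\<forall>z<Suc n. \<bar>c z\<bar> \<le> 3" "y = (\<Sum>z<Suc n. c z *\<^sub>R v z)" by (auto simp: A_def)
        have "(\<Sum>z<n. c z *\<^sub>R v z) \<in> A n" using c(1) unfolding A_def by (intro CollectI exI[of _ c]) auto
        moreover have "c n \<in> {-3..3}" using c(1) by (auto simp: abs_le_iff)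
        ultimately show "y \<in> (\<lambda>p. fst p + snd p *\<^sub>R v n) ` (A n \<times> {-3..3})"
          using c(2) by (intro image_eqI[of _ _ "(\<Sum>z<n. c z *\<^sub>R v z, c n)"]) auto
      qed
      show "(\<lambda>p. fst p + snd p *\<^sub>R v n) ` (A n \<times> {-3..3}) \<subseteq> A (Suc n)"
      proof
        fix y assume "y \<in> (\<lambda>p. fst p + snd p *\<^sub>R v n) ` (A n \<times> {-3..3})"
        then obtain c d where c: "\<forall>z<n. \<bar>c z\<bar> \<le> 3" "d \<in> {-3..3}" "y = (\<Sum>z<n. c z *\<^sub>R v z) + d *\<^sub>R v n" by (auto simp: A_def)
        then show "y \<in> A (Suc n)" unfolding A_def
          by (intro CollectI exI[of _ "c(n := d)"]) (auto simp: less_Suc_eq)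
      qed
    qed
    moreover have "compact ((\<lambda>p. fst p + snd p *\<^sub>R v n) ` (A n \<times> {-3..3}))"
      using Suc by (intro compact_continuous_image compact_Times continuous_intros) auto
    ultimately show ?case by simp
  qed
  have approx: "\<exists>n. \<forall>y\<in>X \<inter> cball 0 1. \<exists>a\<in>A n. norm (T y - a) \<le> e" if e: "e > 0" for e
  proof -
    obtain n where n: "\<And>x. x \<in> XX \<Longrightarrow> bnd 1 x \<Longrightarrow> bnd e (opc T (tail n x))" using T.dfun_zero_tail[OF z e] by blast
    have "\<exists>a\<in>A n. norm (T y - a) \<le> e" if y: "y \<in> X \<inter> cball 0 1" for y
    proof -
      let ?x = "co y"
      have x: "?x \<in> XX" "bnd 1 ?x" using y co_X bnd_mono[OF co_bnd] by auto
      have tX: "tail n ?x \<in> XX" using XX_mul[OF x(1) adm_const[of 1]] by (simp add: tail_def)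
      have hs: "supp 0 n (head n ?x)" by (auto simp: supp_def head_def)
      have hX: "head n ?x \<in> XX" by (rule XX_supp[OF hs])
      have "opc T ?x = (\<lambda>z. opc T (head n ?x) z + opc T (tail n ?x) z)"
        using T.T_add[OF hX tX] head_tail[of ?x n] by simp
      then have "(\<lambda>z. opc T ?x z - opc T (head n ?x) z) = opc T (tail n ?x)" by auto
      then have "emb (opc T ?x) - emb (opc T (head n ?x)) = emb (opc T (tail n ?x))"
        using emb_diff[OF T.T_in[OF x(1)] T.T_in[OF hX]] by simp
      then have "norm (T y - T (emb (head n ?x))) \<le> e"
        using norm_emb_le[OF n[OF x]] emb_opc[OF T x(1)] emb_opc[OF T hX] emb_co y by simp
      moreover have "T (emb (head n ?x)) \<in> A n"
      proof -
        have "opc T (head n ?x) = (\<lambda>u. \<Sum>z<n. head n ?x z * opc T (unit z) u)"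
        proof -
          have "opc T (head n ?x) = opc T (\<lambda>u. \<Sum>z<n. head n ?x z * unit z u)" using supp_decomp[OF hs] by simp
          also have "\<dots> = (\<lambda>u. \<Sum>z<n. opc T (\<lambda>u. head n ?x z * unit z u) u)" by (rule T.T_sum) (rule XX_cmult[OF unit_XX])
          finally show ?thesis using T.T_cmult[OF unit_XX] by simp
        qed
        then have "emb (opc T (head n ?x)) = (\<Sum>z<n. head n ?x z *\<^sub>R emb (opc T (unit z)))"
          using emb_sum[of "{..<n}" "\<lambda>z u. head n ?x z * opc T (unit z) u"] T.T_in[OF unit_XX] XX_cmult emb_cmult by simp
        then have "T (emb (head n ?x)) = (\<Sum>z<n. head n ?x z *\<^sub>R v z)"
          using emb_opc[OF T hX] emb_opc[OF T unit_XX] by (simp add: v_def)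
        moreover have "\<bar>head n ?x z\<bar> \<le> 3" for z using bnd_coef[OF x(2), of z] by (simp add: head_def)
        ultimately show ?thesis unfolding A_def by blast
      qed
      ultimately show ?thesis by blast
    qed
    then show ?thesis by blast
  qed
  have "compact (closure (T ` (X \<inter> cball 0 1)))"
    unfolding compact_eq_totally_bounded
  proof (intro conjI allI impI)
    show "complete (closure (T ` (X \<inter> cball 0 1)))" by (rule complete_closed_subset[OF closed_closure subset_UNIV complete_bcontfun])
    fix e :: real assume e: "e > 0"
    obtain n where n: "\<forall>y\<in>X \<inter> cball 0 1. \<exists>a\<in>A n. norm (T y - a) \<le> e / 4" using approx[of "e / 4"] e by auto
    obtain k where k: "finite k" "A n \<subseteq> (\<Union>x\<in>k. ball x (e / 4))"
      using cA[of n] e unfolding compact_eq_totally_bounded by (meson divide_pos_pos zero_less_numeral)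
    have "T ` (X \<inter> cball 0 1) \<subseteq> (\<Union>x\<in>k. cball x (e / 2))"
    proof (rule image_subsetI)
      fix y assume "y \<in> X \<inter> cball 0 1"
      then obtain a where a: "a \<in> A n" "norm (T y - a) \<le> e / 4" using n by blast
      then obtain x where x: "x \<in> k" "dist x a < e / 4" using k(2) by auto
      have "dist (T y) a \<le> e / 4" using a(2) by (simp add: dist_norm)
      then have "dist x (T y) \<le> e / 2" using x(2) dist_triangle2[of x "T y" a] by linarith
      then show "T y \<in> (\<Union>x\<in>k. cball x (e / 2))" using x(1) by auto
    qed
    then have "closure (T ` (X \<inter> cball 0 1)) \<subseteq> (\<Union>x\<in>k. cball x (e / 2))"
      using k(1) by (intro closure_minimal closed_UN) auto
    also have "\<dots> \<subseteq> (\<Union>x\<in>k. ball x e)" using e by (intro UN_mono) (auto simp: subset_iff)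
    finally show "\<exists>k. finite k \<and> closure (T ` (X \<inter> cball 0 1)) \<subseteq> (\<Union>x\<in>k. ball x e)" using k(1) by blast
  qed
  then show ?thesis using T by (simp add: compact_operators_def)
qed

lemma hh_kernel: "a_kernel LL CK hh = compact_operators X"
proof
  show "a_kernel LL CK hh \<subseteq> compact_operators X"
  proof
    fix T assume "T \<in> a_kernel LL CK hh"
    then have T: "T \<in> carrier LL" "hh T = \<zero>\<^bsub>CK\<^esub>" by (auto simp: a_kernel_def')
    have "dfun (opc T) t = 0" if "t \<in> K" for t using fun_cong[OF T(2), of t] that by (simp add: hh_def CK_sel)
    then show "T \<in> compact_operators X" using dfun_zero_compact T(1) by blast
  qed
  show "compact_operators X \<subseteq> a_kernel LL CK hh"
  proof
    fix T assume T: "T \<in> compact_operators X"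
    then have TL: "T \<in> carrier LL" by (simp add: compact_operators_def)
    have "hh T = \<zero>\<^bsub>CK\<^esub>" unfolding hh_def CK_sel using compact_dfun_zero[OF T] by auto
    then show "T \<in> a_kernel LL CK hh" using TL by (simp add: a_kernel_def')
  qed
qed

text \<open>As rings this is the homomorphism theorem for \<open>hh\<close>. For the coset norms,
  432 comes from \<open>hh_norm\<close>, valid for every representative, and 12 from the one
  representative that \<open>hh_lift\<close> supplies.\<close>

theorem calkin_isomorphic: "banach_algebra_isomorphic (calkin_algebra X) CK"
proof -
  interpret H: ring_hom_ring LL CK hh by (rule hh_ring_hom)
  let ?I = "a_kernel LL CK hh"
  let ?Q = "LL Quot ?I"
  let ?A = "calkin_algebra X"
  let ?h = "\<lambda>A. the_elem (hh ` A)"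
  have sel: "carrier ?A = carrier ?Q" "mult ?A = mult ?Q" "one ?A = one ?Q" "zero ?A = zero ?Q" "add ?A = add ?Q"
    "\<And>c A. c \<odot>\<^bsub>?A\<^esub> A = (\<Union>T\<in>A. ?I +>\<^bsub>LL\<^esub> (c \<odot>\<^bsub>LL\<^esub> T))" "\<And>A. nrm ?A A = (INF T\<in>A. nrm LL T)"
    by (simp_all add: calkin_algebra_def Let_def hh_kernel)
  have surj: "hh ` carrier LL = carrier CK" using hh_lift hh_carrier by blast
  have "?h \<in> ring_iso ?Q CK" by (rule H.FactRing_iso_set[OF surj])
  then have iso: "?h \<in> ring_iso ?A CK"
    unfolding ring_iso_def ring_hom_def sel by simp
  then have bij: "bij_betw ?h (carrier ?A) (carrier CK)" and hom: "?h \<in> ring_hom ?A CK" by (auto simp: ring_iso_def)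
  have coset: "\<exists>T\<in>carrier LL. A = ?I +>\<^bsub>LL\<^esub> T" if "A \<in> carrier ?A" for A
    using H.quot_mem that by (simp add: sel)
  have cosetI: "?I +>\<^bsub>LL\<^esub> T \<in> carrier ?A" if "T \<in> carrier LL" for T
    using that by (auto simp: sel FactRing_def A_RCOSETS_def')
  have hcoset: "?h (?I +>\<^bsub>LL\<^esub> T) = hh T" if "T \<in> carrier LL" for T
    using H.the_elem_simp[OF that] .
  have inj: "A = A'" if "A \<in> carrier ?A" "A' \<in> carrier ?A" "?h A = ?h A'" for A A'
    using bij that by (auto simp: bij_betw_def inj_on_def)
  interpret I: ideal ?I LL by (rule H.kernel_is_ideal)
  have self: "T \<in> ?I +>\<^bsub>LL\<^esub> T" if "T \<in> carrier LL" for T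
    using I.a_rcos_self[OF that] .
  have mem: "T \<in> carrier LL \<and> hh T = ?h A" if A: "A \<in> carrier ?A" "T \<in> A" for A T
  proof -
    obtain T0 where T0: "T0 \<in> carrier LL" "A = ?I +>\<^bsub>LL\<^esub> T0" using coset[OF A(1)] by blast
    then obtain k where k: "k \<in> ?I" "T = k \<oplus>\<^bsub>LL\<^esub> T0" using A(2) by (auto simp: a_r_coset_def')
    have kL: "k \<in> carrier LL" "hh k = \<zero>\<^bsub>CK\<^esub>" using k(1) unfolding a_kernel_def' by blast+
    have "hh T = hh k \<oplus>\<^bsub>CK\<^esub> hh T0" unfolding k(2) by (rule hh_add[OF kL(1) T0(1)])
    also have "\<dots> = hh T0" unfolding kL(2) by (rule H.S.l_zero[OF hh_carrier[OF T0(1)]])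
    finally show ?thesis using hcoset[OF T0(1)] T0(2) k(2) LL_add[OF kL(1) T0(1)] by simp
  qed
  have ne: "A \<noteq> {}" if A: "A \<in> carrier ?A" for A using coset[OF A] self by blast
  have hC: "?h A \<in> carrier CK" if "A \<in> carrier ?A" for A using bij that by (auto simp: bij_betw_def)
  \<comment> \<open>The union defining the scalar multiple collapses to one coset, as all
    representatives of \<open>A\<close> have the same image under \<open>hh\<close>.\<close>
  have sm: "c \<odot>\<^bsub>?A\<^esub> A = ?I +>\<^bsub>LL\<^esub> (c \<odot>\<^bsub>LL\<^esub> T0)" if A: "A \<in> carrier ?A" "T0 \<in> A" for A c T0
  proof -
    have "?I +>\<^bsub>LL\<^esub> (c \<odot>\<^bsub>LL\<^esub> T) = ?I +>\<^bsub>LL\<^esub> (c \<odot>\<^bsub>LL\<^esub> T0)" if "T \<in> A" for T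
    proof (rule inj)
      have T: "T \<in> carrier LL" "T0 \<in> carrier LL" "hh T = hh T0" using mem A that by auto
      then show "?h (?I +>\<^bsub>LL\<^esub> (c \<odot>\<^bsub>LL\<^esub> T)) = ?h (?I +>\<^bsub>LL\<^esub> (c \<odot>\<^bsub>LL\<^esub> T0))"
        by (simp only: hcoset LL_smult hh_smult)
      show "?I +>\<^bsub>LL\<^esub> (c \<odot>\<^bsub>LL\<^esub> T) \<in> carrier ?A" "?I +>\<^bsub>LL\<^esub> (c \<odot>\<^bsub>LL\<^esub> T0) \<in> carrier ?A"
        using T LL_smult cosetI by blast+
    qed
    then show ?thesis unfolding sel(6) using A(2) by blast
  qed
  have hsm: "?h (c \<odot>\<^bsub>?A\<^esub> A) = c \<odot>\<^bsub>CK\<^esub> ?h A" if A: "A \<in> carrier ?A" for A c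
  proof -
    obtain T where T: "T \<in> A" using ne[OF A] by blast
    show ?thesis unfolding sm[OF A T] using mem[OF A T] hcoset[OF LL_smult, of T c] hh_smult[of T c] by simp
  qed
  have bl: "bounded_linear_map ?A CK ?h"
    unfolding bounded_linear_map_def
  proof (intro conjI ballI allI exI[of _ 432])
    show "?h \<in> carrier ?A \<rightarrow> carrier CK" using hC by blast
    show "?h (A \<oplus>\<^bsub>?A\<^esub> A') = ?h A \<oplus>\<^bsub>CK\<^esub> ?h A'" if "A \<in> carrier ?A" "A' \<in> carrier ?A" for A A'
      using ring_hom_add[OF hom that] .
    show "?h (c \<odot>\<^bsub>?A\<^esub> A) = c \<odot>\<^bsub>CK\<^esub> ?h A" if "A \<in> carrier ?A" for A c by (rule hsm[OF that])
    fix A assume A: "A \<in> carrier ?A"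
    have "nrm CK (?h A) / 432 \<le> (INF T\<in>A. nrm LL T)"
    proof (rule cINF_greatest[OF ne[OF A]])
      fix T assume "T \<in> A"
      then have "T \<in> carrier LL" "hh T = ?h A" using mem[OF A] by auto
      then show "nrm CK (?h A) / 432 \<le> nrm LL T" using hh_norm[of T] by simp
    qed
    then show "nrm CK (?h A) \<le> 432 * nrm ?A A" unfolding sel(7) by linarith
  qed
  have "normed_iso ?A CK ?h"
  proof (rule normed_iso_criterion(1)[OF bl])
    show "inj_on ?h (carrier ?A)" "?h ` carrier ?A = carrier CK" using bij by (auto simp: bij_betw_def)
    show "nrm ?A A \<le> 12 * nrm CK (?h A)" if A: "A \<in> carrier ?A" for A
    proof -
      obtain T where T: "T \<in> carrier LL" "hh T = ?h A" "nrm LL T \<le> 12 * nrm CK (?h A)" using hh_lift[OF hC[OF A]] by blast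
      then have "A = ?I +>\<^bsub>LL\<^esub> T" using hcoset[OF T(1)] by (intro inj A cosetI) auto
      then have TA: "T \<in> A" using self[OF T(1)] by simp
      have "(INF T\<in>A. nrm LL T) \<le> nrm LL T"
        using mem[OF A] LL_norm(1) by (intro cINF_lower[OF _ TA] bdd_belowI2[of _ 0]) blast
      then show ?thesis unfolding sel(7) using T(3) by linarith
    qed
    show "A \<oplus>\<^bsub>?A\<^esub> A' \<in> carrier ?A" if "A \<in> carrier ?A" "A' \<in> carrier ?A" for A A'
      using ring.ring_simprules(1)[OF I.quotient_is_ring] that by (simp add: sel)
    show "c \<odot>\<^bsub>?A\<^esub> A \<in> carrier ?A" if A: "A \<in> carrier ?A" for A c
    proof -
      obtain T where T: "T \<in> A" using ne[OF A] by blast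
      then show ?thesis unfolding sm[OF A T] using mem[OF A T] LL_smult cosetI by blast
    qed
  qed
  then show ?thesis unfolding banach_algebra_isomorphic_def using iso by blast
qed

end

theorem theorem2:
  fixes K :: "'k::metric_space set"
  assumes "compact K" and "countable K" and "K \<noteq> {}"
  shows "\<exists>X :: (nat \<Rightarrow>\<^sub>C real) set.
           separable_banach_space X \<and>
           script_L_infty X \<and>
           normed_isomorphic (dual_space X) ell1 \<and>
           banach_algebra_isomorphic (calkin_algebra X) (continuous_function_algebra K)"
proof -
  obtain sim lab wt age cut e1 e2 prd c1 c2 where "ah_system K sim lab wt age cut e1 e2 prd c1 c2"
    using ah_system_exists[OF assms] by blast
  then interpret ah_system K sim lab wt age cut e1 e2 prd c1 c2 .
  show ?thesis
    using X_subspace X_closed X_separable script_L_infty_X dual_isomorphic calkin_isomorphic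
    by (intro exI[of _ X]) (simp add: separable_banach_space_def)
qed

end
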